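(* There exists an absolute constant $c>0$ such that the following holds. If $\mu$ is an even isotropic measure on $S^{n-1}$ and $\delta_{HO}({\rm supp}\,\mu,{\rm supp}\,\nu_n)\ge\varepsilon>0$, then $$V(Z_\infty(\mu))\ge(1+\gamma\varepsilon^3)\,V(Z_\infty(\nu_n)),\qquad V(Z_\infty^*(\mu))\le(1-\gamma\varepsilon^3)\,V(Z_\infty^*(\nu_n)),$$ where $\gamma=n^{-cn^3}$.
   Context: $S^{n-1}$ is the Euclidean unit sphere of $\mathbb{R}^n$, $\langle\cdot,\cdot\rangle$ the Euclidean scalar product, $V$ volume. A Borel measure $\mu$ on $S^{n-1}$ is isotropic if $\int_{S^{n-1}}u\otimes u\,d\mu(u)={\rm Id}_n$; it is even if invariant under $u\mapsto-u$. $Z_\infty(\mu)={\rm conv}\,{\rm supp}\,\mu$ and $Z_\infty^*(\mu)=\{x\in\mathbb{R}^n:\langle x,u\rangle\le1\text{ for all }u\in{\rm supp}\,\mu\}$. A cross measure on $S^{n-1}$ is a measure $\nu$ for which there is an orthonormal basis $u_1,\dots,u_n$ of $\mathbb{R}^n$ with ${\rm supp}\,\nu=\{\pm u_1,\dots,\pm u_n\}$ and $\nu(\{u_i\})=\nu(\{-u_i\})=1/2$ for all $i$. $\nu_n$ is a fixed cross measure on $S^{n-1}$. $\angle(x,y)$ denotes the angle between $x$ and $y$. For compact $X,Y\subseteq S^{n-1}$, the spherical Hausdorff distance is $$\delta_H(X,Y)=\max\left\{\max_{x\in X}\min_{y\in Y}\angle(x,y),\ \max_{y\in Y}\min_{x\in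 X}\angle(x,y)\right\},$$ and $\delta_{HO}(X,Y)=\min\{\delta_H(X,\Phi Y):\Phi\in{\rm O}(n)\}$. *)

theory Defs
  imports "HOL-Analysis.Analysis"
begin

text \<open>
  The constant \<open>c\<close> of the theorem is uniform in the dimension, so the dimension has to be a term
  rather than a type: \<open>\<real>\<^sup>n\<close> is the set of extensional functions on \<open>{..<n}\<close>, which is
  the underlying set of the product of \<open>n\<close> copies of Lebesgue measure on the line.
\<close>

type_synonym rvec = "nat \<Rightarrow> real"

definition Rn :: "nat \<Rightarrow> rvec set" where
  "Rn n = ({..<n} \<rightarrow>\<^sub>E UNIV)"

definition ip :: "nat \<Rightarrow> rvec \<Rightarrow> rvec \<Rightarrow> real" where
  "ip n x y = (\<Sum>i<n. x i * y i)"

definition vnorm :: "nat \<Rightarrow> rvec \<Rightarrow> real" where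
  "vnorm n x = L2_set x {..<n}"

definition vneg :: "nat \<Rightarrow> rvec \<Rightarrow> rvec" where
  "vneg n x = (\<lambda>i\<in>{..<n}. - x i)"

definition usphere :: "nat \<Rightarrow> rvec set" where
  "usphere n = {u \<in> Rn n. vnorm n u = 1}"

definition vol :: "nat \<Rightarrow> rvec set \<Rightarrow> real" where
  "vol n A = measure (Pi\<^sub>M {..<n} (\<lambda>_. lborel)) A"

definition convex_Rn :: "nat \<Rightarrow> rvec set \<Rightarrow> bool" where
  "convex_Rn n C \<longleftrightarrow> C \<subseteq> Rn n \<and>
     (\<forall>x\<in>C. \<forall>y\<in>C. \<forall>a\<ge>0. \<forall>b\<ge>0. a + b = 1 \<longrightarrow> (\<lambda>i\<in>{..<n}. a * x i + b * y i) \<in> C)"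

text \<open>The finite product of Borel \<open>\<sigma>\<close>-algebras is the Borel \<open>\<sigma>\<close>-algebra of \<open>\<real>\<^sup>n\<close>.\<close>

definition borel_measure_on_sphere :: "nat \<Rightarrow> rvec measure \<Rightarrow> bool" where
  "borel_measure_on_sphere n \<mu> \<longleftrightarrow>
     sets \<mu> = sets (restrict_space (Pi\<^sub>M {..<n} (\<lambda>_. borel)) (usphere n))"

text \<open>The isotropy condition \<open>\<integral> u \<otimes> u d\<mu>(u) = Id\<close> is read entrywise.\<close>

definition isotropic :: "nat \<Rightarrow> rvec measure \<Rightarrow> bool" where
  "isotropic n \<mu> \<longleftrightarrow> borel_measure_on_sphere n \<mu> \<and>
     (\<forall>i<n. \<forall>j<n. has_bochner_integral \<mu> (\<lambda>u. u i * u j) (if i = j then 1 else 0))"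

definition even_measure :: "nat \<Rightarrow> rvec measure \<Rightarrow> bool" where
  "even_measure n \<mu> \<longleftrightarrow> (\<forall>A\<in>sets \<mu>. emeasure \<mu> (vneg n ` A) = emeasure \<mu> A)"

definition supp :: "nat \<Rightarrow> rvec measure \<Rightarrow> rvec set" where
  "supp n \<mu> = {u \<in> usphere n. \<forall>r>0. emeasure \<mu> {v \<in> usphere n. vnorm n (\<lambda>i. u i - v i) < r} > 0}"

definition Z_inf :: "nat \<Rightarrow> rvec measure \<Rightarrow> rvec set" where
  "Z_inf n \<mu> = convex_Rn n hull supp n \<mu>"

definition Z_inf_polar :: "nat \<Rightarrow> rvec measure \<Rightarrow> rvec set" where
  "Z_inf_polar n \<mu> = {x \<in> Rn n. \<forall>u\<in>supp n \<mu>. ip n x u \<le> 1}"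

text \<open>\<open>n\<close> orthonormal vectors of \<open>\<real>\<^sup>n\<close> form a basis, so spanning need not be required.\<close>

definition orthonormal_basis :: "nat \<Rightarrow> (nat \<Rightarrow> rvec) \<Rightarrow> bool" where
  "orthonormal_basis n u \<longleftrightarrow>
     (\<forall>i<n. u i \<in> Rn n) \<and> (\<forall>i<n. \<forall>j<n. ip n (u i) (u j) = (if i = j then 1 else 0))"

definition cross_measure :: "nat \<Rightarrow> rvec measure \<Rightarrow> bool" where
  "cross_measure n \<nu> \<longleftrightarrow> borel_measure_on_sphere n \<nu> \<and>
     (\<exists>u. orthonormal_basis n u \<and>
        supp n \<nu> = u ` {..<n} \<union> (\<lambda>i. vneg n (u i)) ` {..<n} \<and>
        (\<forall>i<n. emeasure \<nu> {u i} = 1 / 2 \<and> emeasure \<nu> {vneg n (u i)} = 1 / 2))"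

definition vangle :: "nat \<Rightarrow> rvec \<Rightarrow> rvec \<Rightarrow> real" where
  "vangle n x y = arccos (ip n x y / (vnorm n x * vnorm n y))"

text \<open>
  The suprema and infima in the next two distances are attained for nonempty compact sets.
\<close>

definition sph_hausdorff :: "nat \<Rightarrow> rvec set \<Rightarrow> rvec set \<Rightarrow> real" where
  "sph_hausdorff n X Y =
     max (SUP x\<in>X. INF y\<in>Y. vangle n x y) (SUP y\<in>Y. INF x\<in>X. vangle n x y)"

definition orthogonal_matrices :: "nat \<Rightarrow> (nat \<Rightarrow> nat \<Rightarrow> real) set" where
  "orthogonal_matrices n =
     {A. \<forall>j<n. \<forall>k<n. (\<Sum>i<n. A i j * A i k) = (if j = k then 1 else 0)}"

definition mat_app :: "nat \<Rightarrow> (nat \<Rightarrow> nat \<Rightarrow> real) \<Rightarrow> rvec \<Rightarrow> rvec" where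
  "mat_app n A x = (\<lambda>i\<in>{..<n}. \<Sum>j<n. A i j * x j)"

definition sph_hausdorff_O :: "nat \<Rightarrow> rvec set \<Rightarrow> rvec set \<Rightarrow> real" where
  "sph_hausdorff_O n X Y = (INF A\<in>orthogonal_matrices n. sph_hausdorff n X (mat_app n A ` Y))"

end

theory Submission
  imports Defs "Jordan_Normal_Form.Determinant" "HOL-Probability.Distributions"
begin

text \<open>
  For a cross measure the polar body is a cube of volume \<open>2 ^ n\<close> and the hull is a cross-polytope of
  volume \<open>2 ^ n / fact n\<close>, so the claim is that among even isotropic measures the cube has the
  largest polar body and the cross-polytope is the smallest hull, with a quantitative gap for
  measures whose support is far from every cross.

  The inequality without the gap is a transport argument. An increasing function \<open>T\<close> on the line
  with derivative \<open>t\<close> induces the map sending \<open>x\<close> to the integral of \<open>T (ip n x u)\<close> times \<open>u\<close> over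
  \<open>u\<close>; its Jacobian \<open>A\<close> is the integral of \<open>t (ip n x u)\<close> times \<open>u \<otimes> u\<close>, a positive definite matrix, and
  \<open>transport_inequality\<close> bounds the integral of \<open>g\<close> along this map, weighted with \<open>det A\<close>, by the
  integral of \<open>g\<close>. If \<open>T\<close> carries the uniform density on \<open>[-1, 1]\<close> to the Gaussian, a Bessel
  inequality and \<open>det A \<ge> exp (integral of ln t)\<close> turn this into the bound on the polar body; if \<open>T\<close>
  carries the Gaussian to the two-sided exponential density, they give the bound on the hull.

  The gap comes from the slack in the determinant inequality. Choose a random \<open>n\<close>-tuple of vectors
  with density \<open>(det W)\<^sup>2 / fact n\<close> with respect to \<open>\<mu>\<^sup>n\<close>; isotropy makes this a probability
  density, and \<open>det A\<close> is the expectation of the product of the \<open>t (ip n x (W k))\<close>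
  (\<open>det_tuple\<close>). The determinant inequality is then Jensen's inequality for \<open>exp\<close>, and what it loses
  is controlled from below by the variance of the sum of the \<open>ln (t (ip n x (W k)))\<close> (\<open>det_ge_exp\<close>). Averaged over a small
  cube of points \<open>x\<close>, that variance is at least a constant times the \<^emph>\<open>defect\<close>, the double integral of
  \<open>(ip n u v)\<^sup>2 * (1 - (ip n u v)\<^sup>2)\<close> (\<open>cube_average_var_ge\<close>). So a large defect forces a gap in both
  volumes (\<open>polar_volume_defect\<close>, \<open>hull_volume_defect\<close>).

  The defect is also the expectation of the sum of all \<open>(ip n (W k) (W l))\<^sup>2\<close> with \<open>k \<noteq> l\<close>
  (\<open>tuple_orthogonality_defect\<close>). If it is small, then some tuple of support vectors is nearly
  orthonormal, and Gram-Schmidt gives an orthonormal frame that lies, up to a factor close to \<open>1\<close>,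
  in the hull. Every vector of the frame and its negative are close to the support; as the support is
  at distance \<open>\<epsilon>\<close> from the cross of the frame, there is a support vector \<open>x\<close> far from the whole cross
  (\<open>far_point\<close>, \<open>tilted_frame\<close>). The half-space of \<open>x\<close> cuts a corner off the cube, and adding \<open>x\<close> to
  the cross-polytope enlarges it (\<open>tilted_polar_volume\<close>, \<open>tilted_hull_volume\<close>); both effects are
  linear in \<open>\<epsilon>\<close> and dominate the error made by rounding the frame if the threshold for the defect is
  proportional to \<open>\<epsilon>\<^sup>2\<close>. With this threshold both cases yield a gap of at least
  \<open>\<epsilon> ^ 3 / n ^ (10 * n ^ 3)\<close> for \<open>n \<ge> 2\<close> (\<open>volume_gap\<close>), and on the line every support is a cross.
\<close>

section \<open>Determinants as Leibniz sums\<close>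

text \<open>
  The Leibniz sum has the dimension as a term, evaluates tuples of vectors as matrices without
  conversion, and only reads entries with indices below \<open>n\<close>;
  \<open>dt_conv_det\<close> makes the theory of matrix determinants available for it.
\<close>

definition dt :: "nat \<Rightarrow> (nat \<Rightarrow> nat \<Rightarrow> real) \<Rightarrow> real" where
  "dt n A = (\<Sum>p | p permutes {..<n}. of_int (sign p) * (\<Prod>i<n. A i (p i)))"

abbreviation idm :: "nat \<Rightarrow> nat \<Rightarrow> real" where
  "idm i j \<equiv> (if i = j then 1 else 0)"

lemma dt_conv_det: "dt n A = Determinant.det (Matrix.mat n n (\<lambda>(i, j). A i j))"
proof -
  have *: "(\<Prod>i<n. A i (p i)) = (\<Prod>i = 0..<n. Matrix.mat n n (\<lambda>(i, j). A i j) $$ (i, p i))"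
    if "p permutes {..<n}" for p
    unfolding atLeast0LessThan
    using permutes_in_image[OF that] by (intro prod.cong) auto
  show ?thesis
    unfolding dt_def
    by (subst det_def'[of _ n], simp, unfold atLeast0LessThan)
       (intro sum.cong refl arg_cong2[where f = "(*)"], use * in \<open>simp add: atLeast0LessThan\<close>)
qed

lemma dt_cong: "(\<And>i j. i < n \<Longrightarrow> j < n \<Longrightarrow> A i j = B i j) \<Longrightarrow> dt n A = dt n B"
  unfolding dt_def
  by (intro sum.cong refl arg_cong2[where f = "(*)"] prod.cong)
     (metis lessThan_iff mem_Collect_eq permutes_in_image)

lemma dt_0 [simp]: "dt 0 A = 1"
  by (simp add: dt_def)

lemma dt_mult: "dt n (\<lambda>i j. \<Sum>k<n. A i k * B k j) = dt n A * dt n B"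
proof -
  have "Matrix.mat n n (\<lambda>(i, j). \<Sum>k<n. A i k * B k j) =
      Matrix.mat n n (\<lambda>(i, j). A i j) * Matrix.mat n n (\<lambda>(i, j). B i j)"
    by (intro eq_matI) (auto simp: scalar_prod_def atLeast0LessThan)
  then show ?thesis
    unfolding dt_conv_det by (simp add: Determinant.det_mult[of _ n])
qed

lemma dt_transpose: "dt n (\<lambda>i j. A j i) = dt n A"
proof -
  have "Matrix.mat n n (\<lambda>(i, j). A j i) = transpose_mat (Matrix.mat n n (\<lambda>(i, j). A i j))"
    by (intro eq_matI) auto
  then show ?thesis
    unfolding dt_conv_det by (simp add: Determinant.det_transpose[of _ n])
qed

lemma dt_permute_rows:
  assumes "p permutes {..<n}"
  shows "dt n (\<lambda>i. A (p i)) = of_int (sign p) * dt n A"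
proof -
  have "Matrix.mat n n (\<lambda>(i, j). A (p i) j) =
      Matrix.mat n n (\<lambda>(i, j). Matrix.mat n n (\<lambda>(i, j). A i j) $$ (p i, j))"
    using permutes_in_image[OF assms] by (intro eq_matI) auto
  then show ?thesis
    unfolding dt_conv_det using assms
    by (simp add: Determinant.det_permute_rows[of _ n] atLeast0LessThan)
qed

text \<open>
  Used for matrices with so many zeros that only one or two permutations contribute.
\<close>

lemma dt_sparse:
  assumes S: "S \<subseteq> {p. p permutes {..<n}}"
    and z: "\<And>p. p permutes {..<n} \<Longrightarrow> p \<notin> S \<Longrightarrow> \<exists>i<n. A i (p i) = 0"
  shows "dt n A = (\<Sum>p\<in>S. of_int (sign p) * (\<Prod>i<n. A i (p i)))"
  unfolding dt_def
proof (rule sum.mono_neutral_right)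
  show "finite {p. p permutes {..<n}}" by (simp add: finite_permutations)
  show "\<forall>p\<in>{p. p permutes {..<n}} - S. of_int (sign p) * (\<Prod>i<n. A i (p i)) = 0"
    using z by (auto intro: prod_zero)
qed (use S in auto)

lemma dt_idm [simp]: "dt n idm = 1"
proof -
  have "dt n idm = (\<Sum>p\<in>{id}. of_int (sign p) * (\<Prod>i<n. idm i (p i)))"
  proof (rule dt_sparse)
    fix p assume p: "p permutes {..<n}" "p \<notin> {id}"
    then obtain i where "p i \<noteq> i" by (auto simp: fun_eq_iff)
    with p show "\<exists>i<n. idm i (p i) = 0"
      by (intro exI[of _ i]) (auto simp: permutes_def)
  qed (auto simp: permutes_id)
  then show ?thesis by simp
qed

lemma dt_replace_row:
  assumes "k < n"
  shows "dt n (\<lambda>i j. if i = k then b j else idm i j) = b k"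
proof -
  have "dt n (\<lambda>i j. if i = k then b j else idm i j) =
      (\<Sum>p\<in>{id}. of_int (sign p) * (\<Prod>i<n. if i = k then b (p i) else idm i (p i)))"
  proof (rule dt_sparse)
    fix p assume p: "p permutes {..<n}" "p \<notin> {id}"
    have "\<exists>i<n. i \<noteq> k \<and> p i \<noteq> i"
    proof (rule ccontr)
      assume "\<not> ?thesis"
      then have fx: "p i = i" if "i \<noteq> k" for i
        using that p(1) by (cases "i < n") (auto simp: permutes_def)
      have "p k = k"
        using fx p(1) by (metis permutes_def)
      then have "p = id" using fx by (metis eq_id_iff)
      with p show False by simp
    qed
    then obtain i where "i < n" "i \<noteq> k" "p i \<noteq> i" by auto
    then show "\<exists>i<n. (if i = k then b (p i) else idm i (p i)) = 0"
      by (intro exI[of _ i]) auto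
  qed (auto simp: permutes_id)
  also have "\<dots> = (\<Prod>i<n. if i = k then b i else 1)"
    by (simp cong: if_cong prod.cong)
  also have "\<dots> = b k" using assms by (simp add: prod.delta)
  finally show ?thesis .
qed

lemma dt_replace_two_rows:
  assumes k: "k < n" and l: "l < n" and kl: "k \<noteq> l"
  shows "dt n (\<lambda>i j. if i = k then b j else if i = l then c j else idm i j) = b k * c l - b l * c k"
    (is "dt n ?A = _")
proof -
  let ?t = "Transposition.transpose k l"
  have tid: "?t \<noteq> id" using kl by (metis id_apply transpose_apply_first)
  have "dt n ?A = (\<Sum>p\<in>{id, ?t}. of_int (sign p) * (\<Prod>i<n. ?A i (p i)))"
  proof (rule dt_sparse)
    show "{id, ?t} \<subseteq> {p. p permutes {..<n}}"
      using k l by (auto simp: permutes_id intro: permutes_swap_id)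
    fix p assume p: "p permutes {..<n}" "p \<notin> {id, ?t}"
    have "\<exists>i<n. i \<noteq> k \<and> i \<noteq> l \<and> p i \<noteq> i"
    proof (rule ccontr)
      assume "\<not> ?thesis"
      then have fx: "p i = i" if "i \<noteq> k" "i \<noteq> l" for i
        using that p(1) by (cases "i < n") (auto simp: permutes_def)
      have inj: "p x = p y \<longleftrightarrow> x = y" for x y
        using permutes_inj[OF p(1)] by (auto simp: inj_def)
      have "p k = k \<or> p k = l" "p l = k \<or> p l = l"
        using fx inj by metis+
      then consider "p k = k" "p l = l" | "p k = l" "p l = k"
        using inj kl by metis
      then show False
      proof cases
        case 1
        then have "p = id" using fx by (auto simp: fun_eq_iff) (metis)
        with p show False by simp
      next
        case 2
        then have "p x = ?t x" for x using fx[of x] by (auto simp: Transposition.transpose_def)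
        then have "p = ?t" by (auto simp: fun_eq_iff)
        with p show False by simp
      qed
    qed
    then obtain i where "i < n" "i \<noteq> k" "i \<noteq> l" "p i \<noteq> i" by blast
    then show "\<exists>i<n. ?A i (p i) = 0" by (intro exI[of _ i]) simp
  qed
  also have "\<dots> = (\<Prod>i<n. ?A i i) - (\<Prod>i<n. ?A i (?t i))"
    using tid kl by (simp add: sign_swap_id id_def cong: if_cong)
  also have "(\<Prod>i<n. ?A i i) = (\<Prod>i\<in>{k, l}. ?A i i)"
    using k l by (intro prod.mono_neutral_right) auto
  also have "\<dots> = b k * c l" using kl by simp
  also have "(\<Prod>i<n. ?A i (?t i)) = (\<Prod>i\<in>{k, l}. ?A i (?t i))"
    using k l by (intro prod.mono_neutral_right) (auto simp: transpose_def)
  also have "\<dots> = b l * c k" using kl by simp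
  finally show ?thesis .
qed

lemma dt_inverse:
  assumes "dt n A \<noteq> 0"
  obtains B where "\<And>i j. i < n \<Longrightarrow> j < n \<Longrightarrow> (\<Sum>k<n. B i k * A k j) = idm i j"
proof -
  let ?A = "Matrix.mat n n (\<lambda>(i, j). A i j)"
  have "?A \<in> Units (ring_mat TYPE(real) n ())"
    using assms by (intro det_non_zero_imp_unit) (auto simp: dt_conv_det)
  then obtain B where B: "B \<in> carrier_mat n n" "B * ?A = 1\<^sub>m n"
    by (auto simp: Units_def ring_mat_def)
  have *: "(\<Sum>k<n. B $$ (i, k) * A k j) = idm i j" if "i < n" "j < n" for i j
    using arg_cong[OF B(2), of "\<lambda>C. C $$ (i, j)"] B(1) that
    by (simp add: scalar_prod_def atLeast0LessThan)
  show ?thesis by (rule that[of "\<lambda>i j. B $$ (i, j)"]) (use * in auto)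
qed

text \<open>
  A left inverse of a square matrix is a right inverse.
\<close>

lemma orthonormal_columns:
  assumes "\<And>i j. i < n \<Longrightarrow> j < n \<Longrightarrow> (\<Sum>k<n. A i k * A j k) = idm i j" "i < n" "j < n"
  shows "(\<Sum>k<n. A k i * A k j) = (idm i j :: real)"
proof -
  let ?A = "Matrix.mat n n (\<lambda>(i, j). A i j)" and ?B = "Matrix.mat n n (\<lambda>(i, j). A j i)"
  have "?A * ?B = 1\<^sub>m n"
    using assms(1) by (intro eq_matI) (auto simp: scalar_prod_def atLeast0LessThan)
  then have "?B * ?A = 1\<^sub>m n"
    by (rule mat_mult_left_right_inverse[rotated 2]) auto
  from arg_cong[OF this, of "\<lambda>C. C $$ (i, j)"] show ?thesis
    using assms(2,3) by (simp add: scalar_prod_def atLeast0LessThan)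
qed

lemma dt_nonzero_if_no_kernel:
  assumes "\<And>x. (\<Sum>i<n. \<Sum>j<n. x i * A i j * x j) = 0 \<Longrightarrow> \<forall>i<n. x i = 0"
  shows "dt n A \<noteq> 0"
proof
  let ?A = "Matrix.mat n n (\<lambda>(i, j). A i j)"
  assume "dt n A = 0"
  then obtain v where v: "v \<in> carrier_vec n" "v \<noteq> 0\<^sub>v n" "?A *\<^sub>v v = 0\<^sub>v n"
    unfolding dt_conv_det using det_0_iff_vec_prod_zero[of ?A n] by auto
  have "(\<Sum>j<n. A i j * vec_index v j) = 0" if "i < n" for i
    using arg_cong[OF v(3), of "\<lambda>w. vec_index w i"] v(1) that
    by (simp add: scalar_prod_def atLeast0LessThan)
  then have "(\<Sum>i<n. \<Sum>j<n. vec_index v i * A i j * vec_index v j) = 0"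
    by (simp add: sum_distrib_left[symmetric] mult.assoc)
  from assms[OF this] have "v = 0\<^sub>v n" using v(1) by (intro eq_vecI) auto
  with v show False by simp
qed

lemma dt_last_row:
  "dt (Suc n) (\<lambda>i j. if i = n then (if j = n then s else 0) else A i j) = s * dt n A"
    (is "dt _ ?A = _")
proof -
  have "dt (Suc n) ?A = (\<Sum>p\<in>{p. p permutes {..<n}}. of_int (sign p) * (\<Prod>i<Suc n. ?A i (p i)))"
  proof (rule dt_sparse)
    show "{p. p permutes {..<n}} \<subseteq> {p. p permutes {..<Suc n}}"
      by (auto intro: permutes_subset)
    fix p assume p: "p permutes {..<Suc n}" "p \<notin> {p. p permutes {..<n}}"
    have "p n \<noteq> n"
    proof
      assume "p n = n"
      then have "p permutes {..<n}"
        using p(1) by (auto simp: permutes_def lessThan_Suc less_Suc_eq)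
      with p show False by simp
    qed
    then show "\<exists>i<Suc n. ?A i (p i) = 0" by (intro exI[of _ n]) auto
  qed
  also have "\<dots> = (\<Sum>p | p permutes {..<n}. s * (of_int (sign p) * (\<Prod>i<n. A i (p i))))"
  proof (intro sum.cong refl)
    fix p assume "p \<in> {p. p permutes {..<n}}"
    then have "p n = n" by (auto simp: permutes_def)
    then show "of_int (sign p) * (\<Prod>i<Suc n. ?A i (p i)) = s * (of_int (sign p) * (\<Prod>i<n. A i (p i)))"
      by (simp add: prod.cong[of "{..<n}" "{..<n}" "\<lambda>i. ?A i (p i)" "\<lambda>i. A i (p i)"])
  qed
  also have "\<dots> = s * dt n A" by (simp add: dt_def sum_distrib_left)
  finally show ?thesis .
qed

lemma dt_lower_unitriangular_last:
  "dt (Suc n) (\<lambda>i j. if i = n \<and> j < n then q j else idm i j) = 1"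
proof -
  have "dt (Suc n) (\<lambda>i j. if i = n then (if j = n then 1 else q j) else idm i j) = 1"
    by (subst dt_replace_row) auto
  then show ?thesis
    by (subst dt_cong) (auto)
qed

text \<open>
  Subtracting from the last row the combination \<open>q\<close> of the others clears it up to the
  last entry, which becomes the Schur complement. This is the induction step of the change of
  variables below.
\<close>

lemma dt_Suc_schur:
  assumes q: "\<And>j. j < n \<Longrightarrow> (\<Sum>i<n. q i * A i j) = A n j"
  shows "dt (Suc n) A = (A n n - (\<Sum>i<n. q i * A i n)) * dt n A"
proof -
  let ?L = "\<lambda>i j. if i = n \<and> j < n then - q j else idm i j"
  let ?s = "A n n - (\<Sum>i<n. q i * A i n)"
  have "dt (Suc n) (\<lambda>i j. \<Sum>k<Suc n. ?L i k * A k j) =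
    dt (Suc n) (\<lambda>i j. if i = n then (if j = n then ?s else 0) else A i j)"
  proof (rule dt_cong)
    fix i j assume ij: "i < Suc n" "j < Suc n"
    show "(\<Sum>k<Suc n. ?L i k * A k j) = (if i = n then (if j = n then ?s else 0) else A i j)"
    proof (cases "i = n")
      case True
      have "(\<Sum>k<Suc n. ?L i k * A k j) = A n j - (\<Sum>k<n. q k * A k j)"
        using True by (simp add: sum_negf)
      then show ?thesis using True q[of j] ij by auto
    next
      case False
      have "(\<Sum>k<Suc n. ?L i k * A k j) = (\<Sum>k<Suc n. if k = i then A k j else 0)"
        using False by (intro sum.cong) auto
      then show ?thesis using False ij by simp
    qed
  qed
  then show ?thesis
    by (simp only: dt_mult dt_last_row dt_lower_unitriangular_last)
qed

lemma dt_smult: "dt n (\<lambda>i j. c * A i j) = c ^ n * dt n A"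
  by (simp add: dt_def prod.distrib sum_distrib_left mult.left_commute)

section \<open>Lebesgue measure on extensional functions\<close>

abbreviation Leb :: "nat \<Rightarrow> rvec measure" where
  "Leb n \<equiv> Pi\<^sub>M {..<n} (\<lambda>_. lborel :: real measure)"

interpretation lbp: product_sigma_finite "\<lambda>_::nat. lborel :: real measure"
  by standard

lemma sigma_finite_Leb: "sigma_finite_measure (Leb n)"
  by (rule lbp.sigma_finite) simp

lemma space_Leb [simp]: "space (Leb n) = Rn n"
  by (simp add: space_PiM Rn_def)

lemma coord_measurable [measurable]: "i < n \<Longrightarrow> (\<lambda>x. x i) \<in> borel_measurable (Leb n)"
  by (metis lessThan_iff measurable_component_singleton measurable_lborel1)

lemma ip_measurable [measurable]: "(\<lambda>x. ip n x y) \<in> borel_measurable (Leb n)"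
  unfolding ip_def by measurable

lemma ip_self_measurable [measurable]: "(\<lambda>x. ip n x x) \<in> borel_measurable (Leb n)"
  unfolding ip_def by measurable

lemma lam_measurable [measurable (raw)]:
  "(\<And>i. i < n \<Longrightarrow> (\<lambda>x. f x i) \<in> borel_measurable N) \<Longrightarrow> (\<lambda>x. \<lambda>i\<in>{..<n}. f x i) \<in> measurable N (Leb n)"
  by (rule measurable_restrict) auto

lemma mat_app_measurable [measurable]: "mat_app n A \<in> measurable (Leb n) (Leb n)"
  unfolding mat_app_def by (rule lam_measurable) measurable

lemma lam_in_Rn [simp]: "(\<lambda>i\<in>{..<n}. f i) \<in> Rn n"
  by (simp add: Rn_def)

lemma mat_app_in_Rn [simp]: "mat_app n A x \<in> Rn n"
  by (simp add: mat_app_def)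

lemma Rn_ext: "x \<in> Rn n \<Longrightarrow> y \<in> Rn n \<Longrightarrow> (\<And>i. i < n \<Longrightarrow> x i = y i) \<Longrightarrow> x = y"
  unfolding Rn_def by (rule PiE_ext) auto

lemma Rn_lam [simp]: "x \<in> Rn n \<Longrightarrow> (\<lambda>i\<in>{..<n}. x i) = x"
  by (rule Rn_ext) auto

lemma distr_translate:
  "distr (Leb n) (Leb n) (\<lambda>x. \<lambda>i\<in>{..<n}. x i + a i) = Leb n"
proof (rule lbp.PiM_eqI)
  fix A :: "nat \<Rightarrow> real set" assume A: "\<And>i. i \<in> {..<n} \<Longrightarrow> A i \<in> sets lborel"
  have [measurable]: "(\<lambda>x. \<lambda>i\<in>{..<n}. x i + a i) \<in> measurable (Leb n) (Leb n)"
    by (rule lam_measurable) measurable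
  have AS: "Pi\<^sub>E {..<n} A \<in> sets (Leb n)"
    using A by (intro sets_PiM_I_finite) auto
  have vA: "(\<lambda>t. a i + t) -` A i \<in> sets lborel" if "i < n" for i
    using A[of i] that measurable_sets[of "\<lambda>t. a i + t" borel borel "A i"] by auto
  have "emeasure (distr (Leb n) (Leb n) (\<lambda>x. \<lambda>i\<in>{..<n}. x i + a i)) (Pi\<^sub>E {..<n} A) =
      emeasure (Leb n) ((\<lambda>x. \<lambda>i\<in>{..<n}. x i + a i) -` Pi\<^sub>E {..<n} A \<inter> space (Leb n))"
    by (rule emeasure_distr) (use AS in measurable)
  also have "(\<lambda>x. \<lambda>i\<in>{..<n}. x i + a i) -` Pi\<^sub>E {..<n} A \<inter> space (Leb n) =
      Pi\<^sub>E {..<n} (\<lambda>i. (\<lambda>t. a i + t) -` A i)"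
    by (auto simp: Rn_def PiE_iff add.commute)
  also have "emeasure (Leb n) \<dots> = (\<Prod>i<n. emeasure lborel ((\<lambda>t. a i + t) -` A i))"
    using vA by (subst lbp.emeasure_PiM) auto
  also have "\<dots> = (\<Prod>i<n. emeasure lborel (A i))"
  proof (intro prod.cong refl)
    fix i assume i: "i \<in> {..<n}"
    have "emeasure lborel (A i) = emeasure (distr lborel borel ((+) (a i))) (A i)"
      by (simp add: lborel_distr_plus)
    also have "\<dots> = emeasure lborel ((\<lambda>t. a i + t) -` A i)"
      using A[OF i] by (subst emeasure_distr) auto
    finally show "emeasure lborel ((\<lambda>t. a i + t) -` A i) = emeasure lborel (A i)" by simp
  qed
  finally show "emeasure (distr (Leb n) (Leb n) (\<lambda>x. \<lambda>i\<in>{..<n}. x i + a i)) (Pi\<^sub>E {..<n} A) =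
    (\<Prod>i\<in>{..<n}. emeasure lborel (A i))" .
qed auto

lemma nn_integral_translate:
  assumes [measurable]: "f \<in> borel_measurable (Leb n)"
  shows "(\<integral>\<^sup>+x. f (\<lambda>i\<in>{..<n}. x i + a i) \<partial>Leb n) = (\<integral>\<^sup>+x. f x \<partial>Leb n)"
proof -
  have [measurable]: "(\<lambda>x. \<lambda>i\<in>{..<n}. x i + a i) \<in> measurable (Leb n) (Leb n)"
    by (rule lam_measurable) measurable
  show ?thesis
    by (subst (2) distr_translate[of n a, symmetric], subst nn_integral_distr) auto
qed

lemma nn_integral_Leb_Suc:
  assumes [measurable]: "f \<in> borel_measurable (Leb (Suc n))"
  shows "(\<integral>\<^sup>+x. f x \<partial>Leb (Suc n)) = (\<integral>\<^sup>+y. \<integral>\<^sup>+t. f (y(n := t)) \<partial>lborel \<partial>Leb n)"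
    and "(\<integral>\<^sup>+x. f x \<partial>Leb (Suc n)) = (\<integral>\<^sup>+t. \<integral>\<^sup>+y. f (y(n := t)) \<partial>Leb n \<partial>lborel)"
  using assms unfolding lessThan_Suc
  by (auto intro: lbp.product_nn_integral_insert lbp.product_nn_integral_insert_rev)

lemma upd_measurable1 [measurable]: "(\<lambda>y. y(n := t)) \<in> measurable (Leb n) (Leb (Suc n))"
  unfolding lessThan_Suc by (rule measurable_fun_upd[where J = "{..<n}"]) auto

lemma upd_measurable2 [measurable]: "y \<in> Rn n \<Longrightarrow> (\<lambda>t. y(n := t)) \<in> measurable borel (Leb (Suc n))"
  unfolding lessThan_Suc
  by (rule measurable_fun_upd[where J = "{..<n}"]) (auto simp: space_PiM Rn_def)

text \<open>
  The change of variables formula by induction on \<open>n\<close>: eliminating the last row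
  splits \<open>A\<close> into a shear, a scaling of the last coordinate by the Schur complement,
  and the map of the leading \<open>n \<times> n\<close> block in the other coordinates. Dividing
  by the pivots is why all leading minors have to be nonzero; positive definite matrices satisfy
  this.
\<close>

lemma nn_integral_linear:
  assumes "\<And>k. k \<le> n \<Longrightarrow> dt k A \<noteq> 0" "f \<in> borel_measurable (Leb n)"
  shows "ennreal \<bar>dt n A\<bar> * (\<integral>\<^sup>+x. f (mat_app n A x) \<partial>Leb n) = (\<integral>\<^sup>+x. f x \<partial>Leb n)"
  using assms
proof (induction n arbitrary: f)
  case 0
  have "mat_app 0 A x = x" if "x \<in> space (Leb 0)" for x
    using that by (intro Rn_ext[of _ 0]) (simp_all only: space_Leb, auto)
  then have "(\<integral>\<^sup>+x. f (mat_app 0 A x) \<partial>Leb 0) = (\<integral>\<^sup>+x. f x \<partial>Leb 0)"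
    by (intro nn_integral_cong) simp
  then show ?case by simp
next
  case (Suc n)
  note [measurable] = Suc.prems(2)
  obtain B where B: "\<And>i j. i < n \<Longrightarrow> j < n \<Longrightarrow> (\<Sum>k<n. B i k * A k j) = idm i j"
    by (rule dt_inverse[of n A]) (use Suc.prems(1)[of n] in auto)
  define q where "q i = (\<Sum>l<n. A n l * B l i)" for i
  have q: "(\<Sum>i<n. q i * A i j) = A n j" if j: "j < n" for j
  proof -
    have "(\<Sum>i<n. q i * A i j) = (\<Sum>l<n. A n l * (\<Sum>i<n. B l i * A i j))"
      unfolding q_def by (simp add: sum_distrib_right sum_distrib_left mult.assoc) (rule sum.swap)
    also have "\<dots> = (\<Sum>l<n. if l = j then A n l else 0)"
      using B j by (intro sum.cong) auto
    finally show ?thesis using j by simp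
  qed
  define s where "s = A n n - (\<Sum>i<n. q i * A i n)"
  have dS: "dt (Suc n) A = s * dt n A"
    unfolding s_def by (rule dt_Suc_schur) (rule q)
  have s0: "s \<noteq> 0" using dS Suc.prems(1)[of "Suc n"] by auto
  \<comment> \<open>\<open>f'\<close> is \<open>f\<close> after the shear and the scaling of the last coordinate\<close>
  define f' where "f' x = f (x(n := (\<Sum>i<n. q i * x i) + s * x n))" for x
  have [measurable]: "f' \<in> borel_measurable (Leb (Suc n))"
  proof -
    have "(\<lambda>x. \<lambda>i\<in>{..<Suc n}. if i = n then (\<Sum>i<n. q i * x i) + s * x n else x i)
        \<in> measurable (Leb (Suc n)) (Leb (Suc n))"
      by (rule lam_measurable) measurable
    then have "(\<lambda>x. f (\<lambda>i\<in>{..<Suc n}. if i = n then (\<Sum>i<n. q i * x i) + s * x n else x i))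
        \<in> borel_measurable (Leb (Suc n))" by measurable
    also have "?this \<longleftrightarrow> f' \<in> borel_measurable (Leb (Suc n))"
    proof (rule measurable_cong)
      fix x assume "x \<in> space (Leb (Suc n))"
      then have "(\<lambda>i\<in>{..<Suc n}. if i = n then (\<Sum>i<n. q i * x i) + s * x n else x i) =
          x(n := (\<Sum>i<n. q i * x i) + s * x n)"
        by (auto simp: Rn_def PiE_def extensional_def fun_eq_iff)
      then show "f (\<lambda>i\<in>{..<Suc n}. if i = n then (\<Sum>i<n. q i * x i) + s * x n else x i) = f' x"
        by (simp add: f'_def)
    qed
    finally show ?thesis .
  qed
  have key: "f (mat_app (Suc n) A (y(n := t))) =
      f' ((\<lambda>i\<in>{..<n}. mat_app n A y i + A i n * t)(n := t))" if y: "y \<in> Rn n" for y t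
  proof -
    have 1: "(\<Sum>i<n. q i * (\<lambda>i\<in>{..<n}. mat_app n A y i + A i n * t) i) + s * t =
        (\<Sum>j<n. A n j * y j) + A n n * t"
    proof -
      have "(\<Sum>i<n. q i * (\<lambda>i\<in>{..<n}. mat_app n A y i + A i n * t) i) =
          (\<Sum>i<n. q i * (\<Sum>j<n. A i j * y j)) + (\<Sum>i<n. q i * A i n) * t"
        by (simp add: mat_app_def algebra_simps sum.distrib sum_distrib_left)
      also have "(\<Sum>i<n. q i * (\<Sum>j<n. A i j * y j)) = (\<Sum>j<n. (\<Sum>i<n. q i * A i j) * y j)"
        by (simp add: sum_distrib_right sum_distrib_left mult.assoc) (rule sum.swap)
      also have "\<dots> = (\<Sum>j<n. A n j * y j)" using q by simp
      finally show ?thesis by (simp add: s_def algebra_simps)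
    qed
    have "mat_app (Suc n) A (y(n := t)) =
      (\<lambda>i\<in>{..<n}. mat_app n A y i + A i n * t)(n := (\<Sum>j<n. A n j * y j) + A n n * t)"
      by (auto simp: mat_app_def fun_eq_iff)
    also have "\<dots> = (\<lambda>i\<in>{..<n}. mat_app n A y i + A i n * t)
        (n := (\<Sum>i<n. q i * (\<lambda>i\<in>{..<n}. mat_app n A y i + A i n * t) i) + s * t)"
      by (simp only: 1)
    also have "(\<Sum>i<n. q i * (\<lambda>i\<in>{..<n}. mat_app n A y i + A i n * t) i) =
        (\<Sum>i<n. q i * ((\<lambda>i\<in>{..<n}. mat_app n A y i + A i n * t)(n := t)) i)"
      by (intro sum.cong) auto
    finally show ?thesis unfolding f'_def by (simp only: fun_upd_same fun_upd_upd)
  qed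
  have "(\<integral>\<^sup>+x. f (mat_app (Suc n) A x) \<partial>Leb (Suc n)) =
      (\<integral>\<^sup>+t. \<integral>\<^sup>+y. f (mat_app (Suc n) A (y(n := t))) \<partial>Leb n \<partial>lborel)"
    by (rule nn_integral_Leb_Suc) measurable
  also have "\<dots> = (\<integral>\<^sup>+t. \<integral>\<^sup>+y. f' ((\<lambda>i\<in>{..<n}. mat_app n A y i + A i n * t)(n := t)) \<partial>Leb n \<partial>lborel)"
    by (intro nn_integral_cong) (simp add: key)
  finally have "ennreal \<bar>dt n A\<bar> * (\<integral>\<^sup>+x. f (mat_app (Suc n) A x) \<partial>Leb (Suc n)) =
      ennreal \<bar>dt n A\<bar> * (\<integral>\<^sup>+t. \<integral>\<^sup>+y. f' ((\<lambda>i\<in>{..<n}. mat_app n A y i + A i n * t)(n := t)) \<partial>Leb n \<partial>lborel)"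
    by simp
  also have "\<dots> = (\<integral>\<^sup>+t. ennreal \<bar>dt n A\<bar> * (\<integral>\<^sup>+y. f' ((\<lambda>i\<in>{..<n}. mat_app n A y i + A i n * t)(n := t)) \<partial>Leb n) \<partial>lborel)"
  proof (rule nn_integral_cmult[symmetric])
    interpret sigma_finite_measure "Leb n" by (rule sigma_finite_Leb)
    have "(\<lambda>(t, y). \<lambda>i\<in>{..<Suc n}. if i = n then t else (\<Sum>j<n. A i j * y j) + A i n * t) \<in>
        measurable (borel \<Otimes>\<^sub>M Leb n) (Leb (Suc n))"
      unfolding case_prod_beta by (rule lam_measurable) measurable
    then have "(\<lambda>(t, y). f' (\<lambda>i\<in>{..<Suc n}. if i = n then t else (\<Sum>j<n. A i j * y j) + A i n * t)) \<in>
        borel_measurable (borel \<Otimes>\<^sub>M Leb n)"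
      unfolding case_prod_beta by measurable
    moreover have "(\<lambda>i\<in>{..<Suc n}. if i = n then t else (\<Sum>j<n. A i j * y j) + A i n * t) =
       ((\<lambda>i\<in>{..<n}. mat_app n A y i + A i n * t)(n := t))" for y t
      by (auto simp: fun_eq_iff mat_app_def)
    ultimately have "(\<lambda>(t, y). f' ((\<lambda>i\<in>{..<n}. mat_app n A y i + A i n * t)(n := t))) \<in>
        borel_measurable (borel \<Otimes>\<^sub>M Leb n)" by simp
    from borel_measurable_nn_integral[OF this]
    show "(\<lambda>t. \<integral>\<^sup>+y. f' ((\<lambda>i\<in>{..<n}. mat_app n A y i + A i n * t)(n := t)) \<partial>Leb n) \<in> borel_measurable lborel"
      by simp
  qed
  also have "\<dots> = (\<integral>\<^sup>+t. (\<integral>\<^sup>+y. f' (y(n := t)) \<partial>Leb n) \<partial>lborel)"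
  proof (intro nn_integral_cong)
    fix t :: real
    have [measurable]: "(\<lambda>x. \<lambda>i\<in>{..<n}. x i + A i n * t) \<in> measurable (Leb n) (Leb n)"
      by (rule lam_measurable) measurable
    have "ennreal \<bar>dt n A\<bar> * (\<integral>\<^sup>+y. f' ((\<lambda>i\<in>{..<n}. mat_app n A y i + A i n * t)(n := t)) \<partial>Leb n) =
       (\<integral>\<^sup>+y. f' ((\<lambda>i\<in>{..<n}. y i + A i n * t)(n := t)) \<partial>Leb n)"
      by (rule Suc.IH[where f = "\<lambda>y. f' ((\<lambda>i\<in>{..<n}. y i + A i n * t)(n := t))"])
        (simp add: Suc.prems(1), measurable)
    also have "\<dots> = (\<integral>\<^sup>+y. f' (y(n := t)) \<partial>Leb n)"
      by (rule nn_integral_translate[where f = "\<lambda>y. f' (y(n := t))"]) measurable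
    finally show "ennreal \<bar>dt n A\<bar> * (\<integral>\<^sup>+y. f' ((\<lambda>i\<in>{..<n}. mat_app n A y i + A i n * t)(n := t)) \<partial>Leb n) =
        (\<integral>\<^sup>+y. f' (y(n := t)) \<partial>Leb n)" .
  qed
  also have "\<dots> = (\<integral>\<^sup>+y. (\<integral>\<^sup>+t. f' (y(n := t)) \<partial>lborel) \<partial>Leb n)"
    using nn_integral_Leb_Suc[of f' n] by simp
  finally have 1: "ennreal \<bar>dt n A\<bar> * (\<integral>\<^sup>+x. f (mat_app (Suc n) A x) \<partial>Leb (Suc n)) =
      (\<integral>\<^sup>+y. (\<integral>\<^sup>+t. f' (y(n := t)) \<partial>lborel) \<partial>Leb n)" .
  have 2: "ennreal \<bar>s\<bar> * (\<integral>\<^sup>+y. (\<integral>\<^sup>+t. f' (y(n := t)) \<partial>lborel) \<partial>Leb n) = (\<integral>\<^sup>+x. f x \<partial>Leb (Suc n))"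
  proof -
    have *: "ennreal \<bar>s\<bar> * (\<integral>\<^sup>+t. f' (y(n := t)) \<partial>lborel) = (\<integral>\<^sup>+t. f (y(n := t)) \<partial>lborel)"
      if y: "y \<in> Rn n" for y
    proof -
      have [measurable]: "(\<lambda>t. f (y(n := t))) \<in> borel_measurable borel" using y by measurable
      show ?thesis
        by (subst (2) nn_integral_real_affine[OF _ s0, of _ "\<Sum>i<n. q i * y i"])
          (auto simp: f'_def)
    qed
    have "ennreal \<bar>s\<bar> * (\<integral>\<^sup>+y. (\<integral>\<^sup>+t. f' (y(n := t)) \<partial>lborel) \<partial>Leb n) =
      (\<integral>\<^sup>+y. ennreal \<bar>s\<bar> * (\<integral>\<^sup>+t. f' (y(n := t)) \<partial>lborel) \<partial>Leb n)"
    proof (rule nn_integral_cmult[symmetric])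
      have "(\<lambda>(y, t). \<lambda>i\<in>{..<Suc n}. if i = n then t else y i) \<in>
          measurable (Leb n \<Otimes>\<^sub>M borel) (Leb (Suc n))"
        unfolding case_prod_beta
      proof (rule lam_measurable)
        fix i assume "i < Suc n"
        then show "(\<lambda>x. if i = n then snd x else fst x i) \<in> borel_measurable (Leb n \<Otimes>\<^sub>M borel)"
          by (cases "i = n") auto
      qed
      then have "(\<lambda>(y, t). f' (\<lambda>i\<in>{..<Suc n}. if i = n then t else y i)) \<in>
          borel_measurable (Leb n \<Otimes>\<^sub>M borel)"
        unfolding case_prod_beta by measurable
      then have "(\<lambda>y. \<integral>\<^sup>+t. f' (\<lambda>i\<in>{..<Suc n}. if i = n then t else y i) \<partial>lborel) \<in> borel_measurable (Leb n)"
        by (intro lborel.borel_measurable_nn_integral) (simp add: case_prod_beta)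
      also have "?this \<longleftrightarrow> (\<lambda>y. \<integral>\<^sup>+t. f' (y(n := t)) \<partial>lborel) \<in> borel_measurable (Leb n)"
      proof (intro measurable_cong nn_integral_cong)
        fix y t assume "y \<in> space (Leb n)"
        then have "(\<lambda>i\<in>{..<Suc n}. if i = n then t else y i) = y(n := t)"
          by (auto simp: fun_eq_iff Rn_def PiE_def extensional_def)
        then show "f' (\<lambda>i\<in>{..<Suc n}. if i = n then t else y i) = f' (y(n := t))" by simp
      qed
      finally show "(\<lambda>y. \<integral>\<^sup>+t. f' (y(n := t)) \<partial>lborel) \<in> borel_measurable (Leb n)" .
    qed
    also have "\<dots> = (\<integral>\<^sup>+y. \<integral>\<^sup>+t. f (y(n := t)) \<partial>lborel \<partial>Leb n)"
      using * by (intro nn_integral_cong) auto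
    also have "\<dots> = (\<integral>\<^sup>+x. f x \<partial>Leb (Suc n))"
      by (rule nn_integral_Leb_Suc[symmetric]) measurable
    finally show ?thesis .
  qed
  show ?case
    using 1 2 unfolding dS
    by (simp add: abs_mult ennreal_mult mult.assoc)
qed

text \<open>
  The usual proof of uniqueness of Haar measure: both sides are the integral of \<open>indicator C
  y * indicator B (x + y)\<close> over \<open>m \<Otimes>\<^sub>M Leb n\<close>, evaluated in the
  two orders.
\<close>

lemma translation_invariant_unique:
  assumes m: "sets m = sets (Leb n)" "sigma_finite_measure m"
    and inv: "\<And>a. distr m (Leb n) (\<lambda>x. \<lambda>i\<in>{..<n}. x i + a i) = m"
    and B[measurable]: "B \<in> sets (Leb n)" and C[measurable]: "C \<in> sets (Leb n)"
  shows "emeasure m B * emeasure (Leb n) C =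
    emeasure (Leb n) B * emeasure m {x \<in> Rn n. vneg n x \<in> C}"
proof -
  interpret m: sigma_finite_measure m by fact
  interpret L: sigma_finite_measure "Leb n" by (rule sigma_finite_Leb)
  interpret P: pair_sigma_finite m "Leb n" ..
  note [measurable_cong] = m(1)
  have sp: "space m = Rn n" using sets_eq_imp_space_eq[OF m(1)] by simp
  have tr: "(\<integral>\<^sup>+x. f (\<lambda>i\<in>{..<n}. x i + a i) \<partial>m) = (\<integral>\<^sup>+x. f x \<partial>m)"
    if [measurable]: "f \<in> borel_measurable (Leb n)" for f a
  proof -
    have [measurable]: "(\<lambda>x. \<lambda>i\<in>{..<n}. x i + a i) \<in> measurable m (Leb n)"
      by (rule lam_measurable) measurable
    show ?thesis
      by (subst (2) inv[of a, symmetric], subst nn_integral_distr) auto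
  qed
  have [measurable]: "(\<lambda>x. \<lambda>i\<in>{..<n}. fst x i + snd x i) \<in> measurable (m \<Otimes>\<^sub>M Leb n) (Leb n)"
    by (rule lam_measurable) measurable
  have [measurable]: "(\<lambda>x. \<lambda>i\<in>{..<n}. snd x i - fst x i) \<in> measurable (m \<Otimes>\<^sub>M Leb n) (Leb n)"
    by (rule lam_measurable) measurable
  have "emeasure m B * emeasure (Leb n) C = (\<integral>\<^sup>+y. indicator C y * (\<integral>\<^sup>+x. indicator B x \<partial>m) \<partial>Leb n)"
    by (simp add: nn_integral_multc mult.commute)
  also have "\<dots> = (\<integral>\<^sup>+y. indicator C y * (\<integral>\<^sup>+x. indicator B (\<lambda>i\<in>{..<n}. x i + y i) \<partial>m) \<partial>Leb n)"
    by (subst tr) auto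
  also have "\<dots> = (\<integral>\<^sup>+y. \<integral>\<^sup>+x. indicator C y * indicator B (\<lambda>i\<in>{..<n}. x i + y i) \<partial>m \<partial>Leb n)"
  proof (intro nn_integral_cong nn_integral_cmult[symmetric])
    fix y
    have "(\<lambda>x. \<lambda>i\<in>{..<n}. x i + y i) \<in> measurable m (Leb n)"
      by (rule lam_measurable) measurable
    then show "(\<lambda>x. indicator B (\<lambda>i\<in>{..<n}. x i + y i) :: ennreal) \<in> borel_measurable m"
      by measurable
  qed
  also have "\<dots> = (\<integral>\<^sup>+x. \<integral>\<^sup>+y. indicator C y * indicator B (\<lambda>i\<in>{..<n}. x i + y i) \<partial>Leb n \<partial>m)"
    by (rule P.Fubini') (simp add: case_prod_beta)
  also have "\<dots> = (\<integral>\<^sup>+x. \<integral>\<^sup>+y. indicator C (\<lambda>i\<in>{..<n}. y i - x i) * indicator B y \<partial>Leb n \<partial>m)"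
  proof (rule nn_integral_cong)
    fix x
    have [measurable]: "(\<lambda>z. \<lambda>i\<in>{..<n}. z i - x i) \<in> measurable (Leb n) (Leb n)"
      by (rule lam_measurable) measurable
    have "(\<integral>\<^sup>+y. indicator C y * indicator B (\<lambda>i\<in>{..<n}. x i + y i) \<partial>Leb n) =
      (\<integral>\<^sup>+y. indicator C (\<lambda>i\<in>{..<n}. (\<lambda>i\<in>{..<n}. y i + x i) i - x i) * indicator B (\<lambda>i\<in>{..<n}. y i + x i) \<partial>Leb n)"
    proof (intro nn_integral_cong)
      fix y assume y: "y \<in> space (Leb n)"
      have "(\<lambda>i\<in>{..<n}. (\<lambda>i\<in>{..<n}. y i + x i) i - x i) = y"
        by (rule Rn_ext[of _ n]) (use y in auto)
      then show "indicator C y * indicator B (\<lambda>i\<in>{..<n}. x i + y i) =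
         indicator C (\<lambda>i\<in>{..<n}. (\<lambda>i\<in>{..<n}. y i + x i) i - x i) * (indicator B (\<lambda>i\<in>{..<n}. y i + x i) :: ennreal)"
        by (simp add: add.commute)
    qed
    also have "\<dots> = (\<integral>\<^sup>+y. indicator C (\<lambda>i\<in>{..<n}. y i - x i) * indicator B y \<partial>Leb n)"
      by (rule nn_integral_translate[where f = "\<lambda>z. indicator C (\<lambda>i\<in>{..<n}. z i - x i) * indicator B z"]) measurable
    finally show "(\<integral>\<^sup>+y. indicator C y * indicator B (\<lambda>i\<in>{..<n}. x i + y i) \<partial>Leb n) =
      (\<integral>\<^sup>+y. indicator C (\<lambda>i\<in>{..<n}. y i - x i) * indicator B y \<partial>Leb n)" .
  qed
  also have "\<dots> = (\<integral>\<^sup>+y. \<integral>\<^sup>+x. indicator C (\<lambda>i\<in>{..<n}. y i - x i) * indicator B y \<partial>m \<partial>Leb n)"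
    by (rule P.Fubini'[symmetric]) (simp add: case_prod_beta)
  also have "\<dots> = (\<integral>\<^sup>+y. emeasure m {x \<in> Rn n. vneg n x \<in> C} * indicator B y \<partial>Leb n)"
  proof (rule nn_integral_cong)
    fix y
    have [measurable]: "(\<lambda>x. \<lambda>i\<in>{..<n}. y i - x i) \<in> measurable m (Leb n)"
      by (rule lam_measurable) measurable
    have [measurable]: "vneg n \<in> measurable m (Leb n)"
      unfolding vneg_def by (rule lam_measurable) measurable
    have [measurable]: "(\<lambda>x. indicator C (vneg n x) :: ennreal) \<in> borel_measurable (Leb n)"
      using m(1) by (simp cong: measurable_cong_sets)
    have "(\<integral>\<^sup>+x. indicator C (\<lambda>i\<in>{..<n}. y i - x i) * indicator B y \<partial>m) =
      (\<integral>\<^sup>+x. indicator C (\<lambda>i\<in>{..<n}. y i - x i) \<partial>m) * indicator B y"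
      by (rule nn_integral_multc) measurable
    also have "(\<integral>\<^sup>+x. indicator C (\<lambda>i\<in>{..<n}. y i - x i) \<partial>m) =
      (\<integral>\<^sup>+x. indicator C (vneg n (\<lambda>i\<in>{..<n}. x i + - y i)) \<partial>m)"
      by (intro nn_integral_cong arg_cong2[where f = indicator] refl) (auto simp: vneg_def fun_eq_iff)
    also have "\<dots> = (\<integral>\<^sup>+x. indicator C (vneg n x) \<partial>m)"
      by (rule tr[where f = "\<lambda>x. indicator C (vneg n x)"]) measurable
    also have "\<dots> = (\<integral>\<^sup>+x. indicator {x \<in> space m. vneg n x \<in> C} x \<partial>m)"
      by (intro nn_integral_cong) (auto simp: indicator_def)
    also have "\<dots> = emeasure m {x \<in> space m. vneg n x \<in> C}"
      by (rule nn_integral_indicator) measurable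
    finally show "(\<integral>\<^sup>+x. indicator C (\<lambda>i\<in>{..<n}. y i - x i) * indicator B y \<partial>m) =
      emeasure m {x \<in> Rn n. vneg n x \<in> C} * indicator B y" unfolding sp .
  qed
  also have "\<dots> = emeasure (Leb n) B * emeasure m {x \<in> Rn n. vneg n x \<in> C}"
    by (subst nn_integral_cmult) (auto simp: mult.commute)
  finally show ?thesis .
qed

lemma emeasure_box:
  assumes "\<And>i. i < n \<Longrightarrow> a i \<le> b i"
  shows "emeasure (Leb n) (Pi\<^sub>E {..<n} (\<lambda>i. {a i..b i})) = ennreal (\<Prod>i<n. b i - a i)"
  using assms by (subst lbp.emeasure_PiM) (auto intro!: prod_ennreal)

lemma box_sets [measurable]: "Pi\<^sub>E {..<n} (\<lambda>i. {a i..b i :: real}) \<in> sets (Leb n)"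
  by (rule sets_PiM_I_finite) auto

definition cube :: "nat \<Rightarrow> real \<Rightarrow> rvec set" where
  "cube n r = Pi\<^sub>E {..<n} (\<lambda>_. {-r..r})"

lemma cube_iff: "x \<in> cube n r \<longleftrightarrow> x \<in> Rn n \<and> (\<forall>i<n. \<bar>x i\<bar> \<le> r)"
  by (auto simp: cube_def Rn_def PiE_iff abs_le_iff minus_le_iff)

lemma cube_sets [measurable]: "cube n r \<in> sets (Leb n)"
  by (simp add: cube_def)

lemma emeasure_cube: "r \<ge> 0 \<Longrightarrow> emeasure (Leb n) (cube n r) = ennreal ((2 * r) ^ n)"
  unfolding cube_def by (subst emeasure_box) auto

lemma ip_minus_left: "ip n (\<lambda>i. x i - y i) z = ip n x z - ip n y z"
  and ip_plus_left: "ip n (\<lambda>i. x i + y i) z = ip n x z + ip n y z"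
  and ip_minus_right: "ip n z (\<lambda>i. x i - y i) = ip n z x - ip n z y"
  and ip_plus_right: "ip n z (\<lambda>i. x i + y i) = ip n z x + ip n z y"
  and ip_commute: "ip n x y = ip n y x"
  by (simp_all add: ip_def algebra_simps sum.distrib sum_subtractf)

lemma sq_coord_le_ip: "i < n \<Longrightarrow> (x i)\<^sup>2 \<le> ip n x x"
  unfolding ip_def power2_eq_square
  by (rule member_le_sum[where f = "\<lambda>i. x i * x i"]) auto

lemma ip_self_nonneg [simp]: "0 \<le> ip n x x"
  unfolding ip_def by (rule sum_nonneg) auto

lemma ball_subset_cube: "0 \<le> r \<Longrightarrow> {x \<in> Rn n. ip n x x \<le> r\<^sup>2} \<subseteq> cube n r"
proof safe
  fix x assume r: "0 \<le> r" and x: "x \<in> Rn n" "ip n x x \<le> r\<^sup>2"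
  then have "(x i)\<^sup>2 \<le> r\<^sup>2" if "i < n" for i using sq_coord_le_ip[OF that, of x] by linarith
  then show "x \<in> cube n r" using r x(1) by (auto simp: cube_iff abs_le_square_iff[symmetric])
qed

lemma cube_subset_ball: "0 \<le> r \<Longrightarrow> x \<in> cube n r \<Longrightarrow> ip n x x \<le> n * r\<^sup>2"
proof -
  assume r: "0 \<le> r" and x: "x \<in> cube n r"
  have "ip n x x \<le> (\<Sum>i<n. r\<^sup>2)"
    unfolding ip_def
  proof (rule sum_mono)
    fix i assume "i \<in> {..<n}"
    then have "\<bar>x i\<bar> \<le> \<bar>r\<bar>" using x r by (auto simp: cube_iff)
    then show "x i * x i \<le> r\<^sup>2" by (simp add: abs_le_square_iff power2_eq_square)
  qed
  then show ?thesis by simp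
qed

lemma mat_app_orthogonal_ip:
  assumes Q: "\<And>i j. i < n \<Longrightarrow> j < n \<Longrightarrow> (\<Sum>k<n. Q k i * Q k j) = idm i j"
  shows "ip n (mat_app n Q x) (mat_app n Q y) = ip n x y"
proof -
  have "ip n (mat_app n Q x) (mat_app n Q y) = (\<Sum>k<n. \<Sum>i<n. \<Sum>j<n. (Q k i * Q k j) * (x i * y j))"
    by (simp add: ip_def mat_app_def sum_product algebra_simps)
  also have "\<dots> = (\<Sum>i<n. \<Sum>k<n. \<Sum>j<n. (Q k i * Q k j) * (x i * y j))" by (rule sum.swap)
  also have "\<dots> = (\<Sum>i<n. \<Sum>j<n. \<Sum>k<n. (Q k i * Q k j) * (x i * y j))" by (intro sum.cong refl sum.swap)
  also have "\<dots> = (\<Sum>i<n. \<Sum>j<n. (\<Sum>k<n. Q k i * Q k j) * (x i * y j))"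
    by (simp add: sum_distrib_right)
  also have "\<dots> = (\<Sum>i<n. \<Sum>j<n. if j = i then x i * y i else 0)"
    by (intro sum.cong refl) (auto simp: Q)
  also have "\<dots> = ip n x y" by (simp add: ip_def)
  finally show ?thesis .
qed

lemma mat_app_mult:
  "mat_app n A (mat_app n B x) = mat_app n (\<lambda>i j. \<Sum>k<n. A i k * B k j) x"
  by (auto simp: mat_app_def fun_eq_iff sum_distrib_left sum_distrib_right mult.assoc intro: sum.swap)

text \<open>
  A rotation can have vanishing leading minors, so it is not covered by
  \<open>nn_integral_linear\<close>. Instead, the image of Lebesgue measure under a rotation is
  translation invariant and agrees with Lebesgue measure on the unit ball, hence everywhere.
\<close>

lemma nn_integral_rotate:
  assumes Q: "\<And>i j. i < n \<Longrightarrow> j < n \<Longrightarrow> (\<Sum>k<n. Q i k * Q j k) = idm i j"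
    and f [measurable]: "f \<in> borel_measurable (Leb n)"
  shows "(\<integral>\<^sup>+x. f (mat_app n Q x) \<partial>Leb n) = (\<integral>\<^sup>+x. f x \<partial>Leb n)"
proof -
  have Q': "(\<Sum>k<n. Q k i * Q k j) = idm i j" if "i < n" "j < n" for i j
    using Q that by (rule orthonormal_columns)
  define m where "m = distr (Leb n) (Leb n) (mat_app n Q)"
  define ball where "ball k = {x \<in> Rn n. ip n x x \<le> k\<^sup>2}" for k :: real
  have bs [measurable]: "ball k \<in> sets (Leb n)" for k
  proof -
    have "{x \<in> space (Leb n). ip n x x \<le> k\<^sup>2} \<in> sets (Leb n)" by measurable
    then show ?thesis by (simp add: ball_def)
  qed
  have mb: "emeasure m (ball k) = emeasure (Leb n) (ball k)" for k
    unfolding m_def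
    by (subst emeasure_distr) (use bs[unfolded ball_def] in \<open>auto simp: ball_def mat_app_orthogonal_ip[OF Q'] intro!: arg_cong[where f = "emeasure _"]\<close>)
  have bfin: "emeasure (Leb n) (ball k) < \<infinity>" if "k \<ge> 0" for k
  proof -
    have "emeasure (Leb n) (ball k) \<le> emeasure (Leb n) (cube n k)"
      unfolding ball_def using that by (intro emeasure_mono ball_subset_cube) auto
    then show ?thesis using emeasure_cube[OF that, of n] by (auto simp: less_top[symmetric] top_unique)
  qed
  \<comment> \<open>a nondegenerate ball is needed to cancel its volume at the end\<close>
  have bpos: "emeasure (Leb n) (ball 1) \<noteq> 0"
  proof -
    have "cube n (1 / Suc n) \<subseteq> ball 1"
    proof
      fix x assume x: "x \<in> cube n (1 / Suc n)"
      have "ip n x x \<le> n * (1 / Suc n)\<^sup>2" by (rule cube_subset_ball) (use x in auto)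
      also have "\<dots> \<le> 1" by (simp add: power2_eq_square divide_simps) (simp add: algebra_simps)
      finally show "x \<in> ball 1" using x by (simp add: ball_def cube_iff)
    qed
    then have "emeasure (Leb n) (cube n (1 / Suc n)) \<le> emeasure (Leb n) (ball 1)"
      by (intro emeasure_mono) auto
    moreover have "emeasure (Leb n) (cube n (1 / Suc n)) > 0"
      by (subst emeasure_cube) auto
    ultimately show ?thesis by auto
  qed
  have sf: "sigma_finite_measure m"
  proof
    show "\<exists>A. countable A \<and> A \<subseteq> sets m \<and> \<Union> A = space m \<and> (\<forall>a\<in>A. emeasure m a \<noteq> \<infinity>)"
    proof (intro exI[of _ "range (\<lambda>k::nat. ball (real k))"] conjI)
      show "\<Union> (range (\<lambda>k::nat. ball (real k))) = space m"
      proof -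
        have "\<exists>k::nat. ip n x x \<le> (real k)\<^sup>2" for x
        proof -
          obtain k :: nat where k: "ip n x x \<le> k" using real_arch_simple by blast
          also have "real k \<le> (real k)\<^sup>2"
            by (metis le_square of_nat_le_iff of_nat_mult power2_eq_square)
          finally show ?thesis by blast
        qed
        then show ?thesis by (auto simp: ball_def m_def)
      qed
      show "\<forall>a\<in>range (\<lambda>k::nat. ball (real k)). emeasure m a \<noteq> \<infinity>"
        using mb bfin by (auto simp: less_top)
    qed (auto simp: m_def)
  qed
  \<comment> \<open>translating the image by \<open>a\<close> amounts to translating the argument by the preimage of \<open>a\<close>\<close>
  have inv: "distr m (Leb n) (\<lambda>x. \<lambda>i\<in>{..<n}. x i + a i) = m" for a
  proof -
    define b where "b = mat_app n (\<lambda>i j. Q j i) a"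
    have Qb: "mat_app n Q b i = a i" if "i < n" for i
      unfolding b_def mat_app_mult using that
      by (simp add: mat_app_def Q if_distrib[of "\<lambda>c. c * _"] cong: if_cong)
    have t[measurable]: "(\<lambda>x. \<lambda>i\<in>{..<n}. x i + c i) \<in> measurable (Leb n) (Leb n)" for c
      by (rule lam_measurable) measurable
    have "distr m (Leb n) (\<lambda>x. \<lambda>i\<in>{..<n}. x i + a i) =
        distr (Leb n) (Leb n) (\<lambda>x. \<lambda>i\<in>{..<n}. mat_app n Q x i + a i)"
      unfolding m_def by (subst distr_distr) (auto simp: comp_def)
    also have "(\<lambda>x. \<lambda>i\<in>{..<n}. mat_app n Q x i + a i) = (\<lambda>x. mat_app n Q (\<lambda>i\<in>{..<n}. x i + b i))"
    proof (intro ext)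
      fix x i
      have "(\<Sum>j<n. Q i j * (x j + b j)) = (\<Sum>j<n. Q i j * x j) + a i" if "i < n"
        using Qb[OF that] that by (simp add: mat_app_def distrib_left sum.distrib)
      then show "(\<lambda>i\<in>{..<n}. mat_app n Q x i + a i) i = mat_app n Q (\<lambda>i\<in>{..<n}. x i + b i) i"
        by (simp add: mat_app_def)
    qed
    also have "distr (Leb n) (Leb n) \<dots> = distr (distr (Leb n) (Leb n) (\<lambda>x. \<lambda>i\<in>{..<n}. x i + b i)) (Leb n) (mat_app n Q)"
      by (subst distr_distr) (auto simp: comp_def)
    also have "\<dots> = m" unfolding distr_translate m_def ..
    finally show ?thesis .
  qed
  have "m = Leb n"
  proof (rule measure_eqI)
    show sm: "sets m = sets (Leb n)" by (simp add: m_def)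
    fix B assume "B \<in> sets m"
    then have B: "B \<in> sets (Leb n)" by (simp add: m_def)
    have "{x \<in> Rn n. vneg n x \<in> ball 1} = ball 1"
      by (auto simp: ball_def vneg_def ip_def)
    with translation_invariant_unique[OF sm sf inv B bs, of 1]
    have "emeasure m B * emeasure (Leb n) (ball 1) = emeasure (Leb n) B * emeasure (Leb n) (ball 1)"
      by (simp add: mb)
    then have "emeasure m B * emeasure (Leb n) (ball 1) / emeasure (Leb n) (ball 1) =
        emeasure (Leb n) B * emeasure (Leb n) (ball 1) / emeasure (Leb n) (ball 1)" by simp
    then show "emeasure m B = emeasure (Leb n) B"
      using bpos bfin[of 1] by (simp add: mult_divide_eq_ennreal less_top)
  qed
  then have "(\<integral>\<^sup>+x. f x \<partial>Leb n) = (\<integral>\<^sup>+x. f x \<partial>m)" by simp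
  also have "\<dots> = (\<integral>\<^sup>+x. f (mat_app n Q x) \<partial>Leb n)"
    unfolding m_def by (rule nn_integral_distr) measurable
  finally show ?thesis ..
qed

lemma emeasure_scale:
  assumes r: "r > 0" and B [measurable]: "B \<in> sets (Leb n)"
  shows "emeasure (Leb n) {x \<in> Rn n. (\<lambda>i\<in>{..<n}. x i / r) \<in> B} = ennreal (r ^ n) * emeasure (Leb n) B"
proof -
  let ?A = "\<lambda>i j. (1 / r) * idm i j"
  have dtk: "dt k ?A = (1 / r) ^ k" for k by (subst dt_smult) simp
  have [measurable]: "(\<lambda>x. \<lambda>i\<in>{..<n}. x i / r) \<in> measurable (Leb n) (Leb n)"
    by (rule lam_measurable) measurable
  have "ennreal \<bar>dt n ?A\<bar> * (\<integral>\<^sup>+x. indicator B (mat_app n ?A x) \<partial>Leb n) = (\<integral>\<^sup>+x. indicator B x \<partial>Leb n)"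
    by (rule nn_integral_linear) (use r dtk in auto)
  also have "(\<integral>\<^sup>+x. indicator B (mat_app n ?A x) \<partial>Leb n) =
      (\<integral>\<^sup>+x. indicator {x \<in> space (Leb n). (\<lambda>i\<in>{..<n}. x i / r) \<in> B} x \<partial>Leb n)"
  proof (rule nn_integral_cong)
    fix x assume x: "x \<in> space (Leb n)"
    have "mat_app n ?A x = (\<lambda>i\<in>{..<n}. x i / r)"
    proof (rule Rn_ext[of _ n])
      fix i assume i: "i < n"
      have "(\<Sum>j<n. 1 / r * idm i j * x j) = (\<Sum>j<n. if j = i then x j / r else 0)"
        by (intro sum.cong) auto
      then show "mat_app n ?A x i = (\<lambda>i\<in>{..<n}. x i / r) i" using i by (simp add: mat_app_def)
    qed auto
    with x show "indicator B (mat_app n ?A x) =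
        (indicator {x \<in> space (Leb n). (\<lambda>i\<in>{..<n}. x i / r) \<in> B} x :: ennreal)"
      by (simp add: indicator_def)
  qed
  also have "\<dots> = emeasure (Leb n) {x \<in> space (Leb n). (\<lambda>i\<in>{..<n}. x i / r) \<in> B}"
    by (rule nn_integral_indicator) measurable
  finally have 1: "ennreal ((1 / r) ^ n) * emeasure (Leb n) {x \<in> Rn n. (\<lambda>i\<in>{..<n}. x i / r) \<in> B} = emeasure (Leb n) B"
    unfolding dtk using r by (simp only: space_Leb abs_of_nonneg zero_le_power zero_le_divide_1_iff less_imp_le nn_integral_indicator[OF B])
  have "ennreal (r ^ n) * emeasure (Leb n) B =
     (ennreal (r ^ n) * ennreal ((1 / r) ^ n)) * emeasure (Leb n) {x \<in> Rn n. (\<lambda>i\<in>{..<n}. x i / r) \<in> B}"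
    by (simp only: 1[symmetric] mult.assoc)
  also have "ennreal (r ^ n) * ennreal ((1 / r) ^ n) = 1"
    using r by (subst ennreal_mult[symmetric]) (auto simp: power_one_over)
  finally show ?thesis by (simp only: mult_1)
qed

lemma nn_integral_exp_tail:
  "(\<integral>\<^sup>+r. ennreal (exp (- r)) * indicator {a..} r \<partial>lborel) = ennreal (exp (- a :: real))"
proof -
  have "(\<integral>\<^sup>+r. ennreal (exp (- r)) * indicator {a..} r \<partial>lborel) = ennreal (0 - (- exp (- a)))"
  proof (rule nn_integral_FTC_atLeast)
    show "((\<lambda>x::real. - exp (- x)) \<longlongrightarrow> 0) at_top"
      using tendsto_minus[OF filterlim_compose[OF exp_at_bot filterlim_uminus_at_bot_at_top]] by simp
  qed (auto intro!: derivative_eq_intros)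
  then show ?thesis by simp
qed

text \<open>
  Write \<open>exp (- h x)\<close> as the integral of \<open>exp (- r)\<close> over \<open>r \<ge>
  h x\<close>, exchange the integrals, and use that the sublevel set at \<open>r\<close> has
  \<open>r ^ n\<close> times the volume of the one at \<open>1\<close>.
\<close>

lemma gauge_volume:
  assumes h [measurable]: "h \<in> borel_measurable (Leb n)"
    and h0: "\<And>x. x \<in> Rn n \<Longrightarrow> 0 \<le> h x"
    and hom: "\<And>x r. x \<in> Rn n \<Longrightarrow> r > 0 \<Longrightarrow> h (\<lambda>i\<in>{..<n}. x i / r) = h x / r"
  shows "(\<integral>\<^sup>+x. ennreal (exp (- h x)) \<partial>Leb n) = ennreal (fact n) * emeasure (Leb n) {x \<in> Rn n. h x \<le> 1}"
proof -
  interpret L: sigma_finite_measure "Leb n" by (rule sigma_finite_Leb)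
  interpret P: pair_sigma_finite lborel "Leb n" ..
  have lev [measurable]: "{x \<in> Rn n. h x \<le> r} \<in> sets (Leb n)" for r
  proof -
    have "{x \<in> space (Leb n). h x \<le> r} \<in> sets (Leb n)" by measurable
    then show ?thesis by simp
  qed
  have "(\<integral>\<^sup>+x. ennreal (exp (- h x)) \<partial>Leb n) =
      (\<integral>\<^sup>+x. (\<integral>\<^sup>+r. ennreal (exp (- r)) * (indicator {0..} r * indicator {z. z \<le> r} (h x)) \<partial>lborel) \<partial>Leb n)"
    using h0 by (intro nn_integral_cong, subst nn_integral_exp_tail[symmetric], intro nn_integral_cong)
       (force simp: indicator_def)
  also have "\<dots> = (\<integral>\<^sup>+r. (\<integral>\<^sup>+x. ennreal (exp (- r)) * (indicator {0..} r * indicator {z. z \<le> r} (h x)) \<partial>Leb n) \<partial>lborel)"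
    by (rule P.Fubini') measurable
  also have "\<dots> = (\<integral>\<^sup>+r. ennreal (r ^ n * exp (- r)) * indicator {0..} r * emeasure (Leb n) {x \<in> Rn n. h x \<le> 1} \<partial>lborel)"
  proof (rule nn_integral_cong_AE)
    have "AE r in lborel. (r :: real) \<noteq> 0" by (rule AE_lborel_singleton)
    then show "AE r in lborel. (\<integral>\<^sup>+x. ennreal (exp (- r)) * (indicator {0..} r * indicator {z. z \<le> r} (h x)) \<partial>Leb n) =
        ennreal (r ^ n * exp (- r)) * indicator {0..} r * emeasure (Leb n) {x \<in> Rn n. h x \<le> 1}"
    proof eventually_elim
      case (elim r)
      show ?case
      proof (cases "r > 0")
        case False
        with elim show ?thesis by (simp add: indicator_def)
      next
        case True
        have "(\<integral>\<^sup>+x. ennreal (exp (- r)) * (indicator {0..} r * indicator {z. z \<le> r} (h x)) \<partial>Leb n) =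
            (\<integral>\<^sup>+x. ennreal (exp (- r)) * indicator {x \<in> Rn n. h x \<le> r} x \<partial>Leb n)"
          using True by (intro nn_integral_cong) (auto simp: indicator_def)
        also have "\<dots> = ennreal (exp (- r)) * emeasure (Leb n) {x \<in> Rn n. h x \<le> r}"
          by (rule nn_integral_cmult_indicator) measurable
        also have "{x \<in> Rn n. h x \<le> r} = {x \<in> Rn n. (\<lambda>i\<in>{..<n}. x i / r) \<in> {x \<in> Rn n. h x \<le> 1}}"
          using True by (auto simp: hom divide_le_eq)
        also have "emeasure (Leb n) \<dots> = ennreal (r ^ n) * emeasure (Leb n) {x \<in> Rn n. h x \<le> 1}"
          by (rule emeasure_scale) (use True in auto)
        also have "ennreal (exp (- r)) * \<dots> = ennreal (r ^ n * exp (- r)) * emeasure (Leb n) {x \<in> Rn n. h x \<le> 1}"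
          using True by (simp add: ennreal_mult mult_ac)
        finally show ?thesis using True by simp
      qed
    qed
  qed
  also have "\<dots> = (\<integral>\<^sup>+r. ennreal (r ^ n * exp (- r)) * indicator {0..} r \<partial>lborel) * emeasure (Leb n) {x \<in> Rn n. h x \<le> 1}"
    by (rule nn_integral_multc) auto
  also have "(\<integral>\<^sup>+r. ennreal (r ^ n * exp (- r)) * indicator {0..} r \<partial>lborel) = ennreal (fact n)"
    using nn_intergal_power_times_exp_Ici[of n] by simp
  finally show ?thesis .
qed

lemma nn_integral_exp_abs: "(\<integral>\<^sup>+t. ennreal (exp (- \<bar>t :: real\<bar>)) \<partial>lborel) = 2"
proof -
  have "(\<integral>\<^sup>+t. ennreal (exp (- \<bar>t :: real\<bar>)) \<partial>lborel) =
      (\<integral>\<^sup>+t. ennreal (exp (- t)) * indicator {0..} t + ennreal (exp t) * indicator {..0} t \<partial>lborel)"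
  proof (rule nn_integral_cong_AE)
    show "AE t in lborel. ennreal (exp (- \<bar>t :: real\<bar>)) = ennreal (exp (- t)) * indicator {0..} t + ennreal (exp t) * indicator {..0} t"
      using AE_lborel_singleton[of 0] by eventually_elim (auto simp: indicator_def)
  qed
  also have "\<dots> = (\<integral>\<^sup>+t. ennreal (exp (- t)) * indicator {0..} t \<partial>lborel) + (\<integral>\<^sup>+t. ennreal (exp t) * indicator {..0::real} t \<partial>lborel)"
    by (rule nn_integral_add) auto
  also have "(\<integral>\<^sup>+t. ennreal (exp t) * indicator {..0::real} t \<partial>lborel) =
      (\<integral>\<^sup>+t. ennreal (exp (- t)) * indicator {0..} t \<partial>lborel)"
    by (subst nn_integral_real_affine[where c = "-1" and t = 0]) (auto intro!: nn_integral_cong simp: indicator_def)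
  finally show ?thesis using nn_integral_exp_tail[of 0] by simp
qed

lemma nn_integral_gauss: "(\<integral>\<^sup>+t. ennreal (exp (- pi * t\<^sup>2)) \<partial>lborel) = 1"
proof -
  have *: "exp (- pi * t\<^sup>2) = normal_density 0 (1 / sqrt (2 * pi)) t" for t
    by (simp add: normal_density_def power_divide)
  have "(\<integral>\<^sup>+t. ennreal (normal_density 0 (1 / sqrt (2 * pi)) t) \<partial>lborel) = 1"
    using prob_space.emeasure_space_1[OF prob_space_normal_density[of "1 / sqrt (2 * pi)" 0]]
    by (simp add: emeasure_density)
  then show ?thesis by (simp only: *)
qed

lemma nn_integral_gauss_n: "(\<integral>\<^sup>+x. ennreal (exp (- pi * ip n x x)) \<partial>Leb n) = 1"
proof -
  have "(\<integral>\<^sup>+x. ennreal (exp (- pi * ip n x x)) \<partial>Leb n) = (\<integral>\<^sup>+x. (\<Prod>i<n. ennreal (exp (- pi * (x i)\<^sup>2))) \<partial>Leb n)"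
    by (intro nn_integral_cong)
       (simp add: ip_def exp_sum[symmetric] prod_ennreal power2_eq_square sum_distrib_left[symmetric] sum_negf)
  also have "\<dots> = (\<Prod>i<n. \<integral>\<^sup>+t. ennreal (exp (- pi * t\<^sup>2)) \<partial>lborel)"
    by (rule lbp.product_nn_integral_prod) auto
  finally show ?thesis by (simp only: nn_integral_gauss) simp
qed

text \<open>
  The gauge is the sum norm, for which the integral of \<open>exp (- h x)\<close> is a product.
\<close>

lemma emeasure_cross_polytope:
  "emeasure (Leb n) {x \<in> Rn n. (\<Sum>i<n. \<bar>x i\<bar>) \<le> 1} = ennreal (2 ^ n / fact n)"
proof -
  have "ennreal (fact n) * emeasure (Leb n) {x \<in> Rn n. (\<Sum>i<n. \<bar>x i\<bar>) \<le> 1} =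
      (\<integral>\<^sup>+x. ennreal (exp (- (\<Sum>i<n. \<bar>x i\<bar>))) \<partial>Leb n)"
    by (rule gauge_volume[symmetric])
       (auto intro: sum_nonneg simp: abs_divide sum_divide_distrib)
  also have "\<dots> = (\<integral>\<^sup>+x. (\<Prod>i<n. ennreal (exp (- \<bar>x i\<bar>))) \<partial>Leb n)"
    by (intro nn_integral_cong) (simp add: exp_sum[symmetric] prod_ennreal sum_negf)
  also have "\<dots> = (\<Prod>i<n. \<integral>\<^sup>+t. ennreal (exp (- \<bar>t\<bar>)) \<partial>lborel)"
    by (rule lbp.product_nn_integral_prod) auto
  also have "\<dots> = ennreal (2 ^ n)"
    by (simp add: nn_integral_exp_abs ennreal_power[symmetric])
  finally have "emeasure (Leb n) {x \<in> Rn n. (\<Sum>i<n. \<bar>x i\<bar>) \<le> 1} * ennreal (fact n) / ennreal (fact n) = ennreal (2 ^ n) / ennreal (fact n)"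
    by (subst mult.commute) simp
  then show ?thesis
    by (subst (asm) mult_divide_eq_ennreal) (auto simp: divide_ennreal)
qed

text \<open>
  Links the product \<open>\<sigma>\<close>-algebra on \<open>Rn n\<close> with the topology of
  pointwise convergence on all functions, so that closed and compact sets of functions become
  measurable.
\<close>

lemma id_measurable_borel: "(\<lambda>x. x) \<in> measurable (Leb n) (borel :: rvec measure)"
proof (rule measurable_coordinatewise_then_product)
  fix i
  show "(\<lambda>x. x i) \<in> borel_measurable (Leb n)"
  proof (cases "i < n")
    case False
    then have "x i = undefined" if "x \<in> space (Leb n)" for x
      using that by (auto simp: Rn_def PiE_def extensional_def)
    then have "(\<lambda>x. x i) \<in> borel_measurable (Leb n) \<longleftrightarrow> (\<lambda>x. undefined :: real) \<in> borel_measurable (Leb n)"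
      by (rule measurable_cong)
    then show ?thesis by simp
  qed auto
qed

lemma borel_sets_Leb: "B \<in> sets (borel :: rvec measure) \<Longrightarrow> {x \<in> Rn n. x \<in> B} \<in> sets (Leb n)"
  using measurable_sets[OF id_measurable_borel, of B n] by (simp add: vimage_def Int_def conj_commute)

lemma closed_sets_Leb: "closed B \<Longrightarrow> {x \<in> Rn n. x \<in> B} \<in> sets (Leb n)"
  by (intro borel_sets_Leb) auto

lemma closed_Rn: "closed (Rn n)"
proof -
  have "Rn n = (\<Inter>i\<in>{n..}. {x. x i = undefined})"
    by (auto simp: Rn_def PiE_def extensional_def)
  also have "closed \<dots>"
    by (intro closed_INT ballI closed_Collect_eq continuous_intros continuous_on_product_coordinates)
  finally show ?thesis .
qed

lemma compact_box: "compact {x \<in> Rn n. \<forall>i<n. \<bar>x i\<bar> \<le> r}"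
proof -
  define S where "S i = (if i < n then {-r..r} else {undefined :: real})" for i
  have "compactin (product_topology (\<lambda>i. euclidean) UNIV) (Pi\<^sub>E UNIV S)"
    by (auto simp: compactin_PiE S_def)
  then have "compact (Pi\<^sub>E UNIV S)" by (simp add: euclidean_product_topology)
  also have "Pi\<^sub>E UNIV S = {x \<in> Rn n. \<forall>i<n. \<bar>x i\<bar> \<le> r}"
    by (auto simp: S_def Rn_def PiE_def extensional_def Pi_def abs_le_iff split: if_splits)
  finally show ?thesis .
qed

section \<open>Random tuples with squared determinant density\<close>

text \<open>
  Bounded measurable functions form an algebra and are integrable for every finite measure, which
  settles all integrability questions below by syntactic closure rules.
\<close>

definition bmeas :: "'a measure \<Rightarrow> ('a \<Rightarrow> real) \<Rightarrow> bool" where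
  "bmeas M f \<longleftrightarrow> f \<in> borel_measurable M \<and> (\<exists>C. \<forall>x\<in>space M. \<bar>f x\<bar> \<le> C)"

lemma bmeasI: "f \<in> borel_measurable M \<Longrightarrow> (\<And>x. x \<in> space M \<Longrightarrow> \<bar>f x\<bar> \<le> C) \<Longrightarrow> bmeas M f"
  by (auto simp: bmeas_def)

lemma bmeas_meas: "bmeas M f \<Longrightarrow> f \<in> borel_measurable M"
  by (simp add: bmeas_def)

lemma bmeas_const: "bmeas M (\<lambda>_. c)"
  by (rule bmeasI[of _ _ "\<bar>c\<bar>"]) auto

lemma bmeas_add: "bmeas M f \<Longrightarrow> bmeas M g \<Longrightarrow> bmeas M (\<lambda>x. f x + g x)"
  unfolding bmeas_def
proof safe
  fix C D assume "\<forall>x\<in>space M. \<bar>f x\<bar> \<le> C" "\<forall>x\<in>space M. \<bar>g x\<bar> \<le> D"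
  then show "\<exists>C. \<forall>x\<in>space M. \<bar>f x + g x\<bar> \<le> C"
    by (intro exI[of _ "C + D"]) (metis abs_triangle_ineq add_mono order_trans)
qed auto

lemma bmeas_mult: "bmeas M f \<Longrightarrow> bmeas M g \<Longrightarrow> bmeas M (\<lambda>x. f x * g x)"
  unfolding bmeas_def
proof safe
  fix C D assume "\<forall>x\<in>space M. \<bar>f x\<bar> \<le> C" "\<forall>x\<in>space M. \<bar>g x\<bar> \<le> D"
  then show "\<exists>C. \<forall>x\<in>space M. \<bar>f x * g x\<bar> \<le> C"
    by (intro exI[of _ "C * D"]) (auto simp: abs_mult intro!: mult_mono intro: order_trans[OF abs_ge_zero])
qed auto

lemma bmeas_minus: "bmeas M f \<Longrightarrow> bmeas M (\<lambda>x. - f x)"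
  using bmeas_mult[OF bmeas_const[of M "-1"], of f] by simp

lemma bmeas_diff: "bmeas M f \<Longrightarrow> bmeas M g \<Longrightarrow> bmeas M (\<lambda>x. f x - g x)"
  using bmeas_add[OF _ bmeas_minus, of M f g] by simp

lemma bmeas_power: "bmeas M f \<Longrightarrow> bmeas M (\<lambda>x. f x ^ k)"
  by (induction k) (auto intro: bmeas_const bmeas_mult)

lemma bmeas_sum: "(\<And>i. i \<in> I \<Longrightarrow> bmeas M (f i)) \<Longrightarrow> bmeas M (\<lambda>x. \<Sum>i\<in>I. f i x)"
  by (induction I rule: infinite_finite_induct) (auto intro: bmeas_const bmeas_add)

lemma bmeas_prod: "(\<And>i. i \<in> I \<Longrightarrow> bmeas M (f i)) \<Longrightarrow> bmeas M (\<lambda>x. \<Prod>i\<in>I. f i x)"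
  by (induction I rule: infinite_finite_induct) (auto intro: bmeas_const bmeas_mult)

lemma bmeas_exp: "bmeas M f \<Longrightarrow> bmeas M (\<lambda>x. exp (f x))"
  unfolding bmeas_def
proof safe
  fix C assume "\<forall>x\<in>space M. \<bar>f x\<bar> \<le> C"
  then show "\<exists>C. \<forall>x\<in>space M. \<bar>exp (f x)\<bar> \<le> C"
    by (intro exI[of _ "exp C"]) auto
qed auto

lemma bmeas_divide: "bmeas M f \<Longrightarrow> bmeas M (\<lambda>x. f x / c)"
  using bmeas_mult[OF _ bmeas_const[of M "1 / c"], of f] by simp

lemmas bmeas_intros = bmeas_const bmeas_add bmeas_mult bmeas_minus bmeas_diff bmeas_power bmeas_sum bmeas_prod bmeas_exp bmeas_divide

lemma (in finite_measure) bmeas_integrable: "bmeas M f \<Longrightarrow> integrable M f"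
  unfolding bmeas_def by (elim conjE exE, rule integrable_const_bound[of f]) auto

lemma bmeas_compose: "g \<in> measurable N M \<Longrightarrow> bmeas M f \<Longrightarrow> bmeas N (\<lambda>x. f (g x))"
  unfolding bmeas_def using measurable_space[of g N M] by (auto intro!: measurable_compose[of g N M f])

locale isotropic_measure =
  fixes n :: nat and \<mu> :: "rvec measure"
  assumes iso: "isotropic n \<mu>"
begin

lemma sets_mu: "sets \<mu> = sets (restrict_space (Pi\<^sub>M {..<n} (\<lambda>_. borel)) (usphere n))"
  using iso by (simp add: isotropic_def borel_measure_on_sphere_def)

lemma usphere_Rn: "u \<in> usphere n \<Longrightarrow> u \<in> Rn n"
  by (simp add: usphere_def)

lemma space_mu [simp]: "space \<mu> = usphere n"
  using sets_eq_imp_space_eq[OF sets_mu] usphere_Rn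
  by (auto simp: space_restrict_space space_PiM Rn_def)

lemma usphere_sets [measurable]: "usphere n \<in> sets \<mu>"
  using sets.top[of \<mu>] by simp

lemma id_mu [measurable]: "(\<lambda>u. u) \<in> measurable \<mu> (Leb n)"
proof -
  have "(\<lambda>u. u) \<in> measurable (restrict_space (Pi\<^sub>M {..<n} (\<lambda>_. borel)) (usphere n)) (Pi\<^sub>M {..<n} (\<lambda>_. borel :: real measure))"
    by (rule measurable_restrict_space1) simp
  then show ?thesis
    using sets_mu sets_PiM_cong[of "{..<n}" "{..<n}" "\<lambda>_. lborel :: real measure" "\<lambda>_. borel"]
    by (simp cong: measurable_cong_sets)
qed

lemma Leb_mu: "f \<in> borel_measurable (Leb n) \<Longrightarrow> f \<in> borel_measurable \<mu>"
  using measurable_compose[OF id_mu] by blast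

lemma coord_mu [measurable]: "i < n \<Longrightarrow> (\<lambda>u. u i) \<in> borel_measurable \<mu>"
  by (rule Leb_mu) measurable

lemma ip_usphere: "u \<in> usphere n \<Longrightarrow> ip n u u = 1"
proof -
  assume "u \<in> usphere n"
  then have "sqrt (\<Sum>i<n. (u i)\<^sup>2) = 1" by (simp add: usphere_def vnorm_def L2_set_def)
  then show ?thesis by (simp add: ip_def power2_eq_square)
qed

lemma coord_le_1: "u \<in> usphere n \<Longrightarrow> i < n \<Longrightarrow> \<bar>u i\<bar> \<le> 1"
  using sq_coord_le_ip[of i n u] ip_usphere[of u] by (simp add: abs_square_le_1)

lemma bmeas_coord: "i < n \<Longrightarrow> bmeas \<mu> (\<lambda>u. u i)"
  by (rule bmeasI[of _ _ 1]) (auto simp: coord_le_1)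

lemma second_moment:
  "i < n \<Longrightarrow> j < n \<Longrightarrow> (\<integral>u. u i * u j \<partial>\<mu>) = idm i j"
  "i < n \<Longrightarrow> j < n \<Longrightarrow> integrable \<mu> (\<lambda>u. u i * u j)"
  using iso by (auto simp: isotropic_def has_bochner_integral_iff)

lemma finite_mu: "finite_measure \<mu>"
proof
  have "integrable \<mu> (\<lambda>u. \<Sum>i<n. u i * u i)"
    by (intro Bochner_Integration.integrable_sum) (auto simp: second_moment)
  also have "?this \<longleftrightarrow> integrable \<mu> (\<lambda>u. 1 :: real)"
    by (intro Bochner_Integration.integrable_cong) (auto simp: ip_usphere[unfolded ip_def])
  finally show "emeasure \<mu> (space \<mu>) \<noteq> \<infinity>"
    by (auto simp: integrable_iff_bounded)
qed

sublocale finite_measure \<mu> by (rule finite_mu)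

text \<open>
  The trace of the isotropy condition.
\<close>

lemma total_mass: "measure \<mu> (usphere n) = n"
proof -
  have "(\<Sum>i<n. \<integral>u. u i * u i \<partial>\<mu>) = (\<integral>u. (\<Sum>i<n. u i * u i) \<partial>\<mu>)"
    by (rule Bochner_Integration.integral_sum[symmetric]) (auto simp: second_moment)
  also have "\<dots> = (\<integral>u. 1 \<partial>\<mu>)"
    by (intro Bochner_Integration.integral_cong) (auto simp: ip_usphere[unfolded ip_def])
  finally show ?thesis by (simp add: second_moment)
qed

lemma bmeas_ip: "bmeas \<mu> (\<lambda>u. ip n x u)" "bmeas \<mu> (\<lambda>u. ip n u x)"
  unfolding ip_def by (intro bmeas_intros bmeas_coord; simp)+

lemma integral_ip_ip: "(\<integral>u. ip n x u * ip n y u \<partial>\<mu>) = ip n x y"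
proof -
  have "(\<integral>u. ip n x u * ip n y u \<partial>\<mu>) = (\<integral>u. (\<Sum>i<n. \<Sum>j<n. (x i * y j) * (u i * u j)) \<partial>\<mu>)"
    by (simp add: ip_def sum_product mult_ac)
  also have "\<dots> = (\<Sum>i<n. \<integral>u. (\<Sum>j<n. (x i * y j) * (u i * u j)) \<partial>\<mu>)"
    by (rule Bochner_Integration.integral_sum) (auto simp: second_moment)
  also have "\<dots> = (\<Sum>i<n. \<Sum>j<n. (x i * y j) * idm i j)"
    by (intro sum.cong refl, subst Bochner_Integration.integral_sum) (auto simp: second_moment)
  also have "\<dots> = (\<Sum>i<n. \<Sum>j<n. if j = i then x i * y i else 0)"
    by (intro sum.cong refl) auto
  finally show ?thesis by (simp add: ip_def)
qed

abbreviation PW :: "(nat \<Rightarrow> rvec) measure" where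
  "PW \<equiv> Pi\<^sub>M {..<n} (\<lambda>_. \<mu>)"

sublocale pm: product_sigma_finite "\<lambda>_ :: nat. \<mu>"
  by standard

lemma finite_PW: "finite_measure PW"
proof
  have "emeasure PW (space PW) = (\<Prod>i<n. emeasure \<mu> (space \<mu>))"
    unfolding space_PiM by (rule pm.emeasure_PiM) auto
  then show "emeasure PW (space PW) \<noteq> \<infinity>"
    by (simp add: power_eq_top_ennreal)
qed

sublocale fPW: finite_measure PW by (rule finite_PW)

lemma space_PW_D: "W \<in> space PW \<Longrightarrow> i < n \<Longrightarrow> W i \<in> usphere n"
  by (auto simp: space_PiM)

lemma comp_PW: "k < n \<Longrightarrow> (\<lambda>W. W k) \<in> measurable PW \<mu>"
  by (rule measurable_component_singleton) auto

lemma bmeas_PW: "k < n \<Longrightarrow> bmeas \<mu> f \<Longrightarrow> bmeas PW (\<lambda>W. f (W k))"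
  by (rule bmeas_compose[OF comp_PW])

lemma bmeas_PW_coord: "k < n \<Longrightarrow> i < n \<Longrightarrow> bmeas PW (\<lambda>W. W k i)"
  by (rule bmeas_PW) (auto intro: bmeas_coord)

lemma bmeas_PW_dt: "bmeas PW (dt n)"
proof -
  have "bmeas PW (\<lambda>W. \<Sum>p | p permutes {..<n}. of_int (sign p) * (\<Prod>i<n. W i (p i)))"
    by (intro bmeas_intros bmeas_PW_coord) (auto dest: permutes_in_image)
  then show ?thesis by (simp add: dt_def[abs_def])
qed

text \<open>
  Expanding the determinant turns the integrand into a sum of products over the single vectors,
  and the integral over the product measure factorises.
\<close>

lemma tuple_leibniz:
  assumes \<phi>: "\<And>i. i < n \<Longrightarrow> bmeas \<mu> (\<phi> i)"
  shows "(\<integral>W. (\<Prod>i<n. \<phi> i (W i)) * (\<Prod>i<n. W i i) * dt n W \<partial>PW) = dt n (\<lambda>i j. \<integral>u. \<phi> i u * (u i * u j) \<partial>\<mu>)"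
proof -
  have bm: "bmeas \<mu> (\<lambda>u. \<phi> i u * (u i * u (p i)))" if "i < n" "p permutes {..<n}" for i p
    using that permutes_in_image[OF that(2), of i] by (intro bmeas_intros \<phi> bmeas_coord) auto
  have "(\<integral>W. (\<Prod>i<n. \<phi> i (W i)) * (\<Prod>i<n. W i i) * dt n W \<partial>PW) =
     (\<integral>W. (\<Sum>p | p permutes {..<n}. of_int (sign p) * (\<Prod>i<n. \<phi> i (W i) * (W i i * W i (p i)))) \<partial>PW)"
    by (simp add: dt_def prod.distrib sum_distrib_left mult_ac)
  also have "\<dots> = (\<Sum>p | p permutes {..<n}. \<integral>W. of_int (sign p) * (\<Prod>i<n. \<phi> i (W i) * (W i i * W i (p i))) \<partial>PW)"
  proof (intro Bochner_Integration.integral_sum fPW.bmeas_integrable bmeas_mult bmeas_const bmeas_prod)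
    fix p i assume "p \<in> {p. p permutes {..<n}}" "i \<in> {..<n}"
    then show "bmeas PW (\<lambda>W. \<phi> i (W i))" "bmeas PW (\<lambda>W. W i i)" "bmeas PW (\<lambda>W. W i (p i))"
      using permutes_in_image[of p "{..<n}" i] by (auto intro: bmeas_PW_coord bmeas_PW[OF _ \<phi>])
  qed
  also have "\<dots> = (\<Sum>p | p permutes {..<n}. of_int (sign p) * (\<Prod>i<n. \<integral>u. \<phi> i u * (u i * u (p i)) \<partial>\<mu>))"
  proof (intro sum.cong refl)
    fix p assume p: "p \<in> {p. p permutes {..<n}}"
    have "(\<integral>W. (\<Prod>i<n. \<phi> i (W i) * (W i i * W i (p i))) \<partial>PW) = (\<Prod>i<n. \<integral>u. \<phi> i u * (u i * u (p i)) \<partial>\<mu>)"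
      by (rule pm.product_integral_prod[where f = "\<lambda>i u. \<phi> i u * (u i * u (p i))"])
         (use p bm in \<open>auto intro: bmeas_integrable\<close>)
    then show "(\<integral>W. of_int (sign p) * (\<Prod>i<n. \<phi> i (W i) * (W i i * W i (p i))) \<partial>PW) =
        of_int (sign p) * (\<Prod>i<n. \<integral>u. \<phi> i u * (u i * u (p i)) \<partial>\<mu>)" by simp
  qed
  finally show ?thesis by (simp add: dt_def)
qed

lemma perm_measurable: "p permutes {..<n} \<Longrightarrow> (\<lambda>W. \<lambda>i\<in>{..<n}. W (p i)) \<in> measurable PW PW"
  by (rule measurable_restrict) (use permutes_in_image[of p "{..<n}"] in \<open>auto intro!: comp_PW\<close>)

lemma distr_perm:
  assumes p: "p permutes {..<n}"
  shows "distr PW PW (\<lambda>W. \<lambda>i\<in>{..<n}. W (p i)) = PW"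
proof (rule pm.PiM_eqI)
  fix A :: "nat \<Rightarrow> rvec set" assume A: "\<And>i. i \<in> {..<n} \<Longrightarrow> A i \<in> sets \<mu>"
  have AS: "Pi\<^sub>E {..<n} A \<in> sets PW" using A by (intro sets_PiM_I_finite) auto
  have pin: "p i < n \<longleftrightarrow> i < n" "Hilbert_Choice.inv p i < n \<longleftrightarrow> i < n" for i
    using permutes_in_image[OF p, of i] permutes_in_image[OF permutes_inv[OF p], of i] by auto
  have "emeasure (distr PW PW (\<lambda>W. \<lambda>i\<in>{..<n}. W (p i))) (Pi\<^sub>E {..<n} A) =
     emeasure PW ((\<lambda>W. \<lambda>i\<in>{..<n}. W (p i)) -` Pi\<^sub>E {..<n} A \<inter> space PW)"
    by (rule emeasure_distr[OF perm_measurable[OF p] AS])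
  also have "(\<lambda>W. \<lambda>i\<in>{..<n}. W (p i)) -` Pi\<^sub>E {..<n} A \<inter> space PW = Pi\<^sub>E {..<n} (\<lambda>i. A (Hilbert_Choice.inv p i))"
  proof (intro Set.set_eqI iffI)
    fix W assume W: "W \<in> (\<lambda>W. \<lambda>i\<in>{..<n}. W (p i)) -` Pi\<^sub>E {..<n} A \<inter> space PW"
    have "W i \<in> A (Hilbert_Choice.inv p i)" if "i < n" for i
    proof -
      have "(\<lambda>i\<in>{..<n}. W (p i)) (Hilbert_Choice.inv p i) \<in> A (Hilbert_Choice.inv p i)" using W pin(2)[of i] that by (auto simp: PiE_iff)
      then show ?thesis using pin(2)[of i] that permutes_inverses(1)[OF p] by simp
    qed
    then show "W \<in> Pi\<^sub>E {..<n} (\<lambda>i. A (Hilbert_Choice.inv p i))" using W by (auto simp: space_PiM PiE_iff)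
  next
    fix W assume W: "W \<in> Pi\<^sub>E {..<n} (\<lambda>i. A (Hilbert_Choice.inv p i))"
    have "W i \<in> usphere n" if "i < n" for i
      using W A[of "Hilbert_Choice.inv p i"] pin(2)[of i] that sets.sets_into_space[of "A (Hilbert_Choice.inv p i)" \<mu>] by (auto simp: PiE_iff)
    moreover have "W (p i) \<in> A i" if "i < n" for i
      using PiE_mem[OF W, of "p i"] pin(1)[of i] that permutes_inverses(2)[OF p, of i] by simp
    ultimately show "W \<in> (\<lambda>W. \<lambda>i\<in>{..<n}. W (p i)) -` Pi\<^sub>E {..<n} A \<inter> space PW"
      using W by (auto simp: space_PiM PiE_iff)
  qed
  also have "emeasure PW \<dots> = (\<Prod>i<n. emeasure \<mu> (A (Hilbert_Choice.inv p i)))"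
    by (rule pm.emeasure_PiM) (use A pin in auto)
  also have "\<dots> = (\<Prod>i<n. emeasure \<mu> (A i))"
    using prod.permute[OF permutes_inv[OF p], of "\<lambda>i. emeasure \<mu> (A i)"] by (simp add: comp_def)
  finally show "emeasure (distr PW PW (\<lambda>W. \<lambda>i\<in>{..<n}. W (p i))) (Pi\<^sub>E {..<n} A) = (\<Prod>i\<in>{..<n}. emeasure \<mu> (A i))" .
qed auto

text \<open>
  The density, with respect to the product measure \<open>PW\<close>, of the random tuple of the
  volume argument. It is symmetric in the vectors and vanishes on linearly dependent tuples.
\<close>

definition rho :: "(nat \<Rightarrow> rvec) \<Rightarrow> real" where
  "rho W = (dt n W)\<^sup>2 / fact n"

lemma rho_nonneg: "0 \<le> rho W"
  by (simp add: rho_def)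

lemma bmeas_rho: "bmeas PW rho"
  unfolding rho_def[abs_def] by (intro bmeas_intros bmeas_PW_dt)

text \<open>
  Permuting the vectors multiplies the determinant by the sign and leaves \<open>PW\<close> and
  \<open>h\<close> unchanged, so averaging over all permutations replaces the diagonal product by
  \<open>dt n W / fact n\<close>. This makes expectations under \<open>rho\<close> accessible to
  \<open>tuple_leibniz\<close>.
\<close>

lemma symmetrize:
  assumes h: "bmeas PW h"
    and sym: "\<And>p W. p permutes {..<n} \<Longrightarrow> W \<in> space PW \<Longrightarrow> h (\<lambda>i\<in>{..<n}. W (p i)) = h W"
  shows "(\<integral>W. h W * (\<Prod>i<n. W i i) * dt n W \<partial>PW) = (\<integral>W. rho W * h W \<partial>PW)"
proof -
  define G where "G W = h W * (\<Prod>i<n. W i i) * dt n W" for W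
  have bG: "bmeas PW G"
    unfolding G_def[abs_def] by (intro bmeas_intros h bmeas_PW_dt bmeas_PW_coord) auto
  have one: "(\<integral>W. G W \<partial>PW) = (\<integral>W. h W * (of_int (sign p) * (\<Prod>i<n. W (p i) i)) * dt n W \<partial>PW)"
    if p: "p permutes {..<n}" for p
  proof -
    have "(\<integral>W. G W \<partial>PW) = (\<integral>W. G W \<partial>distr PW PW (\<lambda>W. \<lambda>i\<in>{..<n}. W (p i)))"
      by (simp add: distr_perm[OF p])
    also have "\<dots> = (\<integral>W. G (\<lambda>i\<in>{..<n}. W (p i)) \<partial>PW)"
      by (rule integral_distr[OF perm_measurable[OF p]]) (use bG in \<open>simp add: bmeas_def\<close>)
    also have "\<dots> = (\<integral>W. h W * (of_int (sign p) * (\<Prod>i<n. W (p i) i)) * dt n W \<partial>PW)"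
    proof (rule Bochner_Integration.integral_cong[OF refl])
      fix W assume W: "W \<in> space PW"
      have "dt n (\<lambda>i\<in>{..<n}. W (p i)) = dt n (\<lambda>i. W (p i))" by (rule dt_cong) auto
      also have "\<dots> = of_int (sign p) * dt n W" by (rule dt_permute_rows[OF p])
      finally show "G (\<lambda>i\<in>{..<n}. W (p i)) = h W * (of_int (sign p) * (\<Prod>i<n. W (p i) i)) * dt n W"
        using sym[OF p W] by (simp add: G_def mult_ac)
    qed
    finally show ?thesis .
  qed
  have "fact n * (\<integral>W. G W \<partial>PW) = (\<Sum>p | p permutes {..<n}. \<integral>W. G W \<partial>PW)"
    by (simp add: card_permutations)
  also have "\<dots> = (\<Sum>p | p permutes {..<n}. \<integral>W. h W * (of_int (sign p) * (\<Prod>i<n. W (p i) i)) * dt n W \<partial>PW)"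
    using one by (intro sum.cong) auto
  also have "\<dots> = (\<integral>W. (\<Sum>p | p permutes {..<n}. h W * (of_int (sign p) * (\<Prod>i<n. W (p i) i)) * dt n W) \<partial>PW)"
    by (rule Bochner_Integration.integral_sum[symmetric], intro fPW.bmeas_integrable bmeas_intros h bmeas_PW_dt bmeas_PW_coord)
       (auto simp: permutes_in_image[of _ "{..<n}", unfolded lessThan_iff])
  also have "\<dots> = (\<integral>W. h W * dt n (\<lambda>i j. W j i) * dt n W \<partial>PW)"
  proof (rule Bochner_Integration.integral_cong[OF refl])
    fix W
    have "dt n (\<lambda>i j. W j i) = (\<Sum>p | p permutes {..<n}. of_int (sign p) * (\<Prod>i<n. W (p i) i))"
      by (simp only: dt_def)
    then show "(\<Sum>p | p permutes {..<n}. h W * (of_int (sign p) * (\<Prod>i<n. W (p i) i)) * dt n W) =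
        h W * dt n (\<lambda>i j. W j i) * dt n W"
      by (simp only: sum_distrib_left sum_distrib_right)
  qed
  also have "\<dots> = fact n * (\<integral>W. rho W * h W \<partial>PW)"
  proof -
    have "h W * dt n (\<lambda>i j. W j i) * dt n W = fact n * (rho W * h W)" for W
      unfolding dt_transpose[of n W] by (simp add: rho_def power2_eq_square)
    then show ?thesis by (simp only: integral_mult_right_zero)
  qed
  finally show ?thesis by (simp add: G_def)
qed

lemma rho_total: "(\<integral>W. rho W \<partial>PW) = 1"
proof -
  have "(\<integral>W. rho W * 1 \<partial>PW) = (\<integral>W. 1 * (\<Prod>i<n. W i i) * dt n W \<partial>PW)"
    by (rule symmetrize[symmetric]) (auto intro: bmeas_intros)
  also have "\<dots> = dt n (\<lambda>i j. \<integral>u. 1 * (u i * u j) \<partial>\<mu>)"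
    using tuple_leibniz[of "\<lambda>_ _. 1"] by (simp add: bmeas_intros)
  also have "\<dots> = dt n idm" by (rule dt_cong) (simp add: second_moment)
  finally show ?thesis by simp
qed

text \<open>
  The Cauchy-Binet formula for the matrix with density \<open>e\<close>.
\<close>

lemma det_tuple:
  assumes e: "bmeas \<mu> e"
  shows "dt n (\<lambda>i j. \<integral>u. e u * (u i * u j) \<partial>\<mu>) = (\<integral>W. rho W * (\<Prod>i<n. e (W i)) \<partial>PW)"
proof -
  have "(\<integral>W. rho W * (\<Prod>i<n. e (W i)) \<partial>PW) = (\<integral>W. (\<Prod>i<n. e (W i)) * (\<Prod>i<n. W i i) * dt n W \<partial>PW)"
  proof (rule symmetrize[symmetric])
    show "bmeas PW (\<lambda>W. \<Prod>i<n. e (W i))" by (intro bmeas_intros bmeas_PW e) auto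
    fix p W assume "p permutes {..<n}"
    from prod.permute[OF this, of "\<lambda>i. e (W i)"]
    show "(\<Prod>i<n. e ((\<lambda>i\<in>{..<n}. W (p i)) i)) = (\<Prod>i<n. e (W i))" by (simp add: comp_def)
  qed
  then show ?thesis using tuple_leibniz[of "\<lambda>_. e"] e by simp
qed

definition moment :: "(rvec \<Rightarrow> real) \<Rightarrow> nat \<Rightarrow> nat \<Rightarrow> real" where
  "moment f i j = (\<integral>u. f u * (u i * u j) \<partial>\<mu>)"

lemma moment_trace: "bmeas \<mu> f \<Longrightarrow> (\<Sum>i<n. moment f i i) = (\<integral>u. f u \<partial>\<mu>)"
proof -
  assume f: "bmeas \<mu> f"
  have "(\<Sum>i<n. moment f i i) = (\<integral>u. (\<Sum>i<n. f u * (u i * u i)) \<partial>\<mu>)"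
    unfolding moment_def
    by (rule Bochner_Integration.integral_sum[symmetric]) (intro bmeas_integrable bmeas_intros f bmeas_coord; simp)
  also have "\<dots> = (\<integral>u. f u \<partial>\<mu>)"
    by (intro Bochner_Integration.integral_cong) (auto simp: ip_usphere[unfolded ip_def] simp flip: sum_distrib_left)
  finally show ?thesis .
qed

lemma moment_sym: "moment f i j = moment f j i"
  by (simp add: moment_def mult.commute)

lemma tuple_mean:
  assumes f: "bmeas \<mu> f"
  shows "(\<integral>W. rho W * (\<Sum>k<n. f (W k)) \<partial>PW) = (\<integral>u. f u \<partial>\<mu>)"
proof -
  have "(\<integral>W. rho W * (\<Sum>k<n. f (W k)) \<partial>PW) = (\<integral>W. (\<Sum>k<n. f (W k)) * (\<Prod>i<n. W i i) * dt n W \<partial>PW)"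
  proof (rule symmetrize[symmetric])
    show "bmeas PW (\<lambda>W. \<Sum>i<n. f (W i))" by (intro bmeas_intros bmeas_PW f) auto
    fix p W assume "p permutes {..<n}"
    from sum.permute[OF this, of "\<lambda>i. f (W i)"]
    show "(\<Sum>i<n. f ((\<lambda>i\<in>{..<n}. W (p i)) i)) = (\<Sum>i<n. f (W i))" by (simp add: comp_def)
  qed
  also have "\<dots> = (\<integral>W. (\<Sum>k<n. (\<Prod>i<n. (if i = k then f else (\<lambda>_. 1)) (W i)) * (\<Prod>i<n. W i i) * dt n W) \<partial>PW)"
    by (simp add: sum_distrib_right if_distrib[of "\<lambda>h. h _"] prod.delta cong: if_cong)
  also have "\<dots> = (\<Sum>k<n. \<integral>W. (\<Prod>i<n. (if i = k then f else (\<lambda>_. 1)) (W i)) * (\<Prod>i<n. W i i) * dt n W \<partial>PW)"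
    by (rule Bochner_Integration.integral_sum, intro fPW.bmeas_integrable bmeas_intros bmeas_PW bmeas_PW_dt bmeas_PW_coord)
       (auto intro: f bmeas_const)
  also have "\<dots> = (\<Sum>k<n. dt n (\<lambda>i j. if i = k then moment f k j else idm i j))"
  proof (intro sum.cong refl)
    fix k assume "k \<in> {..<n}"
    show "(\<integral>W. (\<Prod>i<n. (if i = k then f else (\<lambda>_. 1)) (W i)) * (\<Prod>i<n. W i i) * dt n W \<partial>PW) =
       dt n (\<lambda>i j. if i = k then moment f k j else idm i j)"
      by (subst tuple_leibniz) (auto intro!: dt_cong f bmeas_const simp: second_moment moment_def)
  qed
  also have "\<dots> = (\<Sum>k<n. moment f k k)"
    by (intro sum.cong refl, subst dt_replace_row) auto
  finally show ?thesis by (simp add: moment_trace f)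
qed

text \<open>
  The tuple is a determinantal process: a pair of distinct vectors has the intensity of two
  independent ones minus the squared kernel, here in terms of moment matrices and in
  \<open>tuple_pair_kernel\<close> as a double integral.
\<close>

lemma tuple_pair:
  assumes f: "bmeas \<mu> f" and g: "bmeas \<mu> g"
  shows "(\<integral>W. rho W * (\<Sum>k<n. \<Sum>l<n. if k = l then 0 else f (W k) * g (W l)) \<partial>PW) =
    (\<integral>u. f u \<partial>\<mu>) * (\<integral>u. g u \<partial>\<mu>) - (\<Sum>k<n. \<Sum>l<n. moment f k l * moment g k l)"
proof -
  define \<phi> where "\<phi> k l i = (if i = k then f else if i = l then g else (\<lambda>_. 1))" for k l i :: nat
  have \<phi>: "bmeas \<mu> (\<phi> k l i)" for k l i by (auto simp: \<phi>_def intro: f g bmeas_const)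
  have bt: "bmeas PW (\<lambda>W. if k = l then 0 else f (W k) * g (W l))" if "k < n" "l < n" for k l
    using that by (cases "k = l") (auto intro!: bmeas_intros bmeas_PW f g)
  have "(\<integral>W. rho W * (\<Sum>k<n. \<Sum>l<n. if k = l then 0 else f (W k) * g (W l)) \<partial>PW) =
      (\<integral>W. (\<Sum>k<n. \<Sum>l<n. if k = l then 0 else f (W k) * g (W l)) * (\<Prod>i<n. W i i) * dt n W \<partial>PW)"
  proof (rule symmetrize[symmetric])
    show "bmeas PW (\<lambda>W. \<Sum>k<n. \<Sum>l<n. if k = l then 0 else f (W k) * g (W l))"
      by (intro bmeas_sum bt) auto
    fix p W assume p: "p permutes {..<n}"
    have inj: "p k = p l \<longleftrightarrow> k = l" for k l using permutes_inj[OF p] by (auto simp: inj_def)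
    have "(\<Sum>k<n. \<Sum>l<n. if k = l then 0 else f (W k) * g (W l)) =
       (\<Sum>k<n. \<Sum>l<n. if p k = l then 0 else f (W (p k)) * g (W l))"
      using sum.permute[OF p, of "\<lambda>k. \<Sum>l<n. if k = l then 0 else f (W k) * g (W l)"] by (simp add: comp_def)
    also have "\<dots> = (\<Sum>k<n. \<Sum>l<n. if p k = p l then 0 else f (W (p k)) * g (W (p l)))"
      using sum.permute[OF p, of "\<lambda>l. if p k = l then 0 else f (W (p k)) * g (W l)" for k] by (simp add: comp_def)
    finally show "(\<Sum>k<n. \<Sum>l<n. if k = l then 0 else f ((\<lambda>i\<in>{..<n}. W (p i)) k) * g ((\<lambda>i\<in>{..<n}. W (p i)) l)) =
        (\<Sum>k<n. \<Sum>l<n. if k = l then 0 else f (W k) * g (W l))"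
      by (simp only: inj) (intro sum.cong refl, simp)
  qed
  also have "\<dots> = (\<integral>W. (\<Sum>k<n. \<Sum>l<n. (if k = l then 0 else f (W k) * g (W l)) * (\<Prod>i<n. W i i) * dt n W) \<partial>PW)"
    by (simp add: sum_distrib_right)
  also have "\<dots> = (\<Sum>k<n. \<integral>W. (\<Sum>l<n. (if k = l then 0 else f (W k) * g (W l)) * (\<Prod>i<n. W i i) * dt n W) \<partial>PW)"
    by (rule Bochner_Integration.integral_sum, intro fPW.bmeas_integrable bmeas_sum bmeas_mult bmeas_prod bt bmeas_PW_dt bmeas_PW_coord) auto
  also have "\<dots> = (\<Sum>k<n. \<Sum>l<n. \<integral>W. (if k = l then 0 else f (W k) * g (W l)) * (\<Prod>i<n. W i i) * dt n W \<partial>PW)"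
    by (intro sum.cong refl Bochner_Integration.integral_sum fPW.bmeas_integrable bmeas_sum bmeas_mult bmeas_prod bt bmeas_PW_dt bmeas_PW_coord) auto
  also have "\<dots> = (\<Sum>k<n. \<Sum>l<n. moment f k k * moment g l l - moment f k l * moment g k l)"
  proof (intro sum.cong refl)
    fix k l assume kl: "k \<in> {..<n}" "l \<in> {..<n}"
    show "(\<integral>W. (if k = l then 0 else f (W k) * g (W l)) * (\<Prod>i<n. W i i) * dt n W \<partial>PW) =
      moment f k k * moment g l l - moment f k l * moment g k l"
    proof (cases "k = l")
      case False
      have *: "(\<Prod>i<n. \<phi> k l i (W i)) = f (W k) * g (W l)" for W
      proof -
        have "(\<Prod>i<n. \<phi> k l i (W i)) = (\<Prod>i\<in>{k, l}. \<phi> k l i (W i))"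
          using kl by (intro prod.mono_neutral_right) (auto simp: \<phi>_def)
        then show ?thesis using False by (simp add: \<phi>_def)
      qed
      have "(\<integral>W. (if k = l then 0 else f (W k) * g (W l)) * (\<Prod>i<n. W i i) * dt n W \<partial>PW) =
          (\<integral>W. (\<Prod>i<n. \<phi> k l i (W i)) * (\<Prod>i<n. W i i) * dt n W \<partial>PW)"
        using False by (simp add: *)
      also have "\<dots> = dt n (\<lambda>i j. \<integral>u. \<phi> k l i u * (u i * u j) \<partial>\<mu>)"
        by (rule tuple_leibniz) (rule \<phi>)
      also have "\<dots> = dt n (\<lambda>i j. if i = k then moment f k j else if i = l then moment g l j else idm i j)"
        by (rule dt_cong) (auto simp: \<phi>_def moment_def second_moment)
      also have "\<dots> = moment f k k * moment g l l - moment f k l * moment g l k"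
        using kl False by (subst dt_replace_two_rows) auto
      finally show ?thesis by (simp add: moment_sym)
    qed simp
  qed
  also have "\<dots> = (\<Sum>k<n. moment f k k) * (\<Sum>l<n. moment g l l) - (\<Sum>k<n. \<Sum>l<n. moment f k l * moment g k l)"
    by (simp add: sum_subtractf sum_product)
  finally show ?thesis by (simp add: moment_trace f g)
qed

end

section \<open>Variance and the orthogonality defect\<close>

text \<open>
  Square the linear bound for \<open>exp (y / 2)\<close>, whose left side is nonnegative here.
\<close>

lemma exp_ge_quadratic:
  assumes "-2 \<le> (y :: real)"
  shows "1 + y + y\<^sup>2 / 4 \<le> exp y"
proof -
  have "(1 + y / 2)\<^sup>2 \<le> (exp (y / 2))\<^sup>2"
    using assms exp_ge_add_one_self[of "y / 2"] by (intro power_mono) auto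
  also have "(exp (y / 2))\<^sup>2 = exp y"
    by (simp add: power2_eq_square flip: exp_add)
  finally show ?thesis by (simp add: power2_eq_square field_simps)
qed

lemma sum_rotate:
  "(\<Sum>l\<in>L. \<Sum>a\<in>A. \<Sum>b\<in>B. f l a b) = (\<Sum>a\<in>A. \<Sum>b\<in>B. \<Sum>l\<in>L. f l a b)"
proof -
  have "(\<Sum>l\<in>L. \<Sum>a\<in>A. \<Sum>b\<in>B. f l a b) = (\<Sum>a\<in>A. \<Sum>l\<in>L. \<Sum>b\<in>B. f l a b)" by (rule sum.swap)
  also have "\<dots> = (\<Sum>a\<in>A. \<Sum>b\<in>B. \<Sum>l\<in>L. f l a b)" by (intro sum.cong refl sum.swap)
  finally show ?thesis .
qed

context isotropic_measure
begin

lemma integral_ip_sq: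
  assumes g: "bmeas \<mu> g"
  shows "(\<integral>v. g v * (ip n u v)\<^sup>2 \<partial>\<mu>) = (\<Sum>k<n. \<Sum>l<n. u k * u l * moment g k l)"
proof -
  have "(\<integral>v. g v * (ip n u v)\<^sup>2 \<partial>\<mu>) = (\<integral>v. (\<Sum>k<n. \<Sum>l<n. u k * u l * (g v * (v k * v l))) \<partial>\<mu>)"
    by (simp add: ip_def power2_eq_square sum_product sum_distrib_left mult_ac)
  also have "\<dots> = (\<Sum>k<n. \<integral>v. (\<Sum>l<n. u k * u l * (g v * (v k * v l))) \<partial>\<mu>)"
    by (rule Bochner_Integration.integral_sum, intro bmeas_integrable bmeas_intros g bmeas_coord) auto
  also have "\<dots> = (\<Sum>k<n. \<Sum>l<n. \<integral>v. u k * u l * (g v * (v k * v l)) \<partial>\<mu>)"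
    by (intro sum.cong refl Bochner_Integration.integral_sum bmeas_integrable bmeas_intros g bmeas_coord) auto
  finally show ?thesis by (simp add: moment_def)
qed

lemma moment_one: "k < n \<Longrightarrow> l < n \<Longrightarrow> moment (\<lambda>_. 1) k l = idm k l"
  by (simp add: moment_def second_moment)

lemma integral_ip_sq_one: "(\<integral>v. (ip n u v)\<^sup>2 \<partial>\<mu>) = ip n u u"
  using integral_ip_ip[of u u] by (simp add: power2_eq_square)

lemma bmeas_moment_sum: "bmeas \<mu> (\<lambda>u. \<Sum>k<n. \<Sum>l<n. u k * u l * c k l)"
  by (intro bmeas_intros bmeas_coord) auto

lemma integral_moment_sum:
  assumes f: "bmeas \<mu> f"
  shows "(\<integral>u. f u * (\<Sum>k<n. \<Sum>l<n. u k * u l * c k l) \<partial>\<mu>) = (\<Sum>k<n. \<Sum>l<n. moment f k l * c k l)"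
proof -
  have "(\<integral>u. f u * (\<Sum>k<n. \<Sum>l<n. u k * u l * c k l) \<partial>\<mu>) =
     (\<integral>u. (\<Sum>k<n. \<Sum>l<n. (f u * (u k * u l)) * c k l) \<partial>\<mu>)"
    by (simp add: sum_distrib_left mult_ac)
  also have "\<dots> = (\<Sum>k<n. \<integral>u. (\<Sum>l<n. (f u * (u k * u l)) * c k l) \<partial>\<mu>)"
    by (rule Bochner_Integration.integral_sum, intro bmeas_integrable bmeas_intros f bmeas_coord) auto
  also have "\<dots> = (\<Sum>k<n. \<Sum>l<n. \<integral>u. (f u * (u k * u l)) * c k l \<partial>\<mu>)"
    by (intro sum.cong refl Bochner_Integration.integral_sum bmeas_integrable bmeas_intros f bmeas_coord) auto
  finally show ?thesis by (simp add: moment_def)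
qed

lemma kernel_inner:
  assumes g: "bmeas \<mu> g"
  shows "(\<integral>v. f u * g v * (1 - (ip n u v)\<^sup>2) \<partial>\<mu>) =
      f u * (\<integral>v. g v \<partial>\<mu>) - f u * (\<Sum>k<n. \<Sum>l<n. u k * u l * moment g k l)"
proof -
  have "(\<integral>v. f u * g v * (1 - (ip n u v)\<^sup>2) \<partial>\<mu>) = (\<integral>v. f u * g v - f u * (g v * (ip n u v)\<^sup>2) \<partial>\<mu>)"
    by (simp add: algebra_simps)
  also have "\<dots> = (\<integral>v. f u * g v \<partial>\<mu>) - (\<integral>v. f u * (g v * (ip n u v)\<^sup>2) \<partial>\<mu>)"
    by (rule Bochner_Integration.integral_diff; intro bmeas_integrable bmeas_intros g bmeas_ip)
  finally show ?thesis by (simp add: integral_ip_sq g)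
qed

lemma kernel_bmeas:
  assumes f: "bmeas \<mu> f" and g: "bmeas \<mu> g"
  shows "bmeas \<mu> (\<lambda>u. \<integral>v. f u * g v * (1 - (ip n u v)\<^sup>2) \<partial>\<mu>)"
  unfolding kernel_inner[OF g] by (intro bmeas_diff bmeas_mult bmeas_const f bmeas_moment_sum)

lemma tuple_pair_kernel:
  assumes f: "bmeas \<mu> f" and g: "bmeas \<mu> g"
  shows "(\<integral>W. rho W * (\<Sum>k<n. \<Sum>l<n. if k = l then 0 else f (W k) * g (W l)) \<partial>PW) =
    (\<integral>u. (\<integral>v. f u * g v * (1 - (ip n u v)\<^sup>2) \<partial>\<mu>) \<partial>\<mu>)"
proof -
  have "(\<integral>u. (\<integral>v. f u * g v * (1 - (ip n u v)\<^sup>2) \<partial>\<mu>) \<partial>\<mu>) =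
     (\<integral>u. f u * (\<integral>v. g v \<partial>\<mu>) \<partial>\<mu>) - (\<integral>u. f u * (\<Sum>k<n. \<Sum>l<n. u k * u l * moment g k l) \<partial>\<mu>)"
    unfolding kernel_inner[OF g]
    by (rule Bochner_Integration.integral_diff; intro bmeas_integrable bmeas_intros f bmeas_moment_sum)
  then show ?thesis by (simp add: tuple_pair f g integral_moment_sum)
qed

text \<open>
  By \<open>tuple_variance\<close> this is the variance of the sum of \<open>f\<close> over the
  random tuple, in a form that is visibly determined by \<open>\<mu>\<close>.
\<close>

definition var :: "(rvec \<Rightarrow> real) \<Rightarrow> real" where
  "var f = (\<integral>u. (f u)\<^sup>2 \<partial>\<mu>) - (\<Sum>k<n. \<Sum>l<n. (moment f k l)\<^sup>2)"

text \<open>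
  Split the square of the sum into its diagonal, an expectation by \<open>tuple_mean\<close>, and
  its off-diagonal part, given by \<open>tuple_pair\<close>.
\<close>

lemma tuple_variance:
  assumes f: "bmeas \<mu> f"
  shows "(\<integral>W. rho W * ((\<Sum>k<n. f (W k)) - (\<integral>u. f u \<partial>\<mu>))\<^sup>2 \<partial>PW) = var f"
proof -
  define m where "m = (\<integral>u. f u \<partial>\<mu>)"
  let ?S = "\<lambda>W. \<Sum>k<n. f (W k)"
  let ?O = "\<lambda>W. \<Sum>k<n. \<Sum>l<n. if k = l then 0 else f (W k) * f (W l)"
  let ?D = "\<lambda>W. \<Sum>k<n. (f (W k))\<^sup>2"
  have S: "bmeas PW ?S" by (intro bmeas_intros bmeas_PW f) auto
  have D: "bmeas PW ?D" by (intro bmeas_intros bmeas_PW[of _ "\<lambda>u. (f u)\<^sup>2"] f) auto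
  have sq: "(?S W)\<^sup>2 = ?D W + ?O W" for W
  proof -
    have "(?S W)\<^sup>2 = (\<Sum>k<n. \<Sum>l<n. f (W k) * f (W l))"
      by (simp add: power2_eq_square sum_product)
    also have "\<dots> = (\<Sum>k<n. (\<Sum>l<n. (if l = k then (f (W k))\<^sup>2 else 0) + (if k = l then 0 else f (W k) * f (W l))))"
      by (intro sum.cong refl) (auto simp: power2_eq_square)
    finally show ?thesis by (simp add: sum.distrib)
  qed
  have O: "bmeas PW ?O"
  proof -
    have "bmeas PW (\<lambda>W. (?S W)\<^sup>2 - ?D W)" by (intro bmeas_intros S D)
    then show ?thesis by (simp add: sq)
  qed
  have "(\<integral>W. rho W * (?S W - m)\<^sup>2 \<partial>PW) =
     (\<integral>W. (rho W * ?D W + rho W * ?O W) + (m\<^sup>2 * rho W - 2 * m * (rho W * ?S W)) \<partial>PW)"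
    by (intro Bochner_Integration.integral_cong refl) (simp only: power2_diff sq, simp add: algebra_simps)
  also have "\<dots> = ((\<integral>W. rho W * ?D W \<partial>PW) + (\<integral>W. rho W * ?O W \<partial>PW)) +
      ((\<integral>W. m\<^sup>2 * rho W \<partial>PW) - (\<integral>W. 2 * m * (rho W * ?S W) \<partial>PW))"
  proof -
    have i: "integrable PW (\<lambda>W. rho W * ?D W)" "integrable PW (\<lambda>W. rho W * ?O W)"
      "integrable PW (\<lambda>W. m\<^sup>2 * rho W)" "integrable PW (\<lambda>W. 2 * m * (rho W * ?S W))"
      by (intro fPW.bmeas_integrable bmeas_mult bmeas_const bmeas_rho D O S)+
    show ?thesis
      by (simp only: Bochner_Integration.integral_add Bochner_Integration.integral_diff
            Bochner_Integration.integrable_add Bochner_Integration.integrable_diff i)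
  qed
  also have "(\<integral>W. rho W * ?D W \<partial>PW) = (\<integral>u. (f u)\<^sup>2 \<partial>\<mu>)"
    by (rule tuple_mean) (intro bmeas_intros f)
  also have "(\<integral>W. rho W * ?O W \<partial>PW) = m * m - (\<Sum>k<n. \<Sum>l<n. moment f k l * moment f k l)"
    unfolding m_def by (rule tuple_pair) (rule f)+
  also have "(\<integral>W. m\<^sup>2 * rho W \<partial>PW) = m\<^sup>2" by (simp add: rho_total)
  also have "(\<integral>W. 2 * m * (rho W * ?S W) \<partial>PW) = 2 * m * m"
    using tuple_mean[OF f] by (simp add: m_def)
  finally show ?thesis by (simp add: m_def var_def power2_eq_square)
qed

text \<open>
  Expanding \<open>(f u - f v)\<^sup>2\<close>, the two square terms integrate by isotropy to the
  integral of \<open>f\<^sup>2\<close> and the mixed term to the moments. In this form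
  \<open>var\<close> is nonnegative and monotone in the oscillation of \<open>f\<close>.
\<close>

lemma var_double_integral:
  assumes f: "bmeas \<mu> f"
  shows "2 * var f = (\<integral>u. (\<integral>v. (f u - f v)\<^sup>2 * (ip n u v)\<^sup>2 \<partial>\<mu>) \<partial>\<mu>)"
proof -
  have f2: "bmeas \<mu> (\<lambda>u. (f u)\<^sup>2)" by (intro bmeas_intros f)
  have "(\<integral>v. (f u - f v)\<^sup>2 * (ip n u v)\<^sup>2 \<partial>\<mu>) =
      (f u)\<^sup>2 * 1 + (- 2 * (f u * (\<Sum>k<n. \<Sum>l<n. u k * u l * moment f k l)) + 1 * (\<Sum>k<n. \<Sum>l<n. u k * u l * moment (\<lambda>u. (f u)\<^sup>2) k l))"
    if u: "u \<in> usphere n" for u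
  proof -
    have "(\<integral>v. (f u - f v)\<^sup>2 * (ip n u v)\<^sup>2 \<partial>\<mu>) =
        (\<integral>v. (f u)\<^sup>2 * (ip n u v)\<^sup>2 + (- 2 * f u * (f v * (ip n u v)\<^sup>2) + (f v)\<^sup>2 * (ip n u v)\<^sup>2) \<partial>\<mu>)"
      by (simp add: power2_diff algebra_simps)
    also have "\<dots> = (\<integral>v. (f u)\<^sup>2 * (ip n u v)\<^sup>2 \<partial>\<mu>) + ((\<integral>v. - 2 * f u * (f v * (ip n u v)\<^sup>2) \<partial>\<mu>) + (\<integral>v. (f v)\<^sup>2 * (ip n u v)\<^sup>2 \<partial>\<mu>))"
    proof -
      have i: "integrable \<mu> (\<lambda>v. (f u)\<^sup>2 * (ip n u v)\<^sup>2)" "integrable \<mu> (\<lambda>v. - 2 * f u * (f v * (ip n u v)\<^sup>2))"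
        "integrable \<mu> (\<lambda>v. (f v)\<^sup>2 * (ip n u v)\<^sup>2)"
        by (intro bmeas_integrable bmeas_intros f bmeas_ip)+
      show ?thesis
        by (simp only: Bochner_Integration.integral_add Bochner_Integration.integrable_add i)
    qed
    finally show ?thesis
      by (simp add: integral_ip_sq_one ip_usphere[OF u] integral_ip_sq f f2)
  qed
  then have "(\<integral>u. (\<integral>v. (f u - f v)\<^sup>2 * (ip n u v)\<^sup>2 \<partial>\<mu>) \<partial>\<mu>) =
     (\<integral>u. (f u)\<^sup>2 * 1 + (- 2 * (f u * (\<Sum>k<n. \<Sum>l<n. u k * u l * moment f k l)) + 1 * (\<Sum>k<n. \<Sum>l<n. u k * u l * moment (\<lambda>u. (f u)\<^sup>2) k l)) \<partial>\<mu>)"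
    by (intro Bochner_Integration.integral_cong) auto
  also have "\<dots> = (\<integral>u. (f u)\<^sup>2 * 1 \<partial>\<mu>) + ((\<integral>u. - 2 * (f u * (\<Sum>k<n. \<Sum>l<n. u k * u l * moment f k l)) \<partial>\<mu>) +
      (\<integral>u. 1 * (\<Sum>k<n. \<Sum>l<n. u k * u l * moment (\<lambda>u. (f u)\<^sup>2) k l) \<partial>\<mu>))"
  proof -
    have i: "integrable \<mu> (\<lambda>u. (f u)\<^sup>2 * 1)" "integrable \<mu> (\<lambda>u. - 2 * (f u * (\<Sum>k<n. \<Sum>l<n. u k * u l * moment f k l)))"
      "integrable \<mu> (\<lambda>u. 1 * (\<Sum>k<n. \<Sum>l<n. u k * u l * moment (\<lambda>u. (f u)\<^sup>2) k l))"
      by (intro bmeas_integrable bmeas_mult bmeas_const bmeas_power f bmeas_moment_sum)+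
    show ?thesis
      by (simp only: Bochner_Integration.integral_add Bochner_Integration.integrable_add i)
  qed
  also have "(\<integral>u. - 2 * (f u * (\<Sum>k<n. \<Sum>l<n. u k * u l * moment f k l)) \<partial>\<mu>) = - 2 * (\<Sum>k<n. \<Sum>l<n. moment f k l * moment f k l)"
    by (simp add: integral_moment_sum f)
  also have "(\<integral>u. 1 * (\<Sum>k<n. \<Sum>l<n. u k * u l * moment (\<lambda>u. (f u)\<^sup>2) k l) \<partial>\<mu>) = (\<Sum>k<n. \<Sum>l<n. moment (\<lambda>_. 1) k l * moment (\<lambda>u. (f u)\<^sup>2) k l)"
    by (rule integral_moment_sum) (rule bmeas_const)
  also have "\<dots> = (\<Sum>k<n. \<Sum>l<n. if l = k then moment (\<lambda>u. (f u)\<^sup>2) k k else 0)"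
    by (intro sum.cong refl) (auto simp: moment_one)
  also have "\<dots> = (\<integral>u. (f u)\<^sup>2 \<partial>\<mu>)" using moment_trace[OF f2] by simp
  finally show ?thesis by (simp add: var_def power2_eq_square)
qed

text \<open>
  By \<open>det_tuple\<close> the determinant is the expectation of \<open>exp\<close> of the sum
  \<open>S\<close> of \<open>f\<close> over the tuple, and the mean of \<open>S\<close> is the
  integral of \<open>f\<close>. The tangent line of \<open>exp\<close> at that mean gives the
  first bound, the lower parabola \<open>exp_ge_quadratic\<close> the second.
\<close>

lemma det_ge_exp:
  assumes f: "bmeas \<mu> f"
  shows "exp (\<integral>u. f u \<partial>\<mu>) \<le> dt n (\<lambda>i j. \<integral>u. exp (f u) * (u i * u j) \<partial>\<mu>)"
    and "(\<And>W. W \<in> space PW \<Longrightarrow> - 2 \<le> (\<Sum>k<n. f (W k)) - (\<integral>u. f u \<partial>\<mu>)) \<Longrightarrow>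
      exp (\<integral>u. f u \<partial>\<mu>) * (1 + var f / 4) \<le> dt n (\<lambda>i j. \<integral>u. exp (f u) * (u i * u j) \<partial>\<mu>)"
proof -
  define m where "m = (\<integral>u. f u \<partial>\<mu>)"
  let ?S = "\<lambda>W. \<Sum>k<n. f (W k)"
  have S: "bmeas PW ?S" by (intro bmeas_intros bmeas_PW f) auto
  have E: "bmeas PW (\<lambda>W. exp (?S W - m))" by (intro bmeas_intros S)
  have "dt n (\<lambda>i j. \<integral>u. exp (f u) * (u i * u j) \<partial>\<mu>) = (\<integral>W. rho W * (\<Prod>i<n. exp (f (W i))) \<partial>PW)"
    by (rule det_tuple) (intro bmeas_intros f)
  also have "\<dots> = (\<integral>W. exp m * (rho W * exp (?S W - m)) \<partial>PW)"
    by (simp add: exp_sum exp_diff)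
  finally have A: "dt n (\<lambda>i j. \<integral>u. exp (f u) * (u i * u j) \<partial>\<mu>) = exp m * (\<integral>W. rho W * exp (?S W - m) \<partial>PW)"
    by simp
  have lin: "(\<integral>W. rho W * (1 + (?S W - m)) \<partial>PW) = 1"
  proof -
    have "(\<integral>W. rho W * (1 + (?S W - m)) \<partial>PW) = (\<integral>W. (1 - m) * rho W + rho W * ?S W \<partial>PW)"
      by (simp add: algebra_simps)
    also have "\<dots> = (\<integral>W. (1 - m) * rho W \<partial>PW) + (\<integral>W. rho W * ?S W \<partial>PW)"
      by (rule Bochner_Integration.integral_add; intro fPW.bmeas_integrable bmeas_mult bmeas_const bmeas_rho S)
    finally show ?thesis using tuple_mean[OF f] by (simp add: rho_total m_def)
  qed
  have "(\<integral>W. rho W * (1 + (?S W - m)) \<partial>PW) \<le> (\<integral>W. rho W * exp (?S W - m) \<partial>PW)"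
  proof (rule integral_mono)
    show "integrable PW (\<lambda>W. rho W * (1 + (?S W - m)))" "integrable PW (\<lambda>W. rho W * exp (?S W - m))"
      by (intro fPW.bmeas_integrable bmeas_mult bmeas_rho E bmeas_add bmeas_const bmeas_diff S)+
    fix W show "rho W * (1 + (?S W - m)) \<le> rho W * exp (?S W - m)"
      by (intro mult_left_mono rho_nonneg exp_ge_add_one_self)
  qed
  then show "exp (\<integral>u. f u \<partial>\<mu>) \<le> dt n (\<lambda>i j. \<integral>u. exp (f u) * (u i * u j) \<partial>\<mu>)"
    unfolding A lin by (simp add: m_def)
  assume b: "\<And>W. W \<in> space PW \<Longrightarrow> - 2 \<le> (\<Sum>k<n. f (W k)) - (\<integral>u. f u \<partial>\<mu>)"
  have "1 + var f / 4 = (\<integral>W. rho W * (1 + (?S W - m)) \<partial>PW) + (\<integral>W. (rho W * (?S W - m)\<^sup>2) * (1 / 4) \<partial>PW)"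
    using tuple_variance[OF f] unfolding lin by (simp add: m_def)
  also have "\<dots> = (\<integral>W. rho W * (1 + (?S W - m)) + (rho W * (?S W - m)\<^sup>2) * (1 / 4) \<partial>PW)"
    by (rule Bochner_Integration.integral_add[symmetric]; intro fPW.bmeas_integrable bmeas_mult bmeas_rho bmeas_add bmeas_const bmeas_power bmeas_diff S)
  also have "\<dots> \<le> (\<integral>W. rho W * exp (?S W - m) \<partial>PW)"
  proof (rule integral_mono)
    show "integrable PW (\<lambda>W. rho W * (1 + (?S W - m)) + (rho W * (?S W - m)\<^sup>2) * (1 / 4))"
       "integrable PW (\<lambda>W. rho W * exp (?S W - m))"
      by (intro fPW.bmeas_integrable bmeas_mult bmeas_rho E bmeas_add bmeas_const bmeas_power bmeas_diff S)+
    fix W assume W: "W \<in> space PW"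
    have "rho W * (1 + (?S W - m)) + (rho W * (?S W - m)\<^sup>2) * (1 / 4) = rho W * (1 + (?S W - m) + (?S W - m)\<^sup>2 / 4)"
      by (simp add: algebra_simps)
    also have "\<dots> \<le> rho W * exp (?S W - m)"
      using b[OF W] by (intro mult_left_mono rho_nonneg exp_ge_quadratic) (simp add: m_def)
    finally show "rho W * (1 + (?S W - m)) + (rho W * (?S W - m)\<^sup>2) * (1 / 4) \<le> rho W * exp (?S W - m)" .
  qed
  finally show "exp (\<integral>u. f u \<partial>\<mu>) * (1 + var f / 4) \<le> dt n (\<lambda>i j. \<integral>u. exp (f u) * (u i * u j) \<partial>\<mu>)"
    unfolding A by (simp add: m_def)
qed

text \<open>
  It vanishes exactly if almost all pairs of vectors are orthogonal or parallel, as they are for a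
  cross measure.
\<close>

definition defect :: real where
  "defect = (\<integral>u. (\<integral>v. (ip n u v)\<^sup>2 * (1 - (ip n u v)\<^sup>2) \<partial>\<mu>) \<partial>\<mu>)"

text \<open>
  Expand the squared inner product into products of coordinate functions and apply
  \<open>tuple_pair_kernel\<close> to each of them; summing up again under the integral gives the
  defect.
\<close>

lemma tuple_orthogonality_defect:
  "(\<integral>W. rho W * (\<Sum>k<n. \<Sum>l<n. if k = l then 0 else (ip n (W k) (W l))\<^sup>2) \<partial>PW) = defect"
proof -
  let ?f = "\<lambda>a b (u::rvec). u a * u b"
  have f: "bmeas \<mu> (?f a b)" if "a < n" "b < n" for a b
    using that by (intro bmeas_intros bmeas_coord)
  have sq: "(ip n u v)\<^sup>2 = (\<Sum>a<n. \<Sum>b<n. ?f a b u * ?f a b v)" for u v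
    by (simp add: ip_def power2_eq_square sum_product mult_ac)
  have bt: "bmeas PW (\<lambda>W. \<Sum>k<n. \<Sum>l<n. if k = l then 0 else ?f a b (W k) * ?f a b (W l))" if ab: "a < n" "b < n" for a b
  proof (intro bmeas_sum)
    fix k l assume kl: "k \<in> {..<n}" "l \<in> {..<n}"
    have "bmeas PW (\<lambda>W. ?f a b (W k) * ?f a b (W l))"
      using kl by (intro bmeas_intros bmeas_PW_coord ab) auto
    then show "bmeas PW (\<lambda>W. if k = l then 0 else ?f a b (W k) * ?f a b (W l))"
      by (cases "k = l") (auto intro: bmeas_const)
  qed
  have "(\<integral>W. rho W * (\<Sum>k<n. \<Sum>l<n. if k = l then 0 else (ip n (W k) (W l))\<^sup>2) \<partial>PW) =
    (\<integral>W. (\<Sum>a<n. \<Sum>b<n. rho W * (\<Sum>k<n. \<Sum>l<n. if k = l then 0 else ?f a b (W k) * ?f a b (W l))) \<partial>PW)"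
  proof (intro Bochner_Integration.integral_cong refl)
    fix W :: "nat \<Rightarrow> rvec"
    have "(\<Sum>k<n. \<Sum>l<n. if k = l then 0 else (ip n (W k) (W l))\<^sup>2) =
        (\<Sum>k<n. \<Sum>l<n. \<Sum>a<n. \<Sum>b<n. if k = l then 0 else ?f a b (W k) * ?f a b (W l))"
      by (intro sum.cong refl) (auto simp: sq)
    also have "\<dots> = (\<Sum>k<n. \<Sum>a<n. \<Sum>b<n. \<Sum>l<n. if k = l then 0 else ?f a b (W k) * ?f a b (W l))"
    proof (rule sum.cong[OF refl])
      fix k
      show "(\<Sum>l<n. \<Sum>a<n. \<Sum>b<n. if k = l then 0 else ?f a b (W k) * ?f a b (W l)) =
        (\<Sum>a<n. \<Sum>b<n. \<Sum>l<n. if k = l then 0 else ?f a b (W k) * ?f a b (W l))"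
        by (rule sum_rotate)
    qed
    also have "\<dots> = (\<Sum>a<n. \<Sum>b<n. \<Sum>k<n. \<Sum>l<n. if k = l then 0 else ?f a b (W k) * ?f a b (W l))"
      by (rule sum_rotate)
    finally show "rho W * (\<Sum>k<n. \<Sum>l<n. if k = l then 0 else (ip n (W k) (W l))\<^sup>2) =
        (\<Sum>a<n. \<Sum>b<n. rho W * (\<Sum>k<n. \<Sum>l<n. if k = l then 0 else ?f a b (W k) * ?f a b (W l)))"
      by (simp only: sum_distrib_left)
  qed
  also have "\<dots> = (\<Sum>a<n. \<integral>W. (\<Sum>b<n. rho W * (\<Sum>k<n. \<Sum>l<n. if k = l then 0 else ?f a b (W k) * ?f a b (W l))) \<partial>PW)"
    by (rule Bochner_Integration.integral_sum, intro fPW.bmeas_integrable bmeas_sum[where I = "{..<n}" and f = "\<lambda>b W. rho W * (\<Sum>k<n. \<Sum>l<n. if k = l then 0 else ?f _ b (W k) * ?f _ b (W l))"] bmeas_mult[OF bmeas_rho] bt) auto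
  also have "\<dots> = (\<Sum>a<n. \<Sum>b<n. \<integral>W. rho W * (\<Sum>k<n. \<Sum>l<n. if k = l then 0 else ?f a b (W k) * ?f a b (W l)) \<partial>PW)"
    by (rule sum.cong[OF refl], rule Bochner_Integration.integral_sum, intro fPW.bmeas_integrable bmeas_mult[OF bmeas_rho] bt) auto
  also have "\<dots> = (\<Sum>a<n. \<Sum>b<n. \<integral>u. (\<integral>v. ?f a b u * ?f a b v * (1 - (ip n u v)\<^sup>2) \<partial>\<mu>) \<partial>\<mu>)"
    by (intro sum.cong refl tuple_pair_kernel f) auto
  also have "\<dots> = (\<Sum>a<n. \<integral>u. (\<Sum>b<n. \<integral>v. ?f a b u * ?f a b v * (1 - (ip n u v)\<^sup>2) \<partial>\<mu>) \<partial>\<mu>)"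
    by (rule sum.cong[OF refl], rule Bochner_Integration.integral_sum[symmetric], intro bmeas_integrable kernel_bmeas f) auto
  also have "\<dots> = (\<integral>u. (\<Sum>a<n. \<Sum>b<n. \<integral>v. ?f a b u * ?f a b v * (1 - (ip n u v)\<^sup>2) \<partial>\<mu>) \<partial>\<mu>)"
    by (rule Bochner_Integration.integral_sum[symmetric], intro bmeas_integrable bmeas_sum[where I = "{..<n}" and f = "\<lambda>b u. \<integral>v. ?f _ b u * ?f _ b v * (1 - (ip n u v)\<^sup>2) \<partial>\<mu>"] kernel_bmeas f) auto
  also have "\<dots> = defect"
    unfolding defect_def
  proof (intro Bochner_Integration.integral_cong refl)
    fix u
    have b: "bmeas \<mu> (\<lambda>v. ?f a b u * ?f a b v * (1 - (ip n u v)\<^sup>2))" if "a < n" "b < n" for a b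
      using that by (intro bmeas_mult[where g = "\<lambda>v. 1 - (ip n u v)\<^sup>2"] bmeas_mult[OF bmeas_const] f bmeas_diff bmeas_const bmeas_power bmeas_ip)
    have "(\<Sum>a<n. \<Sum>b<n. \<integral>v. ?f a b u * ?f a b v * (1 - (ip n u v)\<^sup>2) \<partial>\<mu>) =
       (\<Sum>a<n. \<integral>v. (\<Sum>b<n. ?f a b u * ?f a b v * (1 - (ip n u v)\<^sup>2)) \<partial>\<mu>)"
      by (rule sum.cong[OF refl], rule Bochner_Integration.integral_sum[symmetric], intro bmeas_integrable b) auto
    also have "\<dots> = (\<integral>v. (\<Sum>a<n. \<Sum>b<n. ?f a b u * ?f a b v * (1 - (ip n u v)\<^sup>2)) \<partial>\<mu>)"
      by (rule Bochner_Integration.integral_sum[symmetric], intro bmeas_integrable bmeas_sum[where I = "{..<n}" and f = "\<lambda>b v. ?f _ b u * ?f _ b v * (1 - (ip n u v)\<^sup>2)"] b) auto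
    also have "\<dots> = (\<integral>v. (ip n u v)\<^sup>2 * (1 - (ip n u v)\<^sup>2) \<partial>\<mu>)"
      by (simp only: sq sum_distrib_right[symmetric])
    finally show "(\<Sum>a<n. \<Sum>b<n. \<integral>v. ?f a b u * ?f a b v * (1 - (ip n u v)\<^sup>2) \<partial>\<mu>) =
       (\<integral>v. (ip n u v)\<^sup>2 * (1 - (ip n u v)\<^sup>2) \<partial>\<mu>)" .
  qed
  finally show ?thesis .
qed

end

section \<open>Second and fourth moments of a cube\<close>

lemma bmeas_pair1: "bmeas M f \<Longrightarrow> bmeas (M \<Otimes>\<^sub>M N) (\<lambda>p. f (fst p))"
  by (rule bmeas_compose[OF measurable_fst])

lemma bmeas_pair2: "bmeas N f \<Longrightarrow> bmeas (M \<Otimes>\<^sub>M N) (\<lambda>p. f (snd p))"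
  by (rule bmeas_compose[OF measurable_snd])

lemma (in finite_measure) bmeas_lebesgue_integral:
  assumes "bmeas (N \<Otimes>\<^sub>M M) (\<lambda>p. G (fst p) (snd p))"
  shows "bmeas N (\<lambda>x. \<integral>y. G x y \<partial>M)"
proof -
  obtain C where G: "(\<lambda>p. G (fst p) (snd p)) \<in> borel_measurable (N \<Otimes>\<^sub>M M)"
    and C: "\<And>p. p \<in> space (N \<Otimes>\<^sub>M M) \<Longrightarrow> \<bar>G (fst p) (snd p)\<bar> \<le> C"
    using assms by (auto simp: bmeas_def)
  show ?thesis
  proof (rule bmeasI)
    show "(\<lambda>x. \<integral>y. G x y \<partial>M) \<in> borel_measurable N"
      using G by (intro borel_measurable_lebesgue_integral) (simp add: case_prod_beta)
    fix x assume x: "x \<in> space N"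
    have "\<bar>\<integral>y. G x y \<partial>M\<bar> \<le> (\<integral>y. \<bar>G x y\<bar> \<partial>M)" by (rule integral_abs_bound)
    also have "\<dots> \<le> (\<integral>y. \<bar>C\<bar> \<partial>M)"
    proof (rule Bochner_Integration.integral_mono')
      fix y assume "y \<in> space M"
      then show "\<bar>G x y\<bar> \<le> \<bar>C\<bar>" using C[of "(x, y)"] x by (auto simp: space_pair_measure)
    qed auto
    also have "\<dots> = measure M (space M) * \<bar>C\<bar>" by simp
    finally show "\<bar>\<integral>y. G x y \<partial>M\<bar> \<le> measure M (space M) * \<bar>C\<bar>" .
  qed
qed

lemma bmeas_Fubini:
  assumes "finite_measure M" "finite_measure N" "bmeas (M \<Otimes>\<^sub>M N) (\<lambda>p. G (fst p) (snd p))"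
  shows "(\<integral>x. (\<integral>y. G x y \<partial>N) \<partial>M) = (\<integral>y. (\<integral>x. G x y \<partial>M) \<partial>N)"
proof -
  interpret M: finite_measure M by fact
  interpret N: finite_measure N by fact
  interpret P: pair_sigma_finite M N ..
  interpret PF: finite_measure "M \<Otimes>\<^sub>M N"
  proof
    have "emeasure (M \<Otimes>\<^sub>M N) (space (M \<Otimes>\<^sub>M N)) = emeasure M (space M) * emeasure N (space N)"
      unfolding space_pair_measure by (rule N.emeasure_pair_measure_Times) auto
    then show "emeasure (M \<Otimes>\<^sub>M N) (space (M \<Otimes>\<^sub>M N)) \<noteq> \<infinity>"
      by (simp add: ennreal_mult_eq_top_iff)
  qed
  show ?thesis
    by (rule P.Fubini_integral[symmetric], subst case_prod_beta') (rule PF.bmeas_integrable[OF assms(3)])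
qed

definition cube_measure :: "nat \<Rightarrow> real \<Rightarrow> rvec measure" where
  "cube_measure n r = restrict_space (Leb n) (cube n r)"

lemma cube_subset_Rn: "cube n r \<subseteq> Rn n"
  by (auto simp: cube_iff)

lemma space_cube_measure [simp]: "space (cube_measure n r) = cube n r"
  using cube_subset_Rn[of n r] by (auto simp: cube_measure_def space_restrict_space)

lemma measurable_cube_measure: "f \<in> borel_measurable (Leb n) \<Longrightarrow> f \<in> borel_measurable (cube_measure n r)"
  unfolding cube_measure_def by (rule measurable_restrict_space1)

lemma emeasure_cube_measure: "0 \<le> r \<Longrightarrow> emeasure (cube_measure n r) (cube n r) = ennreal ((2 * r) ^ n)"
  unfolding cube_measure_def using cube_subset_Rn[of n r]
  by (subst emeasure_restrict_space) (auto simp: emeasure_cube Int_absorb2)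

lemma finite_cube_measure: "0 \<le> r \<Longrightarrow> finite_measure (cube_measure n r)"
  by (rule finite_measureI) (simp add: emeasure_cube_measure)

lemma measure_cube_measure: "0 \<le> r \<Longrightarrow> measure (cube_measure n r) (cube n r) = (2 * r) ^ n"
  by (simp add: measure_def emeasure_cube_measure)

lemma integral_cube_measure: "(\<integral>x. f x \<partial>cube_measure n r) = (\<integral>x. indicator (cube n r) x * f x \<partial>Leb n)" for f :: "_ \<Rightarrow> real"
  unfolding cube_measure_def using cube_subset_Rn[of n r] by (subst integral_restrict_space) (auto simp: Int_absorb2)

lemma integrable_cube_measure_iff:
  "integrable (cube_measure n r) f \<longleftrightarrow> integrable (Leb n) (\<lambda>x. indicator (cube n r) x * f x)" for f :: "_ \<Rightarrow> real"
  unfolding cube_measure_def using cube_subset_Rn[of n r] by (subst integrable_restrict_space) (auto simp: Int_absorb2)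

lemma bmeas_cube_measure_coord: "i < n \<Longrightarrow> bmeas (cube_measure n r) (\<lambda>x. x i)"
  by (rule bmeasI[of _ _ r], rule measurable_cube_measure) (auto simp: cube_iff)

lemma bmeas_cube_measure_ip: "bmeas (cube_measure n r) (\<lambda>x. ip n x a)"
  unfolding ip_def by (intro bmeas_intros bmeas_cube_measure_coord) auto

lemma cube_measure_Suc:
  assumes r: "0 \<le> r" and F: "bmeas (cube_measure (Suc n) r) F"
  shows "(\<integral>x. F x \<partial>cube_measure (Suc n) r) = (\<integral>y. (\<integral>t. F (y(n := t)) * indicator {-r..r} t \<partial>lborel) \<partial>cube_measure n r)"
proof -
  have "integrable (cube_measure (Suc n) r) F"
    by (rule finite_measure.bmeas_integrable[OF finite_cube_measure[OF r] F])
  then have i: "integrable (Pi\<^sub>M (insert n {..<n}) (\<lambda>_. lborel)) (\<lambda>x. indicator (cube (Suc n) r) x * F x)"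
    by (simp add: integrable_cube_measure_iff lessThan_Suc)
  have "(\<integral>x. F x \<partial>cube_measure (Suc n) r) = (\<integral>x. indicator (cube (Suc n) r) x * F x \<partial>Pi\<^sub>M (insert n {..<n}) (\<lambda>_. lborel))"
    by (simp add: integral_cube_measure lessThan_Suc)
  also have "\<dots> = (\<integral>y. (\<integral>t. indicator (cube (Suc n) r) (y(n := t)) * F (y(n := t)) \<partial>lborel) \<partial>Leb n)"
    by (rule lbp.product_integral_insert[OF _ _ i]) auto
  also have "\<dots> = (\<integral>y. indicator (cube n r) y * (\<integral>t. F (y(n := t)) * indicator {-r..r} t \<partial>lborel) \<partial>Leb n)"
  proof (rule Bochner_Integration.integral_cong[OF refl])
    fix y assume y: "y \<in> space (Leb n)"
    have up: "y(n := t) \<in> Rn (Suc n)" for t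
      using y by (auto simp: Rn_def PiE_def extensional_def)
    have "indicator (cube (Suc n) r) (y(n := t)) = indicator (cube n r) y * (indicator {-r..r} t :: real)" for t
      using y up[of t] by (auto simp: indicator_def cube_iff less_Suc_eq abs_le_iff split: if_splits)
    then have "indicator (cube (Suc n) r) (y(n := t)) * F (y(n := t)) =
        indicator (cube n r) y * (F (y(n := t)) * indicator {-r..r} t)" for t
      by simp
    then show "(\<integral>t. indicator (cube (Suc n) r) (y(n := t)) * F (y(n := t)) \<partial>lborel) =
        indicator (cube n r) y * (\<integral>t. F (y(n := t)) * indicator {-r..r} t \<partial>lborel)"
      by (simp only: integral_mult_right_zero)
  qed
  finally show ?thesis by (simp add: integral_cube_measure)
qed

lemma ip_upd: "ip (Suc n) (y(n := t)) a = ip n y a + t * a n"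
  by (simp add: ip_def)

lemma integral_poly4:
  assumes r: "0 \<le> (r :: real)"
  shows "(\<integral>t. (c0 + c1 * t + c2 * t\<^sup>2 + c3 * t ^ 3 + c4 * t ^ 4) * indicator {-r..r} t \<partial>lborel) =
    2 * r * c0 + 2 * r ^ 3 / 3 * c2 + 2 * r ^ 5 / 5 * c4"
proof -
  have i: "integrable lborel (\<lambda>t. t ^ k * indicator {-r..r} t)" for k
    by (rule borel_integrable_atLeastAtMost) auto
  have P: "(\<integral>t. t ^ k * indicator {-r..r} t \<partial>lborel) = (r ^ Suc k - (- r) ^ Suc k) / Suc k" for k
    using r by (intro integral_power) auto
  have "(\<integral>t. (c0 + c1 * t + c2 * t\<^sup>2 + c3 * t ^ 3 + c4 * t ^ 4) * indicator {-r..r} t \<partial>lborel) =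
    (\<integral>t. c0 * (t ^ 0 * indicator {-r..r} t) + (c1 * (t ^ 1 * indicator {-r..r} t) + (c2 * (t ^ 2 * indicator {-r..r} t) +
       (c3 * (t ^ 3 * indicator {-r..r} t) + c4 * (t ^ 4 * indicator {-r..r} t)))) \<partial>lborel)"
    by (intro Bochner_Integration.integral_cong refl) (simp add: algebra_simps)
  also have "\<dots> = c0 * (\<integral>t. t ^ 0 * indicator {-r..r} t \<partial>lborel) + (c1 * (\<integral>t. t ^ 1 * indicator {-r..r} t \<partial>lborel) +
     (c2 * (\<integral>t. t ^ 2 * indicator {-r..r} t \<partial>lborel) + (c3 * (\<integral>t. t ^ 3 * indicator {-r..r} t \<partial>lborel) +
      c4 * (\<integral>t. t ^ 4 * indicator {-r..r} t \<partial>lborel))))"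
    by (simp only: Bochner_Integration.integral_add Bochner_Integration.integrable_add integrable_mult_right integral_mult_right_zero i)
  also have "\<dots> = 2 * r * c0 + 2 * r ^ 3 / 3 * c2 + 2 * r ^ 5 / 5 * c4"
    unfolding P by (simp add: field_simps eval_nat_numeral)
  finally show ?thesis .
qed

lemma cube_moment2:
  assumes r: "0 \<le> r"
  shows "(\<integral>x. ip n x a * ip n x b \<partial>cube_measure n r) = (2 * r) ^ n * (r\<^sup>2 / 3) * ip n a b"
proof (induction n)
  case 0
  then show ?case by (simp add: ip_def)
next
  case (Suc n)
  interpret C: finite_measure "cube_measure n r" by (rule finite_cube_measure[OF r])
  have "(\<integral>x. ip (Suc n) x a * ip (Suc n) x b \<partial>cube_measure (Suc n) r) =
    (\<integral>y. (\<integral>t. (ip n y a + t * a n) * (ip n y b + t * b n) * indicator {-r..r} t \<partial>lborel) \<partial>cube_measure n r)"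
    unfolding ip_upd[symmetric] by (rule cube_measure_Suc[OF r]) (intro bmeas_intros bmeas_cube_measure_ip)
  also have "\<dots> = (\<integral>y. 2 * r * (ip n y a * ip n y b) + 2 * r ^ 3 / 3 * (a n * b n) \<partial>cube_measure n r)"
  proof (intro Bochner_Integration.integral_cong refl)
    fix y
    show "(\<integral>t. (ip n y a + t * a n) * (ip n y b + t * b n) * indicator {-r..r} t \<partial>lborel) =
       2 * r * (ip n y a * ip n y b) + 2 * r ^ 3 / 3 * (a n * b n)"
      using integral_poly4[OF r, of "ip n y a * ip n y b" "ip n y a * b n + ip n y b * a n" "a n * b n" 0 0]
      by (simp add: algebra_simps power2_eq_square)
  qed
  also have "\<dots> = 2 * r * (\<integral>y. ip n y a * ip n y b \<partial>cube_measure n r) + 2 * r ^ 3 / 3 * (a n * b n) * (2 * r) ^ n"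
  proof -
    have "integrable (cube_measure n r) (\<lambda>y. 2 * r * (ip n y a * ip n y b))"
      by (intro C.bmeas_integrable bmeas_intros bmeas_cube_measure_ip)
    then show ?thesis by (subst Bochner_Integration.integral_add) (auto simp: measure_cube_measure[OF r])
  qed
  also have "\<dots> = (2 * r) ^ Suc n * (r\<^sup>2 / 3) * ip (Suc n) a b"
    unfolding Suc.IH by (simp add: ip_def algebra_simps power2_eq_square eval_nat_numeral)
  finally show ?case .
qed

lemma cube_moment4:
  assumes r: "0 \<le> r"
  shows "(\<integral>x. (ip n x a)\<^sup>2 * (ip n x b)\<^sup>2 \<partial>cube_measure n r) =
    (2 * r) ^ n * r ^ 4 * ((ip n a a * ip n b b + 2 * (ip n a b)\<^sup>2) / 9 - 2 / 15 * (\<Sum>i<n. (a i)\<^sup>2 * (b i)\<^sup>2))"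
proof (induction n)
  case 0
  then show ?case by (simp add: ip_def)
next
  case (Suc n)
  interpret C: finite_measure "cube_measure n r" by (rule finite_cube_measure[OF r])
  let ?A = "\<lambda>y. ip n y a" and ?B = "\<lambda>y. ip n y b"
  have "(\<integral>x. (ip (Suc n) x a)\<^sup>2 * (ip (Suc n) x b)\<^sup>2 \<partial>cube_measure (Suc n) r) =
    (\<integral>y. (\<integral>t. (?A y + t * a n)\<^sup>2 * (?B y + t * b n)\<^sup>2 * indicator {-r..r} t \<partial>lborel) \<partial>cube_measure n r)"
    unfolding ip_upd[symmetric] by (rule cube_measure_Suc[OF r]) (intro bmeas_intros bmeas_cube_measure_ip)
  also have "\<dots> = (\<integral>y. 2 * r * ((?A y)\<^sup>2 * (?B y)\<^sup>2) + (2 * r ^ 3 / 3 * (a n)\<^sup>2 * (?B y * ?B y) +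
      (2 * r ^ 3 / 3 * (b n)\<^sup>2 * (?A y * ?A y) + (2 * r ^ 3 / 3 * (4 * a n * b n) * (?A y * ?B y) +
       2 * r ^ 5 / 5 * ((a n)\<^sup>2 * (b n)\<^sup>2)))) \<partial>cube_measure n r)"
  proof (intro Bochner_Integration.integral_cong refl)
    fix y
    let ?c = "(?A y)\<^sup>2 * (b n)\<^sup>2 + (?B y)\<^sup>2 * (a n)\<^sup>2 + 4 * a n * b n * ?A y * ?B y"
    have "(\<integral>t. (?A y + t * a n)\<^sup>2 * (?B y + t * b n)\<^sup>2 * indicator {-r..r} t \<partial>lborel) =
      (\<integral>t. ((?A y)\<^sup>2 * (?B y)\<^sup>2 + (2 * (?A y)\<^sup>2 * ?B y * b n + 2 * ?A y * a n * (?B y)\<^sup>2) * t + ?c * t\<^sup>2 +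
        (2 * ?A y * a n * (b n)\<^sup>2 + 2 * ?B y * b n * (a n)\<^sup>2) * t ^ 3 + ((a n)\<^sup>2 * (b n)\<^sup>2) * t ^ 4) * indicator {-r..r} t \<partial>lborel)"
      by (intro Bochner_Integration.integral_cong refl arg_cong2[where f = "(*)"])
         (simp add: algebra_simps power2_eq_square eval_nat_numeral)
    also have "\<dots> = 2 * r * ((?A y)\<^sup>2 * (?B y)\<^sup>2) + 2 * r ^ 3 / 3 * ?c + 2 * r ^ 5 / 5 * ((a n)\<^sup>2 * (b n)\<^sup>2)"
      by (rule integral_poly4[OF r])
    finally show "(\<integral>t. (?A y + t * a n)\<^sup>2 * (?B y + t * b n)\<^sup>2 * indicator {-r..r} t \<partial>lborel) =
       2 * r * ((?A y)\<^sup>2 * (?B y)\<^sup>2) + (2 * r ^ 3 / 3 * (a n)\<^sup>2 * (?B y * ?B y) +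
      (2 * r ^ 3 / 3 * (b n)\<^sup>2 * (?A y * ?A y) + (2 * r ^ 3 / 3 * (4 * a n * b n) * (?A y * ?B y) +
       2 * r ^ 5 / 5 * ((a n)\<^sup>2 * (b n)\<^sup>2))))"
      by (simp add: algebra_simps power2_eq_square)
  qed
  also have "\<dots> = 2 * r * (\<integral>y. (?A y)\<^sup>2 * (?B y)\<^sup>2 \<partial>cube_measure n r) + (2 * r ^ 3 / 3 * (a n)\<^sup>2 * (\<integral>y. ?B y * ?B y \<partial>cube_measure n r) +
      (2 * r ^ 3 / 3 * (b n)\<^sup>2 * (\<integral>y. ?A y * ?A y \<partial>cube_measure n r) + (2 * r ^ 3 / 3 * (4 * a n * b n) * (\<integral>y. ?A y * ?B y \<partial>cube_measure n r) +
       (2 * r) ^ n * (2 * r ^ 5 / 5 * ((a n)\<^sup>2 * (b n)\<^sup>2)))))"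
  proof -
    have i: "integrable (cube_measure n r) (\<lambda>y. (?A y)\<^sup>2 * (?B y)\<^sup>2)" "integrable (cube_measure n r) (\<lambda>y. ?B y * ?B y)"
       "integrable (cube_measure n r) (\<lambda>y. ?A y * ?A y)" "integrable (cube_measure n r) (\<lambda>y. ?A y * ?B y)"
       "integrable (cube_measure n r) (\<lambda>y. c)" for c :: real
      by (intro C.bmeas_integrable bmeas_intros bmeas_cube_measure_ip)+
    show ?thesis
      by (simp only: Bochner_Integration.integral_add Bochner_Integration.integrable_add integrable_mult_right
           integral_mult_right_zero i lebesgue_integral_const space_cube_measure measure_cube_measure[OF r] real_scaleR_def, simp add: mult_ac)
  qed
  also have "\<dots> = (2 * r) ^ Suc n * r ^ 4 * ((ip (Suc n) a a * ip (Suc n) b b + 2 * (ip (Suc n) a b)\<^sup>2) / 9 -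
      2 / 15 * (\<Sum>i<Suc n. (a i)\<^sup>2 * (b i)\<^sup>2))"
  proof -
    define X Y Z Q N where "X = ip n a a" and "Y = ip n b b" and "Z = ip n a b"
      and "Q = (\<Sum>i<n. (a i)\<^sup>2 * (b i)\<^sup>2)" and "N = (2 * r) ^ n"
    have S: "ip (Suc n) a a = X + (a n)\<^sup>2" "ip (Suc n) b b = Y + (b n)\<^sup>2" "ip (Suc n) a b = Z + a n * b n"
      "(\<Sum>i<Suc n. (a i)\<^sup>2 * (b i)\<^sup>2) = Q + (a n)\<^sup>2 * (b n)\<^sup>2" "(2 * r) ^ Suc n = 2 * r * N"
      by (auto simp: X_def Y_def Z_def Q_def N_def ip_def power2_eq_square)
    show ?thesis
      unfolding Suc.IH cube_moment2[OF r] S X_def[symmetric] Y_def[symmetric] Z_def[symmetric] Q_def[symmetric] N_def[symmetric]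
      by (simp add: field_simps power2_eq_square eval_nat_numeral)
  qed
  finally show ?case .
qed

lemma sum_sq_sq_le:
  assumes "ip n a b = 0"
  shows "2 * (\<Sum>i<n. (a i)\<^sup>2 * (b i)\<^sup>2) \<le> ip n a a * ip n b b"
proof -
  have "4 * (\<Sum>i<n. (a i)\<^sup>2 * (b i)\<^sup>2) = (\<Sum>i<n. (a i * b i + a i * b i)\<^sup>2)"
    by (simp add: sum_distrib_left power2_eq_square algebra_simps)
  also have "\<dots> \<le> (\<Sum>i<n. \<Sum>j<n. (a i * b j + a j * b i)\<^sup>2)"
  proof (rule sum_mono)
    fix i assume "i \<in> {..<n}"
    then show "(a i * b i + a i * b i)\<^sup>2 \<le> (\<Sum>j<n. (a i * b j + a j * b i)\<^sup>2)"
      by (intro member_le_sum[where f = "\<lambda>j. (a i * b j + a j * b i)\<^sup>2"]) auto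
  qed
  also have "\<dots> = (\<Sum>i<n. \<Sum>j<n. (a i * a i) * (b j * b j)) + (\<Sum>i<n. \<Sum>j<n. (b i * b i) * (a j * a j)) +
      2 * (\<Sum>i<n. \<Sum>j<n. (a i * b i) * (a j * b j))"
    by (simp add: power2_eq_square algebra_simps sum.distrib sum_distrib_left)
  also have "\<dots> = 2 * (ip n a a * ip n b b) + 2 * (ip n a b)\<^sup>2"
    by (simp add: ip_def sum_product[symmetric] power2_eq_square)
  finally show ?thesis using assms by simp
qed

text \<open>
  The sum of \<open>(a i)\<^sup>2 * (b i)\<^sup>2\<close>, which the fourth moment of the cube
  contains in addition to the rotation invariant terms, is at most half the product of the squared
  norms if \<open>a\<close> and \<open>b\<close> are orthogonal (\<open>sum_sq_sq_le\<close>). The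
  remaining constant is \<open>1 / 9 - 1 / 15 = 2 / 45\<close>.
\<close>

lemma cube_moment4_ge:
  assumes r: "0 \<le> r" and o: "ip n a b = 0"
  shows "(2 * r) ^ n * r ^ 4 * (2 / 45) * (ip n a a * ip n b b) \<le> (\<integral>x. (ip n x a)\<^sup>2 * (ip n x b)\<^sup>2 \<partial>cube_measure n r)"
proof -
  have "(2 / 45) * (ip n a a * ip n b b) \<le> (ip n a a * ip n b b + 2 * (ip n a b)\<^sup>2) / 9 - 2 / 15 * (\<Sum>i<n. (a i)\<^sup>2 * (b i)\<^sup>2)"
    using sum_sq_sq_le[OF o] o by simp
  then have "(2 * r) ^ n * r ^ 4 * ((2 / 45) * (ip n a a * ip n b b)) \<le>
     (2 * r) ^ n * r ^ 4 * ((ip n a a * ip n b b + 2 * (ip n a b)\<^sup>2) / 9 - 2 / 15 * (\<Sum>i<n. (a i)\<^sup>2 * (b i)\<^sup>2))"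
    using r by (intro mult_left_mono) auto
  then show ?thesis unfolding cube_moment4[OF r] by (simp add: mult.assoc)
qed

context isotropic_measure
begin

lemma bmeas_pair_ip: "bmeas (\<mu> \<Otimes>\<^sub>M \<mu>) (\<lambda>p. ip n (fst p) (snd p))"
  unfolding ip_def
  by (intro bmeas_intros bmeas_pair1[OF bmeas_coord] bmeas_pair2[OF bmeas_coord]) auto

lemma var_mono:
  assumes f: "bmeas \<mu> f" and g: "bmeas \<mu> g"
    and le: "\<And>u v. u \<in> usphere n \<Longrightarrow> v \<in> usphere n \<Longrightarrow> (g u - g v)\<^sup>2 \<le> (f u - f v)\<^sup>2"
  shows "var g \<le> var f"
proof -
  have b: "bmeas (\<mu> \<Otimes>\<^sub>M \<mu>) (\<lambda>p. (h (fst p) - h (snd p))\<^sup>2 * (ip n (fst p) (snd p))\<^sup>2)" if h: "bmeas \<mu> h" for h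
    by (intro bmeas_intros bmeas_pair_ip bmeas_pair1 bmeas_pair2 h)
  have i: "integrable \<mu> (\<lambda>u. \<integral>v. (h u - h v)\<^sup>2 * (ip n u v)\<^sup>2 \<partial>\<mu>)" if h: "bmeas \<mu> h" for h
    by (intro bmeas_integrable bmeas_lebesgue_integral b h)
  have i': "integrable \<mu> (\<lambda>v. (h u - h v)\<^sup>2 * (ip n u v)\<^sup>2)" if h: "bmeas \<mu> h" for h u
    by (intro bmeas_integrable bmeas_mult bmeas_power bmeas_diff bmeas_const bmeas_ip h)
  have "2 * var g \<le> 2 * var f"
    unfolding var_double_integral[OF f] var_double_integral[OF g]
    by (intro integral_mono i i' f g mult_right_mono le) auto
  then show ?thesis by simp
qed

lemma ip_abs_le_1: "u \<in> usphere n \<Longrightarrow> v \<in> usphere n \<Longrightarrow> \<bar>ip n u v\<bar> \<le> 1"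
proof -
  assume u: "u \<in> usphere n" and v: "v \<in> usphere n"
  have "0 \<le> ip n (\<lambda>i. u i - v i) (\<lambda>i. u i - v i)" "0 \<le> ip n (\<lambda>i. u i + v i) (\<lambda>i. u i + v i)" by auto
  then show ?thesis
    by (auto simp: ip_minus_left ip_minus_right ip_plus_left ip_plus_right ip_usphere u v ip_commute[of n v u])
qed

text \<open>
  For unit vectors \<open>u\<close> and \<open>v\<close> the difference \<open>(ip n x u)\<^sup>2
  - (ip n x v)\<^sup>2\<close> factors into the inner products of \<open>x\<close> with the
  orthogonal vectors \<open>u - v\<close> and \<open>u + v\<close>, whose squared norms have
  product \<open>4 * (1 - (ip n u v)\<^sup>2)\<close>. So the average of its square is controlled
  by the fourth moment of the cube, and exchanging the integrals produces the defect.
\<close>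

lemma cube_average_var_ge:
  assumes r: "0 \<le> r"
  shows "(2 * r) ^ n * r ^ 4 * (4 / 45) * defect \<le> (\<integral>x. var (\<lambda>u. (ip n x u)\<^sup>2) \<partial>cube_measure n r)"
proof -
  let ?C = "cube_measure n r"
  let ?G = "\<lambda>x u v. ((ip n x u)\<^sup>2 - (ip n x v)\<^sup>2)\<^sup>2 * (ip n u v)\<^sup>2"
  interpret C: finite_measure ?C by (rule finite_cube_measure[OF r])
  have b1: "bmeas (?C \<Otimes>\<^sub>M (\<mu> \<Otimes>\<^sub>M \<mu>)) (\<lambda>p. ?G (fst p) (fst (snd p)) (snd (snd p)))"
    unfolding ip_def
    by (intro bmeas_intros bmeas_pair1[OF bmeas_cube_measure_coord] bmeas_pair2[OF bmeas_pair1[OF bmeas_coord]] bmeas_pair2[OF bmeas_pair2[OF bmeas_coord]]) auto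
  have b2: "bmeas ((?C \<Otimes>\<^sub>M \<mu>) \<Otimes>\<^sub>M \<mu>) (\<lambda>p. ?G (fst (fst p)) (snd (fst p)) (snd p))"
    unfolding ip_def
    by (intro bmeas_intros bmeas_pair1[OF bmeas_pair1[OF bmeas_cube_measure_coord]] bmeas_pair1[OF bmeas_pair2[OF bmeas_coord]] bmeas_pair2[OF bmeas_coord]) auto
  have b3: "bmeas ((\<mu> \<Otimes>\<^sub>M \<mu>) \<Otimes>\<^sub>M ?C) (\<lambda>p. ?G (snd p) (fst (fst p)) (snd (fst p)))"
    unfolding ip_def
    by (intro bmeas_intros bmeas_pair2[OF bmeas_cube_measure_coord] bmeas_pair1[OF bmeas_pair1[OF bmeas_coord]] bmeas_pair1[OF bmeas_pair2[OF bmeas_coord]]) auto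
  have b4: "bmeas (?C \<Otimes>\<^sub>M \<mu>) (\<lambda>p. ?G (fst p) u (snd p))" for u
    unfolding ip_def
    by (intro bmeas_intros bmeas_pair1[OF bmeas_cube_measure_coord] bmeas_pair2[OF bmeas_coord]) auto
  have "2 * (\<integral>x. var (\<lambda>u. (ip n x u)\<^sup>2) \<partial>?C) = (\<integral>x. 2 * var (\<lambda>u. (ip n x u)\<^sup>2) \<partial>?C)" by simp
  also have "\<dots> = (\<integral>x. (\<integral>u. (\<integral>v. ?G x u v \<partial>\<mu>) \<partial>\<mu>) \<partial>?C)"
    by (subst var_double_integral) (auto intro: bmeas_power bmeas_ip)
  also have "\<dots> = (\<integral>u. (\<integral>x. (\<integral>v. ?G x u v \<partial>\<mu>) \<partial>?C) \<partial>\<mu>)"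
    by (rule bmeas_Fubini[OF finite_cube_measure[OF r] finite_mu], rule bmeas_lebesgue_integral[where G = "\<lambda>p v. ?G (fst p) (snd p) v"], rule b2)
  also have "\<dots> = (\<integral>u. (\<integral>v. (\<integral>x. ?G x u v \<partial>?C) \<partial>\<mu>) \<partial>\<mu>)"
    by (rule Bochner_Integration.integral_cong[OF refl], rule bmeas_Fubini[OF finite_cube_measure[OF r] finite_mu], rule b4)
  finally have eq: "2 * (\<integral>x. var (\<lambda>u. (ip n x u)\<^sup>2) \<partial>?C) = (\<integral>u. (\<integral>v. (\<integral>x. ?G x u v \<partial>?C) \<partial>\<mu>) \<partial>\<mu>)" .
  define K where "K = (2 * r) ^ n * r ^ 4 * (8 / 45)"
  have pt: "K * ((ip n u v)\<^sup>2 * (1 - (ip n u v)\<^sup>2)) \<le> (\<integral>x. ?G x u v \<partial>?C)"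
    if u: "u \<in> usphere n" and v: "v \<in> usphere n" for u v
  proof -
    \<comment> \<open>\<open>u - v\<close> and \<open>u + v\<close> are orthogonal because \<open>u\<close> and \<open>v\<close> have the same norm\<close>
    let ?a = "\<lambda>i. u i - v i" and ?b = "\<lambda>i. u i + v i"
    have o: "ip n ?a ?b = 0"
      by (simp add: ip_minus_left ip_plus_right ip_usphere u v ip_commute[of n v u])
    have ab: "ip n ?a ?a * ip n ?b ?b = 4 * (1 - (ip n u v)\<^sup>2)"
      by (simp add: ip_minus_left ip_minus_right ip_plus_left ip_plus_right ip_usphere u v ip_commute[of n v u] algebra_simps power2_eq_square)
    have "?G x u v = ((ip n x ?a)\<^sup>2 * (ip n x ?b)\<^sup>2) * (ip n u v)\<^sup>2" for x
      by (simp add: ip_minus_right ip_plus_right power2_eq_square algebra_simps)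
    then have G: "(\<integral>x. ?G x u v \<partial>?C) = (\<integral>x. (ip n x ?a)\<^sup>2 * (ip n x ?b)\<^sup>2 \<partial>?C) * (ip n u v)\<^sup>2"
      by (simp only: integral_mult_left_zero)
    have "K * (1 - (ip n u v)\<^sup>2) \<le> (\<integral>x. (ip n x ?a)\<^sup>2 * (ip n x ?b)\<^sup>2 \<partial>?C)"
      using cube_moment4_ge[OF r o] unfolding ab K_def by (simp add: algebra_simps)
    from mult_right_mono[OF this, of "(ip n u v)\<^sup>2"] show ?thesis
      unfolding G by (simp add: mult_ac)
  qed
  have bd: "bmeas (\<mu> \<Otimes>\<^sub>M \<mu>) (\<lambda>p. K * ((ip n (fst p) (snd p))\<^sup>2 * (1 - (ip n (fst p) (snd p))\<^sup>2)))"
    by (intro bmeas_intros bmeas_pair_ip)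
  have bx: "bmeas (\<mu> \<Otimes>\<^sub>M \<mu>) (\<lambda>p. \<integral>x. ?G x (fst p) (snd p) \<partial>?C)"
    by (rule C.bmeas_lebesgue_integral[where G = "\<lambda>p x. ?G x (fst p) (snd p)"]) (rule b3)
  have bx': "bmeas \<mu> (\<lambda>v. \<integral>x. ?G x u v \<partial>?C)" for u
  proof (rule C.bmeas_lebesgue_integral)
    show "bmeas (\<mu> \<Otimes>\<^sub>M ?C) (\<lambda>p. ?G (snd p) u (fst p))"
      unfolding ip_def
      by (intro bmeas_intros bmeas_pair2[OF bmeas_cube_measure_coord] bmeas_pair1[OF bmeas_coord]) auto
  qed
  have "K * defect = (\<integral>u. (\<integral>v. K * ((ip n u v)\<^sup>2 * (1 - (ip n u v)\<^sup>2)) \<partial>\<mu>) \<partial>\<mu>)"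
    by (simp add: defect_def)
  also have "\<dots> \<le> (\<integral>u. (\<integral>v. (\<integral>x. ?G x u v \<partial>?C) \<partial>\<mu>) \<partial>\<mu>)"
  proof (rule integral_mono)
    show "integrable \<mu> (\<lambda>u. \<integral>v. K * ((ip n u v)\<^sup>2 * (1 - (ip n u v)\<^sup>2)) \<partial>\<mu>)"
      by (rule bmeas_integrable[OF bmeas_lebesgue_integral[OF bd]])
    show "integrable \<mu> (\<lambda>u. \<integral>v. (\<integral>x. ?G x u v \<partial>?C) \<partial>\<mu>)"
      by (rule bmeas_integrable[OF bmeas_lebesgue_integral[OF bx]])
    fix u assume u: "u \<in> space \<mu>"
    show "(\<integral>v. K * ((ip n u v)\<^sup>2 * (1 - (ip n u v)\<^sup>2)) \<partial>\<mu>) \<le> (\<integral>v. (\<integral>x. ?G x u v \<partial>?C) \<partial>\<mu>)"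
    proof (rule integral_mono)
      show "integrable \<mu> (\<lambda>v. K * ((ip n u v)\<^sup>2 * (1 - (ip n u v)\<^sup>2)))"
        by (intro bmeas_integrable bmeas_intros bmeas_ip)
      show "integrable \<mu> (\<lambda>v. \<integral>x. ?G x u v \<partial>?C)" by (rule bmeas_integrable[OF bx'])
    qed (use u pt in auto)
  qed
  finally show ?thesis using eq by (simp add: K_def)
qed

end

section \<open>The transport map of an isotropic measure\<close>

lemma ip_cauchy_schwarz: "(ip n x y)\<^sup>2 \<le> ip n x x * ip n y y"
  using Cauchy_Schwarz_ineq_sum[of x y "{..<n}"] by (simp add: ip_def power2_eq_square)

lemma positive_lower_bound:
  fixes t :: "real \<Rightarrow> real"
  assumes t: "continuous_on UNIV t" "\<And>s. 0 < t s" and R: "0 \<le> R"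
  obtains m0 where "0 < m0" "\<And>s. \<bar>s\<bar> \<le> R \<Longrightarrow> m0 \<le> t s"
proof -
  have ct: "continuous_on {-R..R} t" using t(1) continuous_on_subset by blast
  have ne: "{-R..R} \<noteq> {}" using R by simp
  obtain a where a: "a \<in> {-R..R}" "\<forall>s\<in>{-R..R}. t a \<le> t s"
    using continuous_attains_inf[OF compact_Icc ne ct] by blast
  show ?thesis
    by (rule that[of "t a"]) (use a t(2) in \<open>auto simp: abs_le_iff\<close>)
qed

lemma DERIV_continuous_on_UNIV:
  "(\<And>s. (T has_real_derivative t s) (at s)) \<Longrightarrow> continuous_on UNIV (T :: real \<Rightarrow> real)"
  by (auto intro!: continuous_at_imp_continuous_on DERIV_isCont)

lemma mean_value_unordered:
  fixes T :: "real \<Rightarrow> real"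
  assumes T: "\<And>s. (T has_real_derivative t s) (at s)" and "\<bar>a\<bar> \<le> R" "\<bar>b\<bar> \<le> R"
  obtains \<xi> where "T b - T a = t \<xi> * (b - a)" "\<bar>\<xi>\<bar> \<le> R" "\<bar>\<xi> - a\<bar> \<le> \<bar>b - a\<bar>"
proof (cases a b rule: linorder_cases)
  case less
  from MVT2[OF less, of T t] T obtain z where z: "a < z" "z < b" "T b - T a = (b - a) * t z" by auto
  show ?thesis by (rule that[of z]) (use z assms(2,3) less in \<open>auto simp: mult.commute\<close>)
next
  case equal
  then show ?thesis by (intro that[of a]) (use assms in auto)
next
  case greater
  from MVT2[OF greater, of T t] T obtain z where z: "b < z" "z < a" "T a - T b = (a - b) * t z" by auto
  show ?thesis by (rule that[of z]) (use z assms(2,3) greater in \<open>auto simp: algebra_simps\<close>)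
qed

context isotropic_measure
begin

lemma ip_le_radius:
  assumes "ip n x x \<le> R\<^sup>2" "0 \<le> R" "u \<in> usphere n"
  shows "\<bar>ip n x u\<bar> \<le> R"
proof -
  have "(ip n x u)\<^sup>2 \<le> R\<^sup>2"
    using ip_cauchy_schwarz[of n x u] assms(1) ip_usphere[OF assms(3)] by simp
  then show ?thesis using assms(2) by (simp add: abs_le_square_iff[symmetric])
qed

text \<open>
  The transport map induced by \<open>T\<close>.
\<close>

definition Fm :: "(real \<Rightarrow> real) \<Rightarrow> rvec \<Rightarrow> rvec" where
  "Fm T x = (\<lambda>i\<in>{..<n}. \<integral>u. T (ip n x u) * u i \<partial>\<mu>)"

text \<open>
  The Jacobian matrix of \<open>Fm T\<close> at \<open>x\<close> if \<open>t\<close> is the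
  derivative of \<open>T\<close>.
\<close>

definition Am :: "(real \<Rightarrow> real) \<Rightarrow> rvec \<Rightarrow> nat \<Rightarrow> nat \<Rightarrow> real" where
  "Am t x i j = (\<integral>u. t (ip n x u) * (u i * u j) \<partial>\<mu>)"

lemma bmeas_cont_ip:
  assumes f: "continuous_on UNIV (f :: real \<Rightarrow> real)"
  shows "bmeas \<mu> (\<lambda>u. f (ip n x u))"
proof -
  define R where "R = sqrt (ip n x x)"
  have R: "0 \<le> R" "ip n x x \<le> R\<^sup>2" by (auto simp: R_def)
  have "compact (f ` {-R..R})"
    by (rule compact_continuous_image) (use f continuous_on_subset in auto)
  then obtain C where C: "\<And>y. y \<in> f ` {-R..R} \<Longrightarrow> \<bar>y\<bar> \<le> C"
    using compact_imp_bounded bounded_iff by (metis real_norm_def)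
  show ?thesis
  proof (rule bmeasI)
    show "(\<lambda>u. f (ip n x u)) \<in> borel_measurable \<mu>"
      using borel_measurable_continuous_on[OF f bmeas_meas[OF bmeas_ip(1)]] .
    fix u assume "u \<in> space \<mu>"
    then have "\<bar>ip n x u\<bar> \<le> R" using ip_le_radius[OF R(2) R(1)] by simp
    then have "ip n x u \<in> {-R..R}" by (simp add: abs_le_iff)
    then show "\<bar>f (ip n x u)\<bar> \<le> C" using C by blast
  qed
qed

lemma Fm_in_Rn [simp]: "Fm T x \<in> Rn n"
  by (simp add: Fm_def)

lemma Fm_measurable:
  assumes T: "continuous_on UNIV T"
  shows "Fm T \<in> measurable (Leb n) (Leb n)"
  unfolding Fm_def
proof (rule lam_measurable)
  fix i assume i: "i < n"
  have [measurable]: "T \<in> borel_measurable borel" by (rule borel_measurable_continuous_onI[OF T])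
  show "(\<lambda>x. \<integral>u. T (ip n x u) * u i \<partial>\<mu>) \<in> borel_measurable (Leb n)"
    unfolding ip_def using i
    by (intro borel_measurable_lebesgue_integral) (unfold case_prod_beta, measurable)
qed

lemma Am_measurable:
  assumes t: "continuous_on UNIV t" and ij: "i < n" "j < n"
  shows "(\<lambda>x. Am t x i j) \<in> borel_measurable (Leb n)"
proof -
  have [measurable]: "t \<in> borel_measurable borel" by (rule borel_measurable_continuous_onI[OF t])
  show ?thesis
    unfolding Am_def ip_def using ij
    by (intro borel_measurable_lebesgue_integral) (unfold case_prod_beta, measurable)
qed

lemma dt_Am_measurable:
  assumes t: "continuous_on UNIV t"
  shows "(\<lambda>x. dt n (Am t x)) \<in> borel_measurable (Leb n)"
  unfolding dt_def
  by (intro borel_measurable_sum borel_measurable_times borel_measurable_const borel_measurable_prod Am_measurable[OF t])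
     (auto simp: permutes_in_image[of _ "{..<n}", unfolded lessThan_iff])

lemma Am_tuple:
  assumes t: "continuous_on UNIV t"
  shows "dt n (Am t x) = (\<integral>W. rho W * (\<Prod>i<n. t (ip n x (W i))) \<partial>PW)"
  using det_tuple[OF bmeas_cont_ip[OF t]] by (simp add: Am_def[abs_def])

lemma bmeas_tuple_t:
  assumes t: "continuous_on UNIV t"
  shows "bmeas PW (\<lambda>W. rho W * (\<Prod>i<n. t (ip n x (W i))))"
  by (intro bmeas_mult bmeas_rho bmeas_prod bmeas_PW bmeas_cont_ip t) auto

text \<open>
  Since the quadratic form of a leading block is that of the whole matrix at a vector padded with
  zeros, all leading blocks inherit the lower bound from isotropy.
\<close>

lemma Am_quadratic_form:
  assumes t: "continuous_on UNIV t"
    and m: "\<And>u. u \<in> usphere n \<Longrightarrow> m0 \<le> t (ip n x u)" and k: "k \<le> n"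
  shows "m0 * (\<Sum>i<k. (y i)\<^sup>2) \<le> (\<Sum>i<k. \<Sum>j<k. y i * Am t x i j * y j)"
proof -
  have b: "bmeas \<mu> (\<lambda>u. t (ip n x u))" by (rule bmeas_cont_ip[OF t])
  define z where "z i = (if i < k then y i else 0)" for i
  have sz: "(\<Sum>i<k. y i * u i) = ip n z u" for u :: rvec
  proof -
    have "ip n z u = (\<Sum>i<k. z i * u i)"
      unfolding ip_def using k by (intro sum.mono_neutral_right) (auto simp: z_def)
    then show ?thesis by (simp add: z_def)
  qed
  have "(\<Sum>i<k. \<Sum>j<k. y i * Am t x i j * y j) = (\<Sum>i<k. \<Sum>j<k. \<integral>u. t (ip n x u) * ((y i * u i) * (y j * u j)) \<partial>\<mu>)"
  proof (intro sum.cong refl)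
    fix i j
    have "y i * Am t x i j * y j = (\<integral>u. (y i * y j) * (t (ip n x u) * (u i * u j)) \<partial>\<mu>)"
      by (simp add: Am_def)
    also have "\<dots> = (\<integral>u. t (ip n x u) * ((y i * u i) * (y j * u j)) \<partial>\<mu>)" by (simp add: mult_ac)
    finally show "y i * Am t x i j * y j = \<dots>" .
  qed
  also have "\<dots> = (\<Sum>i<k. \<integral>u. (\<Sum>j<k. t (ip n x u) * ((y i * u i) * (y j * u j))) \<partial>\<mu>)"
    by (rule sum.cong[OF refl], rule Bochner_Integration.integral_sum[symmetric], intro bmeas_integrable bmeas_intros b bmeas_coord) (use k in auto)
  also have "\<dots> = (\<integral>u. (\<Sum>i<k. \<Sum>j<k. t (ip n x u) * ((y i * u i) * (y j * u j))) \<partial>\<mu>)"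
    by (rule Bochner_Integration.integral_sum[symmetric], intro bmeas_integrable bmeas_intros b bmeas_coord) (use k in auto)
  also have "\<dots> = (\<integral>u. t (ip n x u) * (ip n z u)\<^sup>2 \<partial>\<mu>)"
    by (simp add: sum_distrib_left[symmetric] sum_distrib_right[symmetric] sz power2_eq_square)
  finally have 1: "(\<Sum>i<k. \<Sum>j<k. y i * Am t x i j * y j) = (\<integral>u. t (ip n x u) * (ip n z u)\<^sup>2 \<partial>\<mu>)" .
  have "m0 * ip n z z = (\<integral>u. m0 * (ip n z u)\<^sup>2 \<partial>\<mu>)" by (simp add: integral_ip_sq_one)
  also have "\<dots> \<le> (\<integral>u. t (ip n x u) * (ip n z u)\<^sup>2 \<partial>\<mu>)"
    by (rule integral_mono) (use m in \<open>auto intro!: bmeas_integrable bmeas_mult bmeas_const bmeas_power bmeas_ip b mult_right_mono\<close>)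
  also have "ip n z z = (\<Sum>i<k. (y i)\<^sup>2)"
    using sz[of z] by (simp add: z_def power2_eq_square)
  finally show ?thesis using 1 by simp
qed

lemma Am_minors_nonzero:
  assumes t: "continuous_on UNIV t" "\<And>s. 0 < t s" and k: "k \<le> n"
  shows "dt k (Am t x) \<noteq> 0"
proof (rule dt_nonzero_if_no_kernel)
  fix y assume z: "(\<Sum>i<k. \<Sum>j<k. y i * Am t x i j * y j) = 0"
  define R where "R = sqrt (ip n x x)"
  have R: "0 \<le> R" "ip n x x \<le> R\<^sup>2" by (auto simp: R_def)
  obtain m0 where m0: "0 < m0" "\<And>s. \<bar>s\<bar> \<le> R \<Longrightarrow> m0 \<le> t s" using positive_lower_bound[OF t R(1)] by metis
  have "m0 * (\<Sum>i<k. (y i)\<^sup>2) \<le> 0"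
    using Am_quadratic_form[OF t(1) m0(2) k, of x y] ip_le_radius[OF R(2,1)] z by auto
  then have "(\<Sum>i<k. (y i)\<^sup>2) \<le> 0" using m0(1) by (simp add: mult_le_0_iff)
  moreover have "0 \<le> (\<Sum>i<k. (y i)\<^sup>2)" by (intro sum_nonneg) auto
  ultimately have "(\<Sum>i<k. (y i)\<^sup>2) = 0" by linarith
  then show "\<forall>i<k. y i = 0" by (subst (asm) sum_nonneg_eq_0_iff) auto
qed

lemma dt_Am_pos:
  assumes t: "continuous_on UNIV t" "\<And>s. 0 < t s"
  shows "0 < dt n (Am t x)"
proof -
  have "0 \<le> dt n (Am t x)"
    unfolding Am_tuple[OF t(1)]
    by (intro Bochner_Integration.integral_nonneg mult_nonneg_nonneg rho_nonneg prod_nonneg) (auto intro: less_imp_le t)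
  then show ?thesis using Am_minors_nonzero[OF t, of n x] by simp
qed

text \<open>
  In the tuple representation of the determinant, the integrand is monotone in \<open>t\<close>.
\<close>

lemma dt_Am_mono:
  assumes t: "continuous_on UNIV t" "\<And>s. 0 < t s" and c: "0 \<le> c"
    and le: "\<And>u. u \<in> usphere n \<Longrightarrow> t (ip n x u) \<le> c * t (ip n y u)"
  shows "dt n (Am t x) \<le> c ^ n * dt n (Am t y)"
proof -
  have "dt n (Am t x) \<le> (\<integral>W. c ^ n * (rho W * (\<Prod>i<n. t (ip n y (W i)))) \<partial>PW)"
    unfolding Am_tuple[OF t(1)]
  proof (rule integral_mono)
    show "integrable PW (\<lambda>W. rho W * (\<Prod>i<n. t (ip n x (W i))))"
      by (intro fPW.bmeas_integrable bmeas_tuple_t t)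
    show "integrable PW (\<lambda>W. c ^ n * (rho W * (\<Prod>i<n. t (ip n y (W i)))))"
      by (intro fPW.bmeas_integrable bmeas_mult[OF bmeas_const] bmeas_tuple_t t)
    fix W assume W: "W \<in> space PW"
    have "(\<Prod>i<n. t (ip n x (W i))) \<le> (\<Prod>i<n. c * t (ip n y (W i)))"
      by (intro prod_mono) (use W in \<open>auto intro!: le space_PW_D less_imp_le[OF t(2)]\<close>)
    then have "rho W * (\<Prod>i<n. t (ip n x (W i))) \<le> rho W * (c ^ n * (\<Prod>i<n. t (ip n y (W i))))"
      by (intro mult_left_mono rho_nonneg) (simp add: prod.distrib)
    then show "rho W * (\<Prod>i<n. t (ip n x (W i))) \<le> c ^ n * (rho W * (\<Prod>i<n. t (ip n y (W i))))"
      by (simp add: mult_ac)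
  qed
  then show ?thesis by (simp add: Am_tuple[OF t(1)])
qed

lemma emeasure_preimage_box:
  assumes t: "continuous_on UNIV t" "\<And>s. 0 < t s" and ab: "\<And>i. i < n \<Longrightarrow> a i \<le> b i"
  shows "ennreal (dt n (Am t x)) * emeasure (Leb n) {y \<in> Rn n. \<forall>i<n. mat_app n (Am t x) y i \<in> {a i..b i}} =
    ennreal (\<Prod>i<n. b i - a i)"
proof -
  let ?B = "Pi\<^sub>E {..<n} (\<lambda>i. {a i..b i})"
  have "ennreal \<bar>dt n (Am t x)\<bar> * (\<integral>\<^sup>+y. indicator ?B (mat_app n (Am t x) y) \<partial>Leb n) = (\<integral>\<^sup>+y. indicator ?B y \<partial>Leb n)"
    by (rule nn_integral_linear) (use Am_minors_nonzero[OF t] in auto)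
  also have "\<dots> = ennreal (\<Prod>i<n. b i - a i)"
    using emeasure_box[OF ab] by simp
  also have "(\<integral>\<^sup>+y. indicator ?B (mat_app n (Am t x) y) \<partial>Leb n) =
    (\<integral>\<^sup>+y. indicator {y \<in> space (Leb n). mat_app n (Am t x) y \<in> ?B} y \<partial>Leb n)"
    by (intro nn_integral_cong) (auto simp: indicator_def)
  also have "\<dots> = emeasure (Leb n) {y \<in> space (Leb n). mat_app n (Am t x) y \<in> ?B}"
    by (rule nn_integral_indicator) measurable
  also have "{y \<in> space (Leb n). mat_app n (Am t x) y \<in> ?B} = {y \<in> Rn n. \<forall>i<n. mat_app n (Am t x) y i \<in> {a i..b i}}"
    by (auto simp: PiE_iff mat_app_def)
  finally show ?thesis using dt_Am_pos[OF t, of x] by simp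
qed

lemma Fm_diff:
  assumes T: "continuous_on UNIV T" and i: "i < n"
  shows "Fm T x i - Fm T y i = (\<integral>u. (T (ip n x u) - T (ip n y u)) * u i \<partial>\<mu>)"
proof -
  have "(\<integral>u. T (ip n x u) * u i - T (ip n y u) * u i \<partial>\<mu>) = (\<integral>u. T (ip n x u) * u i \<partial>\<mu>) - (\<integral>u. T (ip n y u) * u i \<partial>\<mu>)"
    by (rule Bochner_Integration.integral_diff; intro bmeas_integrable bmeas_mult bmeas_cont_ip[OF T] bmeas_coord i)
  then show ?thesis using i by (simp add: Fm_def algebra_simps)
qed

text \<open>
  By the mean value theorem the inner product of \<open>x - y\<close> with the difference of the
  values is at least \<open>m0\<close> times the squared distance. Consequently the preimage of a
  small cube under \<open>Fm T\<close> is small.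
\<close>

lemma Fm_strongly_monotone:
  fixes h :: real
  assumes T: "\<And>s. (T has_real_derivative t s) (at s)"
    and m0: "0 < m0" "\<And>s. \<bar>s\<bar> \<le> R \<Longrightarrow> m0 \<le> t s" and R: "0 \<le> R"
    and x: "ip n x x \<le> R\<^sup>2" and y: "ip n y y \<le> R\<^sup>2"
    and h: "\<And>i. i < n \<Longrightarrow> \<bar>Fm T x i - Fm T y i\<bar> \<le> h"
  shows "m0\<^sup>2 * ip n (\<lambda>i. x i - y i) (\<lambda>i. x i - y i) \<le> n * h\<^sup>2"
proof -
  have cT: "continuous_on UNIV T" by (rule DERIV_continuous_on_UNIV[OF T])
  let ?d = "\<lambda>i. x i - y i"
  have "m0 * ip n ?d ?d = (\<integral>u. m0 * (ip n ?d u)\<^sup>2 \<partial>\<mu>)" by (simp add: integral_ip_sq_one)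
  also have "\<dots> \<le> (\<integral>u. (T (ip n x u) - T (ip n y u)) * ip n ?d u \<partial>\<mu>)"
  proof (rule integral_mono)
    show "integrable \<mu> (\<lambda>u. m0 * (ip n ?d u)\<^sup>2)" by (intro bmeas_integrable bmeas_intros bmeas_ip)
    show "integrable \<mu> (\<lambda>u. (T (ip n x u) - T (ip n y u)) * ip n ?d u)"
      by (intro bmeas_integrable bmeas_mult bmeas_diff bmeas_cont_ip[OF cT] bmeas_ip)
    fix u assume "u \<in> space \<mu>"
    then have u: "\<bar>ip n y u\<bar> \<le> R" "\<bar>ip n x u\<bar> \<le> R" using ip_le_radius[OF x R] ip_le_radius[OF y R] by auto
    obtain \<xi> where xi: "T (ip n x u) - T (ip n y u) = t \<xi> * (ip n x u - ip n y u)" "\<bar>\<xi>\<bar> \<le> R"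
      using mean_value_unordered[OF T u] by metis
    have "m0 * (ip n ?d u)\<^sup>2 \<le> t \<xi> * (ip n ?d u)\<^sup>2" by (intro mult_right_mono m0 xi) auto
    also have "\<dots> = (T (ip n x u) - T (ip n y u)) * ip n ?d u"
      by (simp add: xi(1) ip_minus_left power2_eq_square)
    finally show "m0 * (ip n ?d u)\<^sup>2 \<le> (T (ip n x u) - T (ip n y u)) * ip n ?d u" .
  qed
  also have "\<dots> = (\<integral>u. (\<Sum>i<n. ?d i * ((T (ip n x u) - T (ip n y u)) * u i)) \<partial>\<mu>)"
    unfolding ip_def[of n ?d] by (simp add: sum_distrib_left mult_ac)
  also have "\<dots> = (\<Sum>i<n. \<integral>u. ?d i * ((T (ip n x u) - T (ip n y u)) * u i) \<partial>\<mu>)"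
    by (rule Bochner_Integration.integral_sum, intro bmeas_integrable bmeas_mult[OF bmeas_const] bmeas_mult bmeas_diff bmeas_cont_ip[OF cT] bmeas_coord) auto
  also have "\<dots> = (\<Sum>i<n. ?d i * (Fm T x i - Fm T y i))"
    by (intro sum.cong refl) (simp add: Fm_diff[OF cT])
  also have "\<dots> \<le> (\<Sum>i<n. m0 / 2 * (?d i)\<^sup>2 + h\<^sup>2 / (2 * m0))"
  proof (rule sum_mono)
    fix i assume "i \<in> {..<n}"
    then have "\<bar>Fm T x i - Fm T y i\<bar> \<le> h" using h by simp
    then have h2: "(Fm T x i - Fm T y i)\<^sup>2 \<le> h\<^sup>2"
      using power_mono[of "\<bar>Fm T x i - Fm T y i\<bar>" h 2] by simp
    have "0 \<le> (m0 * ?d i - (Fm T x i - Fm T y i))\<^sup>2" by simp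
    then have "2 * m0 * (?d i * (Fm T x i - Fm T y i)) \<le> m0\<^sup>2 * (?d i)\<^sup>2 + (Fm T x i - Fm T y i)\<^sup>2"
      by (simp add: power2_eq_square algebra_simps)
    also have "\<dots> \<le> m0\<^sup>2 * (?d i)\<^sup>2 + h\<^sup>2" using h2 by simp
    finally show "?d i * (Fm T x i - Fm T y i) \<le> m0 / 2 * (?d i)\<^sup>2 + h\<^sup>2 / (2 * m0)"
      using m0(1) by (simp add: field_simps power2_eq_square)
  qed
  also have "\<dots> = m0 / 2 * ip n ?d ?d + n * h\<^sup>2 / (2 * m0)"
    by (simp add: sum.distrib ip_def power2_eq_square sum_distrib_left)
  finally have "m0 * ip n ?d ?d \<le> (m0 * ip n ?d ?d) / 2 + n * h\<^sup>2 / (2 * m0)" by simp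
  then have "m0 * ip n ?d ?d \<le> 2 * (n * h\<^sup>2 / (2 * m0))" by linarith
  then have "m0 * ip n ?d ?d \<le> n * h\<^sup>2 / m0" by simp
  then show ?thesis using m0(1) by (simp add: field_simps power2_eq_square)
qed

lemma Fm_linear_approx:
  fixes \<delta> \<theta> :: real
  assumes T: "\<And>s. (T has_real_derivative t s) (at s)" and t: "continuous_on UNIV t"
    and uc: "\<And>s s'. \<bar>s\<bar> \<le> R \<Longrightarrow> \<bar>s'\<bar> \<le> R \<Longrightarrow> \<bar>s - s'\<bar> \<le> \<eta> \<Longrightarrow> \<bar>t s - t s'\<bar> \<le> \<delta>" and R: "0 \<le> R"
    and x: "ip n x x \<le> R\<^sup>2" and y: "ip n y y \<le> R\<^sup>2"
    and d: "ip n (\<lambda>i. x i - y i) (\<lambda>i. x i - y i) \<le> \<theta>\<^sup>2" "0 \<le> \<theta>" "\<theta> \<le> \<eta>" and i: "i < n"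
  shows "\<bar>Fm T x i - Fm T y i - (mat_app n (Am t y) x i - mat_app n (Am t y) y i)\<bar> \<le> n * (\<delta> * \<theta>)"
proof -
  have cT: "continuous_on UNIV T" by (rule DERIV_continuous_on_UNIV[OF T])
  let ?d = "\<lambda>i. x i - y i"
  have "mat_app n (Am t y) x i - mat_app n (Am t y) y i = (\<Sum>j<n. \<integral>u. ?d j * (t (ip n y u) * (u i * u j)) \<partial>\<mu>)"
  proof -
    have "mat_app n (Am t y) x i - mat_app n (Am t y) y i = (\<Sum>j<n. ?d j * Am t y i j)"
      using i by (simp add: mat_app_def sum_subtractf[symmetric] right_diff_distrib left_diff_distrib mult.commute)
    then show ?thesis by (simp add: Am_def)
  qed
  also have "\<dots> = (\<integral>u. (\<Sum>j<n. ?d j * (t (ip n y u) * (u i * u j))) \<partial>\<mu>)"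
    by (rule Bochner_Integration.integral_sum[symmetric], intro bmeas_integrable bmeas_mult[OF bmeas_const] bmeas_mult bmeas_cont_ip[OF t] bmeas_coord) (use i in auto)
  also have "\<dots> = (\<integral>u. t (ip n y u) * ip n ?d u * u i \<partial>\<mu>)"
    unfolding ip_def[of n ?d] by (simp add: sum_distrib_left sum_distrib_right mult_ac)
  finally have 1: "mat_app n (Am t y) x i - mat_app n (Am t y) y i = (\<integral>u. t (ip n y u) * ip n ?d u * u i \<partial>\<mu>)" .
  have 2: "Fm T x i - Fm T y i - (mat_app n (Am t y) x i - mat_app n (Am t y) y i) =
      (\<integral>u. (T (ip n x u) - T (ip n y u)) * u i - t (ip n y u) * ip n ?d u * u i \<partial>\<mu>)"
    unfolding 1 Fm_diff[OF cT i]
    by (rule Bochner_Integration.integral_diff[symmetric]; intro bmeas_integrable bmeas_mult bmeas_diff bmeas_cont_ip[OF cT] bmeas_cont_ip[OF t] bmeas_coord[OF i] bmeas_ip)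
  have "\<bar>Fm T x i - Fm T y i - (mat_app n (Am t y) x i - mat_app n (Am t y) y i)\<bar> \<le>
      (\<integral>u. \<bar>(T (ip n x u) - T (ip n y u)) * u i - t (ip n y u) * ip n ?d u * u i\<bar> \<partial>\<mu>)"
    unfolding 2 by (rule integral_abs_bound)
  also have "\<dots> \<le> (\<integral>u. \<delta> * \<theta> \<partial>\<mu>)"
  proof (rule integral_mono)
    show "integrable \<mu> (\<lambda>u. \<bar>(T (ip n x u) - T (ip n y u)) * u i - t (ip n y u) * ip n ?d u * u i\<bar>)"
      by (intro integrable_abs bmeas_integrable bmeas_mult bmeas_diff bmeas_cont_ip[OF cT] bmeas_cont_ip[OF t] bmeas_coord[OF i] bmeas_ip)
    show "integrable \<mu> (\<lambda>u. \<delta> * \<theta>)" by simp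
    fix u assume "u \<in> space \<mu>"
    then have us: "u \<in> usphere n" by simp
    have u: "\<bar>ip n y u\<bar> \<le> R" "\<bar>ip n x u\<bar> \<le> R" using ip_le_radius[OF x R us] ip_le_radius[OF y R us] by auto
    obtain \<xi> where xi: "T (ip n x u) - T (ip n y u) = t \<xi> * (ip n x u - ip n y u)" "\<bar>\<xi>\<bar> \<le> R"
       "\<bar>\<xi> - ip n y u\<bar> \<le> \<bar>ip n x u - ip n y u\<bar>"
      using mean_value_unordered[OF T u] by metis
    have du: "\<bar>ip n ?d u\<bar> \<le> \<theta>" by (rule ip_le_radius[OF d(1,2) us])
    have "\<bar>\<xi> - ip n y u\<bar> \<le> \<eta>" using xi(3) du d(3) by (simp add: ip_minus_left)
    then have dt: "\<bar>t \<xi> - t (ip n y u)\<bar> \<le> \<delta>" using uc[OF xi(2) u(1)] by simp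
    have "(T (ip n x u) - T (ip n y u)) * u i - t (ip n y u) * ip n ?d u * u i =
        ((t \<xi> - t (ip n y u)) * ip n ?d u) * u i"
      by (simp add: xi(1) ip_minus_left algebra_simps)
    also have "\<bar>\<dots>\<bar> \<le> (\<delta> * \<theta>) * 1"
      unfolding abs_mult
      by (intro mult_mono dt du coord_le_1[OF us i]) (use d(2) dt in \<open>auto intro: order_trans[OF abs_ge_zero]\<close>)
    finally show "\<bar>(T (ip n x u) - T (ip n y u)) * u i - t (ip n y u) * ip n ?d u * u i\<bar> \<le> \<delta> * \<theta>" by simp
  qed
  also have "\<dots> = n * (\<delta> * \<theta>)" by (simp add: total_mass)
  finally show ?thesis .
qed

end

context isotropic_measure
begin

section \<open>The transport inequality\<close>

text \<open>
  By strong monotonicity the part \<open>S\<close> of the domain that is mapped to a cube of side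
  \<open>h\<close> has diameter of order \<open>h\<close>. There the map differs from its
  linearisation at \<open>x0\<close> by \<open>o(h)\<close>, so \<open>S\<close> lies in the
  linear preimage of a slightly larger cube, and \<open>det A\<close> is nearly constant on
  \<open>S\<close>.
\<close>

lemma transport_cell:
  fixes g :: "rvec \<Rightarrow> real" and h \<delta> \<eta> \<theta> m0 G :: real
  assumes T: "\<And>s. (T has_real_derivative t s) (at s)" and t: "continuous_on UNIV t" "\<And>s. 0 < t s"
    and R: "0 \<le> R"
    and m0: "0 < m0" "\<And>s. \<bar>s\<bar> \<le> R \<Longrightarrow> m0 \<le> t s"
    and uc: "\<And>s s'. \<bar>s\<bar> \<le> R \<Longrightarrow> \<bar>s'\<bar> \<le> R \<Longrightarrow> \<bar>s - s'\<bar> \<le> \<eta> \<Longrightarrow> \<bar>t s - t s'\<bar> \<le> \<delta>"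
    and S: "\<And>x. x \<in> S \<Longrightarrow> x \<in> Rn n \<and> ip n x x \<le> R\<^sup>2"
    and cell: "\<And>x i. x \<in> S \<Longrightarrow> i < n \<Longrightarrow> Fm T x i \<in> {a i..a i + h}"
    and h: "0 < h" and th: "\<theta> = sqrt n * h / m0" "\<theta> \<le> \<eta>" and de: "0 \<le> \<delta>"
    and G: "\<And>x. x \<in> S \<Longrightarrow> g (Fm T x) \<le> G" "0 \<le> G"
  shows "(\<integral>\<^sup>+x. ennreal (g (Fm T x) * dt n (Am t x)) * indicator S x \<partial>Leb n) \<le>
    ennreal (G * (1 + \<delta> / m0) ^ n * (h + 2 * (n * (\<delta> * \<theta>))) ^ n)"
proof (cases "S = {}")
  case False
  then obtain x0 where x0: "x0 \<in> S" by blast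
  note x0b = conjunct2[OF S[OF x0]]
  define c where "c = n * (\<delta> * \<theta>)"
  have th0: "0 \<le> \<theta>" using h m0(1) by (simp add: th)
  have c0: "0 \<le> c" using th0 de by (simp add: c_def)
  define a' where "a' i = mat_app n (Am t x0) x0 i + (a i - Fm T x0 i) - c" for i
  define B where "B = {y \<in> Rn n. \<forall>i<n. mat_app n (Am t x0) y i \<in> {a' i..a' i + (h + 2 * c)}}"
  have near: "ip n (\<lambda>i. x i - x0 i) (\<lambda>i. x i - x0 i) \<le> \<theta>\<^sup>2" if x: "x \<in> S" for x
  proof -
    have "\<bar>Fm T x i - Fm T x0 i\<bar> \<le> h" if "i < n" for i
      using cell[OF x that] cell[OF x0 that] by (auto simp: abs_le_iff)
    from Fm_strongly_monotone[OF T m0 R conjunct2[OF S[OF x]] x0b this]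
    have "m0\<^sup>2 * ip n (\<lambda>i. x i - x0 i) (\<lambda>i. x i - x0 i) \<le> n * h\<^sup>2" by simp
    then show ?thesis using m0(1)
      by (simp add: th(1) power_divide power_mult_distrib field_simps)
  qed
  have SB: "x \<in> B" if x: "x \<in> S" for x
  proof -
    have "mat_app n (Am t x0) x i \<in> {a' i..a' i + (h + 2 * c)}" if i: "i < n" for i
    proof -
      have "\<bar>Fm T x i - Fm T x0 i - (mat_app n (Am t x0) x i - mat_app n (Am t x0) x0 i)\<bar> \<le> c"
        unfolding c_def
        by (rule Fm_linear_approx[OF T t(1) uc R conjunct2[OF S[OF x]] x0b near[OF x] th0 th(2) i])
      moreover have "a i \<le> Fm T x i" "Fm T x i \<le> a i + h" using cell[OF x i] by auto
      ultimately show ?thesis unfolding a'_def atLeastAtMost_iff by linarith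
    qed
    then show ?thesis using S[OF x] by (simp add: B_def)
  qed
  have dtx: "dt n (Am t x) \<le> (1 + \<delta> / m0) ^ n * dt n (Am t x0)" if x: "x \<in> S" for x
  proof (rule dt_Am_mono[OF t])
    show "0 \<le> 1 + \<delta> / m0" using de m0(1) by simp
    fix u assume u: "u \<in> usphere n"
    have r: "\<bar>ip n x u\<bar> \<le> R" "\<bar>ip n x0 u\<bar> \<le> R"
      using ip_le_radius[OF conjunct2[OF S[OF x]] R u] ip_le_radius[OF x0b R u] by auto
    have "\<bar>ip n (\<lambda>i. x i - x0 i) u\<bar> \<le> \<theta>" by (rule ip_le_radius[OF near[OF x] th0 u])
    then have "\<bar>ip n x u - ip n x0 u\<bar> \<le> \<eta>" using th(2) by (simp add: ip_minus_left)
    from uc[OF r this] have "t (ip n x u) \<le> t (ip n x0 u) + \<delta>" by (simp add: abs_le_iff)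
    also have "\<delta> \<le> \<delta> / m0 * t (ip n x0 u)"
      using mult_left_mono[OF m0(2)[OF r(2)], of "\<delta> / m0"] de m0(1) by simp
    finally show "t (ip n x u) \<le> (1 + \<delta> / m0) * t (ip n x0 u)" by (simp add: algebra_simps)
  qed
  have Bs: "B \<in> sets (Leb n)"
  proof -
    have "{y \<in> space (Leb n). \<forall>i\<in>{..<n}. mat_app n (Am t x0) y i \<in> {a' i..a' i + (h + 2 * c)}} \<in> sets (Leb n)"
    proof (rule sets.sets_Collect_finite_All)
      fix i assume "i \<in> {..<n}"
      then have "(\<lambda>y. mat_app n (Am t x0) y i) \<in> borel_measurable (Leb n)"
        using measurable_compose[OF mat_app_measurable coord_measurable] by simp
      then show "{y \<in> space (Leb n). mat_app n (Am t x0) y i \<in> {a' i..a' i + (h + 2 * c)}} \<in> sets (Leb n)"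
        by measurable
    qed simp
    then show ?thesis unfolding B_def Ball_def lessThan_iff space_Leb .
  qed
  let ?K = "G * (1 + \<delta> / m0) ^ n"
  have K0: "0 \<le> ?K" using G(2) de m0(1) by simp
  have "(\<integral>\<^sup>+x. ennreal (g (Fm T x) * dt n (Am t x)) * indicator S x \<partial>Leb n) \<le>
      (\<integral>\<^sup>+x. ennreal (?K * dt n (Am t x0)) * indicator B x \<partial>Leb n)"
  proof (rule nn_integral_mono)
    fix x
    show "ennreal (g (Fm T x) * dt n (Am t x)) * indicator S x \<le> ennreal (?K * dt n (Am t x0)) * indicator B x"
    proof (cases "x \<in> S")
      case True
      have "g (Fm T x) * dt n (Am t x) \<le> G * ((1 + \<delta> / m0) ^ n * dt n (Am t x0))"
        by (intro mult_mono G dtx True less_imp_le[OF dt_Am_pos[OF t]])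
      then show ?thesis using True SB[OF True] by (simp add: mult.assoc ennreal_leI)
    qed simp
  qed
  also have "\<dots> = ennreal (?K * dt n (Am t x0)) * emeasure (Leb n) B"
    by (rule nn_integral_cmult_indicator[OF Bs])
  also have "\<dots> = ennreal ?K * (ennreal (dt n (Am t x0)) * emeasure (Leb n) B)"
  proof -
    have "ennreal (?K * dt n (Am t x0)) = ennreal ?K * ennreal (dt n (Am t x0))"
      by (rule ennreal_mult[OF K0 less_imp_le[OF dt_Am_pos[OF t]]])
    then show ?thesis by (simp only: mult.assoc[of "ennreal ?K"])
  qed
  also have "ennreal (dt n (Am t x0)) * emeasure (Leb n) B = ennreal (\<Prod>i<n. a' i + (h + 2 * c) - a' i)"
    unfolding B_def by (rule emeasure_preimage_box[OF t]) (use h c0 in auto)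
  also have "ennreal ?K * \<dots> = ennreal (?K * (h + 2 * c) ^ n)"
    using K0 h c0 by (simp add: ennreal_mult)
  finally show ?thesis by (simp add: c_def)
qed simp

text \<open>
  Cut a box containing the image of \<open>D\<close> into cubes and add up
  \<open>transport_cell\<close>. Because the target is subdivided, and not the domain, the cubes
  are disjoint and their preimages cover \<open>D\<close>; the integral of \<open>g\<close> over
  the cubes then bounds the sum over the preimages.
\<close>

lemma transport_step:
  fixes g :: "rvec \<Rightarrow> real" and \<delta> e m0 L :: real
  assumes T: "\<And>s. (T has_real_derivative t s) (at s)" and t: "continuous_on UNIV t" "\<And>s. 0 < t s"
    and R: "0 \<le> R"
    and m0: "0 < m0" "\<And>s. \<bar>s\<bar> \<le> R \<Longrightarrow> m0 \<le> t s"
    and D [measurable]: "D \<in> sets (Leb n)" and DR: "\<And>x. x \<in> D \<Longrightarrow> ip n x x \<le> R\<^sup>2"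
    and L: "0 \<le> L" "\<And>x i. x \<in> D \<Longrightarrow> i < n \<Longrightarrow> \<bar>Fm T x i\<bar> \<le> L"
    and g [measurable]: "g \<in> borel_measurable (Leb n)" and g0: "\<And>z. 0 \<le> g z"
    and guc: "\<And>e. e > 0 \<Longrightarrow> \<exists>d>0. \<forall>z\<in>Rn n. \<forall>z'\<in>Rn n. (\<forall>i<n. \<bar>z i - z' i\<bar> \<le> d) \<longrightarrow> g z \<le> g z' + e"
    and de: "0 < \<delta>" "0 < e"
  shows "(\<integral>\<^sup>+x. ennreal (g (Fm T x) * dt n (Am t x)) * indicator D x \<partial>Leb n) \<le>
    ennreal ((1 + \<delta> / m0) ^ n * (1 + 2 * (n * (\<delta> * (sqrt n / m0)))) ^ n) *
      ((\<integral>\<^sup>+z. ennreal (g z) \<partial>Leb n) + ennreal (e * (2 * L + 2) ^ n))"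
proof -
  have ct: "continuous_on {-R..R} t" using t(1) continuous_on_subset by blast
  have "uniformly_continuous_on {-R..R} t" by (rule compact_uniformly_continuous[OF ct compact_Icc])
  then obtain \<eta>' where et': "0 < \<eta>'" "\<And>s s'. s \<in> {-R..R} \<Longrightarrow> s' \<in> {-R..R} \<Longrightarrow> dist s' s < \<eta>' \<Longrightarrow> dist (t s') (t s) < \<delta>"
    unfolding uniformly_continuous_on_def using de(1) by metis
  define \<eta> where "\<eta> = \<eta>' / 2"
  have eta: "0 < \<eta>" using et' by (simp add: \<eta>_def)
  have uc: "\<bar>t s - t s'\<bar> \<le> \<delta>" if "\<bar>s\<bar> \<le> R" "\<bar>s'\<bar> \<le> R" "\<bar>s - s'\<bar> \<le> \<eta>" for s s'
    using et'(2)[of s' s] that et'(1) by (auto simp: dist_real_def \<eta>_def abs_le_iff)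
  obtain d where d: "0 < d" "\<And>z z'. z \<in> Rn n \<Longrightarrow> z' \<in> Rn n \<Longrightarrow> (\<And>i. i < n \<Longrightarrow> \<bar>z i - z' i\<bar> \<le> d) \<Longrightarrow> g z \<le> g z' + e"
    using guc[OF de(2)] by blast
  \<comment> \<open>the three bounds on the mesh serve the estimate \<open>N2\<close>, the continuity of \<open>g\<close> and the hypothesis \<open>\<theta> \<le> \<eta>\<close> on cells\<close>
  define h where "h = min 1 (min d (\<eta> * m0 / (sqrt n + 1)))"
  have h: "0 < h" "h \<le> 1" "h \<le> d"
    using d eta m0(1) by (auto simp: h_def add_nonneg_pos)
  define \<theta> where "\<theta> = sqrt n * h / m0"
  have th: "\<theta> \<le> \<eta>"
  proof -
    have "h \<le> \<eta> * m0 / (sqrt n + 1)" by (simp add: h_def)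
    then have "h * (sqrt n + 1) \<le> \<eta> * m0" by (subst (asm) pos_le_divide_eq) (auto simp: add_nonneg_pos)
    then have "sqrt n * h \<le> \<eta> * m0" using h(1) by (simp add: algebra_simps)
    then show ?thesis using m0(1) by (simp add: \<theta>_def field_simps)
  qed
  \<comment> \<open>the additional cell covers values equal to the upper end \<open>L\<close>\<close>
  define N where "N = nat \<lceil>2 * L / h\<rceil> + 1"
  have N1: "2 * L / h < N" unfolding N_def using real_nat_ceiling_ge[of "2 * L / h"] by simp
  have N2: "N * h \<le> 2 * L + 2"
  proof -
    have "real N \<le> 2 * L / h + 2"
      unfolding N_def using L(1) h(1) by (simp add: of_nat_nat) linarith
    then have "N * h \<le> (2 * L / h + 2) * h" using h(1) by (intro mult_right_mono) auto
    also have "\<dots> = 2 * L + 2 * h" using h(1) by (simp add: field_simps)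
    finally show ?thesis using h(2) by simp
  qed
  define a where "a k i = - L + real (k i) * h" for k :: "nat \<Rightarrow> nat" and i
  define q where "q k = Pi\<^sub>E {..<n} (\<lambda>i. {a k i..<a k i + h})" for k
  define Idx where "Idx = Pi\<^sub>E {..<n} (\<lambda>_. {..<N})"
  define S where "S k = D \<inter> {x. Fm T x \<in> q k}" for k
  have fin: "finite Idx" by (simp add: Idx_def finite_PiE)
  have qs [measurable]: "q k \<in> sets (Leb n)" for k
    unfolding q_def by (rule sets_PiM_I_finite) auto
  have eq: "emeasure (Leb n) (q k) = ennreal (h ^ n)" for k
    unfolding q_def using h(1) by (subst lbp.emeasure_PiM) (auto simp: ennreal_power)
  have [measurable]: "Fm T \<in> measurable (Leb n) (Leb n)"
    by (rule Fm_measurable[OF DERIV_continuous_on_UNIV[OF T]])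
  have Ss: "S k \<in> sets (Leb n)" for k
  proof -
    have "{x \<in> space (Leb n). Fm T x \<in> q k} \<in> sets (Leb n)" by measurable
    moreover have "S k = D \<inter> {x \<in> space (Leb n). Fm T x \<in> q k}"
      using sets.sets_into_space[OF D] by (auto simp: S_def)
    ultimately show ?thesis using D by simp
  qed
  have DRn: "x \<in> Rn n" if "x \<in> D" for x using sets.sets_into_space[OF D] that by auto
  have cover: "\<exists>k\<in>Idx. x \<in> S k" if x: "x \<in> D" for x
  proof -
    define k where "k = (\<lambda>i\<in>{..<n}. nat \<lfloor>(Fm T x i + L) / h\<rfloor>)"
    have ki: "a k i \<le> Fm T x i \<and> Fm T x i < a k i + h \<and> k i < N" if i: "i < n" for i
    proof -
      have b: "\<bar>Fm T x i\<bar> \<le> L" by (rule L(2)[OF x i])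
      have nn: "0 \<le> (Fm T x i + L) / h" using b h(1) by (simp add: abs_le_iff)
      have rk: "real (k i) = of_int \<lfloor>(Fm T x i + L) / h\<rfloor>"
        using i nn by (simp add: k_def of_nat_nat)
      have l: "real (k i) \<le> (Fm T x i + L) / h" "(Fm T x i + L) / h < real (k i) + 1"
        unfolding rk by linarith+
      have "(Fm T x i + L) / h \<le> 2 * L / h" using b h(1) by (simp add: divide_right_mono abs_le_iff)
      then have "real (k i) < N" using l N1 by linarith
      moreover have "real (k i) * h \<le> Fm T x i + L" "Fm T x i + L < (real (k i) + 1) * h"
        using l h(1) by (simp_all add: pos_le_divide_eq pos_divide_less_eq)
      ultimately show ?thesis by (simp add: a_def algebra_simps)
    qed
    have "k \<in> Idx" using ki by (auto simp: Idx_def k_def)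
    moreover have "x \<in> S k" using x ki by (auto simp: S_def q_def PiE_iff Fm_def)
    ultimately show ?thesis by blast
  qed
  define C where "C k = (\<integral>\<^sup>+x. ennreal (g (Fm T x) * dt n (Am t x)) * indicator (S k) x \<partial>Leb n)" for k
  \<comment> \<open>the total distortion, which tends to \<open>1\<close> with \<open>\<delta>\<close>\<close>
  define \<kappa> where "\<kappa> = (1 + \<delta> / m0) ^ n * (1 + 2 * (n * (\<delta> * (sqrt n / m0)))) ^ n"
  have k0: "0 \<le> \<kappa>" using de m0(1) by (simp add: \<kappa>_def)
  have Cle: "C k \<le> ennreal (h ^ n * \<kappa>) * ennreal (g z + e)" if z: "z \<in> q k" for k z
  proof -
    have zR: "z \<in> Rn n" using z by (auto simp: q_def Rn_def PiE_iff)
    have "C k \<le> ennreal ((g z + e) * (1 + \<delta> / m0) ^ n * (h + 2 * (n * (\<delta> * \<theta>))) ^ n)"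
      unfolding C_def
    proof (rule transport_cell[OF T t R m0 uc, where a = "a k"])
      fix x assume x: "x \<in> S k"
      show "x \<in> Rn n \<and> ip n x x \<le> R\<^sup>2" using x DRn DR by (auto simp: S_def)
      have Fx: "Fm T x i \<in> {a k i..<a k i + h}" if "i < n" for i
        using x that by (auto simp: S_def q_def PiE_iff)
      then show "Fm T x i \<in> {a k i..a k i + h}" if "i < n" for i using that[THEN Fx] by auto
      show "g (Fm T x) \<le> g z + e"
      proof (rule d(2)[OF Fm_in_Rn zR])
        fix i assume i: "i < n"
        then have "z i \<in> {a k i..<a k i + h}" using z by (auto simp: q_def PiE_iff)
        then show "\<bar>Fm T x i - z i\<bar> \<le> d" using Fx[OF i] h(3) by (auto simp: abs_le_iff)
      qed
    qed (use h th de g0 in \<open>auto simp: \<theta>_def intro: add_nonneg_nonneg less_imp_le\<close>)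
    also have "h + 2 * (n * (\<delta> * \<theta>)) = h * (1 + 2 * (n * (\<delta> * (sqrt n / m0))))"
      by (simp add: \<theta>_def algebra_simps)
    also have "(g z + e) * (1 + \<delta> / m0) ^ n * \<dots> ^ n = (h ^ n * \<kappa>) * (g z + e)"
      by (simp add: \<kappa>_def power_mult_distrib)
    finally show ?thesis using k0 h(1) g0[of z] de by (simp add: ennreal_mult)
  qed
  have Cint: "C k * ennreal (h ^ n) \<le> ennreal (h ^ n * \<kappa>) * (\<integral>\<^sup>+z. ennreal (g z + e) * indicator (q k) z \<partial>Leb n)" for k
  proof -
    have "C k * ennreal (h ^ n) = (\<integral>\<^sup>+z. C k * indicator (q k) z \<partial>Leb n)"
      by (subst nn_integral_cmult_indicator) (auto simp: eq)
    also have "\<dots> \<le> (\<integral>\<^sup>+z. ennreal (h ^ n * \<kappa>) * (ennreal (g z + e) * indicator (q k) z) \<partial>Leb n)"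
    proof (rule nn_integral_mono)
      fix z show "C k * indicator (q k) z \<le> ennreal (h ^ n * \<kappa>) * (ennreal (g z + e) * indicator (q k) z)"
        using Cle[of z k] by (cases "z \<in> q k") auto
    qed
    also have "\<dots> = ennreal (h ^ n * \<kappa>) * (\<integral>\<^sup>+z. ennreal (g z + e) * indicator (q k) z \<partial>Leb n)"
      by (rule nn_integral_cmult) measurable
    finally show ?thesis .
  qed
  have [measurable]: "(\<lambda>x. dt n (Am t x)) \<in> borel_measurable (Leb n)" by (rule dt_Am_measurable[OF t(1)])
  have "(\<integral>\<^sup>+x. ennreal (g (Fm T x) * dt n (Am t x)) * indicator D x \<partial>Leb n) \<le>
     (\<integral>\<^sup>+x. (\<Sum>k\<in>Idx. ennreal (g (Fm T x) * dt n (Am t x)) * indicator (S k) x) \<partial>Leb n)"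
  proof (rule nn_integral_mono)
    fix x
    show "ennreal (g (Fm T x) * dt n (Am t x)) * indicator D x \<le> (\<Sum>k\<in>Idx. ennreal (g (Fm T x) * dt n (Am t x)) * indicator (S k) x)"
    proof (cases "x \<in> D")
      case True
      then obtain k where k: "k \<in> Idx" "x \<in> S k" using cover by blast
      have "ennreal (g (Fm T x) * dt n (Am t x)) * indicator (S k) x \<le> (\<Sum>k\<in>Idx. ennreal (g (Fm T x) * dt n (Am t x)) * indicator (S k) x)"
        by (rule member_le_sum) (use k fin in auto)
      then show ?thesis using True k by simp
    qed simp
  qed
  also have "\<dots> = (\<Sum>k\<in>Idx. C k)"
    unfolding C_def by (rule nn_integral_sum) (use Ss in measurable)
  finally have LC: "(\<integral>\<^sup>+x. ennreal (g (Fm T x) * dt n (Am t x)) * indicator D x \<partial>Leb n) \<le> (\<Sum>k\<in>Idx. C k)" .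
  define Box where "Box = Pi\<^sub>E {..<n} (\<lambda>_. {- L..- L + N * h})"
  have disj: "disjoint_family_on q Idx"
    unfolding disjoint_family_on_def
  proof (intro ballI impI)
    fix k k' assume kk: "k \<in> Idx" "k' \<in> Idx" "k \<noteq> k'"
    show "q k \<inter> q k' = {}"
    proof (rule ccontr)
      assume "q k \<inter> q k' \<noteq> {}"
      then obtain z where z: "z \<in> q k" "z \<in> q k'" by blast
      have "k i = k' i" if i: "i < n" for i
      proof -
        have "a k i \<le> z i" "z i < a k i + h" "a k' i \<le> z i" "z i < a k' i + h"
          using z i by (auto simp: q_def PiE_iff)
        then have "real (k i) * h < (real (k' i) + 1) * h" "real (k' i) * h < (real (k i) + 1) * h"
          by (simp_all add: a_def algebra_simps)
        then have "real (k i) < real (k' i) + 1" "real (k' i) < real (k i) + 1"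
          using h(1) by simp_all
        then show ?thesis by linarith
      qed
      then have "k = k'" using kk(1,2) unfolding Idx_def by (intro PiE_ext[of k "{..<n}" "\<lambda>_. {..<N}" k']) auto
      with kk(3) show False by simp
    qed
  qed
  have qBox: "q k \<subseteq> Box" if k: "k \<in> Idx" for k
  proof
    fix z assume z: "z \<in> q k"
    have "- L \<le> z i \<and> z i \<le> - L + N * h" if i: "i < n" for i
    proof -
      have 1: "a k i \<le> z i" "z i < a k i + h" using z i by (auto simp: q_def PiE_iff)
      have "k i < N" using k i by (auto simp: Idx_def)
      then have "real (k i) + 1 \<le> N" by linarith
      then have "(real (k i) + 1) * h \<le> N * h" using h(1) by (intro mult_right_mono) auto
      moreover have "0 \<le> real (k i) * h" using h(1) by simp
      moreover have "(real (k i) + 1) * h = real (k i) * h + h" by (simp add: algebra_simps)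
      ultimately show ?thesis using 1 unfolding a_def by linarith
    qed
    then show "z \<in> Box" using z by (auto simp: Box_def q_def PiE_iff)
  qed
  have [measurable]: "Box \<in> sets (Leb n)" by (simp add: Box_def)
  have "(\<Sum>k\<in>Idx. C k) * ennreal (h ^ n) \<le> (\<Sum>k\<in>Idx. ennreal (h ^ n * \<kappa>) * (\<integral>\<^sup>+z. ennreal (g z + e) * indicator (q k) z \<partial>Leb n))"
    unfolding sum_distrib_right by (intro sum_mono Cint)
  also have "\<dots> = ennreal (h ^ n * \<kappa>) * (\<integral>\<^sup>+z. (\<Sum>k\<in>Idx. ennreal (g z + e) * indicator (q k) z) \<partial>Leb n)"
    by (subst nn_integral_sum) (auto simp: sum_distrib_left)
  also have "\<dots> \<le> ennreal (h ^ n * \<kappa>) * (\<integral>\<^sup>+z. ennreal (g z) + ennreal e * indicator Box z \<partial>Leb n)"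
  proof (intro mult_left_mono nn_integral_mono)
    fix z
    have "(\<Sum>k\<in>Idx. ennreal (g z + e) * indicator (q k) z) = ennreal (g z + e) * indicator (\<Union>k\<in>Idx. q k) z"
      by (simp add: sum_distrib_left[symmetric] indicator_UN_disjoint[OF fin disj])
    also have "\<dots> \<le> ennreal (g z + e) * indicator Box z"
      by (intro mult_left_mono) (use qBox in \<open>auto simp: indicator_def\<close>)
    also have "\<dots> \<le> ennreal (g z) + ennreal e * indicator Box z"
      using g0[of z] de by (auto simp: indicator_def ennreal_plus)
    finally show "(\<Sum>k\<in>Idx. ennreal (g z + e) * indicator (q k) z) \<le> ennreal (g z) + ennreal e * indicator Box z" .
  qed simp
  also have "(\<integral>\<^sup>+z. ennreal (g z) + ennreal e * indicator Box z \<partial>Leb n) = (\<integral>\<^sup>+z. ennreal (g z) \<partial>Leb n) + ennreal e * emeasure (Leb n) Box"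
    by (subst nn_integral_add) (auto simp: nn_integral_cmult_indicator)
  also have "emeasure (Leb n) Box = ennreal ((N * h) ^ n)"
    unfolding Box_def using h(1) by (subst emeasure_box) auto
  also have "ennreal e * \<dots> = ennreal (e * (N * h) ^ n)" using de h(1) by (simp add: ennreal_mult)
  finally have 1: "(\<Sum>k\<in>Idx. C k) * ennreal (h ^ n) \<le>
      ennreal (h ^ n * \<kappa>) * ((\<integral>\<^sup>+z. ennreal (g z) \<partial>Leb n) + ennreal (e * (N * h) ^ n))" .
  have 2: "ennreal (e * (N * h) ^ n) \<le> ennreal (e * (2 * L + 2) ^ n)"
    using N2 h(1) de L(1) by (intro ennreal_leI mult_left_mono power_mono) auto
  have "ennreal (h ^ n) * (\<Sum>k\<in>Idx. C k) \<le> ennreal (h ^ n) * (ennreal \<kappa> * ((\<integral>\<^sup>+z. ennreal (g z) \<partial>Leb n) + ennreal (e * (N * h) ^ n)))"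
    using 1 h(1) k0 by (simp add: ennreal_mult mult_ac)
  then have "(\<Sum>k\<in>Idx. C k) \<le> ennreal \<kappa> * ((\<integral>\<^sup>+z. ennreal (g z) \<partial>Leb n) + ennreal (e * (N * h) ^ n))"
    using h(1) by (simp add: ennreal_mult_le_mult_iff)
  also have "\<dots> \<le> ennreal \<kappa> * ((\<integral>\<^sup>+z. ennreal (g z) \<partial>Leb n) + ennreal (e * (2 * L + 2) ^ n))"
    by (intro mult_left_mono add_left_mono 2) auto
  finally show ?thesis using LC unfolding \<kappa>_def by (rule order_trans[rotated])
qed

text \<open>
  The inequality half of the change of variables formula for \<open>Fm T\<close>, obtained from
  \<open>transport_step\<close> as both error parameters tend to \<open>0\<close>.
\<close>

theorem transport_inequality:
  fixes g :: "rvec \<Rightarrow> real"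
  assumes T: "\<And>s. (T has_real_derivative t s) (at s)" and t: "continuous_on UNIV t" "\<And>s. 0 < t s"
    and R: "0 \<le> R" and D: "D \<in> sets (Leb n)" and DR: "\<And>x. x \<in> D \<Longrightarrow> ip n x x \<le> R\<^sup>2"
    and g: "g \<in> borel_measurable (Leb n)" and g0: "\<And>z. 0 \<le> g z"
    and guc: "\<And>e. e > 0 \<Longrightarrow> \<exists>d>0. \<forall>z\<in>Rn n. \<forall>z'\<in>Rn n. (\<forall>i<n. \<bar>z i - z' i\<bar> \<le> d) \<longrightarrow> g z \<le> g z' + e"
  shows "(\<integral>\<^sup>+x. ennreal (g (Fm T x) * dt n (Am t x)) * indicator D x \<partial>Leb n) \<le> (\<integral>\<^sup>+z. ennreal (g z) \<partial>Leb n)"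
proof (cases "(\<integral>\<^sup>+z. ennreal (g z) \<partial>Leb n) = \<infinity>")
  case False
  define I where "I = enn2real (\<integral>\<^sup>+z. ennreal (g z) \<partial>Leb n)"
  have I: "0 \<le> I" "(\<integral>\<^sup>+z. ennreal (g z) \<partial>Leb n) = ennreal I"
    using False by (auto simp: I_def less_top infinity_ennreal_def)
  obtain m0 where m0: "0 < m0" "\<And>s. \<bar>s\<bar> \<le> R \<Longrightarrow> m0 \<le> t s"
    using positive_lower_bound[OF t R] by metis
  have cT: "continuous_on UNIV T" by (rule DERIV_continuous_on_UNIV[OF T])
  obtain L0 where L0: "\<And>s. \<bar>s\<bar> \<le> R \<Longrightarrow> \<bar>T s\<bar> \<le> L0"
  proof -
    have "compact (T ` {-R..R})"
      by (rule compact_continuous_image) (use cT continuous_on_subset in auto)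
    then obtain C where C: "\<And>y. y \<in> T ` {-R..R} \<Longrightarrow> \<bar>y\<bar> \<le> C"
      using compact_imp_bounded bounded_iff by (metis real_norm_def)
    show ?thesis
    proof (rule that[of C])
      fix s assume "\<bar>s\<bar> \<le> R"
      then have "T s \<in> T ` {-R..R}" by (intro imageI) (simp add: abs_le_iff)
      then show "\<bar>T s\<bar> \<le> C" by (rule C)
    qed
  qed
  have L00: "0 \<le> L0" using L0[of 0] R by auto
  define L where "L = L0 * n"
  have L: "\<bar>Fm T x i\<bar> \<le> L" if x: "x \<in> D" and i: "i < n" for x i
  proof -
    have "\<bar>\<integral>u. T (ip n x u) * u i \<partial>\<mu>\<bar> \<le> (\<integral>u. \<bar>T (ip n x u) * u i\<bar> \<partial>\<mu>)" by (rule integral_abs_bound)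
    also have "\<dots> \<le> (\<integral>u. L0 \<partial>\<mu>)"
    proof (rule integral_mono)
      show "integrable \<mu> (\<lambda>u. \<bar>T (ip n x u) * u i\<bar>)"
        by (intro integrable_abs bmeas_integrable bmeas_mult bmeas_cont_ip[OF cT] bmeas_coord i)
      fix u assume "u \<in> space \<mu>"
      then have u: "u \<in> usphere n" by simp
      have "\<bar>T (ip n x u)\<bar> * \<bar>u i\<bar> \<le> L0 * 1"
        by (intro mult_mono L0 ip_le_radius[OF DR[OF x] R u] coord_le_1[OF u i]) (auto simp: L00)
      then show "\<bar>T (ip n x u) * u i\<bar> \<le> L0" by (simp add: abs_mult)
    qed simp
    finally show ?thesis using i by (simp add: Fm_def total_mass L_def mult.commute)
  qed
  have L'0: "0 \<le> L" using L00 by (simp add: L_def)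
  let ?X = "\<lambda>k::nat. (1 + (1 / Suc k) / m0) ^ n * (1 + 2 * (n * ((1 / Suc k) * (sqrt n / m0)))) ^ n *
      (I + (1 / Suc k) * (2 * L + 2) ^ n)"
  have z: "(\<lambda>k. 1 / real (Suc k)) \<longlonglongrightarrow> 0" using LIMSEQ_inverse_real_of_nat by (simp add: inverse_eq_divide)
  have "?X \<longlonglongrightarrow> (1 + 0 / m0) ^ n * (1 + 2 * (n * (0 * (sqrt n / m0)))) ^ n * (I + 0 * (2 * L + 2) ^ n)"
    by (intro tendsto_intros z) (use m0(1) in auto)
  then have lim: "(\<lambda>k. ennreal (?X k)) \<longlonglongrightarrow> ennreal I"
    by (intro tendsto_ennrealI) simp
  show ?thesis
    unfolding I(2)
  proof (rule LIMSEQ_le_const[OF lim], intro exI allI impI)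
    fix k :: nat
    have "(\<integral>\<^sup>+x. ennreal (g (Fm T x) * dt n (Am t x)) * indicator D x \<partial>Leb n) \<le>
      ennreal ((1 + (1 / Suc k) / m0) ^ n * (1 + 2 * (n * ((1 / Suc k) * (sqrt n / m0)))) ^ n) *
      ((\<integral>\<^sup>+z. ennreal (g z) \<partial>Leb n) + ennreal ((1 / Suc k) * (2 * L + 2) ^ n))"
      by (rule transport_step[OF T t R m0 D DR L'0 L g g0 guc]) auto
    also have "\<dots> = ennreal (?X k)"
    proof -
      have *: "ennreal a * (ennreal I + ennreal b) = ennreal (a * (I + b))" if "0 \<le> a" "0 \<le> b" for a b
        using I(1) that by (simp add: ennreal_mult ennreal_plus)
      show ?thesis
        unfolding I(2) by (rule *) (use m0(1) L'0 in auto)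
    qed
    finally show "(\<integral>\<^sup>+x. ennreal (g (Fm T x) * dt n (Am t x)) * indicator D x \<partial>Leb n) \<le> ennreal (?X k)" .
  qed
qed simp

end

section \<open>Two transport maps on the line\<close>

lemma continuous_antiderivative:
  assumes "continuous_on UNIV (f :: real \<Rightarrow> real)"
  obtains F where "\<And>x. (F has_real_derivative f x) (at x)" "F 0 = 0"
proof -
  have "\<exists>F. \<forall>x::real. - \<infinity> < ereal x \<longrightarrow> ereal x < \<infinity> \<longrightarrow> (F has_vector_derivative f x) (at x)"
    by (rule einterval_antiderivative) (use assms in \<open>auto simp: continuous_on_eq_continuous_at\<close>)
  then obtain F where F: "\<And>x. (F has_real_derivative f x) (at x)"
    by (auto simp: has_real_derivative_iff_has_vector_derivative)
  show ?thesis
    by (rule that[of "\<lambda>x. F x - F 0"]) (auto intro!: derivative_eq_intros F)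
qed

lemma half_gauss: "(\<integral>\<^sup>+t. ennreal (exp (- pi * t\<^sup>2)) * indicator {0..} t \<partial>lborel) = ennreal (1 / 2)"
proof -
  let ?h = "\<integral>\<^sup>+t. ennreal (exp (- pi * t\<^sup>2)) * indicator {0..} t \<partial>lborel"
  have "1 = (\<integral>\<^sup>+t. ennreal (exp (- pi * t\<^sup>2)) * indicator {0..} t + ennreal (exp (- pi * t\<^sup>2)) * indicator {..0} t \<partial>lborel)"
    unfolding nn_integral_gauss[symmetric]
  proof (rule nn_integral_cong_AE)
    show "AE t in lborel. ennreal (exp (- pi * t\<^sup>2)) = ennreal (exp (- pi * t\<^sup>2)) * indicator {0..} t + ennreal (exp (- pi * t\<^sup>2)) * indicator {..0} t"
      using AE_lborel_singleton[of 0] by eventually_elim (auto simp: indicator_def)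
  qed
  also have "\<dots> = ?h + (\<integral>\<^sup>+t. ennreal (exp (- pi * t\<^sup>2)) * indicator {..0::real} t \<partial>lborel)"
    by (rule nn_integral_add) auto
  also have "(\<integral>\<^sup>+t. ennreal (exp (- pi * t\<^sup>2)) * indicator {..0::real} t \<partial>lborel) = ?h"
    by (subst nn_integral_real_affine[where c = "-1" and t = 0]) (auto intro!: nn_integral_cong simp: indicator_def)
  finally have e: "?h + ?h = 1" by simp
  then have "?h < \<infinity>" by (cases "?h = \<infinity>") (auto simp: less_top)
  then obtain r where r: "0 \<le> r" "?h = ennreal r" by (cases ?h) auto
  have "ennreal (r + r) = ennreal 1" unfolding ennreal_plus[OF r(1) r(1)] using e unfolding r(2) by simp
  then have "r + r = 1" using r(1) by (subst (asm) ennreal_inj) auto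
  then have "r = 1 / 2" by simp
  then show ?thesis unfolding r(2) by (rule arg_cong)
qed

text \<open>
  A primitive \<open>P\<close> of the Gaussian density is an increasing odd bijection onto the
  open interval of radius \<open>1 / 2\<close>, since the total mass is \<open>1\<close>.
\<close>

lemma gauss_primitive:
  obtains P where "\<And>t. (P has_real_derivative exp (- pi * t\<^sup>2)) (at t)" "P 0 = 0"
    "strict_mono P" "\<And>t. P (- t) = - P t" "\<And>t. \<bar>P t\<bar> < 1 / 2"
    "\<And>y. \<bar>y\<bar> < 1 / 2 \<Longrightarrow> \<exists>t. P t = y"
proof -
  have "continuous_on UNIV (\<lambda>t::real. exp (- pi * t\<^sup>2))" by (intro continuous_intros)
  then obtain P where P: "\<And>t. (P has_real_derivative exp (- pi * t\<^sup>2)) (at t)" "P 0 = 0"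
    using continuous_antiderivative by blast
  have sm: "P a < P b" if "a < b" for a b
    by (rule DERIV_pos_imp_increasing[OF that]) (use P(1) exp_gt_zero in blast)
  have mono: "P a \<le> P b" if "a \<le> b" for a b using sm[of a b] that by (cases "a = b") auto
  have odd: "P (- t) = - P t" for t
  proof -
    have "((\<lambda>t. P t + P (- t)) has_real_derivative 0) (at t)" for t
    proof -
      have "((\<lambda>t. P (- t)) has_real_derivative exp (- pi * (- t)\<^sup>2) * (- 1)) (at t)"
        by (rule DERIV_chain2[OF P(1)]) (auto intro!: derivative_eq_intros)
      from DERIV_add[OF P(1) this] show ?thesis by simp
    qed
    then have "P t + P (- t) = P 0 + P (- 0)" using DERIV_isconst_all by blast
    then show ?thesis using P(2) by simp
  qed
  have bd: "P b \<le> 1 / 2" for b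
  proof (cases "0 \<le> b")
    case True
    have "(\<integral>\<^sup>+t. ennreal (exp (- pi * t\<^sup>2)) * indicator {0..b} t \<partial>lborel) = ennreal (P b - P 0)"
      by (rule nn_integral_FTC_Icc) (use P True in auto)
    moreover have "(\<integral>\<^sup>+t. ennreal (exp (- pi * t\<^sup>2)) * indicator {0..b} t \<partial>lborel) \<le> (\<integral>\<^sup>+t. ennreal (exp (- pi * t\<^sup>2)) * indicator {0..} t \<partial>lborel)"
      by (intro nn_integral_mono) (auto simp: indicator_def)
    ultimately have "ennreal (P b) \<le> ennreal (1 / 2)" using half_gauss P(2) by simp
    then show ?thesis by (subst (asm) ennreal_le_iff) auto
  next
    case False
    then show ?thesis using mono[of b 0] P(2) by simp
  qed
  have bda: "bdd_above (range P)" by (rule bdd_aboveI[of _ "1 / 2"]) (use bd in blast)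
  define L where "L = Sup (range P)"
  have lim: "(P \<longlongrightarrow> L) at_top"
  proof (rule order_tendstoI)
    fix a assume "a < L"
    then obtain t0 where t0: "a < P t0" unfolding L_def using less_cSup_iff[OF _ bda] by auto
    show "eventually (\<lambda>t. a < P t) at_top"
      using eventually_ge_at_top[of t0] by eventually_elim (use t0 mono in \<open>auto intro: less_le_trans\<close>)
  next
    fix a assume a: "L < a"
    have "P t \<le> L" for t unfolding L_def by (rule cSup_upper[OF _ bda]) auto
    then show "eventually (\<lambda>t. P t < a) at_top"
      using a by (intro always_eventually allI) (rule le_less_trans)
  qed
  have "(\<integral>\<^sup>+t. ennreal (exp (- pi * t\<^sup>2)) * indicator {0..} t \<partial>lborel) = ennreal (L - P 0)"
    by (rule nn_integral_FTC_atLeast) (use P lim in auto)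
  then have "ennreal L = ennreal (1 / 2)" using half_gauss P(2) by simp
  moreover have "0 \<le> L" unfolding L_def using cSup_upper[OF _ bda, of "P 0"] P(2) by auto
  ultimately have L: "L = 1 / 2" by (subst (asm) ennreal_inj) auto
  have lt: "P t < 1 / 2" for t using sm[of t "t + 1"] bd[of "t + 1"] by simp
  have lt': "\<bar>P t\<bar> < 1 / 2" for t using lt[of t] lt[of "- t"] odd[of t] by auto
  have surj0: "\<exists>t. P t = y" if y: "0 \<le> y" "y < 1 / 2" for y
  proof -
    obtain t0 where t0: "y < P t0" using y(2) less_cSup_iff[OF _ bda, of y] L unfolding L_def by auto
    then have "0 \<le> t0" using y(1) mono[of t0 0] P(2) by (cases "0 \<le> t0") auto
    moreover have "\<forall>t. 0 \<le> t \<and> t \<le> t0 \<longrightarrow> isCont P t" using P(1) DERIV_isCont by blast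
    ultimately show ?thesis using IVT[of P 0 y t0] t0 y P(2) by force
  qed
  have surj: "\<exists>t. P t = y" if "\<bar>y\<bar> < 1 / 2" for y
  proof (cases "0 \<le> y")
    case False
    moreover have "- y < 1 / 2" using that by linarith
    ultimately obtain t where "P t = - y" using surj0[of "- y"] by auto
    then show ?thesis using odd[of t] by (intro exI[of _ "- t"]) simp
  qed (use surj0[of y] that in auto)
  show ?thesis
    by (rule that[OF P]) (use sm odd lt' surj in \<open>auto simp: strict_mono_def\<close>)
qed

lemma exp_ge_gauss_small: "1 - pi * s\<^sup>2 \<le> exp (- pi * s\<^sup>2)"
  using exp_ge_add_one_self[of "- pi * s\<^sup>2"] by simp

text \<open>
  The map that carries the uniform density on \<open>[-1, 1]\<close> to the Gaussian is
  \<open>Q\<close>, the inverse of \<open>2 * P\<close>; the identity for \<open>ln (t s)\<close>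
  is its Monge-Ampere equation. As \<open>Q\<close> is only defined on the open interval,
  \<open>T\<close> follows it on \<open>[-r, r]\<close> and continues with constant slope outside,
  which keeps it continuously differentiable on the line. The last two properties quantify the
  oscillation of \<open>ln t\<close> near \<open>0\<close>: it is at least quadratic, which makes
  the variance comparable to the one of \<open>(ip n x u)\<^sup>2\<close>, and small enough for
  \<open>exp_ge_quadratic\<close>.
\<close>

lemma uniform_to_gauss:
  assumes r: "1 / 2 \<le> r" "r < 1"
  obtains T t where "\<And>s. (T has_real_derivative t s) (at s)" "continuous_on UNIV t" "\<And>s. 0 < t s"
    "\<And>s. \<bar>s\<bar> \<le> r \<Longrightarrow> ln (t s) = pi * (T s)\<^sup>2 - ln 2"
    "\<And>a b. \<bar>a\<bar> \<le> 1 / 8 \<Longrightarrow> \<bar>b\<bar> \<le> 1 / 8 \<Longrightarrow> ((a\<^sup>2 - b\<^sup>2) / 2)\<^sup>2 \<le> (ln (t a) - ln (t b))\<^sup>2"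
    "\<And>a b. \<bar>a\<bar> \<le> 1 / 8 \<Longrightarrow> \<bar>b\<bar> \<le> 1 / 8 \<Longrightarrow> - (4 * \<bar>b\<bar>) \<le> ln (t a) - ln (t b)"
proof -
  obtain P where P: "\<And>t. (P has_real_derivative exp (- pi * t\<^sup>2)) (at t)" "P 0 = 0"
    "strict_mono P" "\<And>t. P (- t) = - P t" "\<And>t. \<bar>P t\<bar> < 1 / 2" "\<And>y. \<bar>y\<bar> < 1 / 2 \<Longrightarrow> \<exists>t. P t = y"
    by (rule gauss_primitive) blast
  define Q where "Q s = (SOME t. P t = s / 2)" for s
  have PQ: "P (Q s) = s / 2" if "\<bar>s\<bar> < 1" for s
  proof -
    have "\<exists>t. P t = s / 2" using P(6)[of "s / 2"] that by simp
    then show ?thesis unfolding Q_def by (rule someI_ex)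
  qed
  have inj: "P a = P b \<longleftrightarrow> a = b" for a b using strict_mono_eq[OF P(3)] .
  have le: "P a \<le> P b \<longleftrightarrow> a \<le> b" for a b using strict_mono_less_eq[OF P(3)] .
  have QP: "Q (2 * P t) = t" for t using PQ[of "2 * P t"] P(5)[of t] inj by simp
  have Q0: "Q 0 = 0" using QP[of 0] P(2) by simp
  have Qodd: "Q (- s) = - Q s" if "\<bar>s\<bar> < 1" for s
    using PQ[of s] PQ[of "- s"] that P(4)[of "Q s"] inj[of "Q (- s)" "- Q s"] by simp
  have Qmono: "Q a \<le> Q b" if "\<bar>a\<bar> < 1" "\<bar>b\<bar> < 1" "a \<le> b" for a b
    using PQ[of a] PQ[of b] that le[of "Q a" "Q b"] by simp
  have contP: "isCont P t" for t using P(1) DERIV_isCont by blast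
  have dQ: "(Q has_real_derivative exp (pi * (Q s)\<^sup>2) / 2) (at s)" if s: "\<bar>s\<bar> < 1" for s
  proof -
    have "(Q has_real_derivative inverse (2 * exp (- pi * (Q s)\<^sup>2))) (at s)"
    proof (rule DERIV_inverse_function[where f = "\<lambda>t. 2 * P t" and a = "-1" and b = 1])
      show "((\<lambda>t. 2 * P t) has_real_derivative 2 * exp (- pi * (Q s)\<^sup>2)) (at (Q s))"
        by (rule DERIV_cmult[OF P(1)])
      show "2 * P (Q y) = y" if "- 1 < y" "y < 1" for y using PQ[of y] that by (simp add: abs_less_iff)
      have "isCont Q (2 * P (Q s))"
        by (rule isCont_inverse_function[where f = "\<lambda>t. 2 * P t" and d = 1 and x = "Q s"]) (auto intro!: QP continuous_intros contP)
      then show "isCont Q s" using PQ[OF s] by simp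
    qed (use s in auto)
    then show ?thesis by (simp add: exp_minus)
  qed
  have contQ: "continuous_on {-r..r} Q"
    using r by (intro continuous_at_imp_continuous_on ballI DERIV_isCont[OF dQ]) auto
  \<comment> \<open>the argument of \<open>Q\<close> is clamped to \<open>[-r, r]\<close>\<close>
  define t where "t s = exp (pi * (Q (max (- r) (min r s)))\<^sup>2) / 2" for s
  have ct: "continuous_on UNIV t"
  proof -
    have "continuous_on UNIV (\<lambda>s. Q (max (- r) (min r s)))"
      by (rule continuous_on_compose2[OF contQ]) (use r in \<open>auto intro!: continuous_intros\<close>)
    then show ?thesis unfolding t_def by (intro continuous_intros) auto
  qed
  have tp: "0 < t s" for s by (simp add: t_def)
  obtain T where T: "\<And>s. (T has_real_derivative t s) (at s)" "T 0 = 0"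
    using continuous_antiderivative[OF ct] by blast
  have clamp: "max (- r) (min r s) = s" if "\<bar>s\<bar> \<le> r" for s
    using that by (auto simp: abs_le_iff min_absorb2 intro!: max_absorb2)
  have tQ: "t s = exp (pi * (Q s)\<^sup>2) / 2" if "\<bar>s\<bar> \<le> r" for s
    unfolding t_def clamp[OF that] ..
  have TQ: "T s = Q s" if s: "\<bar>s\<bar> \<le> r" for s
  proof -
    have d: "((\<lambda>s. T s - Q s) has_real_derivative 0) (at s)" if "\<bar>s\<bar> \<le> r" for s
    proof -
      have "\<bar>s\<bar> < 1" using that r by simp
      from DERIV_diff[OF T(1) dQ[OF this]] show ?thesis unfolding tQ[OF that] by simp
    qed
    have "T s - Q s = T (- r) - Q (- r)" if "\<bar>s\<bar> \<le> r" for s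
    proof (rule DERIV_isconst2[of "- r" r])
      show "continuous_on {-r..r} (\<lambda>s. T s - Q s)"
        by (intro continuous_at_imp_continuous_on ballI DERIV_isCont[OF d]) auto
      show "((\<lambda>s. T s - Q s) has_real_derivative 0) (at x)" if "- r < x" "x < r" for x
        by (rule d) (use that in auto)
    qed (use that r in auto)
    from this[of s] this[of 0] s r show ?thesis using T(2) Q0 by simp
  qed
  have lnt: "ln (t s) = pi * (T s)\<^sup>2 - ln 2" if s: "\<bar>s\<bar> \<le> r" for s
    unfolding tQ[OF s] TQ[OF s] by (simp add: ln_div)
  have Plip: "P b - P a \<le> b - a" if "a \<le> b" for a b
  proof (cases "a = b")
    case False
    then have "a < b" using that by simp
    from MVT2[OF this, of P "\<lambda>t. exp (- pi * t\<^sup>2)"] P(1)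
    obtain z where z: "P b - P a = (b - a) * exp (- pi * z\<^sup>2)" by auto
    have "exp (- pi * z\<^sup>2) \<le> 1" by simp
    then show ?thesis unfolding z using \<open>a < b\<close> by (simp add: mult_left_le)
  qed simp
  have Qlip: "(b - a) / 2 \<le> Q b - Q a" if "\<bar>a\<bar> < 1" "\<bar>b\<bar> < 1" "a \<le> b" for a b
    using Plip[OF Qmono[OF that]] PQ[OF that(1)] PQ[OF that(2)] by (simp add: field_simps)
  have Qle: "Q s \<le> s" if s: "0 \<le> s" "s \<le> 1 / 8" for s
  proof -
    have "s / 2 \<le> P s"
    proof (cases "s = 0")
      case False
      then have "0 < s" using s by simp
      from MVT2[OF this, of P "\<lambda>t. exp (- pi * t\<^sup>2)"] P(1)
      obtain z where z: "0 < z" "z < s" "P s - P 0 = (s - 0) * exp (- pi * z\<^sup>2)" by auto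
      have "z\<^sup>2 \<le> (1 / 8)\<^sup>2" using z s by (intro power_mono) auto
      then have "pi * z\<^sup>2 \<le> 4 * (1 / 8)\<^sup>2" using pi_less_4 by (intro mult_mono) auto
      then have "1 / 2 \<le> 1 - pi * z\<^sup>2" by (simp add: power2_eq_square)
      then have "1 / 2 \<le> exp (- pi * z\<^sup>2)" using exp_ge_gauss_small[of z] by linarith
      then show ?thesis using z P(2) \<open>0 < s\<close> mult_left_mono[of "1/2" "exp (- pi * z\<^sup>2)" s] by simp
    qed (use P(2) in simp)
    then have "P (Q s) \<le> P s" using PQ[of s] s by simp
    then show ?thesis using le by simp
  qed
  have Tabs: "(T s)\<^sup>2 = (Q \<bar>s\<bar>)\<^sup>2" if "\<bar>s\<bar> \<le> 1 / 8" for s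
    using TQ[of s] Qodd[of s] that r by (cases "0 \<le> s") auto
  have key: "((a\<^sup>2 - b\<^sup>2) / 2)\<^sup>2 \<le> (ln (t a) - ln (t b))\<^sup>2" if ab: "\<bar>b\<bar> \<le> \<bar>a\<bar>" "\<bar>a\<bar> \<le> 1 / 8" for a b
  proof -
    have b: "\<bar>b\<bar> \<le> 1 / 8" using ab by simp
    have 1: "(\<bar>a\<bar> - \<bar>b\<bar>) / 2 \<le> Q \<bar>a\<bar> - Q \<bar>b\<bar>" using Qlip[of "\<bar>b\<bar>" "\<bar>a\<bar>"] ab b by simp
    have 2: "\<bar>a\<bar> / 2 \<le> Q \<bar>a\<bar>" "\<bar>b\<bar> / 2 \<le> Q \<bar>b\<bar>" using Qlip[of 0 "\<bar>a\<bar>"] Qlip[of 0 "\<bar>b\<bar>"] ab b Q0 by auto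
    have "(\<bar>a\<bar> - \<bar>b\<bar>) / 2 * ((\<bar>a\<bar> + \<bar>b\<bar>) / 2) \<le> (Q \<bar>a\<bar> - Q \<bar>b\<bar>) * (Q \<bar>a\<bar> + Q \<bar>b\<bar>)"
      using 1 2 ab by (intro mult_mono) auto
    then have A: "(a\<^sup>2 - b\<^sup>2) / 4 \<le> (Q \<bar>a\<bar>)\<^sup>2 - (Q \<bar>b\<bar>)\<^sup>2"
      by (simp add: power2_eq_square algebra_simps)
    have nn: "0 \<le> a\<^sup>2 - b\<^sup>2" using ab(1) by (simp add: abs_le_square_iff)
    have "(a\<^sup>2 - b\<^sup>2) / 2 = 2 * ((a\<^sup>2 - b\<^sup>2) / 4)" by simp
    also have "\<dots> \<le> pi * ((Q \<bar>a\<bar>)\<^sup>2 - (Q \<bar>b\<bar>)\<^sup>2)"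
      using A nn pi_ge_two by (intro mult_mono) auto
    also have "\<dots> = ln (t a) - ln (t b)"
      using lnt[of a] lnt[of b] ab b r Tabs[of a] Tabs[of b] by (simp add: algebra_simps)
    finally show ?thesis using nn by (intro power_mono) auto
  qed
  have key2: "- (4 * \<bar>b\<bar>) \<le> ln (t a) - ln (t b)" if "\<bar>a\<bar> \<le> 1 / 8" "\<bar>b\<bar> \<le> 1 / 8" for a b
  proof -
    have "0 \<le> Q \<bar>b\<bar>" "Q \<bar>b\<bar> \<le> \<bar>b\<bar>" using Qlip[of 0 "\<bar>b\<bar>"] Q0 Qle[of "\<bar>b\<bar>"] that by auto
    then have "(Q \<bar>b\<bar>)\<^sup>2 \<le> \<bar>b\<bar>\<^sup>2" by (intro power_mono)
    also have "\<bar>b\<bar>\<^sup>2 \<le> \<bar>b\<bar>" unfolding power2_eq_square using that by (intro mult_left_le) auto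
    finally have "pi * (Q \<bar>b\<bar>)\<^sup>2 \<le> 4 * \<bar>b\<bar>" using pi_less_4 by (intro mult_mono) auto
    moreover have "0 \<le> pi * (T a)\<^sup>2" by simp
    moreover have "ln (t a) - ln (t b) = pi * (T a)\<^sup>2 - pi * (Q \<bar>b\<bar>)\<^sup>2"
      using lnt[of a] lnt[of b] that r Tabs[of b] by simp
    ultimately show ?thesis by linarith
  qed
  show ?thesis
  proof (rule that[OF T(1) ct tp lnt])
    show "((a\<^sup>2 - b\<^sup>2) / 2)\<^sup>2 \<le> (ln (t a) - ln (t b))\<^sup>2" if "\<bar>a\<bar> \<le> 1 / 8" "\<bar>b\<bar> \<le> 1 / 8" for a b
    proof (cases "\<bar>b\<bar> \<le> \<bar>a\<bar>")
      case False
      have "((a\<^sup>2 - b\<^sup>2) / 2)\<^sup>2 = ((b\<^sup>2 - a\<^sup>2) / 2)\<^sup>2" by (simp add: power2_commute power_divide)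
      also have "\<dots> \<le> (ln (t b) - ln (t a))\<^sup>2" using key[of a b] that False by auto
      finally show ?thesis by (simp add: power2_commute)
    qed (use key that in auto)
  qed (use key2 in auto)
qed

text \<open>
  The map that carries the Gaussian to the density \<open>exp (- \<bar>x\<bar>) / 2\<close> is the
  odd function with \<open>S x = - ln (1 - 2 * P x)\<close> for \<open>x \<ge> 0\<close>. It is
  introduced as the primitive of its slope, an even continuous function, so that differentiability
  at \<open>0\<close> is immediate. The last two properties play the same role as in
  \<open>uniform_to_gauss\<close>.
\<close>

lemma gauss_to_exponential:
  obtains S s where "\<And>x. (S has_real_derivative s x) (at x)" "continuous_on UNIV s" "\<And>x. 0 < s x"
    "\<And>x. ln (s x) = ln 2 - pi * x\<^sup>2 + \<bar>S x\<bar>"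
    "\<And>a b. \<bar>a\<bar> \<le> 1 / 8 \<Longrightarrow> \<bar>b\<bar> \<le> 1 / 8 \<Longrightarrow> ((a\<^sup>2 - b\<^sup>2) / 2)\<^sup>2 \<le> (ln (s a) - ln (s b))\<^sup>2"
    "\<And>a b. \<bar>a\<bar> \<le> 1 / 8 \<Longrightarrow> \<bar>b\<bar> \<le> 1 / 8 \<Longrightarrow> - (4 * \<bar>b\<bar>) \<le> ln (s a) - ln (s b)"
proof -
  obtain P where P: "\<And>t. (P has_real_derivative exp (- pi * t\<^sup>2)) (at t)" "P 0 = 0"
    "strict_mono P" "\<And>t. P (- t) = - P t" "\<And>t. \<bar>P t\<bar> < 1 / 2" "\<And>y. \<bar>y\<bar> < 1 / 2 \<Longrightarrow> \<exists>t. P t = y"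
    by (rule gauss_primitive) blast
  have le: "P a \<le> P b \<longleftrightarrow> a \<le> b" for a b using strict_mono_less_eq[OF P(3)] .
  have Pp: "0 < 1 - 2 * P x" for x using P(5)[of x] by (auto simp: abs_less_iff)
  have cP: "continuous_on UNIV P" by (rule DERIV_continuous_on_UNIV[OF P(1)])
  define s where "s x = 2 * exp (- pi * x\<^sup>2) / (1 - 2 * P \<bar>x\<bar>)" for x
  have cs: "continuous_on UNIV s"
    unfolding s_def using Pp by (intro continuous_intros continuous_on_compose2[OF cP]) (auto simp: less_le)
  have sp: "0 < s x" for x unfolding s_def using Pp by simp
  have seven: "s (- x) = s x" for x by (simp add: s_def)
  obtain S where S: "\<And>x. (S has_real_derivative s x) (at x)" "S 0 = 0"
    using continuous_antiderivative[OF cs] by blast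
  have Sp: "S x = - ln (1 - 2 * P x)" if x: "0 \<le> x" for x
  proof -
    have d: "((\<lambda>x. S x + ln (1 - 2 * P x)) has_real_derivative s y - 2 * exp (- pi * y\<^sup>2) / (1 - 2 * P y)) (at y)" for y
      using Pp[of y] by (auto intro!: derivative_eq_intros S(1) P(1))
    have "S x + ln (1 - 2 * P x) = S 0 + ln (1 - 2 * P 0)" if "0 < x"
    proof (rule DERIV_isconst2[of 0 x])
      show "continuous_on {0..x} (\<lambda>x. S x + ln (1 - 2 * P x))"
        by (intro continuous_at_imp_continuous_on ballI DERIV_isCont[OF d])
      show "((\<lambda>x. S x + ln (1 - 2 * P x)) has_real_derivative 0) (at y)" if "0 < y" for y
        using d[of y] that by (simp add: s_def)
    qed (use that in auto)
    then show ?thesis using S(2) P(2) x by (cases "x = 0") auto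
  qed
  have Sodd: "S (- x) = - S x" for x
  proof -
    have "((\<lambda>t. S t + S (- t)) has_real_derivative 0) (at t)" for t
    proof -
      have "((\<lambda>t. S (- t)) has_real_derivative s (- t) * (- 1)) (at t)"
        by (rule DERIV_chain2[OF S(1)]) (auto intro!: derivative_eq_intros)
      from DERIV_add[OF S(1) this] show ?thesis by (simp add: seven)
    qed
    then have "S x + S (- x) = S 0 + S (- 0)" using DERIV_isconst_all by blast
    then show ?thesis using S(2) by simp
  qed
  have Snn: "0 \<le> S x" if "0 \<le> x" for x
  proof -
    have "0 \<le> P x" using le[of 0 x] P(2) that by simp
    then show ?thesis using Sp[OF that] Pp[of x] by (simp add: ln_le_zero_iff)
  qed
  have Sabs: "\<bar>S x\<bar> = - ln (1 - 2 * P \<bar>x\<bar>)" for x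
    using Sp[of "\<bar>x\<bar>"] Snn[of "\<bar>x\<bar>"] Sodd[of x] by (cases "0 \<le> x") auto
  have lns: "ln (s x) = ln 2 - pi * x\<^sup>2 + \<bar>S x\<bar>" for x
    unfolding Sabs s_def using Pp[of "\<bar>x\<bar>"] by (simp add: ln_div ln_mult)
  have lnabs: "ln (s x) = ln 2 - pi * \<bar>x\<bar>\<^sup>2 + S \<bar>x\<bar>" for x
    using lns[of "\<bar>x\<bar>"] Snn[of "\<bar>x\<bar>"] by (simp add: s_def)
  have s_lo: "7 / 4 \<le> s x" and s_hi: "s x \<le> 4" if x: "0 \<le> x" "x \<le> 1 / 8" for x
  proof -
    have "x\<^sup>2 \<le> (1 / 8)\<^sup>2" using x by (intro power_mono) auto
    then have "pi * x\<^sup>2 \<le> 4 * (1 / 8)\<^sup>2" using pi_less_4 by (intro mult_mono) auto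
    then have e: "7 / 8 \<le> exp (- pi * x\<^sup>2)" using exp_ge_gauss_small[of x] by (simp add: power2_eq_square)
    have P0: "0 \<le> P x" using le[of 0 x] P(2) x by simp
    have P1: "P x \<le> x"
    proof (cases "x = 0")
      case False
      then have "0 < x" using x by simp
      from MVT2[OF this, of P "\<lambda>t. exp (- pi * t\<^sup>2)"] P(1)
      obtain z where z: "P x - P 0 = (x - 0) * exp (- pi * z\<^sup>2)" by auto
      have "exp (- pi * z\<^sup>2) \<le> 1" by simp
      then show ?thesis using z P(2) \<open>0 < x\<close> by (simp add: mult_left_le)
    qed (use P(2) in simp)
    have d: "3 / 4 \<le> 1 - 2 * P x" "1 - 2 * P x \<le> 1" using P0 P1 x by auto
    have "7 / 4 * (1 - 2 * P x) \<le> 7 / 4 * 1" using d by (intro mult_left_mono) auto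
    then show "7 / 4 \<le> s x" using e d x by (simp add: s_def pos_le_divide_eq)
    have "exp (- pi * x\<^sup>2) \<le> 1" by simp
    then have "2 * exp (- pi * x\<^sup>2) \<le> 4 * (1 - 2 * P x)"
      using mult_mono[of 2 4 "exp (- pi * x\<^sup>2)" "4 / 3 * (1 - 2 * P x)"] d
        mult_left_mono[of "exp (- pi * x\<^sup>2)" 1 2] by argo
    then show "s x \<le> 4" using d x by (simp add: s_def pos_divide_le_eq)
  qed
  have Slip: "7 / 4 * (a - b) \<le> S a - S b" "S a - S b \<le> 4 * (a - b)" if ab: "0 \<le> b" "b \<le> a" "a \<le> 1 / 8" for a b
  proof -
    have "7 / 4 * (a - b) \<le> S a - S b \<and> S a - S b \<le> 4 * (a - b)"
    proof (cases "a = b")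
      case False
      then have "b < a" using ab by simp
      from MVT2[OF this, of S s] S(1) obtain z where z: "b < z" "z < a" "S a - S b = (a - b) * s z" by auto
      have "7 / 4 \<le> s z" "s z \<le> 4" using s_lo[of z] s_hi[of z] z ab by auto
      then have "(a - b) * (7 / 4) \<le> (a - b) * s z" "(a - b) * s z \<le> (a - b) * 4"
        using \<open>b < a\<close> by (intro mult_left_mono; simp)+
      then show ?thesis unfolding z(3) by simp
    qed simp
    then show "7 / 4 * (a - b) \<le> S a - S b" "S a - S b \<le> 4 * (a - b)" by auto
  qed
  have key: "(\<bar>a\<bar> - \<bar>b\<bar>) / 2 \<le> ln (s a) - ln (s b)" if ab: "\<bar>b\<bar> \<le> \<bar>a\<bar>" "\<bar>a\<bar> \<le> 1 / 8" for a b
  proof -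
    have "pi * (\<bar>a\<bar> + \<bar>b\<bar>) \<le> 4 * (1 / 4)" using pi_less_4 ab by (intro mult_mono) auto
    then have "(pi * (\<bar>a\<bar> + \<bar>b\<bar>)) * (\<bar>a\<bar> - \<bar>b\<bar>) \<le> 1 * (\<bar>a\<bar> - \<bar>b\<bar>)" using ab by (intro mult_right_mono) auto
    then have "pi * \<bar>a\<bar>\<^sup>2 - pi * \<bar>b\<bar>\<^sup>2 \<le> \<bar>a\<bar> - \<bar>b\<bar>" by (simp add: power2_eq_square algebra_simps)
    then show ?thesis unfolding lnabs using Slip(1)[of "\<bar>b\<bar>" "\<bar>a\<bar>"] ab by simp
  qed
  have key1: "((a\<^sup>2 - b\<^sup>2) / 2)\<^sup>2 \<le> (ln (s a) - ln (s b))\<^sup>2" if ab: "\<bar>b\<bar> \<le> \<bar>a\<bar>" "\<bar>a\<bar> \<le> 1 / 8" for a b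
  proof -
    have "(\<bar>a\<bar> + \<bar>b\<bar>) * (\<bar>a\<bar> - \<bar>b\<bar>) \<le> 1 * (\<bar>a\<bar> - \<bar>b\<bar>)" using ab by (intro mult_right_mono) auto
    then have "a\<^sup>2 - b\<^sup>2 \<le> \<bar>a\<bar> - \<bar>b\<bar>" by (simp add: algebra_simps power2_eq_square)
    then have "(a\<^sup>2 - b\<^sup>2) / 2 \<le> ln (s a) - ln (s b)" using key[OF ab] by simp
    moreover have "0 \<le> a\<^sup>2 - b\<^sup>2" using ab(1) by (simp add: abs_le_square_iff)
    ultimately show ?thesis by (intro power_mono) auto
  qed
  show ?thesis
  proof (rule that[OF S(1) cs sp lns])
    show "((a\<^sup>2 - b\<^sup>2) / 2)\<^sup>2 \<le> (ln (s a) - ln (s b))\<^sup>2" if "\<bar>a\<bar> \<le> 1 / 8" "\<bar>b\<bar> \<le> 1 / 8" for a b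
    proof (cases "\<bar>b\<bar> \<le> \<bar>a\<bar>")
      case False
      have "((a\<^sup>2 - b\<^sup>2) / 2)\<^sup>2 = ((b\<^sup>2 - a\<^sup>2) / 2)\<^sup>2" by (simp add: power2_commute power_divide)
      also have "\<dots> \<le> (ln (s b) - ln (s a))\<^sup>2" using key1[of a b] that False by auto
      finally show ?thesis by (simp add: power2_commute)
    qed (use key1 that in auto)
    show "- (4 * \<bar>b\<bar>) \<le> ln (s a) - ln (s b)" if "\<bar>a\<bar> \<le> 1 / 8" "\<bar>b\<bar> \<le> 1 / 8" for a b
    proof -
      have "ln (s 0) \<le> ln (s a)" using key[of 0 a] that by simp
      moreover have "ln (s b) - ln (s 0) \<le> 4 * \<bar>b\<bar>"
      proof -
        have "ln (s b) - ln (s 0) = (S \<bar>b\<bar> - S 0) - pi * \<bar>b\<bar>\<^sup>2" by (simp add: lnabs)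
        also have "\<dots> \<le> S \<bar>b\<bar> - S 0" by simp
        also have "\<dots> \<le> 4 * (\<bar>b\<bar> - 0)" by (rule Slip(2)) (use that in auto)
        finally show ?thesis by simp
      qed
      ultimately show ?thesis by simp
    qed
  qed
qed

section \<open>Support, polar body and hull\<close>

lemma vnorm_sqrt: "vnorm n x = sqrt (ip n x x)"
  by (simp add: vnorm_def L2_set_def ip_def power2_eq_square)

lemma vnorm_triangle: "vnorm n (\<lambda>i. u i - w i) \<le> vnorm n (\<lambda>i. u i - v i) + vnorm n (\<lambda>i. v i - w i)"
  unfolding vnorm_def
  using L2_set_triangle_ineq[of "\<lambda>i. u i - v i" "\<lambda>i. v i - w i" "{..<n}"] by simp

lemma ip_continuous_on [continuous_intros]:
  assumes "continuous_on S f" "continuous_on S g"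
  shows "continuous_on S (\<lambda>x. ip n (f x) (g x))"
  unfolding ip_def
  by (intro continuous_intros continuous_on_product_then_coordinatewise[OF assms(1)]
        continuous_on_product_then_coordinatewise[OF assms(2)])

lemma continuous_on_lam [continuous_intros]:
  assumes "\<And>i. i < n \<Longrightarrow> continuous_on S (\<lambda>x. f x i)"
  shows "continuous_on S (\<lambda>x. \<lambda>i\<in>{..<n}. f x i)"
proof (rule continuous_on_coordinatewise_then_product)
  fix i show "continuous_on S (\<lambda>x. (\<lambda>i\<in>{..<n}. f x i) i)"
    using assms[of i] by (cases "i < n") auto
qed

lemma vneg_in_Rn [simp]: "vneg n x \<in> Rn n"
  by (simp add: vneg_def)

lemma ip_vneg [simp]: "ip n (vneg n x) y = - ip n x y" "ip n x (vneg n y) = - ip n x y"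
  by (auto simp: ip_def vneg_def sum_negf)

lemma vneg_vneg: "x \<in> Rn n \<Longrightarrow> vneg n (vneg n x) = x"
  by (rule Rn_ext[of _ n]) (auto simp: vneg_def)

lemma ip_lam [simp]: "ip n (\<lambda>i\<in>{..<n}. f i) y = ip n f y" "ip n x (\<lambda>i\<in>{..<n}. f i) = ip n x f"
  by (auto simp: ip_def)

lemma ip_scale [simp]: "ip n (\<lambda>i. c * x i) y = c * ip n x y" "ip n x (\<lambda>i. c * y i) = c * ip n x y"
  by (auto simp: ip_def sum_distrib_left mult_ac)

lemma ip_div [simp]: "ip n (\<lambda>i. x i / c) y = ip n x y / c" "ip n x (\<lambda>i. y i / c) = ip n x y / c"
  by (auto simp: ip_def sum_divide_distrib)

locale even_isotropic = isotropic_measure +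
  assumes even: "even_measure n \<mu>" and n_pos: "1 \<le> n"
begin

abbreviation X :: "rvec set" where "X \<equiv> supp n \<mu>"
abbreviation K :: "rvec set" where "K \<equiv> Z_inf_polar n \<mu>"
abbreviation Z :: "rvec set" where "Z \<equiv> Z_inf n \<mu>"

definition sball :: "rvec \<Rightarrow> real \<Rightarrow> rvec set" where
  "sball u r = {v \<in> usphere n. vnorm n (\<lambda>i. u i - v i) < r}"

lemma sball_sets [measurable]: "sball u r \<in> sets \<mu>"
proof -
  have "{v \<in> space \<mu>. sqrt (\<Sum>i<n. (u i - v i)\<^sup>2) < r} \<in> sets \<mu>" by measurable
  then show ?thesis by (simp add: sball_def vnorm_def L2_set_def)
qed

lemma X_iff: "u \<in> X \<longleftrightarrow> u \<in> usphere n \<and> (\<forall>r>0. emeasure \<mu> (sball u r) > 0)"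
  by (simp add: supp_def sball_def)

lemma X_usphere: "u \<in> X \<Longrightarrow> u \<in> usphere n"
  by (simp add: X_iff)

lemma X_Rn: "u \<in> X \<Longrightarrow> u \<in> Rn n"
  using X_usphere usphere_Rn by blast

definition null_balls :: "rvec set set" where
  "null_balls = {{v. vnorm n (\<lambda>i. u i - v i) < r} | u r. 0 < r \<and> emeasure \<mu> (sball u r) = 0}"

lemma open_null_balls: "B \<in> null_balls \<Longrightarrow> open B"
proof -
  have c: "continuous_on UNIV (\<lambda>v. vnorm n (\<lambda>i. u i - v i))" for u
    unfolding vnorm_def L2_set_def
    by (intro continuous_intros continuous_on_product_coordinates)
  show "B \<in> null_balls \<Longrightarrow> open B"
    unfolding null_balls_def by (auto intro!: open_Collect_less c continuous_on_const)
qed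

lemma X_eq: "X = usphere n - \<Union> null_balls"
proof (intro Set.set_eqI iffI)
  fix v assume v: "v \<in> X"
  have "v \<notin> B" if "B \<in> null_balls" for B
  proof
    assume "v \<in> B"
    with that obtain u r where ur: "emeasure \<mu> (sball u r) = 0" "vnorm n (\<lambda>i. u i - v i) < r"
      by (auto simp: null_balls_def)
    define s where "s = r - vnorm n (\<lambda>i. u i - v i)"
    have "sball v s \<subseteq> sball u r"
    proof
      fix w assume "w \<in> sball v s"
      then show "w \<in> sball u r" using vnorm_triangle[of n u w v] by (auto simp: sball_def s_def)
    qed
    then have "emeasure \<mu> (sball v s) \<le> emeasure \<mu> (sball u r)" by (intro emeasure_mono) auto
    moreover have "emeasure \<mu> (sball v s) > 0" using v ur(2) by (auto simp: X_iff s_def)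
    ultimately show False using ur(1) by simp
  qed
  then show "v \<in> usphere n - \<Union> null_balls" using v X_usphere by blast
next
  fix v assume v: "v \<in> usphere n - \<Union> null_balls"
  have "emeasure \<mu> (sball v r) > 0" if r: "0 < r" for r
  proof (rule ccontr)
    assume "\<not> ?thesis"
    then have "{w. vnorm n (\<lambda>i. v i - w i) < r} \<in> null_balls" using r by (auto simp: null_balls_def)
    moreover have "v \<in> {w. vnorm n (\<lambda>i. v i - w i) < r}" using r by (simp add: vnorm_def L2_set_def)
    ultimately show False using v by blast
  qed
  then show "v \<in> X" using v by (simp add: X_iff)
qed

text \<open>
  The complement of the support is a union of open balls of measure zero, and by the Lindelof
  property countably many of them suffice.
\<close>

lemma AE_X: "AE u in \<mu>. u \<in> X"
proof -
  obtain F where F: "F \<subseteq> null_balls" "countable F" "\<Union> F = \<Union> null_balls"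
    using Lindelof[OF open_null_balls] by metis
  have "AE v in \<mu>. \<forall>B\<in>F. v \<notin> B"
  proof (subst AE_ball_countable[OF F(2)], intro ballI)
    fix B assume "B \<in> F"
    then obtain u r where ur: "emeasure \<mu> (sball u r) = 0" "B = {v. vnorm n (\<lambda>i. u i - v i) < r}"
      using F(1) by (auto simp: null_balls_def)
    have "sball u r \<in> null_sets \<mu>" using ur(1) by (intro null_setsI) auto
    then have "AE v in \<mu>. v \<notin> sball u r" by (rule AE_not_in)
    then show "AE v in \<mu>. v \<notin> B"
      using AE_space by eventually_elim (auto simp: ur(2) sball_def)
  qed
  then show ?thesis
    using AE_space
  proof eventually_elim
    case (elim v)
    then show ?case using F(3) by (auto simp: X_eq)
  qed
qed

lemma compact_X: "compact X"
proof -
  have "closed (usphere n)"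
  proof -
    have "usphere n = Rn n \<inter> {x. ip n x x = 1}"
      by (auto simp: usphere_def vnorm_sqrt)
    also have "closed \<dots>"
      by (intro closed_Int closed_Rn closed_Collect_eq continuous_intros)
    finally show ?thesis .
  qed
  moreover have "open (\<Union> null_balls)" by (intro open_Union ballI open_null_balls)
  ultimately have cl: "closed X" unfolding X_eq by (intro closed_Diff)
  have "X \<subseteq> {x \<in> Rn n. \<forall>i<n. \<bar>x i\<bar> \<le> 1}"
    using X_usphere X_Rn coord_le_1 by auto
  then have "X = X \<inter> {x \<in> Rn n. \<forall>i<n. \<bar>x i\<bar> \<le> 1}" by blast
  also have "compact \<dots>" by (rule closed_Int_compact[OF cl compact_box])
  finally show ?thesis .
qed

lemma vneg_usphere: "u \<in> usphere n \<Longrightarrow> vneg n u \<in> usphere n"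
  by (auto simp: usphere_def vnorm_sqrt)

lemma X_sym: "u \<in> X \<Longrightarrow> vneg n u \<in> X"
proof -
  assume u: "u \<in> X"
  have nn: "vnorm n (\<lambda>i. vneg n a i - vneg n b i) = vnorm n (\<lambda>i. a i - b i)" for a b
    unfolding vnorm_def L2_set_def by (simp add: vneg_def power2_commute)
  have "sball (vneg n u) r = vneg n ` sball u r" for r
  proof (intro Set.set_eqI iffI)
    fix v assume v: "v \<in> sball (vneg n u) r"
    then have vR: "v \<in> Rn n" "v \<in> usphere n" using usphere_Rn by (auto simp: sball_def)
    have "vnorm n (\<lambda>i. u i - vneg n v i) = vnorm n (\<lambda>i. vneg n u i - v i)"
      using nn[of u "vneg n v"] vneg_vneg[OF vR(1)] by simp
    then have "vneg n v \<in> sball u r" using v vneg_usphere by (auto simp: sball_def)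
    then show "v \<in> vneg n ` sball u r" using vneg_vneg[OF vR(1)] by (metis imageI)
  next
    fix v assume "v \<in> vneg n ` sball u r"
    then show "v \<in> sball (vneg n u) r" using vneg_usphere nn by (auto simp: sball_def)
  qed
  then have "emeasure \<mu> (sball (vneg n u) r) = emeasure \<mu> (sball u r)" for r
    using even by (simp add: even_measure_def)
  then show ?thesis using u vneg_usphere by (auto simp: X_iff)
qed

lemma K_iff: "x \<in> K \<longleftrightarrow> x \<in> Rn n \<and> (\<forall>u\<in>X. ip n x u \<le> 1)"
  by (simp add: Z_inf_polar_def)

lemma K_abs: "x \<in> K \<Longrightarrow> u \<in> X \<Longrightarrow> \<bar>ip n x u\<bar> \<le> 1"
  using X_sym[of u] by (auto simp: K_iff abs_le_iff)

text \<open>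
  Integrate the squared inner products and use isotropy.
\<close>

lemma abs_ip_bound_norm:
  assumes "\<And>u. u \<in> X \<Longrightarrow> \<bar>ip n x u\<bar> \<le> 1"
  shows "ip n x x \<le> n"
proof -
  have "ip n x x = (\<integral>u. (ip n x u)\<^sup>2 \<partial>\<mu>)" by (simp add: integral_ip_sq_one)
  also have "\<dots> \<le> (\<integral>u. 1 \<partial>\<mu>)"
  proof (rule integral_mono_AE)
    show "AE u in \<mu>. (ip n x u)\<^sup>2 \<le> 1"
      using AE_X by eventually_elim (use assms abs_square_le_1 in auto)
  qed (auto intro!: bmeas_integrable bmeas_power bmeas_ip)
  finally show ?thesis by (simp add: total_mass)
qed

lemma K_norm: "x \<in> K \<Longrightarrow> ip n x x \<le> n"
  by (rule abs_ip_bound_norm) (rule K_abs)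

lemma K_coord: "y \<in> K \<Longrightarrow> i < n \<Longrightarrow> \<bar>y i\<bar> \<le> n"
proof -
  assume y: "y \<in> K" and i: "i < n"
  have "(y i)\<^sup>2 \<le> n" using sq_coord_le_ip[OF i, of y] K_norm[OF y] by simp
  also have "real n \<le> (real n)\<^sup>2" using n_pos by (simp add: power2_eq_square)
  finally show "\<bar>y i\<bar> \<le> n" by (simp add: abs_le_square_iff[symmetric])
qed

lemma K_sets [measurable]: "K \<in> sets (Leb n)"
proof -
  have "closed {x. \<forall>u\<in>X. ip n x u \<le> 1}"
    unfolding Collect_ball_eq by (intro closed_INT ballI closed_Collect_le continuous_intros)
  from closed_sets_Leb[OF this, of n] show ?thesis by (simp add: Z_inf_polar_def)
qed

lemma zero_K: "(\<lambda>i\<in>{..<n}. 0) \<in> K"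
  by (simp add: K_iff) (simp add: ip_def)

text \<open>
  The support function of the polar body, which is the gauge of the hull up to closure.
\<close>

definition hK :: "rvec \<Rightarrow> real" where
  "hK z = (SUP y\<in>K. ip n y z)"

lemma hK_bdd: "bdd_above ((\<lambda>y. ip n y z) ` K)"
proof (rule bdd_aboveI2)
  fix y assume y: "y \<in> K"
  have "ip n y z \<le> (\<Sum>i<n. \<bar>y i\<bar> * \<bar>z i\<bar>)"
    unfolding ip_def by (intro sum_mono) (metis abs_ge_self abs_mult)
  also have "\<dots> \<le> (\<Sum>i<n. n * \<bar>z i\<bar>)"
    by (intro sum_mono mult_right_mono K_coord y) auto
  finally show "ip n y z \<le> (\<Sum>i<n. n * \<bar>z i\<bar>)" .
qed

lemma hK_upper: "y \<in> K \<Longrightarrow> ip n y z \<le> hK z"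
  unfolding hK_def by (rule cSUP_upper[OF _ hK_bdd])

lemma hK_le: "(\<And>y. y \<in> K \<Longrightarrow> ip n y z \<le> c) \<Longrightarrow> hK z \<le> c"
  unfolding hK_def using zero_K by (intro cSUP_least) auto

lemma hK_le_iff: "hK z \<le> c \<longleftrightarrow> (\<forall>y\<in>K. ip n y z \<le> c)"
  using hK_upper hK_le by (meson order_trans)

lemma hK_nonneg: "0 \<le> hK z"
  using hK_upper[OF zero_K, of z] by (simp add: ip_def)

lemma hK_div: "r > 0 \<Longrightarrow> hK (\<lambda>i\<in>{..<n}. z i / r) = hK z / r"
proof (rule antisym)
  assume r: "r > 0"
  show "hK (\<lambda>i\<in>{..<n}. z i / r) \<le> hK z / r"
    by (rule hK_le) (use r hK_upper in \<open>auto intro!: divide_right_mono\<close>)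
  have "hK z \<le> r * hK (\<lambda>i\<in>{..<n}. z i / r)"
  proof (rule hK_le)
    fix y assume "y \<in> K"
    from hK_upper[OF this, of "\<lambda>i\<in>{..<n}. z i / r"]
    show "ip n y z \<le> r * hK (\<lambda>i\<in>{..<n}. z i / r)" using r by (simp add: field_simps)
  qed
  then show "hK z / r \<le> hK (\<lambda>i\<in>{..<n}. z i / r)" using r by (simp add: field_simps)
qed

lemma hK_measurable [measurable]: "hK \<in> borel_measurable (Leb n)"
proof (rule borel_measurableI_le)
  fix c
  have "closed {z. \<forall>y\<in>K. ip n y z \<le> c}"
    unfolding Collect_ball_eq by (intro closed_INT ballI closed_Collect_le continuous_intros)
  from closed_sets_Leb[OF this, of n] show "{z \<in> space (Leb n). hK z \<le> c} \<in> sets (Leb n)"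
    by (simp add: hK_le_iff)
qed

lemma hK_lipschitz:
  fixes d :: real
  assumes "\<And>i. i < n \<Longrightarrow> \<bar>z i - z' i\<bar> \<le> d" "0 \<le> d"
  shows "hK z \<le> hK z' + n * n * d"
proof (rule hK_le)
  fix y assume y: "y \<in> K"
  have "ip n y z = ip n y z' + ip n y (\<lambda>i. z i - z' i)" by (simp add: ip_minus_right)
  also have "ip n y (\<lambda>i. z i - z' i) \<le> (\<Sum>i<n. n * d)"
    unfolding ip_def
  proof (rule sum_mono)
    fix i assume i: "i \<in> {..<n}"
    have "y i * (z i - z' i) \<le> \<bar>y i\<bar> * \<bar>z i - z' i\<bar>" by (metis abs_ge_self abs_mult)
    also have "\<dots> \<le> n * d" using i by (intro mult_mono K_coord y assms) auto
    finally show "y i * (z i - z' i) \<le> n * d" .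
  qed
  finally show "ip n y z \<le> hK z' + n * n * d" using hK_upper[OF y, of z'] by simp
qed

lemma convex_RnD: "convex_Rn n C \<Longrightarrow> x \<in> C \<Longrightarrow> y \<in> C \<Longrightarrow> 0 \<le> a \<Longrightarrow> 0 \<le> b \<Longrightarrow> a + b = 1 \<Longrightarrow>
  (\<lambda>i\<in>{..<n}. a * x i + b * y i) \<in> C"
  unfolding convex_Rn_def by blast

lemma convex_Rn_Rn: "convex_Rn n (Rn n)"
  by (simp add: convex_Rn_def)

lemma Z_convex: "convex_Rn n Z"
proof -
  have "convex_Rn n (\<Inter>S)" if "S \<noteq> {}" "\<And>C. C \<in> S \<Longrightarrow> convex_Rn n C" for S :: "rvec set set"
  proof -
    have "\<Inter>S \<subseteq> Rn n" using that unfolding convex_Rn_def by blast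
    moreover have "(\<lambda>i\<in>{..<n}. a * x i + b * y i) \<in> \<Inter>S"
      if "x \<in> \<Inter>S" "y \<in> \<Inter>S" "0 \<le> a" "0 \<le> b" "a + b = 1" for x y a b
      using that \<open>\<And>C. C \<in> S \<Longrightarrow> convex_Rn n C\<close> convex_RnD by (auto simp del: restrict_apply)
    ultimately show ?thesis unfolding convex_Rn_def by blast
  qed
  from this[of "{C. convex_Rn n C \<and> X \<subseteq> C}"] show ?thesis
    unfolding Z_inf_def hull_def using convex_Rn_Rn X_Rn by blast
qed

lemma X_subset_Z: "X \<subseteq> Z"
  unfolding Z_inf_def by (rule hull_subset)

lemma Z_least: "convex_Rn n C \<Longrightarrow> X \<subseteq> C \<Longrightarrow> Z \<subseteq> C"
  unfolding Z_inf_def by (rule hull_minimal)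

lemma Z_Rn: "Z \<subseteq> Rn n"
  using Z_convex by (simp add: convex_Rn_def)

text \<open>
  Iterated joining of pairs of points exhausts the hull, and every stage is compact. So
  \<open>Z\<close> is a countable union of compact sets and measurable.
\<close>

primrec Zk :: "nat \<Rightarrow> rvec set" where
  "Zk 0 = X"
| "Zk (Suc k) = (\<lambda>(a, x, y). \<lambda>i\<in>{..<n}. (1 - a) * x i + a * y i) ` ({0..1} \<times> Zk k \<times> Zk k)"

lemma Zk_Rn: "Zk k \<subseteq> Rn n"
  by (cases k) (auto simp: X_Rn simp del: restrict_apply)

lemma Zk_mono: "Zk k \<subseteq> Zk (Suc k)"
proof
  fix x assume x: "x \<in> Zk k"
  then have "x = (\<lambda>(a, x, y). \<lambda>i\<in>{..<n}. (1 - a) * x i + a * y i) (0, x, x)"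
    using Zk_Rn[of k] by auto
  then show "x \<in> Zk (Suc k)" using x unfolding Zk.simps by (intro image_eqI[where x = "(0, x, x)"]) auto
qed

lemma Zk_compact: "compact (Zk k)"
proof (induction k)
  case 0
  then show ?case by (simp add: compact_X)
next
  case (Suc k)
  have "continuous_on UNIV (\<lambda>(a, x, y). \<lambda>i\<in>{..<n}. (1 - a) * x i + a * (y :: rvec) i)"
  proof -
    have "continuous_on UNIV (\<lambda>p :: real \<times> rvec \<times> rvec. fst (snd p) i)" "continuous_on UNIV (\<lambda>p :: real \<times> rvec \<times> rvec. snd (snd p) i)" for i
      by (rule continuous_on_product_then_coordinatewise, intro continuous_on_fst continuous_on_snd continuous_on_id)+
    then show ?thesis
      unfolding case_prod_beta
      by (intro continuous_on_lam continuous_on_add continuous_on_mult continuous_on_diff continuous_on_const continuous_on_fst continuous_on_id)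
  qed
  then show ?case
    unfolding Zk.simps
    by (intro compact_continuous_image compact_Times Suc compact_Icc) (blast intro: continuous_on_subset)
qed

lemma Z_eq_Zk: "Z = (\<Union>k. Zk k)"
proof
  have mono: "Zk j \<subseteq> Zk k" if "j \<le> k" for j k
    using lift_Suc_mono_le[of Zk, OF Zk_mono that] .
  show "Z \<subseteq> (\<Union>k. Zk k)"
  proof (rule Z_least)
    show "X \<subseteq> (\<Union>k. Zk k)" using Zk.simps(1) by blast
    show "convex_Rn n (\<Union>k. Zk k)"
      unfolding convex_Rn_def
    proof (intro conjI ballI allI impI)
      show "(\<Union>k. Zk k) \<subseteq> Rn n" using Zk_Rn by blast
      fix x y a b assume xy: "x \<in> (\<Union>k. Zk k)" "y \<in> (\<Union>k. Zk k)" and ab: "0 \<le> a" "0 \<le> b" "a + b = (1::real)"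
      then obtain j k where jk: "x \<in> Zk j" "y \<in> Zk k" by blast
      then have m: "x \<in> Zk (max j k)" "y \<in> Zk (max j k)" using mono[of j "max j k"] mono[of k "max j k"] by auto
      have a: "a = 1 - b" using ab by simp
      have "(\<lambda>i\<in>{..<n}. a * x i + b * y i) \<in> Zk (Suc (max j k))"
        unfolding Zk.simps a
        by (rule image_eqI[where x = "(b, x, y)"]) (use m ab in auto)
      then show "(\<lambda>i\<in>{..<n}. a * x i + b * y i) \<in> (\<Union>k. Zk k)" by blast
    qed
  qed
  have "Zk k \<subseteq> Z" for k
  proof (induction k)
    case 0
    then show ?case by (simp add: X_subset_Z)
  next
    case (Suc k)
    then show ?case by (auto simp del: restrict_apply intro!: convex_RnD[OF Z_convex])
  qed
  then show "(\<Union>k. Zk k) \<subseteq> Z" by blast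
qed

lemma Z_sets [measurable]: "Z \<in> sets (Leb n)"
proof -
  have "Z = (\<Union>k. {x \<in> Rn n. x \<in> Zk k})" using Z_eq_Zk Zk_Rn by auto
  also have "\<dots> \<in> sets (Leb n)"
    by (intro sets.countable_UN) (auto intro: closed_sets_Leb compact_imp_closed Zk_compact)
  finally show ?thesis .
qed

lemma Z_sym: "x \<in> Z \<Longrightarrow> vneg n x \<in> Z"
proof -
  have "convex_Rn n {x \<in> Rn n. vneg n x \<in> Z}"
    unfolding convex_Rn_def
  proof (intro conjI ballI allI impI)
    fix x y a b assume xy: "x \<in> {x \<in> Rn n. vneg n x \<in> Z}" "y \<in> {x \<in> Rn n. vneg n x \<in> Z}" and ab: "0 \<le> a" "0 \<le> b" "a + b = (1::real)"
    have "vneg n (\<lambda>i\<in>{..<n}. a * x i + b * y i) = (\<lambda>i\<in>{..<n}. a * vneg n x i + b * vneg n y i)"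
      by (auto simp: vneg_def fun_eq_iff)
    also have "\<dots> \<in> Z" using xy ab by (intro convex_RnD[OF Z_convex]) auto
    finally show "(\<lambda>i\<in>{..<n}. a * x i + b * y i) \<in> {x \<in> Rn n. vneg n x \<in> Z}" by (simp del: restrict_apply)
  qed auto
  moreover have "X \<subseteq> {x \<in> Rn n. vneg n x \<in> Z}" using X_Rn X_sym X_subset_Z by blast
  ultimately have "Z \<subseteq> {x \<in> Rn n. vneg n x \<in> Z}" by (rule Z_least)
  then show "x \<in> Z \<Longrightarrow> vneg n x \<in> Z" by blast
qed

lemma X_nonempty: "X \<noteq> {}"
proof
  assume "X = {}"
  then have "AE u in \<mu>. False" using AE_X by simp
  then have "emeasure \<mu> (space \<mu>) = 0" by (simp only: eventually_False ae_filter_eq_bot_iff)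
  then show False using total_mass n_pos by (simp add: measure_def)
qed

lemma zero_Z: "(\<lambda>i\<in>{..<n}. 0) \<in> Z"
proof -
  obtain u where u: "u \<in> X" using X_nonempty by blast
  have "(\<lambda>i\<in>{..<n}. 1 / 2 * u i + 1 / 2 * vneg n u i) \<in> Z"
    by (rule convex_RnD[OF Z_convex]) (use u X_sym X_subset_Z in auto)
  also have "(\<lambda>i\<in>{..<n}. 1 / 2 * u i + 1 / 2 * vneg n u i) = (\<lambda>i\<in>{..<n}. 0)"
    by (auto simp: vneg_def fun_eq_iff)
  finally show ?thesis .
qed

text \<open>
  \<open>Z\<close> is convex and symmetric and contains \<open>0\<close>.
\<close>

lemma Z_combo:
  assumes z: "z1 \<in> Z" "z2 \<in> Z" and ab: "\<bar>a\<bar> + \<bar>b\<bar> \<le> 1"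
  shows "(\<lambda>i\<in>{..<n}. a * z1 i + b * z2 i) \<in> Z"
proof (cases "\<bar>a\<bar> + \<bar>b\<bar> = 0")
  case True
  then have "a = 0" "b = 0" by auto
  then show ?thesis using zero_Z by simp
next
  case False
  define s where "s = \<bar>a\<bar> + \<bar>b\<bar>"
  have s: "0 < s" "s \<le> 1" using False ab by (auto simp: s_def)
  have sg: "\<exists>z'\<in>Z. \<forall>i<n. c * z i = \<bar>c\<bar> * z' i" if "z \<in> Z" for c z
  proof (cases "0 \<le> c")
    case False
    then show ?thesis using Z_sym[OF that] by (intro bexI[of _ "vneg n z"]) (auto simp: vneg_def)
  qed (use that in auto)
  obtain y1 where y1: "y1 \<in> Z" "\<And>i. i < n \<Longrightarrow> a * z1 i = \<bar>a\<bar> * y1 i" using sg[OF z(1)] by blast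
  obtain y2 where y2: "y2 \<in> Z" "\<And>i. i < n \<Longrightarrow> b * z2 i = \<bar>b\<bar> * y2 i" using sg[OF z(2)] by blast
  have 1: "(\<lambda>i\<in>{..<n}. (\<bar>a\<bar> / s) * y1 i + (\<bar>b\<bar> / s) * y2 i) \<in> Z" (is "?w \<in> Z")
    by (rule convex_RnD[OF Z_convex y1(1) y2(1)]) (use s in \<open>auto simp: s_def add_divide_distrib[symmetric]\<close>)
  have "(\<lambda>i\<in>{..<n}. s * ?w i + (1 - s) * (\<lambda>i\<in>{..<n}. 0) i) \<in> Z"
    by (rule convex_RnD[OF Z_convex 1 zero_Z]) (use s in auto)
  also have "(\<lambda>i\<in>{..<n}. s * ?w i + (1 - s) * (\<lambda>i\<in>{..<n}. 0) i) = (\<lambda>i\<in>{..<n}. a * z1 i + b * z2 i)"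
    using s by (auto simp: fun_eq_iff y1(2) y2(2) field_simps)
  finally show ?thesis .
qed

lemma Z_abs_combo:
  assumes "finite I" "\<And>k. k \<in> I \<Longrightarrow> w k \<in> Z"
  shows "\<exists>z\<in>Z. \<forall>i<n. (\<Sum>k\<in>I. \<beta> k * w k i) = (\<Sum>k\<in>I. \<bar>\<beta> k\<bar>) * z i"
  using assms
proof (induction I rule: finite_induct)
  case empty
  then show ?case using zero_Z by auto
next
  case (insert k I)
  then obtain z where z: "z \<in> Z" "\<And>i. i < n \<Longrightarrow> (\<Sum>k\<in>I. \<beta> k * w k i) = (\<Sum>k\<in>I. \<bar>\<beta> k\<bar>) * z i" by auto
  define s where "s = (\<Sum>k\<in>I. \<bar>\<beta> k\<bar>)"
  have s0: "0 \<le> s" unfolding s_def by (intro sum_nonneg) auto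
  show ?case
  proof (cases "\<bar>\<beta> k\<bar> + s = 0")
    case True
    then have "\<beta> k = 0" "s = 0" using s0 by auto
    then show ?thesis using insert.hyps z by (intro bexI[OF _ z(1)]) (auto simp: s_def)
  next
    case False
    let ?t = "\<bar>\<beta> k\<bar> + s"
    have t: "0 < ?t" using False s0 by auto
    have "(\<lambda>i\<in>{..<n}. \<beta> k / ?t * w k i + s / ?t * z i) \<in> Z"
      by (rule Z_combo) (use insert.prems z t s0 in \<open>auto simp: abs_divide add_divide_distrib[symmetric]\<close>)
    moreover have "(\<Sum>k\<in>insert k I. \<beta> k * w k i) = (\<Sum>k\<in>insert k I. \<bar>\<beta> k\<bar>) * (\<lambda>i\<in>{..<n}. \<beta> k / ?t * w k i + s / ?t * z i) i"
      if i: "i < n" for i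
    proof -
      have "?t * (\<beta> k / ?t * w k i + s / ?t * z i) = \<beta> k * w k i + s * z i"
        using t by (simp add: distrib_left)
      then show ?thesis using insert.hyps i z(2)[OF i] by (simp add: s_def)
    qed
    ultimately show ?thesis by blast
  qed
qed

text \<open>
  The mean of \<open>h\<close> under the probability density \<open>rho\<close> is
  \<open>c\<close>, and almost every tuple consists of support vectors.
\<close>

lemma exists_tuple:
  assumes h: "bmeas PW h" and hm: "(\<integral>W. rho W * h W \<partial>PW) = c"
  obtains W where "\<And>k. k < n \<Longrightarrow> W k \<in> X" "rho W > 0" "h W \<le> c"
proof -
  have "\<exists>W\<in>space PW. (\<forall>k<n. W k \<in> X) \<and> rho W > 0 \<and> h W \<le> c"
  proof (rule ccontr)
    assume neg: "\<not> ?thesis"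
    have AEW: "AE W in PW. \<forall>k\<in>{..<n}. W k \<in> X"
    proof (rule AE_finite_allI)
      fix k assume "k \<in> {..<n}"
      then have k: "k < n" by simp
      obtain N where N: "N \<in> null_sets \<mu>" "{u \<in> space \<mu>. u \<notin> X} \<subseteq> N"
        using AE_X unfolding eventually_ae_filter by blast
      have "(\<lambda>W. W k) -` N \<inter> space PW \<in> null_sets PW"
      proof (rule null_setsI)
        show "(\<lambda>W. W k) -` N \<inter> space PW \<in> sets PW"
          using measurable_sets[OF comp_PW[OF k]] N by auto
        have "(\<lambda>W. W k) -` N \<inter> space PW = Pi\<^sub>E {..<n} (\<lambda>i. if i = k then N else space \<mu>)"
        proof (intro Set.set_eqI iffI)
          fix W assume W: "W \<in> Pi\<^sub>E {..<n} (\<lambda>i. if i = k then N else space \<mu>)"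
          have "W i \<in> usphere n" if "i < n" for i
            using PiE_mem[OF W, of i] that sets.sets_into_space[OF null_setsD2[OF N(1)]]
            by (cases "i = k") auto
          moreover have "W k \<in> N" using PiE_mem[OF W, of k] k by simp
          ultimately show "W \<in> (\<lambda>W. W k) -` N \<inter> space PW"
            using W by (auto simp: space_PiM PiE_iff)
        qed (auto simp: space_PiM PiE_iff)
        also have "emeasure PW \<dots> = (\<Prod>i<n. emeasure \<mu> (if i = k then N else space \<mu>))"
          by (rule pm.emeasure_PiM) (use N in auto)
        also have "\<dots> = 0" using k N by (intro prod_zero) auto
        finally show "emeasure PW ((\<lambda>W. W k) -` N \<inter> space PW) = 0" .
      qed
      then have "AE W in PW. W \<notin> (\<lambda>W. W k) -` N \<inter> space PW" by (rule AE_not_in)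
      then show "AE W in PW. W k \<in> X"
        using AE_space
      proof eventually_elim
        case (elim W)
        then show ?case using N(2) space_PW_D[OF elim(2) k] by auto
      qed
    qed simp
    have ae: "AE W in PW. 0 \<le> rho W * (h W - c)"
      using AEW AE_space
    proof eventually_elim
      case (elim W)
      show ?case
      proof (cases "rho W = 0")
        case False
        then have "rho W > 0" using rho_nonneg[of W] by simp
        then have "c < h W" using neg elim by force
        then show ?thesis using \<open>rho W > 0\<close> by simp
      qed simp
    qed
    have int: "integrable PW (\<lambda>W. rho W * (h W - c))"
      by (intro fPW.bmeas_integrable bmeas_mult bmeas_rho bmeas_diff h bmeas_const)
    have "(\<integral>W. rho W * (h W - c) \<partial>PW) = (\<integral>W. rho W * h W - c * rho W \<partial>PW)"
      by (simp add: algebra_simps)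
    also have "\<dots> = (\<integral>W. rho W * h W \<partial>PW) - (\<integral>W. c * rho W \<partial>PW)"
      by (rule Bochner_Integration.integral_diff; intro fPW.bmeas_integrable bmeas_mult bmeas_rho h bmeas_const)
    also have "\<dots> = 0" by (simp add: hm rho_total)
    finally have "AE W in PW. rho W * (h W - c) = 0"
      using integral_nonneg_eq_0_iff_AE[OF int ae] by simp
    then have "AE W in PW. rho W = 0"
      using AEW AE_space
    proof eventually_elim
      case (elim W)
      show ?case
      proof (rule ccontr)
        assume "rho W \<noteq> 0"
        then have "rho W > 0" using rho_nonneg[of W] by simp
        then have "c < h W" using neg elim by force
        then show False using elim(1) \<open>rho W > 0\<close> by simp
      qed
    qed
    then have "(\<integral>W. rho W \<partial>PW) = 0" by (rule integral_eq_zero_AE)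
    then show False using rho_total by simp
  qed
  then show ?thesis using that by blast
qed

text \<open>
  A tuple of positive density is a basis made of support vectors, and small vectors have small
  coefficients in this basis.
\<close>

lemma ball_in_Z: "\<exists>\<sigma>>0. \<forall>x\<in>Rn n. (\<forall>i<n. \<bar>x i\<bar> \<le> \<sigma>) \<longrightarrow> x \<in> Z"
proof -
  obtain W where W: "\<And>k. k < n \<Longrightarrow> W k \<in> X" "rho W > 0"
    using exists_tuple[OF bmeas_const[of PW 1], of 1] rho_total by auto
  have "dt n W \<noteq> 0" using W(2) by (auto simp: rho_def)
  then obtain B where B: "\<And>i j. i < n \<Longrightarrow> j < n \<Longrightarrow> (\<Sum>k<n. B i k * W k j) = idm i j"
    by (rule dt_inverse) blast
  define C where "C = (\<Sum>k<n. \<Sum>i<n. \<bar>B i k\<bar>)"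
  have C0: "0 \<le> C" unfolding C_def by (intro sum_nonneg) auto
  define \<sigma> where "\<sigma> = 1 / (C + 1)"
  have s: "0 < \<sigma>" "\<sigma> * C \<le> 1" using C0 by (auto simp: \<sigma>_def field_simps)
  have "x \<in> Z" if x: "x \<in> Rn n" "\<forall>i<n. \<bar>x i\<bar> \<le> \<sigma>" for x
  proof -
    define \<beta> where "\<beta> k = (\<Sum>i<n. x i * B i k)" for k
    have rep: "(\<Sum>k<n. \<beta> k * W k j) = x j" if j: "j < n" for j
    proof -
      have "(\<Sum>k<n. \<beta> k * W k j) = (\<Sum>i<n. x i * (\<Sum>k<n. B i k * W k j))"
        unfolding \<beta>_def by (simp add: sum_distrib_right sum_distrib_left mult.assoc) (rule sum.swap)
      also have "\<dots> = (\<Sum>i<n. if i = j then x i else 0)" using B j by (intro sum.cong) auto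
      finally show ?thesis using j by simp
    qed
    have "(\<Sum>k<n. \<bar>\<beta> k\<bar>) \<le> (\<Sum>k<n. \<Sum>i<n. \<sigma> * \<bar>B i k\<bar>)"
    proof (rule sum_mono)
      fix k
      have "\<bar>\<beta> k\<bar> \<le> (\<Sum>i<n. \<bar>x i * B i k\<bar>)" unfolding \<beta>_def by (rule sum_abs)
      also have "\<dots> \<le> (\<Sum>i<n. \<sigma> * \<bar>B i k\<bar>)"
        using x(2) by (intro sum_mono) (auto simp: abs_mult intro!: mult_right_mono)
      finally show "\<bar>\<beta> k\<bar> \<le> (\<Sum>i<n. \<sigma> * \<bar>B i k\<bar>)" .
    qed
    also have "\<dots> = \<sigma> * C" by (simp add: C_def sum_distrib_left)
    finally have le: "(\<Sum>k<n. \<bar>\<beta> k\<bar>) \<le> 1" using s by simp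
    obtain z where z: "z \<in> Z" "\<And>i. i < n \<Longrightarrow> (\<Sum>k<n. \<beta> k * W k i) = (\<Sum>k<n. \<bar>\<beta> k\<bar>) * z i"
      using Z_abs_combo[of "{..<n}" W \<beta>] W(1) X_subset_Z by auto
    have "(\<lambda>i\<in>{..<n}. (\<Sum>k<n. \<bar>\<beta> k\<bar>) * z i + 0 * z i) \<in> Z"
      by (rule Z_combo[OF z(1) z(1)]) (use le in \<open>auto simp: abs_of_nonneg sum_nonneg\<close>)
    also have "(\<lambda>i\<in>{..<n}. (\<Sum>k<n. \<bar>\<beta> k\<bar>) * z i + 0 * z i) = x"
      by (rule Rn_ext[of _ n]) (use x(1) z(2) rep in auto)
    finally show ?thesis .
  qed
  then show ?thesis using s by blast
qed

lemma Z_norm: "x \<in> Z \<Longrightarrow> ip n x x \<le> 1"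
proof -
  have "convex_Rn n {x \<in> Rn n. ip n x x \<le> 1}"
    unfolding convex_Rn_def
  proof (intro conjI ballI allI impI)
    fix x y a b assume xy: "x \<in> {x \<in> Rn n. ip n x x \<le> 1}" "y \<in> {x \<in> Rn n. ip n x x \<le> 1}" and ab: "0 \<le> a" "0 \<le> b" "a + b = (1::real)"
    have "0 \<le> ip n (\<lambda>i. x i - y i) (\<lambda>i. x i - y i)" by simp
    then have "2 * ip n x y \<le> 2" using xy by (simp add: ip_minus_left ip_minus_right ip_commute[of n y x])
    then have c: "ip n x y \<le> 1" by simp
    have "ip n (\<lambda>i. a * x i + b * y i) (\<lambda>i. a * x i + b * y i) = a * a * ip n x x + 2 * (a * b) * ip n x y + b * b * ip n y y"
      by (simp add: ip_plus_left ip_plus_right ip_commute[of n y x] algebra_simps)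
    also have "\<dots> \<le> a * a * 1 + 2 * (a * b) * 1 + b * b * 1"
      using ab xy c by (intro add_mono mult_left_mono) auto
    also have "\<dots> = (a + b) * (a + b)" by (simp add: algebra_simps)
    finally show "(\<lambda>i\<in>{..<n}. a * x i + b * y i) \<in> {x \<in> Rn n. ip n x x \<le> 1}" using ab by simp
  qed auto
  moreover have "X \<subseteq> {x \<in> Rn n. ip n x x \<le> 1}" using X_Rn X_usphere ip_usphere by auto
  ultimately have "Z \<subseteq> {x \<in> Rn n. ip n x x \<le> 1}" by (rule Z_least)
  then show "x \<in> Z \<Longrightarrow> ip n x x \<le> 1" by blast
qed

lemma ip_diff_self: "ip n (\<lambda>i. x i - y i) (\<lambda>i. x i - y i) = ip n x x - 2 * ip n x y + ip n y y"
  by (simp add: ip_minus_left ip_minus_right ip_commute[of n y x])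

text \<open>
  The separating hyperplane argument with an approximate instead of a true nearest point: if
  \<open>z\<close> had distance at least \<open>sqrt e\<close> from \<open>Z\<close>, the
  direction from an almost nearest point to \<open>z\<close>, suitably scaled, would be a point of
  the polar body that contradicts \<open>hK z \<le> 1\<close>.
\<close>

lemma approx_by_Z:
  assumes z: "z \<in> Rn n" "hK z \<le> 1" and e: "0 < e"
  shows "\<exists>c\<in>Z. ip n (\<lambda>i. z i - c i) (\<lambda>i. z i - c i) < e"
proof (rule ccontr)
  assume neg: "\<not> ?thesis"
  define q where "q c = ip n (\<lambda>i. z i - c i) (\<lambda>i. z i - c i)" for c
  have far: "e \<le> q c" if "c \<in> Z" for c using neg that by (auto simp: q_def not_less)
  define d where "d = (INF c\<in>Z. q c)"
  have bdd: "bdd_below (q ` Z)" by (rule bdd_belowI2[of _ 0]) (simp add: q_def)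
  have dq: "d \<le> q c" if "c \<in> Z" for c unfolding d_def by (rule cINF_lower[OF bdd that])
  define s where "s = min 1 (e / 8)"
  define \<eta> where "\<eta> = s * e / 2"
  have s: "0 < s" "s \<le> 1" "s \<le> e / 8" using e by (auto simp: s_def)
  have eta: "0 < \<eta>" using s e by (simp add: \<eta>_def)
  have "\<exists>c\<in>Z. q c < d + \<eta>"
  proof (rule ccontr)
    assume "\<not> ?thesis"
    then have "d + \<eta> \<le> d" unfolding d_def using zero_Z by (intro cINF_greatest) (auto simp: not_less d_def)
    then show False using eta by simp
  qed
  then obtain c where c: "c \<in> Z" "q c < d + \<eta>" by blast
  define y where "y = (\<lambda>i\<in>{..<n}. z i - c i)"
  have yq: "ip n y y = q c" by (simp add: y_def q_def)
  have sep: "ip n y c' \<le> ip n y z - e / 2" if c': "c' \<in> Z" for c'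
  proof -
    have w: "(\<lambda>i\<in>{..<n}. (1 - s) * c i + s * c' i) \<in> Z"
      by (rule convex_RnD[OF Z_convex c(1) c']) (use s in auto)
    let ?v = "\<lambda>i. c' i - c i"
    have "q (\<lambda>i\<in>{..<n}. (1 - s) * c i + s * c' i) = ip n (\<lambda>i. y i - s * ?v i) (\<lambda>i. y i - s * ?v i)"
      unfolding q_def ip_def by (intro sum.cong refl) (simp add: y_def algebra_simps)
    also have "\<dots> = q c - 2 * s * ip n y ?v + s\<^sup>2 * ip n ?v ?v"
      unfolding ip_diff_self[of y "\<lambda>i. s * ?v i"] ip_scale yq by (simp add: power2_eq_square)
    finally have "2 * s * ip n y ?v \<le> \<eta> + s\<^sup>2 * ip n ?v ?v"
      using dq[OF w] c(2) by simp
    also have "ip n ?v ?v \<le> 4"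
    proof -
      have "0 \<le> ip n (\<lambda>i. c' i + c i) (\<lambda>i. c' i + c i)" by simp
      then show ?thesis using Z_norm[OF c(1)] Z_norm[OF c']
        by (simp add: ip_minus_left ip_minus_right ip_plus_left ip_plus_right ip_commute[of n c c'])
    qed
    finally have "2 * s * ip n y ?v \<le> \<eta> + s\<^sup>2 * 4" using s by (simp add: mult_left_mono)
    also have "\<dots> = 2 * s * (e / 4 + 2 * s)" by (simp add: \<eta>_def power2_eq_square algebra_simps)
    finally have "ip n y ?v \<le> e / 4 + 2 * s" using s by simp
    also have "\<dots> \<le> e / 2" using s by simp
    finally have "ip n y c' \<le> ip n y c + e / 2" by (simp add: ip_minus_right)
    also have "ip n y c = ip n y z - q c"
    proof -
      have "ip n y y = ip n y z - ip n y c" unfolding y_def by (simp add: ip_minus_right)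
      then show ?thesis using yq by simp
    qed
    finally show ?thesis using far[OF c(1)] by simp
  qed
  define \<sigma> where "\<sigma> = ip n y z - e / 2"
  have s0: "0 \<le> \<sigma>" using sep[OF zero_Z] by (simp add: \<sigma>_def) (simp add: ip_def)
  define \<gamma> where "\<gamma> = \<sigma> + e / 4"
  have g: "0 < \<gamma>" using s0 e by (simp add: \<gamma>_def)
  have "(\<lambda>i\<in>{..<n}. y i / \<gamma>) \<in> K"
  proof -
    have "ip n y u / \<gamma> \<le> 1" if u: "u \<in> X" for u
      using sep[of u] u X_subset_Z g e by (auto simp: \<sigma>_def \<gamma>_def divide_le_eq)
    then show ?thesis by (simp add: K_iff)
  qed
  from hK_upper[OF this, of z] z(2) have "ip n y z / \<gamma> \<le> 1" by simp
  then have "ip n y z \<le> \<gamma>" using g by (simp add: divide_le_eq)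
  then show False using e by (simp add: \<gamma>_def \<sigma>_def)
qed

text \<open>
  The bipolar theorem up to closure, which is harmless for volumes. The distance between
  \<open>z\<close> and its approximation in \<open>Z\<close> is absorbed by the ball contained in
  \<open>Z\<close>, at the cost of the factor \<open>s\<close>.
\<close>

lemma bipolar_shrunk:
  assumes z: "z \<in> Rn n" "hK z \<le> 1" and s: "0 < s" "s < 1"
  shows "(\<lambda>i\<in>{..<n}. s * z i) \<in> Z"
proof -
  obtain \<sigma> where sg: "\<sigma> > 0" "\<And>x. x \<in> Rn n \<Longrightarrow> (\<And>i. i < n \<Longrightarrow> \<bar>x i\<bar> \<le> \<sigma>) \<Longrightarrow> x \<in> Z"
    using ball_in_Z by blast
  \<comment> \<open>the error that \<open>z = c + (z - c)\<close> may have so that \<open>s * z\<close> is the combination of \<open>c\<close> and a vector \<open>w\<close> of the ball with weights \<open>s\<close> and \<open>1 - s\<close>\<close>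
  define e where "e = (\<sigma> * (1 - s))\<^sup>2"
  have e: "0 < e" using sg s by (simp add: e_def)
  obtain c where c: "c \<in> Z" "ip n (\<lambda>i. z i - c i) (\<lambda>i. z i - c i) < e" using approx_by_Z[OF z e] by blast
  define w where "w = (\<lambda>i\<in>{..<n}. s / (1 - s) * (z i - c i))"
  have "w \<in> Z"
  proof (rule sg(2))
    fix i assume i: "i < n"
    have "(z i - c i)\<^sup>2 \<le> (\<sigma> * (1 - s))\<^sup>2"
      using sq_coord_le_ip[OF i, of "\<lambda>i. z i - c i"] c(2) by (simp add: e_def)
    then have "\<bar>z i - c i\<bar> \<le> \<bar>\<sigma> * (1 - s)\<bar>" by (simp add: abs_le_square_iff)
    then have b: "\<bar>z i - c i\<bar> \<le> \<sigma> * (1 - s)" using sg(1) s by (simp add: abs_mult)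
    have "\<bar>w i\<bar> = s / (1 - s) * \<bar>z i - c i\<bar>" using i s by (simp add: w_def abs_mult)
    also have "\<dots> \<le> s / (1 - s) * (\<sigma> * (1 - s))" using b s by (intro mult_left_mono) auto
    also have "\<dots> = s * \<sigma>" using s by simp
    also have "\<dots> \<le> \<sigma>" using s sg(1) by simp
    finally show "\<bar>w i\<bar> \<le> \<sigma>" .
  qed (simp add: w_def)
  have "(\<lambda>i\<in>{..<n}. s * c i + (1 - s) * w i) \<in> Z"
    by (rule Z_combo[OF c(1) \<open>w \<in> Z\<close>]) (use s in auto)
  also have "(\<lambda>i\<in>{..<n}. s * c i + (1 - s) * w i) = (\<lambda>i\<in>{..<n}. s * z i)"
  proof (rule Rn_ext[of _ n])
    fix i assume i: "i < n"
    have "(1 - s) * w i = s * (z i - c i)" using i s by (simp add: w_def)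
    then show "(\<lambda>i\<in>{..<n}. s * c i + (1 - s) * w i) i = (\<lambda>i\<in>{..<n}. s * z i) i"
      using i by (simp add: algebra_simps)
  qed auto
  finally show ?thesis .
qed

end

section \<open>Volume bounds with the defect\<close>

lemma gauss_1d_lipschitz: "\<bar>exp (- pi * a\<^sup>2) - exp (- pi * b\<^sup>2)\<bar> \<le> 2 * pi * \<bar>a - b\<bar>"
proof -
  have d: "((\<lambda>s. exp (- pi * s\<^sup>2)) has_real_derivative - (2 * pi * s * exp (- pi * s\<^sup>2))) (at s)" for s
    by (auto intro!: derivative_eq_intros)
  have bd: "\<bar>- (2 * pi * s * exp (- pi * s\<^sup>2))\<bar> \<le> 2 * pi" for s
  proof -
    have "\<bar>s\<bar> \<le> 1 + s\<^sup>2" using zero_le_power2[of "\<bar>s\<bar> - 1"] zero_le_power2[of s] by (simp add: power2_diff)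
    also have "\<dots> \<le> 1 + pi * s\<^sup>2" using pi_ge_two mult_right_mono[of 1 pi "s\<^sup>2"] by simp
    also have "\<dots> \<le> exp (pi * s\<^sup>2)" by (rule exp_ge_add_one_self)
    finally have "\<bar>s\<bar> * exp (- pi * s\<^sup>2) \<le> exp (pi * s\<^sup>2) * exp (- pi * s\<^sup>2)" by (intro mult_right_mono) auto
    then have "\<bar>s\<bar> * exp (- pi * s\<^sup>2) \<le> 1" by (simp flip: exp_add)
    then have "2 * pi * (\<bar>s\<bar> * exp (- pi * s\<^sup>2)) \<le> 2 * pi * 1" by (intro mult_left_mono) auto
    then show ?thesis by (simp add: abs_mult mult.assoc)
  qed
  have "norm (exp (- pi * a\<^sup>2) - exp (- pi * b\<^sup>2)) \<le> 2 * pi * norm (a - b)"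
    by (rule field_differentiable_bound[of UNIV]) (use d bd in auto)
  then show ?thesis by simp
qed

lemma gauss_uniformly_continuous:
  assumes e: "0 < e" and n: "1 \<le> n"
  shows "\<exists>d>0. \<forall>z\<in>Rn n. \<forall>z'\<in>Rn n. (\<forall>i<n. \<bar>z i - z' i\<bar> \<le> d) \<longrightarrow> exp (- pi * ip n z z) \<le> exp (- pi * ip n z' z') + e"
proof (intro exI conjI ballI impI)
  define d where "d = e / (n * (2 * pi))"
  show "0 < d" using e n by (simp add: d_def)
  fix z z' :: rvec assume z: "\<forall>i<n. \<bar>z i - z' i\<bar> \<le> d"
  have pr: "exp (- pi * ip n x x) = (\<Prod>i<n. exp (- pi * (x i)\<^sup>2))" for x
    by (simp add: ip_def exp_sum[symmetric] power2_eq_square sum_distrib_left[symmetric] sum_negf)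
  have "norm ((\<Prod>i<n. exp (- pi * (z i)\<^sup>2)) - (\<Prod>i<n. exp (- pi * (z' i)\<^sup>2))) \<le>
      (\<Sum>i<n. norm (exp (- pi * (z i)\<^sup>2) - exp (- pi * (z' i)\<^sup>2)))"
    by (rule norm_prod_diff) auto
  also have "\<dots> \<le> (\<Sum>i<n. 2 * pi * d)"
  proof (rule sum_mono)
    fix i assume "i \<in> {..<n}"
    then have A: "2 * pi * \<bar>z i - z' i\<bar> \<le> 2 * pi * d" using z by (intro mult_left_mono) auto
    show "norm (exp (- pi * (z i)\<^sup>2) - exp (- pi * (z' i)\<^sup>2)) \<le> 2 * pi * d"
      unfolding real_norm_def by (rule order_trans[OF gauss_1d_lipschitz A])
  qed
  also have "\<dots> = e" using n by (simp add: d_def)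
  finally show "exp (- pi * ip n z z) \<le> exp (- pi * ip n z' z') + e"
    unfolding pr by (simp add: abs_le_iff)
qed

context isotropic_measure
begin

lemma var_nonneg:
  assumes f: "bmeas \<mu> f"
  shows "0 \<le> var f"
proof -
  have "0 \<le> 2 * var f"
    unfolding var_double_integral[OF f] by (intro Bochner_Integration.integral_nonneg) auto
  then show ?thesis by simp
qed

lemma var_scale: "var (\<lambda>u. c * f u) = c\<^sup>2 * var f"
proof -
  have "moment (\<lambda>u. c * f u) k l = c * moment f k l" for k l by (simp add: moment_def mult.assoc)
  then show ?thesis by (simp add: var_def power_mult_distrib sum_distrib_left right_diff_distrib)
qed

lemma bmeas_var_square: "bmeas (cube_measure n r) (\<lambda>x. var (\<lambda>u. (ip n x u)\<^sup>2))"
proof -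
  let ?C = "cube_measure n r"
  let ?G = "\<lambda>x u v. ((ip n x u)\<^sup>2 - (ip n x v)\<^sup>2)\<^sup>2 * (ip n u v)\<^sup>2"
  have b2: "bmeas ((?C \<Otimes>\<^sub>M \<mu>) \<Otimes>\<^sub>M \<mu>) (\<lambda>p. ?G (fst (fst p)) (snd (fst p)) (snd p))"
    unfolding ip_def
    by (intro bmeas_intros bmeas_pair1[OF bmeas_pair1[OF bmeas_cube_measure_coord]] bmeas_pair1[OF bmeas_pair2[OF bmeas_coord]] bmeas_pair2[OF bmeas_coord]) auto
  have "bmeas ?C (\<lambda>x. (\<integral>u. (\<integral>v. ?G x u v \<partial>\<mu>) \<partial>\<mu>) / 2)"
    by (intro bmeas_divide bmeas_lebesgue_integral bmeas_lebesgue_integral[where G = "\<lambda>p v. ?G (fst p) (snd p) v"] b2)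
  also have "(\<lambda>x. (\<integral>u. (\<integral>v. ?G x u v \<partial>\<mu>) \<partial>\<mu>) / 2) = (\<lambda>x. var (\<lambda>u. (ip n x u)\<^sup>2))"
    using var_double_integral[of "\<lambda>u. (ip n _ u)\<^sup>2"] by (simp add: fun_eq_iff bmeas_power bmeas_ip flip: var_double_integral)
  finally show ?thesis .
qed

lemma defect_nonneg: "0 \<le> defect"
  unfolding defect_def
proof (intro Bochner_Integration.integral_nonneg mult_nonneg_nonneg)
  fix u v assume "u \<in> space \<mu>" "v \<in> space \<mu>"
  then have "\<bar>ip n u v\<bar> \<le> 1" using ip_abs_le_1 by simp
  then show "0 \<le> 1 - (ip n u v)\<^sup>2" by (simp add: abs_square_le_1)
qed auto

text \<open>
  So small that on the cube of this radius all inner products with unit vectors are at most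
  \<open>1 / (8 * n)\<close>, and a sum of \<open>n\<close> of them at most \<open>1 / 8\<close>.
\<close>

definition core_radius :: real where "core_radius = 1 / (8 * n\<^sup>2)"

lemma cube_ip_small:
  assumes n: "1 \<le> n" and x: "x \<in> cube n core_radius" and u: "u \<in> usphere n"
  shows "\<bar>ip n x u\<bar> \<le> 1 / (8 * n)" "\<bar>ip n x u\<bar> \<le> 1 / 8" "ip n x x \<le> (1 / (8 * n))\<^sup>2"
proof -
  have c0: "0 \<le> core_radius" by (simp add: core_radius_def)
  have "ip n x x \<le> n * core_radius\<^sup>2" by (rule cube_subset_ball[OF c0 x])
  also have "\<dots> \<le> (1 / (8 * n))\<^sup>2"
  proof -
    have "real n * 1 \<le> real n * real n" using n by (intro mult_left_mono) auto
    then have "real n \<le> (real n)\<^sup>2" by (simp add: power2_eq_square)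
    then have "n * core_radius\<^sup>2 \<le> (real n)\<^sup>2 * core_radius\<^sup>2" by (intro mult_right_mono) auto
    also have "\<dots> = (1 / (8 * n))\<^sup>2" using n by (simp add: core_radius_def power2_eq_square field_simps)
    finally show ?thesis .
  qed
  finally show a: "ip n x x \<le> (1 / (8 * n))\<^sup>2" .
  show b: "\<bar>ip n x u\<bar> \<le> 1 / (8 * n)" by (rule ip_le_radius[OF a _ u]) simp
  have "1 / (8 * real n) \<le> 1 / 8" using n by (simp add: field_simps)
  then show "\<bar>ip n x u\<bar> \<le> 1 / 8" using b by simp
qed

lemma dt_Am_lower:
  assumes t: "continuous_on UNIV t" "\<And>s. 0 < t s"
  shows "exp (\<integral>u. ln (t (ip n x u)) \<partial>\<mu>) \<le> dt n (Am t x)"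
proof -
  have f: "bmeas \<mu> (\<lambda>u. ln (t (ip n x u)))"
    by (rule bmeas_cont_ip) (use t in \<open>auto intro!: continuous_intros simp: less_imp_neq[symmetric]\<close>)
  from det_ge_exp(1)[OF f] show ?thesis using t(2) by (simp add: Am_def[abs_def])
qed

text \<open>
  On the small cube the sums over tuples fall short of their mean by at most \<open>2\<close>, so
  the refined bound of \<open>det_ge_exp\<close> applies to \<open>ln t\<close>, and its variance
  is compared with the one of half the square.
\<close>

lemma dt_Am_lower_cube:
  assumes n: "1 \<le> n" and t: "continuous_on UNIV t" "\<And>s. 0 < t s"
    and k1: "\<And>a b. \<bar>a\<bar> \<le> 1 / 8 \<Longrightarrow> \<bar>b\<bar> \<le> 1 / 8 \<Longrightarrow> ((a\<^sup>2 - b\<^sup>2) / 2)\<^sup>2 \<le> (ln (t a) - ln (t b))\<^sup>2"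
    and k2: "\<And>a b. \<bar>a\<bar> \<le> 1 / 8 \<Longrightarrow> \<bar>b\<bar> \<le> 1 / 8 \<Longrightarrow> - (4 * \<bar>b\<bar>) \<le> ln (t a) - ln (t b)"
    and x: "x \<in> cube n core_radius"
  shows "exp (\<integral>u. ln (t (ip n x u)) \<partial>\<mu>) * (1 + var (\<lambda>u. (ip n x u)\<^sup>2) / 16) \<le> dt n (Am t x)"
proof -
  let ?f = "\<lambda>u. ln (t (ip n x u))"
  have f: "bmeas \<mu> ?f"
    by (rule bmeas_cont_ip) (use t in \<open>auto intro!: continuous_intros simp: less_imp_neq[symmetric]\<close>)
  have sm: "- 2 \<le> (\<Sum>k<n. ?f (W k)) - (\<integral>u. ?f u \<partial>\<mu>)" if W: "W \<in> space PW" for W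
  proof -
    have "(\<integral>u. ?f u \<partial>\<mu>) \<le> n * ?f (W k) + 1 / 2" if k: "k < n" for k
    proof -
      have "(\<integral>u. ?f u \<partial>\<mu>) \<le> (\<integral>u. ?f (W k) + 1 / (2 * n) \<partial>\<mu>)"
      proof (rule integral_mono)
        fix u assume "u \<in> space \<mu>"
        then have u: "u \<in> usphere n" by simp
        have "- (4 * \<bar>ip n x u\<bar>) \<le> ?f (W k) - ?f u"
          by (rule k2) (use cube_ip_small[OF n x] u space_PW_D[OF W k] in auto)
        moreover have "4 * \<bar>ip n x u\<bar> \<le> 1 / (2 * n)"
          using cube_ip_small(1)[OF n x u] by simp
        ultimately show "?f u \<le> ?f (W k) + 1 / (2 * n)" by linarith
      qed (auto intro!: bmeas_integrable f)
      also have "\<dots> = n * (?f (W k) + 1 / (2 * n))" by (simp add: total_mass)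
      also have "\<dots> = n * ?f (W k) + 1 / 2" using n by (simp add: distrib_left)
      finally show ?thesis .
    qed
    then have "(\<Sum>k<n. \<integral>u. ?f u \<partial>\<mu>) \<le> (\<Sum>k<n. n * ?f (W k) + 1 / 2)" by (intro sum_mono) auto
    then have "n * (\<integral>u. ?f u \<partial>\<mu>) \<le> n * ((\<Sum>k<n. ?f (W k)) + 1 / 2)"
      by (simp add: sum.distrib sum_distrib_left distrib_left)
    then show ?thesis using n by simp
  qed
  have g: "bmeas \<mu> (\<lambda>u. (1 / 2) * (ip n x u)\<^sup>2)" by (intro bmeas_intros bmeas_ip)
  have "var (\<lambda>u. (1 / 2) * (ip n x u)\<^sup>2) \<le> var ?f"
  proof (rule var_mono[OF f g])
    fix u v assume uv: "u \<in> usphere n" "v \<in> usphere n"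
    show "(1 / 2 * (ip n x u)\<^sup>2 - 1 / 2 * (ip n x v)\<^sup>2)\<^sup>2 \<le> (?f u - ?f v)\<^sup>2"
      using k1[of "ip n x u" "ip n x v"] cube_ip_small(2)[OF n x] uv by (simp add: diff_divide_distrib)
  qed
  then have v: "var (\<lambda>u. (ip n x u)\<^sup>2) / 16 \<le> var ?f / 4"
    unfolding var_scale by (simp add: power2_eq_square)
  have "exp (\<integral>u. ?f u \<partial>\<mu>) * (1 + var (\<lambda>u. (ip n x u)\<^sup>2) / 16) \<le> exp (\<integral>u. ?f u \<partial>\<mu>) * (1 + var ?f / 4)"
    using v by (intro mult_left_mono) auto
  also have "\<dots> \<le> dt n (\<lambda>i j. \<integral>u. exp (?f u) * (u i * u j) \<partial>\<mu>)"
    by (rule det_ge_exp(2)[OF f sm])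
  finally show ?thesis using t(2) by (simp add: Am_def[abs_def])
qed

text \<open>
  The vector \<open>Fm T x\<close> consists of the coefficients of the function \<open>T (ip n x
  u)\<close> with respect to the coordinate functions, which isotropy makes orthonormal.
\<close>

lemma Fm_bessel:
  assumes T: "continuous_on UNIV T"
  shows "ip n (Fm T x) (Fm T x) \<le> (\<integral>u. (T (ip n x u))\<^sup>2 \<partial>\<mu>)"
    and ip_Fm: "ip n y (Fm T x) = (\<integral>u. T (ip n x u) * ip n y u \<partial>\<mu>)"
proof -
  show *: "ip n y (Fm T x) = (\<integral>u. T (ip n x u) * ip n y u \<partial>\<mu>)" for y
  proof -
    have "ip n y (Fm T x) = (\<Sum>i<n. \<integral>u. y i * (T (ip n x u) * u i) \<partial>\<mu>)"
      by (simp add: ip_def Fm_def)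
    also have "\<dots> = (\<integral>u. (\<Sum>i<n. y i * (T (ip n x u) * u i)) \<partial>\<mu>)"
      by (rule Bochner_Integration.integral_sum[symmetric], intro bmeas_integrable bmeas_mult[OF bmeas_const] bmeas_mult bmeas_cont_ip[OF T] bmeas_coord) auto
    also have "\<dots> = (\<integral>u. T (ip n x u) * ip n y u \<partial>\<mu>)"
      by (simp add: ip_def[of n y] sum_distrib_left mult_ac)
    finally show ?thesis .
  qed
  let ?F = "Fm T x"
  have "ip n ?F ?F = (\<integral>u. T (ip n x u) * ip n ?F u \<partial>\<mu>)" by (rule *)
  also have "\<dots> \<le> (\<integral>u. (1 / 2) * (T (ip n x u))\<^sup>2 + (1 / 2) * (ip n ?F u)\<^sup>2 \<partial>\<mu>)"
  proof (rule integral_mono)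
    show "integrable \<mu> (\<lambda>u. T (ip n x u) * ip n ?F u)"
      by (intro bmeas_integrable bmeas_mult bmeas_cont_ip[OF T] bmeas_ip)
    show "integrable \<mu> (\<lambda>u. (1 / 2) * (T (ip n x u))\<^sup>2 + (1 / 2) * (ip n ?F u)\<^sup>2)"
      by (intro bmeas_integrable bmeas_add bmeas_mult bmeas_const bmeas_power bmeas_cont_ip[OF T] bmeas_ip)
    fix u
    show "T (ip n x u) * ip n ?F u \<le> (1 / 2) * (T (ip n x u))\<^sup>2 + (1 / 2) * (ip n ?F u)\<^sup>2"
      using sum_squares_bound[of "T (ip n x u)" "ip n ?F u"] by simp
  qed
  also have "\<dots> = (\<integral>u. (1 / 2) * (T (ip n x u))\<^sup>2 \<partial>\<mu>) + (\<integral>u. (1 / 2) * (ip n ?F u)\<^sup>2 \<partial>\<mu>)"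
    by (rule Bochner_Integration.integral_add; intro bmeas_integrable bmeas_mult bmeas_const bmeas_power bmeas_cont_ip[OF T] bmeas_ip)
  also have "\<dots> = (1 / 2) * (\<integral>u. (T (ip n x u))\<^sup>2 \<partial>\<mu>) + (1 / 2) * ip n ?F ?F"
    by (simp add: integral_ip_sq_one)
  finally show "ip n ?F ?F \<le> (\<integral>u. (T (ip n x u))\<^sup>2 \<partial>\<mu>)" by simp
qed

text \<open>
  Half of the lower bound that \<open>cube_average_var_ge\<close> gives for the extra term
  \<open>var / 16\<close> of \<open>dt_Am_lower_cube\<close>, integrated over the small cube.
\<close>

definition gain :: real where
  "gain = (2 * core_radius) ^ n * core_radius ^ 4 / 360 * defect"

lemma gain_nonneg: "0 \<le> gain"
  using defect_nonneg by (simp add: gain_def core_radius_def)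

lemma cube_gain:
  "ennreal (2 * gain) \<le> (\<integral>\<^sup>+x. ennreal (var (\<lambda>u. (ip n x u)\<^sup>2) / 16) * indicator (cube n core_radius) x \<partial>Leb n)"
proof -
  have c0: "0 \<le> core_radius" by (simp add: core_radius_def)
  interpret C: finite_measure "cube_measure n core_radius" by (rule finite_cube_measure[OF c0])
  have "2 * gain \<le> (\<integral>x. var (\<lambda>u. (ip n x u)\<^sup>2) / 16 \<partial>cube_measure n core_radius)"
    using cube_average_var_ge[OF c0] by (simp add: gain_def mult_ac)
  then have "ennreal (2 * gain) \<le> ennreal (\<integral>x. var (\<lambda>u. (ip n x u)\<^sup>2) / 16 \<partial>cube_measure n core_radius)"
    by (rule ennreal_leI)
  also have "\<dots> = (\<integral>\<^sup>+x. ennreal (var (\<lambda>u. (ip n x u)\<^sup>2) / 16) \<partial>cube_measure n core_radius)"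
    by (rule nn_integral_eq_integral[symmetric])
       (auto intro!: C.bmeas_integrable bmeas_divide bmeas_var_square var_nonneg bmeas_power bmeas_ip)
  also have "\<dots> = (\<integral>\<^sup>+x. ennreal (var (\<lambda>u. (ip n x u)\<^sup>2) / 16) * indicator (cube n core_radius) x \<partial>Leb n)"
    unfolding cube_measure_def using cube_subset_Rn[of n core_radius]
    by (subst nn_integral_restrict_space) (auto simp: Int_absorb2)
  finally show ?thesis .
qed

lemma var_square_measurable:
  "(\<lambda>x. ennreal (var (\<lambda>u. (ip n x u)\<^sup>2) / 16) * indicator (cube n core_radius) x) \<in> borel_measurable (Leb n)"
proof -
  have "(\<lambda>x. ennreal (var (\<lambda>u. (ip n x u)\<^sup>2) / 16)) \<in> borel_measurable (cube_measure n core_radius)"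
    using bmeas_meas[OF bmeas_var_square[of core_radius]] by measurable
  then show ?thesis
    unfolding cube_measure_def using cube_subset_Rn[of n core_radius]
    by (subst (asm) borel_measurable_restrict_space_iff_ennreal) (auto simp: Int_absorb2)
qed

end

context even_isotropic
begin

text \<open>
  Apply \<open>transport_inequality\<close> with the Gaussian as \<open>g\<close>. By the
  Monge-Ampere equation and \<open>Fm_bessel\<close> the integrand is at least \<open>1 / 2 ^
  n\<close> on the whole slab body, and larger by the variance term on the small cube.
\<close>

lemma polar_slab_volume:
  assumes r: "1 / 2 \<le> r" "r < 1"
  shows "emeasure (Leb n) {x \<in> Rn n. \<forall>u\<in>X. \<bar>ip n x u\<bar> \<le> r} + ennreal (2 * gain) \<le> ennreal (2 ^ n)"
proof -
  obtain T t where T: "\<And>s. (T has_real_derivative t s) (at s)" and t: "continuous_on UNIV t" "\<And>s. 0 < t s"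
    and lt: "\<And>s. \<bar>s\<bar> \<le> r \<Longrightarrow> ln (t s) = pi * (T s)\<^sup>2 - ln 2"
    and k1: "\<And>a b. \<bar>a\<bar> \<le> 1 / 8 \<Longrightarrow> \<bar>b\<bar> \<le> 1 / 8 \<Longrightarrow> ((a\<^sup>2 - b\<^sup>2) / 2)\<^sup>2 \<le> (ln (t a) - ln (t b))\<^sup>2"
    and k2: "\<And>a b. \<bar>a\<bar> \<le> 1 / 8 \<Longrightarrow> \<bar>b\<bar> \<le> 1 / 8 \<Longrightarrow> - (4 * \<bar>b\<bar>) \<le> ln (t a) - ln (t b)"
    using uniform_to_gauss[OF r] by metis
  have cT: "continuous_on UNIV T" by (rule DERIV_continuous_on_UNIV[OF T])
  define D where "D = {x \<in> Rn n. \<forall>u\<in>X. \<bar>ip n x u\<bar> \<le> r}"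
  have Ds [measurable]: "D \<in> sets (Leb n)"
  proof -
    have "closed {x. \<forall>u\<in>X. \<bar>ip n x u\<bar> \<le> r}"
      unfolding Collect_ball_eq by (intro closed_INT ballI closed_Collect_le continuous_intros)
    from closed_sets_Leb[OF this, of n] show ?thesis by (simp add: D_def)
  qed
  have DR: "ip n x x \<le> (sqrt n)\<^sup>2" if "x \<in> D" for x
    using abs_ip_bound_norm[of x] that r by (force simp: D_def)
  let ?g = "\<lambda>z. exp (- pi * ip n z z)"
  let ?v = "\<lambda>x. ennreal (var (\<lambda>u. (ip n x u)\<^sup>2) / 16) * indicator (cube n core_radius) x"
  have cube_D: "cube n core_radius \<subseteq> D"
    using cube_ip_small(2)[OF n_pos] X_usphere r by (fastforce simp: D_def cube_iff)
  have "ennreal (1 / 2 ^ n) * (emeasure (Leb n) D + ennreal (2 * gain)) \<le>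
      ennreal (1 / 2 ^ n) * (emeasure (Leb n) D + (\<integral>\<^sup>+x. ?v x \<partial>Leb n))"
    by (intro mult_left_mono add_left_mono cube_gain) auto
  also have "\<dots> = (\<integral>\<^sup>+x. ennreal (1 / 2 ^ n) * (indicator D x + ?v x) \<partial>Leb n)"
    using var_square_measurable by (subst nn_integral_cmult) (auto simp: nn_integral_add)
  also have "\<dots> \<le> (\<integral>\<^sup>+x. ennreal (?g (Fm T x) * dt n (Am t x)) * indicator D x \<partial>Leb n)"
  proof (rule nn_integral_mono)
    fix x
    show "ennreal (1 / 2 ^ n) * (indicator D x + ?v x) \<le> ennreal (?g (Fm T x) * dt n (Am t x)) * indicator D x"
    proof (cases "x \<in> D")
      case False
      then show ?thesis using cube_D by (auto simp: indicator_def)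
    next
      case True
      let ?E = "\<integral>u. ln (t (ip n x u)) \<partial>\<mu>"
      define V where "V = (if x \<in> cube n core_radius then var (\<lambda>u. (ip n x u)\<^sup>2) / 16 else 0)"
      have V0: "0 \<le> V" by (auto simp: V_def intro!: var_nonneg bmeas_power bmeas_ip)
      have dtV: "exp ?E * (1 + V) \<le> dt n (Am t x)"
        using dt_Am_lower[OF t, of x] dt_Am_lower_cube[OF n_pos t k1 k2, of x] by (auto simp: V_def)
      have E: "?E = pi * (\<integral>u. (T (ip n x u))\<^sup>2 \<partial>\<mu>) - n * ln 2"
      proof -
        have "?E = (\<integral>u. pi * (T (ip n x u))\<^sup>2 - ln 2 \<partial>\<mu>)"
        proof (rule integral_cong_AE)
          show "AE u in \<mu>. ln (t (ip n x u)) = pi * (T (ip n x u))\<^sup>2 - ln 2"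
            using AE_X by eventually_elim (use True lt in \<open>auto simp: D_def\<close>)
          show "(\<lambda>u. ln (t (ip n x u))) \<in> borel_measurable \<mu>"
            by (rule bmeas_meas[OF bmeas_cont_ip]) (use t in \<open>auto intro!: continuous_intros simp: less_imp_neq[symmetric]\<close>)
          show "(\<lambda>u. pi * (T (ip n x u))\<^sup>2 - ln 2) \<in> borel_measurable \<mu>"
            by (intro bmeas_meas bmeas_diff bmeas_mult bmeas_const bmeas_power bmeas_cont_ip[OF cT])
        qed
        also have "\<dots> = (\<integral>u. pi * (T (ip n x u))\<^sup>2 \<partial>\<mu>) - (\<integral>u. ln 2 \<partial>\<mu>)"
          by (rule Bochner_Integration.integral_diff; intro bmeas_integrable bmeas_mult bmeas_const bmeas_power bmeas_cont_ip[OF cT])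
        finally show ?thesis by (simp add: total_mass)
      qed
      have "- pi * (\<integral>u. (T (ip n x u))\<^sup>2 \<partial>\<mu>) \<le> - pi * ip n (Fm T x) (Fm T x)"
        using Fm_bessel[OF cT, of x] by simp
      then have "exp (- pi * (\<integral>u. (T (ip n x u))\<^sup>2 \<partial>\<mu>)) * (exp ?E * (1 + V)) \<le> ?g (Fm T x) * dt n (Am t x)"
        using V0 dtV by (intro mult_mono) auto
      moreover have "exp (- pi * (\<integral>u. (T (ip n x u))\<^sup>2 \<partial>\<mu>)) * (exp ?E * (1 + V)) = 1 / 2 ^ n * (1 + V)"
      proof -
        have "exp (- pi * (\<integral>u. (T (ip n x u))\<^sup>2 \<partial>\<mu>)) * exp ?E = exp (- (n * ln 2))"
          unfolding E by (simp flip: exp_add)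
        also have "\<dots> = 1 / 2 ^ n" by (simp add: exp_minus exp_of_nat_mult inverse_eq_divide)
        finally show ?thesis by (simp only: mult.assoc[symmetric])
      qed
      ultimately have "1 / 2 ^ n * (1 + V) \<le> ?g (Fm T x) * dt n (Am t x)" by simp
      then have "ennreal (1 / 2 ^ n * (1 + V)) \<le> ennreal (?g (Fm T x) * dt n (Am t x))" by (rule ennreal_leI)
      moreover have "ennreal (1 / 2 ^ n * (1 + V)) = ennreal (1 / 2 ^ n) * (indicator D x + ?v x)"
      proof -
        have "indicator D x + ?v x = ennreal (1 + V)"
          using True V0 by (auto simp: V_def indicator_def ennreal_plus)
        moreover have "ennreal (1 / 2 ^ n * (1 + V)) = ennreal (1 / 2 ^ n) * ennreal (1 + V)"
          by (rule ennreal_mult) (use V0 in auto)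
        ultimately show ?thesis by simp
      qed
      ultimately show ?thesis using True by simp
    qed
  qed
  also have "\<dots> \<le> (\<integral>\<^sup>+z. ennreal (?g z) \<partial>Leb n)"
  proof (rule transport_inequality[OF T t _ Ds DR])
    fix e :: real assume "0 < e"
    then show "\<exists>d>0. \<forall>z\<in>Rn n. \<forall>z'\<in>Rn n. (\<forall>i<n. \<bar>z i - z' i\<bar> \<le> d) \<longrightarrow> ?g z \<le> ?g z' + e"
      by (rule gauss_uniformly_continuous[OF _ n_pos])
  qed auto
  also have "\<dots> = 1" by (rule nn_integral_gauss_n)
  finally have "ennreal (2 ^ n) * (ennreal (1 / 2 ^ n) * (emeasure (Leb n) D + ennreal (2 * gain))) \<le> ennreal (2 ^ n) * 1"
    by (intro mult_left_mono) auto
  also have "ennreal (2 ^ n) * (ennreal (1 / 2 ^ n) * (emeasure (Leb n) D + ennreal (2 * gain))) =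
      (ennreal (2 ^ n) * ennreal (1 / 2 ^ n)) * (emeasure (Leb n) D + ennreal (2 * gain))" by (simp only: mult.assoc)
  also have "ennreal (2 ^ n) * ennreal (1 / 2 ^ n) = 1" by (subst ennreal_mult[symmetric]) auto
  finally show ?thesis by (simp add: D_def)
qed

text \<open>
  Let the slab width \<open>r\<close> tend to \<open>1\<close>.
\<close>

theorem polar_volume_defect: "vol n K \<le> 2 ^ n - 2 * gain"
proof -
  have step: "ennreal (r ^ n) * emeasure (Leb n) K + ennreal (2 * gain) \<le> ennreal (2 ^ n)" if r: "1 / 2 \<le> r" "r < 1" for r
  proof -
    have "ennreal (r ^ n) * emeasure (Leb n) K = emeasure (Leb n) {x \<in> Rn n. (\<lambda>i\<in>{..<n}. x i / r) \<in> K}"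
      by (rule emeasure_scale[symmetric]) (use r in auto)
    also have "{x \<in> Rn n. (\<lambda>i\<in>{..<n}. x i / r) \<in> K} \<subseteq> {x \<in> Rn n. \<forall>u\<in>X. \<bar>ip n x u\<bar> \<le> r}"
    proof safe
      fix x u assume x: "(\<lambda>i\<in>{..<n}. x i / r) \<in> K" and u: "u \<in> X"
      have "\<bar>ip n x u / r\<bar> \<le> 1" using K_abs[OF x u] by simp
      then show "\<bar>ip n x u\<bar> \<le> r" using r by (simp add: abs_divide)
    qed
    then have "emeasure (Leb n) {x \<in> Rn n. (\<lambda>i\<in>{..<n}. x i / r) \<in> K} \<le> emeasure (Leb n) {x \<in> Rn n. \<forall>u\<in>X. \<bar>ip n x u\<bar> \<le> r}"
    proof (rule emeasure_mono)
      have "closed {x. \<forall>u\<in>X. \<bar>ip n x u\<bar> \<le> r}"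
        unfolding Collect_ball_eq by (intro closed_INT ballI closed_Collect_le continuous_intros)
      from closed_sets_Leb[OF this, of n] show "{x \<in> Rn n. \<forall>u\<in>X. \<bar>ip n x u\<bar> \<le> r} \<in> sets (Leb n)" by simp
    qed
    finally show ?thesis using polar_slab_volume[OF r] by (meson add_right_mono order_trans)
  qed
  have fin: "emeasure (Leb n) K \<noteq> \<infinity>"
  proof
    assume "emeasure (Leb n) K = \<infinity>"
    then show False using step[of "1 / 2"] by (simp add: ennreal_mult_top top_unique)
  qed
  then have vK: "emeasure (Leb n) K = ennreal (vol n K)"
    by (simp add: vol_def emeasure_eq_ennreal_measure)
  have v0: "0 \<le> vol n K" by (simp add: vol_def)
  have step': "r ^ n * vol n K + 2 * gain \<le> 2 ^ n" if r: "1 / 2 \<le> r" "r < 1" for r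
  proof -
    have "ennreal (r ^ n * vol n K + 2 * gain) \<le> ennreal (2 ^ n)"
      using step[OF r] r v0 gain_nonneg unfolding vK by (simp add: ennreal_plus ennreal_mult)
    then show ?thesis by (subst (asm) ennreal_le_iff) auto
  qed
  define R where "R k = 1 - 1 / real (Suc (Suc k))" for k :: nat
  have "R \<longlonglongrightarrow> 1 - 0"
    unfolding R_def using LIMSEQ_Suc[OF LIMSEQ_inverse_real_of_nat]
    by (intro tendsto_diff tendsto_const) (simp add: inverse_eq_divide)
  then have "(\<lambda>k. R k ^ n * vol n K + 2 * gain) \<longlonglongrightarrow> (1 - 0) ^ n * vol n K + 2 * gain"
    by (intro tendsto_intros)
  moreover have "R k ^ n * vol n K + 2 * gain \<le> 2 ^ n" for k
    by (rule step') (auto simp: R_def field_simps)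
  ultimately have "(1 - 0) ^ n * vol n K + 2 * gain \<le> 2 ^ n"
    by (intro LIMSEQ_le_const2) auto
  then show ?thesis by simp
qed

lemma exp_hK_uniformly_continuous:
  assumes e: "0 < e"
  shows "\<exists>d>0. \<forall>z\<in>Rn n. \<forall>z'\<in>Rn n. (\<forall>i<n. \<bar>z i - z' i\<bar> \<le> d) \<longrightarrow> exp (- hK z) \<le> exp (- hK z') + e"
proof (intro exI conjI ballI impI)
  define d where "d = ln (1 + e) / (n * n)"
  show d0: "0 < d" using e n_pos by (simp add: d_def)
  fix z z' assume z: "\<forall>i<n. \<bar>z i - z' i\<bar> \<le> d"
  have "hK z' \<le> hK z + n * n * d"
    by (rule hK_lipschitz) (use z d0 in \<open>auto simp: abs_minus_commute\<close>)
  then have "exp (- hK z) \<le> exp (- hK z' + n * n * d)" by simp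
  also have "\<dots> = exp (- hK z') * (1 + e)"
  proof -
    have "n * n * d = ln (1 + e)" using n_pos by (simp add: d_def)
    then show ?thesis using e by (simp only: exp_add exp_ln add_pos_pos zero_less_one)
  qed
  also have "\<dots> \<le> exp (- hK z') + 1 * e"
    using hK_nonneg[of z'] e by (simp add: distrib_left)
  finally show "exp (- hK z) \<le> exp (- hK z') + e" by simp
qed

text \<open>
  Apply \<open>transport_inequality\<close> with \<open>g z = exp (- hK z)\<close>. Points of the
  polar body have inner products of modulus at most \<open>1\<close> with the support, so
  \<open>hK (Fm T x)\<close> is at most the integral of \<open>\<bar>T (ip n x u)\<bar>\<close>,
  and the Monge-Ampere equation leaves a Gaussian as lower bound for the integrand. By
  \<open>gauge_volume\<close> the right-hand side is a volume.
\<close>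

theorem bipolar_volume_defect:
  "ennreal (2 ^ n * (1 + gain)) \<le> ennreal (fact n) * emeasure (Leb n) {z \<in> Rn n. hK z \<le> 1}"
proof -
  obtain T t where T: "\<And>s. (T has_real_derivative t s) (at s)" and t: "continuous_on UNIV t" "\<And>s. 0 < t s"
    and lt: "\<And>s. ln (t s) = ln 2 - pi * s\<^sup>2 + \<bar>T s\<bar>"
    and k1: "\<And>a b. \<bar>a\<bar> \<le> 1 / 8 \<Longrightarrow> \<bar>b\<bar> \<le> 1 / 8 \<Longrightarrow> ((a\<^sup>2 - b\<^sup>2) / 2)\<^sup>2 \<le> (ln (t a) - ln (t b))\<^sup>2"
    and k2: "\<And>a b. \<bar>a\<bar> \<le> 1 / 8 \<Longrightarrow> \<bar>b\<bar> \<le> 1 / 8 \<Longrightarrow> - (4 * \<bar>b\<bar>) \<le> ln (t a) - ln (t b)"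
    using gauss_to_exponential by metis
  have cT: "continuous_on UNIV T" by (rule DERIV_continuous_on_UNIV[OF T])
  have caT: "continuous_on UNIV (\<lambda>s. \<bar>T s\<bar>)" by (intro continuous_intros cT)
  define V where "V x = (if x \<in> cube n core_radius then var (\<lambda>u. (ip n x u)\<^sup>2) / 16 else 0)" for x
  have V0: "0 \<le> V x" for x by (auto simp: V_def intro!: var_nonneg bmeas_power bmeas_ip)
  have pt: "2 ^ n * exp (- pi * ip n x x) * (1 + V x) \<le> exp (- hK (Fm T x)) * dt n (Am t x)" for x
  proof -
    let ?E = "\<integral>u. ln (t (ip n x u)) \<partial>\<mu>" and ?A = "\<integral>u. \<bar>T (ip n x u)\<bar> \<partial>\<mu>"
    have dtV: "exp ?E * (1 + V x) \<le> dt n (Am t x)"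
      using dt_Am_lower[OF t, of x] dt_Am_lower_cube[OF n_pos t k1 k2, of x] by (auto simp: V_def)
    have E: "?E = n * ln 2 - pi * ip n x x + ?A"
    proof -
      have "?E = (\<integral>u. ln 2 - pi * (ip n x u)\<^sup>2 + \<bar>T (ip n x u)\<bar> \<partial>\<mu>)" by (simp add: lt)
      also have "\<dots> = (\<integral>u. ln 2 - pi * (ip n x u)\<^sup>2 \<partial>\<mu>) + ?A"
        by (rule Bochner_Integration.integral_add; intro bmeas_integrable bmeas_diff bmeas_const bmeas_mult bmeas_power bmeas_ip bmeas_cont_ip[OF caT])
      also have "(\<integral>u. ln 2 - pi * (ip n x u)\<^sup>2 \<partial>\<mu>) = (\<integral>u. ln 2 \<partial>\<mu>) - (\<integral>u. pi * (ip n x u)\<^sup>2 \<partial>\<mu>)"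
        by (rule Bochner_Integration.integral_diff; intro bmeas_integrable bmeas_const bmeas_mult bmeas_power bmeas_ip)
      finally show ?thesis by (simp add: total_mass integral_ip_sq_one)
    qed
    have "hK (Fm T x) \<le> ?A"
    proof (rule hK_le)
      fix y assume y: "y \<in> K"
      have "ip n y (Fm T x) = (\<integral>u. T (ip n x u) * ip n y u \<partial>\<mu>)" by (rule ip_Fm[OF cT])
      also have "\<dots> \<le> ?A"
      proof (rule integral_mono_AE)
        show "integrable \<mu> (\<lambda>u. T (ip n x u) * ip n y u)"
          by (intro bmeas_integrable bmeas_mult bmeas_cont_ip[OF cT] bmeas_ip)
        show "integrable \<mu> (\<lambda>u. \<bar>T (ip n x u)\<bar>)" by (intro bmeas_integrable bmeas_cont_ip[OF caT])
        show "AE u in \<mu>. T (ip n x u) * ip n y u \<le> \<bar>T (ip n x u)\<bar>"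
          using AE_X
        proof eventually_elim
          case (elim u)
          have "T (ip n x u) * ip n y u \<le> \<bar>T (ip n x u)\<bar> * \<bar>ip n y u\<bar>" by (metis abs_ge_self abs_mult)
          also have "\<dots> \<le> \<bar>T (ip n x u)\<bar> * 1" using K_abs[OF y elim] by (intro mult_left_mono) auto
          finally show ?case by simp
        qed
      qed
      finally show "ip n y (Fm T x) \<le> ?A" .
    qed
    then have "exp (- ?A) * (exp ?E * (1 + V x)) \<le> exp (- hK (Fm T x)) * dt n (Am t x)"
      using V0[of x] dtV by (intro mult_mono) auto
    moreover have "exp (- ?A) * exp ?E = 2 ^ n * exp (- pi * ip n x x)"
    proof -
      have "exp (- ?A) * exp ?E = exp (n * ln 2) * exp (- pi * ip n x x)"
        unfolding E by (simp flip: exp_add)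
      then show ?thesis by (simp add: exp_of_nat_mult)
    qed
    ultimately show ?thesis by (simp only: mult.assoc[symmetric])
  qed
  let ?v = "\<lambda>x. ennreal (var (\<lambda>u. (ip n x u)\<^sup>2) / 16) * indicator (cube n core_radius) x"
  let ?h = "\<lambda>x. ennreal (2 ^ n) * (ennreal (exp (- pi * ip n x x)) + ennreal (1 / 2) * ?v x)"
  \<comment> \<open>the transport inequality is stated for bounded domains, so exhaust the space by balls\<close>
  define B where "B k = {x \<in> Rn n. ip n x x \<le> (real k)\<^sup>2}" for k :: nat
  have Bs [measurable]: "B k \<in> sets (Leb n)" for k
  proof -
    have "{x \<in> space (Leb n). ip n x x \<le> (real k)\<^sup>2} \<in> sets (Leb n)" by measurable
    then show ?thesis by (simp add: B_def)
  qed
  have hm [measurable]: "?h \<in> borel_measurable (Leb n)" using var_square_measurable by measurable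
  have k: "(\<integral>\<^sup>+x. ?h x * indicator (B k) x \<partial>Leb n) \<le> (\<integral>\<^sup>+z. ennreal (exp (- hK z)) \<partial>Leb n)" for k
  proof -
    have "(\<integral>\<^sup>+x. ?h x * indicator (B k) x \<partial>Leb n) \<le> (\<integral>\<^sup>+x. ennreal (exp (- hK (Fm T x)) * dt n (Am t x)) * indicator (B k) x \<partial>Leb n)"
    proof (intro nn_integral_mono mult_right_mono)
      fix x
      \<comment> \<open>on the small cube the Gaussian density is at least \<open>1 / 2\<close>\<close>
      have "1 / 2 * V x \<le> exp (- pi * ip n x x) * V x"
      proof (cases "x \<in> cube n core_radius")
        case True
        obtain u where "u \<in> usphere n" using X_nonempty X_usphere by blast
        then have "ip n x x \<le> (1 / (8 * n))\<^sup>2" by (rule cube_ip_small(3)[OF n_pos True])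
        also have "\<dots> \<le> (1 / 8)\<^sup>2" using n_pos by (intro power_mono) (auto simp: field_simps)
        finally have "pi * ip n x x \<le> 4 * (1 / 8)\<^sup>2" using pi_less_4 by (intro mult_mono) auto
        then have "pi * ip n x x \<le> 1 / 2" by (simp add: power2_eq_square)
        then have "1 / 2 \<le> exp (- pi * ip n x x)" using exp_ge_add_one_self[of "- pi * ip n x x"] by linarith
        then show ?thesis using V0 by (intro mult_right_mono) auto
      qed (simp add: V_def)
      then have "2 ^ n * (exp (- pi * ip n x x) + 1 / 2 * V x) \<le> 2 ^ n * (exp (- pi * ip n x x) * (1 + V x))"
        by (intro mult_left_mono) (auto simp: algebra_simps)
      also have "\<dots> \<le> exp (- hK (Fm T x)) * dt n (Am t x)" using pt[of x] by (simp add: mult.assoc)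
      finally have "ennreal (2 ^ n * (exp (- pi * ip n x x) + 1 / 2 * V x)) \<le> ennreal (exp (- hK (Fm T x)) * dt n (Am t x))"
        by (rule ennreal_leI)
      moreover have "?v x = ennreal (V x)" by (simp add: V_def indicator_def)
      then have "?h x = ennreal (2 ^ n * (exp (- pi * ip n x x) + 1 / 2 * V x))"
        using V0[of x] by (simp only: ennreal_mult[symmetric] ennreal_plus[symmetric] exp_ge_zero zero_le_divide_1_iff zero_le_numeral mult_nonneg_nonneg add_nonneg_nonneg zero_le_power)
      ultimately show "?h x \<le> ennreal (exp (- hK (Fm T x)) * dt n (Am t x))" by simp
    qed simp
    also have "\<dots> \<le> (\<integral>\<^sup>+z. ennreal (exp (- hK z)) \<partial>Leb n)"
      by (rule transport_inequality[OF T t _ Bs, where R = "real k"]) (auto simp: B_def intro: exp_hK_uniformly_continuous)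
    finally show ?thesis .
  qed
  have "(\<integral>\<^sup>+x. ?h x \<partial>Leb n) = (\<integral>\<^sup>+x. (SUP k. ?h x * indicator (B k) x) \<partial>Leb n)"
  proof (rule nn_integral_cong)
    fix x assume x: "x \<in> space (Leb n)"
    obtain k :: nat where k: "ip n x x \<le> real k" using real_arch_simple by blast
    have kk: "real k \<le> (real k)\<^sup>2" by (metis le_square of_nat_le_iff of_nat_mult power2_eq_square)
    have "x \<in> B k" using order_trans[OF k kk] x unfolding B_def by simp
    then have "?h x = ?h x * indicator (B k) x" by simp
    also have "\<dots> \<le> (SUP k. ?h x * indicator (B k) x)" by (rule SUP_upper) simp
    finally show "?h x = (SUP k. ?h x * indicator (B k) x)"
      by (intro antisym SUP_least) (auto simp: indicator_def)
  qed
  also have "\<dots> = (SUP k. \<integral>\<^sup>+x. ?h x * indicator (B k) x \<partial>Leb n)"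
  proof (rule nn_integral_monotone_convergence_SUP)
    have "B k \<subseteq> B (Suc k)" for k
    proof
      fix x assume "x \<in> B k"
      moreover have "(real k)\<^sup>2 \<le> (real (Suc k))\<^sup>2" by (intro power_mono) auto
      ultimately show "x \<in> B (Suc k)" unfolding B_def by (auto intro: order_trans)
    qed
    then show "incseq (\<lambda>k x. ?h x * indicator (B k) x)"
      by (intro incseq_SucI le_funI mult_left_mono) (auto simp: indicator_def)
  qed measurable
  also have "\<dots> \<le> (\<integral>\<^sup>+z. ennreal (exp (- hK z)) \<partial>Leb n)" by (intro SUP_least k)
  also have "\<dots> = ennreal (fact n) * emeasure (Leb n) {z \<in> Rn n. hK z \<le> 1}"
    by (rule gauge_volume) (auto intro: hK_nonneg hK_div)
  finally have main: "(\<integral>\<^sup>+x. ?h x \<partial>Leb n) \<le> ennreal (fact n) * emeasure (Leb n) {z \<in> Rn n. hK z \<le> 1}" .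
  have "ennreal (2 ^ n * (1 + gain)) = ennreal (2 ^ n) * (1 + ennreal (1 / 2) * ennreal (2 * gain))"
  proof -
    have "ennreal (1 / 2) * ennreal (2 * gain) = ennreal gain"
      using gain_nonneg by (subst ennreal_mult[symmetric]) auto
    then show ?thesis using gain_nonneg by (simp add: ennreal_mult ennreal_plus)
  qed
  also have "\<dots> \<le> ennreal (2 ^ n) * (1 + ennreal (1 / 2) * (\<integral>\<^sup>+x. ?v x \<partial>Leb n))"
    by (intro mult_left_mono add_left_mono cube_gain) auto
  also have "\<dots> = (\<integral>\<^sup>+x. ?h x \<partial>Leb n)"
  proof -
    have vm: "(\<lambda>x. ennreal (1 / 2) * ?v x) \<in> borel_measurable (Leb n)"
      by (rule borel_measurable_times_ennreal[OF borel_measurable_const var_square_measurable])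
    have "(\<integral>\<^sup>+x. ?h x \<partial>Leb n) = ennreal (2 ^ n) * (\<integral>\<^sup>+x. ennreal (exp (- pi * ip n x x)) + ennreal (1 / 2) * ?v x \<partial>Leb n)"
      by (rule nn_integral_cmult) (use vm in measurable)
    also have "(\<integral>\<^sup>+x. ennreal (exp (- pi * ip n x x)) + ennreal (1 / 2) * ?v x \<partial>Leb n) =
        (\<integral>\<^sup>+x. ennreal (exp (- pi * ip n x x)) \<partial>Leb n) + (\<integral>\<^sup>+x. ennreal (1 / 2) * ?v x \<partial>Leb n)"
      by (rule nn_integral_add) (use vm in measurable)
    also have "(\<integral>\<^sup>+x. ennreal (1 / 2) * ?v x \<partial>Leb n) = ennreal (1 / 2) * (\<integral>\<^sup>+x. ?v x \<partial>Leb n)"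
      by (rule nn_integral_cmult[OF var_square_measurable])
    finally show ?thesis by (simp only: nn_integral_gauss_n)
  qed
  finally show ?thesis using main by (rule order_trans)
qed

lemma emeasure_Z_finite: "emeasure (Leb n) Z < \<infinity>"
proof -
  have "Z \<subseteq> cube n 1"
    using ball_subset_cube[of 1 n] Z_norm Z_Rn by auto
  then have "emeasure (Leb n) Z \<le> emeasure (Leb n) (cube n 1)" by (intro emeasure_mono) auto
  also have "\<dots> < \<infinity>" by (simp add: emeasure_cube)
  finally show ?thesis .
qed

text \<open>
  By \<open>bipolar_shrunk\<close> the hull and the sublevel set of \<open>hK\<close> have the
  same volume.
\<close>

theorem hull_volume_defect: "2 ^ n / fact n * (1 + gain) \<le> vol n Z"
proof -
  define C where "C = {z \<in> Rn n. hK z \<le> 1}"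
  have Cs [measurable]: "C \<in> sets (Leb n)"
  proof -
    have "{z \<in> space (Leb n). hK z \<le> 1} \<in> sets (Leb n)" by measurable
    then show ?thesis by (simp add: C_def)
  qed
  have vZ: "emeasure (Leb n) Z = ennreal (vol n Z)"
    using emeasure_Z_finite by (simp add: vol_def emeasure_eq_ennreal_measure)
  have v0: "0 \<le> vol n Z" by (simp add: vol_def)
  have step: "ennreal (s ^ n) * emeasure (Leb n) C \<le> ennreal (vol n Z)" if s: "0 < s" "s < 1" for s
  proof -
    have "ennreal (s ^ n) * emeasure (Leb n) C = emeasure (Leb n) {x \<in> Rn n. (\<lambda>i\<in>{..<n}. x i / s) \<in> C}"
      by (rule emeasure_scale[symmetric]) (use s in auto)
    also have "\<dots> \<le> emeasure (Leb n) Z"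
    proof (rule emeasure_mono)
      show "{x \<in> Rn n. (\<lambda>i\<in>{..<n}. x i / s) \<in> C} \<subseteq> Z"
      proof safe
        fix x assume x: "x \<in> Rn n" "(\<lambda>i\<in>{..<n}. x i / s) \<in> C"
        have "(\<lambda>i\<in>{..<n}. s * (\<lambda>i\<in>{..<n}. x i / s) i) \<in> Z"
          by (rule bipolar_shrunk[OF _ _ s]) (use x in \<open>auto simp: C_def simp del: restrict_apply\<close>)
        also have "(\<lambda>i\<in>{..<n}. s * (\<lambda>i\<in>{..<n}. x i / s) i) = x"
          by (rule Rn_ext[of _ n]) (use x s in auto)
        finally show "x \<in> Z" .
      qed
    qed simp
    finally show ?thesis by (simp add: vZ)
  qed
  have step': "s ^ n * (2 ^ n * (1 + gain)) \<le> fact n * vol n Z" if s: "0 < s" "s < 1" for s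
  proof -
    have "ennreal (s ^ n * (2 ^ n * (1 + gain))) = ennreal (s ^ n) * ennreal (2 ^ n * (1 + gain))"
      using s gain_nonneg by (intro ennreal_mult) auto
    also have "\<dots> \<le> ennreal (s ^ n) * (ennreal (fact n) * emeasure (Leb n) C)"
      unfolding C_def by (intro mult_left_mono bipolar_volume_defect) auto
    also have "\<dots> = ennreal (fact n) * (ennreal (s ^ n) * emeasure (Leb n) C)" by (simp only: mult.left_commute)
    also have "\<dots> \<le> ennreal (fact n) * ennreal (vol n Z)" by (intro mult_left_mono step s) auto
    also have "\<dots> = ennreal (fact n * vol n Z)" using v0 by (subst ennreal_mult) auto
    finally show ?thesis using v0 by (subst (asm) ennreal_le_iff) auto
  qed
  define R where "R k = 1 - 1 / real (Suc (Suc k))" for k :: nat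
  have "R \<longlonglongrightarrow> 1 - 0"
    unfolding R_def using LIMSEQ_Suc[OF LIMSEQ_inverse_real_of_nat]
    by (intro tendsto_diff tendsto_const) (simp add: inverse_eq_divide)
  then have "(\<lambda>k. R k ^ n * (2 ^ n * (1 + gain))) \<longlonglongrightarrow> (1 - 0) ^ n * (2 ^ n * (1 + gain))"
    by (intro tendsto_intros)
  moreover have "R k ^ n * (2 ^ n * (1 + gain)) \<le> fact n * vol n Z" for k
    by (rule step') (auto simp: R_def field_simps)
  ultimately have "(1 - 0) ^ n * (2 ^ n * (1 + gain)) \<le> fact n * vol n Z"
    by (intro LIMSEQ_le_const2) auto
  then show ?thesis by (simp add: field_simps)
qed

end

section \<open>Orthonormal frames and cross measures\<close>

lemma frame_ip: "orthonormal_basis n v \<Longrightarrow> i < n \<Longrightarrow> j < n \<Longrightarrow> (\<Sum>k<n. v i k * v j k) = idm i j"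
  by (simp add: orthonormal_basis_def ip_def)

lemma frame_columns: "orthonormal_basis n v \<Longrightarrow> i < n \<Longrightarrow> j < n \<Longrightarrow> (\<Sum>k<n. v k i * v k j) = idm i j"
  by (rule orthonormal_columns) (auto simp: frame_ip)

lemma frame_parseval: "orthonormal_basis n v \<Longrightarrow> ip n (mat_app n v x) (mat_app n v y) = ip n x y"
  by (rule mat_app_orthogonal_ip) (auto simp: frame_columns)

lemma frame_coord: "i < n \<Longrightarrow> mat_app n v x i = ip n (v i) x"
  by (simp add: mat_app_def ip_def)

lemma frame_expand:
  assumes v: "orthonormal_basis n v" and j: "j < n"
  shows "(\<Sum>i<n. ip n (v i) x * v i j) = x j"
proof -
  have "(\<Sum>i<n. ip n (v i) x * v i j) = (\<Sum>i<n. \<Sum>k<n. x k * (v i k * v i j))"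
    unfolding ip_def sum_distrib_right by (intro sum.cong refl) simp
  also have "\<dots> = (\<Sum>k<n. \<Sum>i<n. x k * (v i k * v i j))" by (rule sum.swap)
  also have "\<dots> = (\<Sum>k<n. if k = j then x k else 0)"
    by (intro sum.cong refl) (simp add: sum_distrib_left[symmetric] frame_columns[OF v _ j])
  finally show ?thesis using j by simp
qed

lemma emeasure_frame:
  assumes v: "orthonormal_basis n v" and S [measurable]: "S \<in> sets (Leb n)"
  shows "emeasure (Leb n) {x \<in> Rn n. mat_app n v x \<in> S} = emeasure (Leb n) S"
proof -
  have "(\<integral>\<^sup>+x. indicator S (mat_app n v x) \<partial>Leb n) = (\<integral>\<^sup>+x. indicator S x \<partial>Leb n)"
    by (rule nn_integral_rotate) (auto simp: frame_ip[OF v])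
  also have "(\<integral>\<^sup>+x. indicator S (mat_app n v x) \<partial>Leb n) = (\<integral>\<^sup>+x. indicator {x \<in> space (Leb n). mat_app n v x \<in> S} x \<partial>Leb n)"
    by (intro nn_integral_cong) (auto simp: indicator_def)
  also have "\<dots> = emeasure (Leb n) {x \<in> space (Leb n). mat_app n v x \<in> S}"
    by (rule nn_integral_indicator) measurable
  finally show ?thesis by simp
qed

lemma frame_preimage_sets:
  "S \<in> sets (Leb n) \<Longrightarrow> {x \<in> Rn n. mat_app n v x \<in> S} \<in> sets (Leb n)"
  using measurable_sets[OF mat_app_measurable, of S n v] by (simp add: vimage_def Int_def conj_commute)

text \<open>
  In the coordinates of the frame the polar body is a cube.
\<close>

lemma cross_polar_volume:
  assumes o: "orthonormal_basis n f" and s: "supp n \<nu> = f ` {..<n} \<union> (\<lambda>i. vneg n (f i)) ` {..<n}"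
  shows "vol n (Z_inf_polar n \<nu>) = 2 ^ n"
proof -
  have "Z_inf_polar n \<nu> = {x \<in> Rn n. mat_app n f x \<in> cube n 1}"
    unfolding Z_inf_polar_def s
    by (auto simp: cube_iff frame_coord abs_le_iff ball_Un ip_def[of n "f _"] mult.commute ip_def sum_negf vneg_def)
  then have "emeasure (Leb n) (Z_inf_polar n \<nu>) = ennreal (2 ^ n)"
    using emeasure_frame[OF o cube_sets, of 1] emeasure_cube[of 1 n] by simp
  then show ?thesis by (simp add: vol_def measure_def)
qed

text \<open>
  The cross-polytope in the coordinates of the frame is convex and contains the support.
\<close>

lemma cross_hull_volume:
  assumes o: "orthonormal_basis n f" and s: "supp n \<nu> = f ` {..<n} \<union> (\<lambda>i. vneg n (f i)) ` {..<n}"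
  shows "vol n (Z_inf n \<nu>) \<le> 2 ^ n / fact n"
proof -
  define S where "S = {y \<in> Rn n. (\<Sum>i<n. \<bar>y i\<bar>) \<le> 1}"
  have Ss: "S \<in> sets (Leb n)"
  proof -
    have "{y \<in> space (Leb n). (\<Sum>i<n. \<bar>y i\<bar>) \<le> 1} \<in> sets (Leb n)" by measurable
    then show ?thesis by (simp add: S_def)
  qed
  define C where "C = {x \<in> Rn n. mat_app n f x \<in> S}"
  have Ci: "x \<in> C \<longleftrightarrow> x \<in> Rn n \<and> (\<Sum>i<n. \<bar>ip n (f i) x\<bar>) \<le> 1" for x
    by (simp add: C_def S_def frame_coord)
  have "convex_Rn n C"
    unfolding convex_Rn_def
  proof (intro conjI ballI allI impI)
    show "C \<subseteq> Rn n" by (auto simp: C_def)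
    fix x y a b assume xy: "x \<in> C" "y \<in> C" and ab: "0 \<le> a" "0 \<le> b" "a + b = (1::real)"
    have "(\<Sum>i<n. \<bar>ip n (f i) (\<lambda>i. a * x i + b * y i)\<bar>) \<le> (\<Sum>i<n. a * \<bar>ip n (f i) x\<bar> + b * \<bar>ip n (f i) y\<bar>)"
    proof (rule sum_mono)
      fix i
      have "ip n (f i) (\<lambda>i. a * x i + b * y i) = a * ip n (f i) x + b * ip n (f i) y"
        by (simp add: ip_def algebra_simps sum.distrib sum_distrib_left)
      also have "\<bar>\<dots>\<bar> \<le> a * \<bar>ip n (f i) x\<bar> + b * \<bar>ip n (f i) y\<bar>"
        using ab abs_triangle_ineq[of "a * ip n (f i) x" "b * ip n (f i) y"] by (simp add: abs_mult)
      finally show "\<bar>ip n (f i) (\<lambda>i. a * x i + b * y i)\<bar> \<le> a * \<bar>ip n (f i) x\<bar> + b * \<bar>ip n (f i) y\<bar>" .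
    qed
    also have "\<dots> = a * (\<Sum>i<n. \<bar>ip n (f i) x\<bar>) + b * (\<Sum>i<n. \<bar>ip n (f i) y\<bar>)"
      by (simp add: sum.distrib sum_distrib_left)
    also have "\<dots> \<le> a * 1 + b * 1" using xy ab by (intro add_mono mult_left_mono) (auto simp: Ci)
    finally show "(\<lambda>i\<in>{..<n}. a * x i + b * y i) \<in> C" using ab by (simp add: Ci)
  qed
  moreover have "supp n \<nu> \<subseteq> C"
  proof -
    have fk: "(\<Sum>i<n. \<bar>ip n (f i) (f k)\<bar>) = 1" if "k < n" for k
    proof -
      have "(\<Sum>i<n. \<bar>ip n (f i) (f k)\<bar>) = (\<Sum>i<n. if i = k then 1 else 0)"
        using o that by (intro sum.cong) (auto simp: orthonormal_basis_def)
      then show ?thesis using that by simp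
    qed
    have "f k \<in> Rn n" if "k < n" for k using o that by (simp add: orthonormal_basis_def)
    then show ?thesis unfolding s using fk by (auto simp: Ci)
  qed
  ultimately have sub: "Z_inf n \<nu> \<subseteq> C" unfolding Z_inf_def by (rule hull_minimal[rotated])
  have "emeasure (Leb n) (Z_inf n \<nu>) \<le> emeasure (Leb n) C"
    by (rule emeasure_mono[OF sub]) (simp add: C_def frame_preimage_sets[OF Ss])
  also have "\<dots> = ennreal (2 ^ n / fact n)"
    unfolding C_def emeasure_frame[OF o Ss] unfolding S_def by (rule emeasure_cross_polytope)
  finally have "enn2real (emeasure (Leb n) (Z_inf n \<nu>)) \<le> enn2real (ennreal (2 ^ n / fact n))"
    by (intro enn2real_mono) (auto simp: less_top[symmetric])
  then show ?thesis by (simp add: vol_def measure_def)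
qed

text \<open>
  The matrix is the sum of the \<open>v k \<otimes> f k\<close>.
\<close>

lemma frame_transfer:
  assumes f: "orthonormal_basis n f" and v: "orthonormal_basis n v"
  obtains A where "A \<in> orthogonal_matrices n" "\<And>k. k < n \<Longrightarrow> mat_app n A (f k) = v k"
    "\<And>k. k < n \<Longrightarrow> mat_app n A (vneg n (f k)) = vneg n (v k)"
proof -
  define A where "A i j = (\<Sum>k<n. v k i * f k j)" for i j
  have "A \<in> orthogonal_matrices n"
    unfolding orthogonal_matrices_def
  proof (intro CollectI allI impI)
    fix j k assume jk: "j < n" "k < n"
    have "(\<Sum>i<n. A i j * A i k) = (\<Sum>i<n. \<Sum>p<n. \<Sum>q<n. (f p j * f q k) * (v p i * v q i))"
      by (simp add: A_def sum_product mult_ac)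
    also have "\<dots> = (\<Sum>p<n. \<Sum>q<n. \<Sum>i<n. (f p j * f q k) * (v p i * v q i))" by (rule sum_rotate)
    also have "\<dots> = (\<Sum>p<n. \<Sum>q<n. if q = p then f p j * f p k else 0)"
      by (intro sum.cong refl) (auto simp: sum_distrib_left[symmetric] frame_ip[OF v])
    also have "\<dots> = (\<Sum>p<n. f p j * f p k)" by simp
    also have "\<dots> = idm j k" by (rule frame_columns[OF f jk])
    finally show "(\<Sum>i<n. A i j * A i k) = (if j = k then 1 else 0)" .
  qed
  moreover have Af: "mat_app n A (f k) = v k" if k: "k < n" for k
  proof (rule Rn_ext[of _ n])
    show "v k \<in> Rn n" using v k by (simp add: orthonormal_basis_def)
    fix i assume i: "i < n"
    have "mat_app n A (f k) i = (\<Sum>j<n. \<Sum>p<n. v p i * (f p j * f k j))"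
      using i by (simp add: mat_app_def A_def sum_distrib_right mult.assoc)
    also have "\<dots> = (\<Sum>p<n. \<Sum>j<n. v p i * (f p j * f k j))" by (rule sum.swap)
    also have "\<dots> = (\<Sum>p<n. if p = k then v p i else 0)"
      by (intro sum.cong refl) (auto simp: sum_distrib_left[symmetric] frame_ip[OF f _ k])
    finally show "mat_app n A (f k) i = v k i" using k by simp
  qed simp
  moreover have "mat_app n A (vneg n (f k)) = vneg n (v k)" if k: "k < n" for k
  proof -
    have "mat_app n A (vneg n (f k)) = vneg n (mat_app n A (f k))"
      by (auto simp: mat_app_def vneg_def fun_eq_iff sum_negf)
    then show ?thesis by (simp add: Af[OF k])
  qed
  ultimately show ?thesis using that by blast
qed

section \<open>Hausdorff distance to a cross\<close>

lemma vangle_range: "0 \<le> vangle n x y" "vangle n x y \<le> pi"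
proof -
  have "\<bar>ip n x y\<bar> \<le> vnorm n x * vnorm n y"
  proof -
    have "\<bar>ip n x y\<bar>\<^sup>2 \<le> (vnorm n x * vnorm n y)\<^sup>2"
      using ip_cauchy_schwarz[of n x y] by (simp add: vnorm_sqrt power_mult_distrib)
    then show ?thesis by (rule power2_le_imp_le) (simp add: vnorm_sqrt)
  qed
  moreover have "0 \<le> vnorm n x * vnorm n y" by (simp add: vnorm_sqrt)
  ultimately have "-1 \<le> ip n x y / (vnorm n x * vnorm n y)" "ip n x y / (vnorm n x * vnorm n y) \<le> 1"
    by (cases "vnorm n x * vnorm n y = 0"; simp only: abs_le_iff; simp add: divide_le_eq le_divide_eq)+
  then show "0 \<le> vangle n x y" "vangle n x y \<le> pi"
    unfolding vangle_def by (rule arccos_lbound, rule arccos_ubound)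
qed

lemma INF_vangle_range:
  assumes "Y \<noteq> {}"
  shows "0 \<le> (INF y\<in>Y. vangle n x y)" "(INF y\<in>Y. vangle n x y) \<le> pi"
    "bdd_below ((\<lambda>y. vangle n x y) ` Y)"
proof -
  show b: "bdd_below ((\<lambda>y. vangle n x y) ` Y)" by (rule bdd_belowI2[of _ 0]) (rule vangle_range)
  show "0 \<le> (INF y\<in>Y. vangle n x y)" using assms by (intro cINF_greatest vangle_range) auto
  obtain y where "y \<in> Y" using assms by blast
  then have "(INF y\<in>Y. vangle n x y) \<le> vangle n x y" by (rule cINF_lower[OF b])
  then show "(INF y\<in>Y. vangle n x y) \<le> pi" using vangle_range(2)[of n x y] by linarith
qed

lemma vangle_commute: "vangle n x y = vangle n y x"
  by (simp add: vangle_def ip_def mult.commute)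

lemma INF_vangle_range':
  assumes "X \<noteq> {}"
  shows "0 \<le> (INF x\<in>X. vangle n x y)" "(INF x\<in>X. vangle n x y) \<le> pi"
    "bdd_below ((\<lambda>x. vangle n x y) ` X)"
  using INF_vangle_range[OF assms, of n y] by (simp_all only: vangle_commute[of n _ y])

lemma sph_hausdorff_range:
  assumes "X \<noteq> {}" "Y \<noteq> {}"
  shows "0 \<le> sph_hausdorff n X Y" "sph_hausdorff n X Y \<le> pi"
proof -
  obtain x where x: "x \<in> X" using assms by blast
  have "bdd_above ((\<lambda>x. INF y\<in>Y. vangle n x y) ` X)"
    by (rule bdd_aboveI2[of _ _ pi]) (rule INF_vangle_range(2)[OF assms(2)])
  then have "(INF y\<in>Y. vangle n x y) \<le> (SUP x\<in>X. INF y\<in>Y. vangle n x y)" by (rule cSUP_upper[OF x])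
  then show "0 \<le> sph_hausdorff n X Y" using INF_vangle_range(1)[OF assms(2), of n x] by (simp add: sph_hausdorff_def)
  show "sph_hausdorff n X Y \<le> pi"
    unfolding sph_hausdorff_def
    by (intro max.boundedI cSUP_least assms INF_vangle_range(2) INF_vangle_range'(2))
qed

text \<open>
  Any two frames are related by an orthogonal matrix, so the distance up to orthogonal maps is
  bounded by the distance to the cross of an arbitrary frame.
\<close>

lemma sph_hausdorff_O_le:
  assumes X: "X \<noteq> {}" and n: "1 \<le> n" and f: "orthonormal_basis n f" and v: "orthonormal_basis n v"
  shows "sph_hausdorff_O n X (f ` {..<n} \<union> (\<lambda>i. vneg n (f i)) ` {..<n}) \<le>
    sph_hausdorff n X (v ` {..<n} \<union> (\<lambda>i. vneg n (v i)) ` {..<n})"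
proof -
  let ?Y = "f ` {..<n} \<union> (\<lambda>i. vneg n (f i)) ` {..<n}"
  have "f 0 \<in> ?Y" using n by simp
  then have Y: "?Y \<noteq> {}" by blast
  obtain A where A: "A \<in> orthogonal_matrices n" "\<And>k. k < n \<Longrightarrow> mat_app n A (f k) = v k"
    "\<And>k. k < n \<Longrightarrow> mat_app n A (vneg n (f k)) = vneg n (v k)"
    using frame_transfer[OF f v] by metis
  have eq: "mat_app n A ` ?Y = v ` {..<n} \<union> (\<lambda>i. vneg n (v i)) ` {..<n}"
    using A by (auto simp: image_Un image_image)
  have "bdd_below ((\<lambda>A. sph_hausdorff n X (mat_app n A ` ?Y)) ` orthogonal_matrices n)"
    by (rule bdd_belowI2[of _ 0]) (use X Y in \<open>auto intro!: sph_hausdorff_range\<close>)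
  from cINF_lower[OF this A(1)] show ?thesis
    unfolding sph_hausdorff_O_def using eq by simp
qed

lemma cos_le_quadratic:
  assumes "0 \<le> t" "t \<le> pi / 2"
  shows "cos t \<le> 1 - t\<^sup>2 / 8"
proof (cases "t = 0")
  case False
  let ?s = "t / 2"
  have s: "0 < ?s" "?s \<le> pi / 3" using assms False pi_gt_zero by auto
  from MVT2[OF s(1), of sin cos] obtain z where z: "0 < z" "z < ?s" "sin ?s - sin 0 = (?s - 0) * cos z" by auto
  have "cos (pi / 3) \<le> cos z" using z s by (intro cos_monotone_0_pi_le) auto
  then have "1 / 2 \<le> cos z" by (simp add: cos_60)
  then have "?s * (1 / 2) \<le> sin ?s" using z(3) mult_left_mono[OF _ less_imp_le[OF s(1)], of "1 / 2" "cos z"] by simp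
  then have "(?s * (1 / 2))\<^sup>2 \<le> (sin ?s)\<^sup>2" using s by (intro power_mono) auto
  moreover have "cos t = 1 - 2 * (sin ?s)\<^sup>2" using cos_double_sin[of ?s] by simp
  ultimately show ?thesis by (simp add: power2_eq_square)
qed simp

text \<open>
  If every vector of the cross is within angle \<open>\<epsilon> / 2\<close> of \<open>X\<close>,
  a Hausdorff distance of at least \<open>\<epsilon>\<close> can only be due to a vector of
  \<open>X\<close> that is far from the cross.
\<close>

lemma far_point:
  assumes X: "X \<noteq> {}" "\<And>x. x \<in> X \<Longrightarrow> x \<in> usphere n" and n: "1 \<le> n" and v: "orthonormal_basis n v"
    and e: "0 < \<epsilon>" "\<epsilon> \<le> sph_hausdorff n X (v ` {..<n} \<union> (\<lambda>i. vneg n (v i)) ` {..<n})"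
    and near: "\<And>i. i < n \<Longrightarrow> \<exists>x\<in>X. 1 - \<epsilon>\<^sup>2 / 32 \<le> ip n x (v i)"
    and near': "\<And>i. i < n \<Longrightarrow> \<exists>x\<in>X. 1 - \<epsilon>\<^sup>2 / 32 \<le> ip n x (vneg n (v i))"
  obtains x where "x \<in> X" "\<And>i. i < n \<Longrightarrow> \<bar>ip n x (v i)\<bar> \<le> 1 - \<epsilon>\<^sup>2 / 32"
proof -
  let ?V = "v ` {..<n} \<union> (\<lambda>i. vneg n (v i)) ` {..<n}"
  have "v 0 \<in> ?V" using n by simp
  then have V: "?V \<noteq> {}" by blast
  have Vn: "vnorm n y = 1" "ip n y y = 1" if "y \<in> ?V" for y
    using that v by (auto simp: vnorm_sqrt orthonormal_basis_def)
  have Xn: "vnorm n x = 1" "ip n x x = 1" if "x \<in> X" for x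
    using X(2)[OF that] real_sqrt_eq_1_iff[of "ip n x x"] by (auto simp: usphere_def vnorm_sqrt)
  have ang: "vangle n x y = arccos (ip n x y)" if "x \<in> X" "y \<in> ?V" for x y
    using Vn(1)[OF that(2)] Xn(1)[OF that(1)] by (simp add: vangle_def)
  have cs: "\<bar>ip n x y\<bar> \<le> 1" if "x \<in> X" "y \<in> ?V" for x y
    using ip_cauchy_schwarz[of n x y] Vn(2)[OF that(2)] Xn(2)[OF that(1)] by (simp add: abs_square_le_1)
  have epi: "\<epsilon> \<le> pi" using e(2) sph_hausdorff_range(2)[OF X(1) V, of n] by linarith
  have q: "cos (\<epsilon> / 2) \<le> 1 - \<epsilon>\<^sup>2 / 32"
    using cos_le_quadratic[of "\<epsilon> / 2"] e(1) epi by (simp add: power2_eq_square)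
  have nearV: "\<exists>x\<in>X. 1 - \<epsilon>\<^sup>2 / 32 \<le> ip n x y" if "y \<in> ?V" for y
    using that near near' by auto
  have second: "(SUP y\<in>?V. INF x\<in>X. vangle n x y) \<le> \<epsilon> / 2"
  proof (rule cSUP_least[OF V])
    fix y assume y: "y \<in> ?V"
    obtain x where x: "x \<in> X" "1 - \<epsilon>\<^sup>2 / 32 \<le> ip n x y" using nearV[OF y] by blast
    have "(INF x\<in>X. vangle n x y) \<le> vangle n x y"
      by (rule cINF_lower[OF INF_vangle_range'(3)[OF X(1)] x(1)])
    also have "\<dots> = arccos (ip n x y)" by (rule ang[OF x(1) y])
    also have "\<dots> \<le> arccos (cos (\<epsilon> / 2))"
      using q x(2) cs[OF x(1) y] by (intro arccos_le_arccos) auto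
    also have "\<dots> = \<epsilon> / 2" using e(1) epi by (intro arccos_cos) auto
    finally show "(INF x\<in>X. vangle n x y) \<le> \<epsilon> / 2" .
  qed
  have first: "\<epsilon> \<le> (SUP x\<in>X. INF y\<in>?V. vangle n x y)"
    using e second unfolding sph_hausdorff_def by (auto simp: le_max_iff_disj)
  have "\<exists>x\<in>X. \<epsilon> / 2 < (INF y\<in>?V. vangle n x y)"
  proof (rule ccontr)
    assume "\<not> ?thesis"
    then have "(SUP x\<in>X. INF y\<in>?V. vangle n x y) \<le> \<epsilon> / 2"
      by (intro cSUP_least[OF X(1)]) (auto simp: not_less)
    then show False using first e(1) by simp
  qed
  then obtain x where x: "x \<in> X" "\<epsilon> / 2 < (INF y\<in>?V. vangle n x y)" by blast
  have lt: "ip n x y \<le> 1 - \<epsilon>\<^sup>2 / 32" if y: "y \<in> ?V" for y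
  proof -
    have "(INF y\<in>?V. vangle n x y) \<le> vangle n x y" by (rule cINF_lower[OF INF_vangle_range(3)[OF V] y])
    then have "\<epsilon> / 2 < arccos (ip n x y)" using x(2) ang[OF x(1) y] by simp
    moreover have "arccos (ip n x y) \<le> pi" using cs[OF x(1) y] by (intro arccos_ubound) (auto simp: abs_le_iff)
    ultimately have "cos (arccos (ip n x y)) \<le> cos (\<epsilon> / 2)" using e(1) by (intro cos_monotone_0_pi_le) auto
    also have "cos (arccos (ip n x y)) = ip n x y" using cs[OF x(1) y] by (intro cos_arccos) (auto simp: abs_le_iff)
    finally show ?thesis using q by simp
  qed
  show ?thesis
  proof (rule that[OF x(1)])
    fix i assume i: "i < n"
    show "\<bar>ip n x (v i)\<bar> \<le> 1 - \<epsilon>\<^sup>2 / 32" using lt[of "v i"] lt[of "vneg n (v i)"] i by auto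
  qed
qed

section \<open>Frames near almost orthonormal tuples\<close>

lemma ip_sum_left: "ip n (\<lambda>i. \<Sum>j\<in>J. c j * w j i) y = (\<Sum>j\<in>J. c j * ip n (w j) y)"
  unfolding ip_def sum_distrib_right sum_distrib_left mult.assoc by (rule sum.swap)

lemma gram_schmidt_step_bound:
  fixes x \<tau> s :: real
  assumes "0 \<le> x" "24 * x \<le> 1" "0 \<le> \<tau>" "\<tau> \<le> x" "0 < s" "1 - 4 * x * \<tau> \<le> s"
  shows "(1 + 4 * x) / s \<le> 1 + 12 * x"
proof -
  have "4 * x * \<tau> \<le> 4 * x * (1 / 24)" using assms by (intro mult_left_mono) auto
  then have s: "1 - x / 6 \<le> s" using assms by simp
  have "x * x \<le> x * (1 / 24)" using assms by (intro mult_left_mono) auto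
  then have "1 + 4 * x \<le> (1 + 12 * x) * (1 - x / 6)" using assms by (simp add: algebra_simps)
  also have "\<dots> \<le> (1 + 12 * x) * s" using s assms by (intro mult_left_mono) auto
  finally show ?thesis using assms by (simp add: divide_le_eq)
qed

text \<open>
  Gram-Schmidt with quantitative control. If \<open>\<bar>ip n (w i) (w j)\<bar> \<le>
  \<tau>\<close>, then the coefficients \<open>c j\<close> of \<open>w m\<close> with respect to
  the previous vectors are at most \<open>2 * \<tau>\<close>, so the orthogonalised vector keeps a
  norm \<open>s\<close> with \<open>s\<^sup>2 \<ge> 1 - 4 * n * \<tau>\<^sup>2\<close>, and its
  representation in terms of \<open>w\<close> has sum norm at most \<open>(1 + 4 * n * \<tau>) /
  s\<close>. That the coefficients are triangular is part of the induction hypothesis because the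
  bound on \<open>c j\<close> uses that \<open>w m\<close> does not occur in \<open>v j\<close>.
\<close>

lemma almost_orthonormal_frame:
  fixes \<tau> :: real
  assumes w: "\<And>k. k < n \<Longrightarrow> ip n (w k) (w k) = 1"
    and near: "\<And>i j. i < n \<Longrightarrow> j < n \<Longrightarrow> i \<noteq> j \<Longrightarrow> \<bar>ip n (w i) (w j)\<bar> \<le> \<tau>"
    and tau: "0 \<le> \<tau>" "24 * (n * \<tau>) \<le> 1"
  shows "\<exists>v b. orthonormal_basis n v \<and> (\<forall>k<n. v k = (\<lambda>i\<in>{..<n}. \<Sum>l<n. b k l * w l i)) \<and>
    (\<forall>k<n. (\<Sum>l<n. \<bar>b k l\<bar>) \<le> 1 + 12 * (n * \<tau>)) \<and> (\<forall>k<n. 1 - 4 * (n * \<tau>) * \<tau> \<le> ip n (v k) (w k))"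
proof -
  have "m \<le> n \<Longrightarrow> \<exists>v b. (\<forall>i<m. \<forall>j<m. ip n (v i) (v j) = idm i j) \<and>
    (\<forall>k<m. v k = (\<lambda>i\<in>{..<n}. \<Sum>l<n. b k l * w l i) \<and> (\<forall>l>k. b k l = 0) \<and>
      (\<Sum>l<n. \<bar>b k l\<bar>) \<le> 1 + 12 * (n * \<tau>) \<and> 1 - 4 * (n * \<tau>) * \<tau> \<le> ip n (v k) (w k))" for m
  proof (induction m)
    case (Suc m)
    then have mn: "m < n" "m \<le> n" by auto
    from Suc.IH[OF mn(2)] obtain v b where o: "\<forall>i<m. \<forall>j<m. ip n (v i) (v j) = idm i j"
      and H: "\<forall>k<m. v k = (\<lambda>i\<in>{..<n}. \<Sum>l<n. b k l * w l i) \<and> (\<forall>l>k. b k l = 0) \<and>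
        (\<Sum>l<n. \<bar>b k l\<bar>) \<le> 1 + 12 * (n * \<tau>) \<and> 1 - 4 * (n * \<tau>) * \<tau> \<le> ip n (v k) (w k)"
      by (elim exE conjE)
    have v: "v k = (\<lambda>i\<in>{..<n}. \<Sum>l<n. b k l * w l i)" and b0: "\<And>l. k < l \<Longrightarrow> b k l = 0"
      and b1: "(\<Sum>l<n. \<bar>b k l\<bar>) \<le> 1 + 12 * (n * \<tau>)"
      and vw: "1 - 4 * (n * \<tau>) * \<tau> \<le> ip n (v k) (w k)" if "k < m" for k
      using H[rule_format, OF that] by blast+
    define x where "x = n * \<tau>"
    have n1: "1 \<le> real n" using mn by simp
    have tx: "\<tau> \<le> x" using mult_right_mono[OF n1 tau(1)] by (simp add: x_def)
    have x: "0 \<le> x" "24 * x \<le> 1" using tau by (auto simp: x_def)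
    define c where "c j = ip n (v j) (w m)" for j
    have c: "\<bar>c j\<bar> \<le> 2 * \<tau>" if j: "j < m" for j
    proof -
      have "c j = (\<Sum>l<n. b j l * ip n (w l) (w m))"
        unfolding c_def v[OF j] ip_lam by (rule ip_sum_left)
      also have "\<bar>\<dots>\<bar> \<le> (\<Sum>l<n. \<bar>b j l\<bar> * \<tau>)"
      proof (rule order_trans[OF sum_abs sum_mono])
        fix l assume l: "l \<in> {..<n}"
        show "\<bar>b j l * ip n (w l) (w m)\<bar> \<le> \<bar>b j l\<bar> * \<tau>"
        proof (cases "l = m")
          case True
          then show ?thesis using b0[OF j, of l] j tau by simp
        next
          case False
          then show ?thesis using near[of l m] l mn by (auto simp: abs_mult intro!: mult_left_mono)
        qed
      qed
      also have "\<dots> = (\<Sum>l<n. \<bar>b j l\<bar>) * \<tau>" by (simp add: sum_distrib_right)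
      also have "\<dots> \<le> 2 * \<tau>" using b1[OF j] tau by (intro mult_right_mono) auto
      finally show ?thesis .
    qed
    define q where "q = (\<Sum>j<m. (c j)\<^sup>2)"
    have q0: "0 \<le> q" unfolding q_def by (intro sum_nonneg) auto
    have q: "q \<le> 4 * x * \<tau>"
    proof -
      have "q \<le> (\<Sum>j<m. (2 * \<tau>)\<^sup>2)"
        unfolding q_def
      proof (rule sum_mono)
        fix j assume "j \<in> {..<m}"
        then have "\<bar>c j\<bar> \<le> \<bar>2 * \<tau>\<bar>" using c[of j] tau by simp
        then show "(c j)\<^sup>2 \<le> (2 * \<tau>)\<^sup>2" by (simp only: abs_le_square_iff)
      qed
      also have "\<dots> = m * (4 * \<tau> * \<tau>)" by (simp add: power2_eq_square)
      also have "\<dots> \<le> n * (4 * \<tau> * \<tau>)" using mn tau by (intro mult_right_mono) auto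
      finally show ?thesis by (simp add: x_def mult_ac)
    qed
    have "4 * x * \<tau> \<le> 4 * (1 / 24) * (1 / 24)" using x tx tau by (intro mult_mono) auto
    then have q1: "q < 1" using q by simp
    define s where "s = sqrt (1 - q)"
    have s: "0 < s" "s * s = 1 - q" using q1 by (auto simp: s_def)
    have "s \<le> 1" using q0 q1 by (simp add: s_def)
    then have "s * s \<le> s" using s(1) by (simp add: mult_left_le)
    then have s1: "1 - 4 * x * \<tau> \<le> s" using s(2) q by simp
    define u where "u i = w m i - (\<Sum>j<m. c j * v j i)" for i
    define bm where "bm l = ((if l = m then 1 else 0) - (\<Sum>j<m. c j * b j l)) / s" for l
    define vm where "vm = (\<lambda>i\<in>{..<n}. u i / s)"
    have uv: "ip n u (v k) = 0" if k: "k < m" for k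
    proof -
      have "(\<Sum>j<m. c j * ip n (v j) (v k)) = (\<Sum>j<m. if j = k then c j else 0)"
        by (intro sum.cong refl) (use o k in auto)
      also have "\<dots> = c k" using k by simp
      finally show ?thesis unfolding u_def ip_minus_left ip_sum_left by (simp add: c_def ip_commute[of n "w m"])
    qed
    have uw: "ip n u (w m) = s * s"
      unfolding u_def ip_minus_left ip_sum_left s(2) q_def by (simp add: w[OF mn(1)] c_def power2_eq_square)
    have uu: "ip n u u = s * s"
    proof -
      have "ip n u u = ip n (w m) u - (\<Sum>j<m. c j * ip n (v j) u)"
        using ip_minus_left[of n "w m" "\<lambda>i. \<Sum>j<m. c j * v j i" u] unfolding ip_sum_left u_def[symmetric] .
      also have "(\<Sum>j<m. c j * ip n (v j) u) = 0" using uv by (intro sum.neutral) (auto simp: ip_commute[of n "v _" u])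
      finally show ?thesis using uw by (simp add: ip_commute[of n "w m" u])
    qed
    have vv: "ip n vm (v k) = 0" "ip n (v k) vm = 0" if "k < m" for k
      using uv[OF that] by (auto simp: vm_def ip_commute[of n "v k"])
    have vmvm: "ip n vm vm = 1" using uu s(1) by (simp add: vm_def)
    have vmw: "ip n vm (w m) = s" using uw s(1) by (simp add: vm_def)
    have bmv: "vm = (\<lambda>i\<in>{..<n}. \<Sum>l<n. bm l * w l i)"
    proof (rule Rn_ext[of _ n])
      fix i assume i: "i < n"
      have "(\<Sum>l<n. bm l * w l i) = (\<Sum>l<n. (if l = m then w l i else 0) - (\<Sum>j<m. c j * (b j l * w l i))) / s"
        unfolding sum_divide_distrib bm_def
        by (intro sum.cong refl) (auto simp: left_diff_distrib sum_distrib_right mult.assoc)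
      also have "\<dots> = (w m i - (\<Sum>l<n. \<Sum>j<m. c j * (b j l * w l i))) / s"
        using mn by (simp add: sum_subtractf)
      also have "(\<Sum>l<n. \<Sum>j<m. c j * (b j l * w l i)) = (\<Sum>j<m. \<Sum>l<n. c j * (b j l * w l i))" by (rule sum.swap)
      also have "\<dots> = (\<Sum>j<m. c j * v j i)"
        by (intro sum.cong refl) (use i in \<open>simp add: v sum_distrib_left\<close>)
      finally show "vm i = (\<lambda>i\<in>{..<n}. \<Sum>l<n. bm l * w l i) i" using i by (simp add: vm_def u_def)
    qed (auto simp: vm_def)
    have bm0: "bm l = 0" if "m < l" for l
      using that b0 by (simp add: bm_def)
    have bm1: "(\<Sum>l<n. \<bar>bm l\<bar>) \<le> 1 + 12 * (n * \<tau>)"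
    proof -
      have "(\<Sum>l<n. \<bar>bm l\<bar>) \<le> (\<Sum>l<n. ((if l = m then 1 else 0) + (\<Sum>j<m. \<bar>c j\<bar> * \<bar>b j l\<bar>)) / s)"
      proof (rule sum_mono)
        fix l
        have "\<bar>(if l = m then 1 else 0) - (\<Sum>j<m. c j * b j l)\<bar> \<le> (if l = m then 1 else 0) + \<bar>\<Sum>j<m. c j * b j l\<bar>"
          by (rule order_trans[OF abs_triangle_ineq4]) simp
        also have "\<bar>\<Sum>j<m. c j * b j l\<bar> \<le> (\<Sum>j<m. \<bar>c j\<bar> * \<bar>b j l\<bar>)"
          using sum_abs[of "\<lambda>j. c j * b j l" "{..<m}"] by (simp add: abs_mult)
        finally show "\<bar>bm l\<bar> \<le> ((if l = m then 1 else 0) + (\<Sum>j<m. \<bar>c j\<bar> * \<bar>b j l\<bar>)) / s"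
          using s(1) by (simp add: bm_def divide_right_mono)
      qed
      also have "\<dots> = (1 + (\<Sum>l<n. \<Sum>j<m. \<bar>c j\<bar> * \<bar>b j l\<bar>)) / s"
        using mn by (simp add: sum_divide_distrib[symmetric] sum.distrib)
      also have "(\<Sum>l<n. \<Sum>j<m. \<bar>c j\<bar> * \<bar>b j l\<bar>) = (\<Sum>j<m. \<bar>c j\<bar> * (\<Sum>l<n. \<bar>b j l\<bar>))"
        unfolding sum_distrib_left by (rule sum.swap)
      also have "\<dots> \<le> (\<Sum>j<m. 2 * \<tau> * 2)"
      proof (rule sum_mono)
        fix j assume j: "j \<in> {..<m}"
        show "\<bar>c j\<bar> * (\<Sum>l<n. \<bar>b j l\<bar>) \<le> 2 * \<tau> * 2"
          using j c[of j] b1[of j] tau by (intro mult_mono) (auto intro: sum_nonneg)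
      qed
      also have "\<dots> = 4 * (m * \<tau>)" by simp
      also have "\<dots> \<le> 4 * x" using mn tau by (auto simp: x_def intro!: mult_right_mono)
      finally have "(\<Sum>l<n. \<bar>bm l\<bar>) \<le> (1 + 4 * x) / s" using s(1) by (simp add: divide_right_mono)
      also have "\<dots> \<le> 1 + 12 * x" by (rule gram_schmidt_step_bound[OF x tau(1) tx s(1) s1])
      finally show ?thesis by (simp add: x_def)
    qed
    have "\<forall>i<Suc m. \<forall>j<Suc m. ip n ((v(m := vm)) i) ((v(m := vm)) j) = idm i j"
      using o vv vmvm by (auto simp: less_Suc_eq)
    moreover have "(v(m := vm)) k = (\<lambda>i\<in>{..<n}. \<Sum>l<n. (b(m := bm)) k l * w l i) \<and> (\<forall>l>k. (b(m := bm)) k l = 0) \<and>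
      (\<Sum>l<n. \<bar>(b(m := bm)) k l\<bar>) \<le> 1 + 12 * (n * \<tau>) \<and> 1 - 4 * (n * \<tau>) * \<tau> \<le> ip n ((v(m := vm)) k) (w k)"
      if k: "k < Suc m" for k
    proof (cases "k = m")
      case True
      then show ?thesis using bmv bm0 bm1 vmw s1 by (simp add: x_def)
    next
      case False
      with k have "k < m" by simp
      then show ?thesis using v b0 b1 vw False by (simp add: x_def)
    qed
    ultimately show ?case by blast
  qed simp
  from this[OF order_refl] obtain v b where
    "\<forall>i<n. \<forall>j<n. ip n (v i) (v j) = idm i j"
    and *: "\<forall>k<n. v k = (\<lambda>i\<in>{..<n}. \<Sum>l<n. b k l * w l i) \<and> (\<forall>l>k. b k l = 0) \<and>
      (\<Sum>l<n. \<bar>b k l\<bar>) \<le> 1 + 12 * (n * \<tau>) \<and> 1 - 4 * (n * \<tau>) * \<tau> \<le> ip n (v k) (w k)"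
    by blast
  moreover have "v k \<in> Rn n" if "k < n" for k
    using *[rule_format, OF that] by (simp del: restrict_apply)
  ultimately have "orthonormal_basis n v" by (simp add: orthonormal_basis_def)
  then show ?thesis using * by blast
qed

text \<open>
  Let \<open>\<alpha>\<close> be the largest of the \<open>a i\<close>, \<open>S\<close> the sum
  of the others and \<open>\<sigma> = sqrt (1 - \<alpha>\<^sup>2)\<close>, which is at least
  \<open>\<epsilon> / 6\<close>. As \<open>S \<ge> \<sigma>\<close> and \<open>\<alpha> * S \<ge>
  \<sigma>\<^sup>2\<close>, the bound \<open>\<alpha> + 3 / 4 * S \<ge> 1 + \<sigma> / 5\<close>
  follows from the first estimate if \<open>\<alpha>\<close> is large and from the second one if
  it is not. The weight \<open>3 / 4\<close> leaves room for the box that is cut off in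
  \<open>tilted_polar_volume\<close>.
\<close>

lemma tilted_sum_bound:
  fixes a :: "nat \<Rightarrow> real"
  assumes a: "\<And>i. i < n \<Longrightarrow> 0 \<le> a i" "\<And>i. i < n \<Longrightarrow> a i \<le> 1 - \<epsilon>\<^sup>2 / 32" "(\<Sum>i<n. (a i)\<^sup>2) = 1" and e: "0 < \<epsilon>"
  obtains k where "k < n" "1 + \<epsilon> / 30 \<le> a k + 3 / 4 * (\<Sum>i\<in>{..<n} - {k}. a i)"
proof -
  have n: "n \<noteq> 0" using a(3) by (intro notI) simp
  then have "Max (a ` {..<n}) \<in> a ` {..<n}" by (intro Max_in) auto
  then obtain k where k: "k < n" "a k = Max (a ` {..<n})" by auto
  have mx: "a i \<le> a k" if "i < n" for i using that unfolding k(2) by (intro Max_ge) auto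
  define \<alpha> S \<sigma> where "\<alpha> = a k" and "S = (\<Sum>i\<in>{..<n} - {k}. a i)" and "\<sigma> = sqrt (1 - \<alpha>\<^sup>2)"
  have al: "0 \<le> \<alpha>" "\<alpha> \<le> 1 - \<epsilon>\<^sup>2 / 32" using a(1,2)[OF k(1)] by (auto simp: \<alpha>_def)
  have S0: "0 \<le> S" unfolding S_def by (intro sum_nonneg) (use a in auto)
  have rest: "(\<Sum>i\<in>{..<n} - {k}. (a i)\<^sup>2) = 1 - \<alpha>\<^sup>2"
    using a(3) sum.remove[of "{..<n}" k "\<lambda>i. (a i)\<^sup>2"] k by (simp add: \<alpha>_def)
  have "\<alpha> \<le> 1" using al(2) zero_le_power2[of \<epsilon>] by linarith
  then have a1: "\<alpha>\<^sup>2 \<le> 1" using al(1) by (simp add: power_le_one)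
  have sg: "0 \<le> \<sigma>" "\<sigma>\<^sup>2 = 1 - \<alpha>\<^sup>2" using a1 by (auto simp: \<sigma>_def)
  have se: "\<epsilon> / 6 \<le> \<sigma>"
  proof (rule power2_le_imp_le[OF _ sg(1)])
    have "\<epsilon>\<^sup>2 / 32 * 1 \<le> (1 - \<alpha>) * (1 + \<alpha>)" using al \<open>\<alpha> \<le> 1\<close> by (intro mult_mono) auto
    also have "\<dots> = \<sigma>\<^sup>2" unfolding sg(2) by (simp add: power2_eq_square algebra_simps)
    finally have "\<epsilon>\<^sup>2 / 32 \<le> \<sigma>\<^sup>2" by simp
    moreover have "(\<epsilon> / 6)\<^sup>2 \<le> \<epsilon>\<^sup>2 / 32" by (simp add: power_divide)
    ultimately show "(\<epsilon> / 6)\<^sup>2 \<le> \<sigma>\<^sup>2" by linarith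
  qed
  have "1 - \<alpha>\<^sup>2 \<le> (\<Sum>i\<in>{..<n} - {k}. \<alpha> * a i)"
    unfolding rest[symmetric] power2_eq_square[of "a _"]
    by (intro sum_mono mult_right_mono) (use a mx \<alpha>_def in auto)
  then have aS: "1 - \<alpha>\<^sup>2 \<le> \<alpha> * S" by (simp add: S_def sum_distrib_left)
  have "1 - \<alpha>\<^sup>2 \<le> (\<Sum>i\<in>{..<n} - {k}. S * a i)"
    unfolding rest[symmetric] power2_eq_square[of "a _"]
  proof (intro sum_mono mult_right_mono)
    fix i assume i: "i \<in> {..<n} - {k}"
    show "a i \<le> S" unfolding S_def by (rule member_le_sum[OF i]) (use a in auto)
    show "0 \<le> a i" using i a by auto
  qed
  then have SS: "\<sigma>\<^sup>2 \<le> S\<^sup>2" by (simp add: S_def[symmetric] sum_distrib_left[symmetric] power2_eq_square[of S] sg)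
  then have Sg: "\<sigma> \<le> S" using S0 by (rule power2_le_imp_le)
  have "1 + \<sigma> / 5 \<le> \<alpha> + 3 / 4 * S"
  proof (cases "3 / 5 \<le> \<alpha>")
    case True
    then have "(3 / 5)\<^sup>2 \<le> \<alpha>\<^sup>2" by (intro power_mono) auto
    then have "\<sigma>\<^sup>2 \<le> (4 / 5)\<^sup>2" unfolding sg(2) by (simp add: power2_eq_square)
    then have "\<sigma> \<le> 4 / 5" by (rule power2_le_imp_le) simp
    then have "\<sigma> * \<sigma> \<le> 4 / 5 * \<sigma>" using sg(1) by (intro mult_right_mono)
    then have "(1 - 11 / 20 * \<sigma>)\<^sup>2 \<le> 1 - \<sigma>\<^sup>2" using sg(1) by (simp add: power2_eq_square algebra_simps)
    also have "\<dots> = \<alpha>\<^sup>2" using sg(2) by simp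
    finally have "1 - 11 / 20 * \<sigma> \<le> \<alpha>" using al(1) by (rule power2_le_imp_le)
    then show ?thesis using Sg by simp
  next
    case False
    then have "\<alpha> \<noteq> 0" using aS by (intro notI) simp
    then have ap: "0 < \<alpha>" using al by simp
    \<comment> \<open>the convex function \<open>\<alpha> / 4 + 3 / (4 * \<alpha>)\<close> exceeds \<open>6 / 5\<close> on \<open>(0, 3 / 5]\<close>\<close>
    have "0 \<le> (3 / 5 - \<alpha>) * (21 / 5 - \<alpha>)" using False by (intro mult_nonneg_nonneg) auto
    moreover have "(3 / 5 - \<alpha>) * (21 / 5 - \<alpha>) = \<alpha> * \<alpha> - 24 / 5 * \<alpha> + 63 / 25" by (simp add: field_simps)
    ultimately have "0 \<le> \<alpha> * \<alpha> - 24 / 5 * \<alpha> + 63 / 25" by (simp only:)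
    moreover define p where "p = \<alpha> * \<alpha>"
    ultimately have "0 \<le> p - 24 / 5 * \<alpha> + 63 / 25" by (simp only:)
    then have "\<alpha> * (6 / 5) \<le> p + 3 / 4 * (1 - p)" by argo
    then have "\<alpha> * (6 / 5) \<le> \<alpha> * \<alpha> + 3 / 4 * (1 - \<alpha>\<^sup>2)" by (simp only: power2_eq_square p_def)
    also have "\<dots> \<le> \<alpha> * \<alpha> + 3 / 4 * (\<alpha> * S)" using aS by simp
    also have "\<dots> = \<alpha> * (\<alpha> + 3 / 4 * S)" by (simp add: algebra_simps)
    finally have "6 / 5 \<le> \<alpha> + 3 / 4 * S" using ap by simp
    moreover have "\<sigma> \<le> 1" unfolding \<sigma>_def by simp
    ultimately show ?thesis by simp
  qed
  then have "1 + \<epsilon> / 30 \<le> \<alpha> + 3 / 4 * S" using se by simp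
  then show ?thesis using that k(1) by (simp add: \<alpha>_def S_def)
qed

section \<open>A support vector away from the frame\<close>

lemma emeasure_simplex:
  assumes "0 \<le> t"
  shows "emeasure (Leb n) {y \<in> Rn n. (\<forall>i<n. 0 \<le> y i) \<and> (\<Sum>i<n. y i) \<le> t} = ennreal (t ^ n / fact n)"
proof -
  have "{x. (\<forall>i\<in>{..<n}. 0 \<le> x i) \<and> sum x {..<n} \<le> t} \<inter> space (Leb n) =
      {y \<in> Rn n. (\<forall>i<n. 0 \<le> y i) \<and> (\<Sum>i<n. y i) \<le> t}" by auto
  with emeasure_std_simplex_aux[of "{..<n}" t] assms show ?thesis by simp
qed

lemma emeasure_simplex_layer:
  fixes b t \<kappa> :: real
  assumes "0 \<le> t" "0 \<le> \<kappa>"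
  shows "emeasure (Leb n) {y \<in> Rn n. (\<forall>i<n. b \<le> y i) \<and> n * b + t < (\<Sum>i<n. y i) \<and> (\<Sum>i<n. y i) \<le> n * b + t + \<kappa>} =
    ennreal (((t + \<kappa>) ^ n - t ^ n) / fact n)"
proof -
  define L where "L = {y \<in> Rn n. (\<forall>i<n. b \<le> y i) \<and> n * b + t < (\<Sum>i<n. y i) \<and> (\<Sum>i<n. y i) \<le> n * b + t + \<kappa>}"
  define S where "S t = {y \<in> Rn n. (\<forall>i<n. 0 \<le> y i) \<and> (\<Sum>i<n. y i) \<le> t}" for t
  have eS: "emeasure (Leb n) (S t) = ennreal (t ^ n / fact n)" if "0 \<le> t" for t
    unfolding S_def using that by (rule emeasure_simplex)
  have S [measurable]: "S t \<in> sets (Leb n)" for t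
  proof -
    have "S t = {y \<in> space (Leb n). (\<forall>i\<in>{..<n}. 0 \<le> y i) \<and> (\<Sum>i<n. y i) \<le> t}"
      unfolding S_def by (rule Collect_cong) auto
    also have "\<dots> \<in> sets (Leb n)" by measurable
    finally show ?thesis .
  qed
  have L [measurable]: "L \<in> sets (Leb n)"
  proof -
    have "L = {y \<in> space (Leb n). (\<forall>i\<in>{..<n}. b \<le> y i) \<and> n * b + t < (\<Sum>i<n. y i) \<and> (\<Sum>i<n. y i) \<le> n * b + t + \<kappa>}"
      unfolding L_def by (rule Collect_cong) auto
    also have "\<dots> \<in> sets (Leb n)" by measurable
    finally show ?thesis .
  qed
  have "emeasure (Leb n) L = (\<integral>\<^sup>+y. indicator L y \<partial>Leb n)"
    by (rule nn_integral_indicator[OF L, symmetric])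
  also have "\<dots> = (\<integral>\<^sup>+y. indicator L (\<lambda>i\<in>{..<n}. y i + b) \<partial>Leb n)"
    by (rule nn_integral_translate[symmetric]) measurable
  also have "\<dots> = (\<integral>\<^sup>+y. indicator (S (t + \<kappa>) - S t) y \<partial>Leb n)"
  proof (intro nn_integral_cong)
    fix y assume "y \<in> space (Leb n)"
    then have y: "y \<in> Rn n" by simp
    have p: "(\<forall>i<n. b \<le> (\<lambda>i\<in>{..<n}. y i + b) i) \<longleftrightarrow> (\<forall>i<n. 0 \<le> y i)"
      by (intro all_cong) (simp add: restrict_def)
    have q: "(\<Sum>i<n. (\<lambda>i\<in>{..<n}. y i + b) i) = (\<Sum>i<n. y i) + n * b"
      by (subst sum.cong[OF refl restrict_apply']) (simp_all add: sum.distrib)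
    have "(\<lambda>i\<in>{..<n}. y i + b) \<in> L \<longleftrightarrow> y \<in> S (t + \<kappa>) - S t"
      unfolding L_def S_def mem_Collect_eq p q Diff_iff using y lam_in_Rn[of "\<lambda>i. y i + b" n] by argo
    then show "indicator L (\<lambda>i\<in>{..<n}. y i + b) = (indicator (S (t + \<kappa>) - S t) y :: ennreal)"
      by (simp only: indicator_def)
  qed
  also have "\<dots> = emeasure (Leb n) (S (t + \<kappa>) - S t)" by (rule nn_integral_indicator) measurable
  also have "\<dots> = emeasure (Leb n) (S (t + \<kappa>)) - emeasure (Leb n) (S t)"
  proof (rule emeasure_Diff[OF _ S S])
    show "emeasure (Leb n) (S t) \<noteq> \<infinity>" by (simp only: eS[OF assms(1)]) simp
    show "S t \<subseteq> S (t + \<kappa>)"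
    proof
      fix y assume "y \<in> S t"
      then show "y \<in> S (t + \<kappa>)" using assms(2) unfolding S_def mem_Collect_eq
        by (elim conjE, intro conjI) (assumption | linarith)+
    qed
  qed
  also have "\<dots> = ennreal (((t + \<kappa>) ^ n - t ^ n) / fact n)"
  proof -
    have "0 \<le> t ^ n / fact n" using assms(1) by simp
    moreover have "0 \<le> t + \<kappa>" using assms by linarith
    ultimately show ?thesis by (simp only: eS[OF assms(1)] eS ennreal_minus diff_divide_distrib)
  qed
  finally show ?thesis unfolding L_def .
qed

context even_isotropic
begin

lemma K_Z_abs:
  assumes y: "y \<in> K" and z: "z \<in> Z"
  shows "\<bar>ip n y z\<bar> \<le> 1"
proof -
  have "convex_Rn n {z \<in> Rn n. ip n y z \<le> 1}"
    unfolding convex_Rn_def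
  proof (intro conjI ballI allI impI)
    fix p q a b assume pq: "p \<in> {z \<in> Rn n. ip n y z \<le> 1}" "q \<in> {z \<in> Rn n. ip n y z \<le> 1}"
      and ab: "0 \<le> a" "0 \<le> b" "a + b = (1::real)"
    have "a * ip n y p + b * ip n y q \<le> a * 1 + b * 1" using pq ab by (intro add_mono mult_left_mono) auto
    then show "(\<lambda>i\<in>{..<n}. a * p i + b * q i) \<in> {z \<in> Rn n. ip n y z \<le> 1}"
      using ab by (simp add: ip_plus_right)
  qed auto
  then have "Z \<subseteq> {z \<in> Rn n. ip n y z \<le> 1}"
    by (rule Z_least) (use y X_Rn in \<open>auto simp: K_iff\<close>)
  then show ?thesis using z Z_sym[OF z] by (auto simp: abs_le_iff)
qed

text \<open>
  In the coordinates of the frame, the polar body lies in the cube of radius \<open>1 + e\<close>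
  and in the half-space of \<open>x\<close>. The box with \<open>k\<close>-th side \<open>[1 - m,
  1]\<close> and the other sides \<open>[3 / 4, 1]\<close> lies in the cube and, by the hypothesis
  on \<open>x\<close>, outside the half-space.
\<close>

lemma tilted_polar_volume:
  assumes v: "orthonormal_basis n v" and e: "0 \<le> e" and vZ: "\<And>i. i < n \<Longrightarrow> (\<lambda>j\<in>{..<n}. v i j / (1 + e)) \<in> Z"
    and x: "x \<in> X" and a: "\<And>i. i < n \<Longrightarrow> 0 \<le> ip n (v i) x" "\<And>i. i < n \<Longrightarrow> ip n (v i) x \<le> 1"
    and k: "k < n" and m: "0 < m" "m \<le> 1"
    and tilt: "1 + m < ip n (v k) x + 3 / 4 * (\<Sum>i\<in>{..<n} - {k}. ip n (v i) x)"
  shows "vol n K \<le> 2 ^ n * (1 + e) ^ n - m / 4 ^ n"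
proof -
  define B where "B = {y \<in> cube n (1 + e). (\<Sum>i<n. y i * ip n (v i) x) \<le> 1}"
  define C where "C = Pi\<^sub>E {..<n} (\<lambda>i. {(if i = k then 1 - m else 3 / 4)..1::real})"
  have B [measurable]: "B \<in> sets (Leb n)"
  proof -
    have "{y \<in> space (Leb n). y \<in> cube n (1 + e) \<and> (\<Sum>i<n. y i * ip n (v i) x) \<le> 1} \<in> sets (Leb n)" by measurable
    moreover have "{y \<in> space (Leb n). y \<in> cube n (1 + e) \<and> (\<Sum>i<n. y i * ip n (v i) x) \<le> 1} = B"
      by (auto simp: B_def cube_iff)
    ultimately show ?thesis by simp
  qed
  have C [measurable]: "C \<in> sets (Leb n)" unfolding C_def by (rule box_sets)
  have disj: "B \<inter> C = {}"
  proof -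
    have False if y: "y \<in> B" "y \<in> C" for y
    proof -
      have yc: "i < n \<Longrightarrow> (if i = k then 1 - m else 3 / 4) \<le> y i" for i using y(2) by (auto simp: C_def PiE_iff)
      have "ip n (v k) x - m + 3 / 4 * (\<Sum>i\<in>{..<n} - {k}. ip n (v i) x)
          \<le> (1 - m) * ip n (v k) x + (\<Sum>i\<in>{..<n} - {k}. 3 / 4 * ip n (v i) x)"
        using mult_left_mono[OF a(2)[OF k], of m] m by (simp add: sum_distrib_left algebra_simps)
      also have "\<dots> \<le> y k * ip n (v k) x + (\<Sum>i\<in>{..<n} - {k}. y i * ip n (v i) x)"
      proof (intro add_mono sum_mono mult_right_mono a(1) k)
        show "1 - m \<le> y k" using yc[OF k] by simp
        fix i assume i: "i \<in> {..<n} - {k}"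
        then show "3 / 4 \<le> y i" "i < n" using yc[of i] by auto
      qed
      also have "\<dots> = (\<Sum>i<n. y i * ip n (v i) x)" using sum.remove[of "{..<n}" k "\<lambda>i. y i * ip n (v i) x"] k by simp
      also have "\<dots> \<le> 1" using y(1) by (simp add: B_def)
      finally show False using tilt by simp
    qed
    then show ?thesis by blast
  qed
  have "K \<subseteq> {y \<in> Rn n. mat_app n v y \<in> B}"
  proof
    fix y assume y: "y \<in> K"
    have "\<bar>ip n (v i) y\<bar> \<le> 1 + e" if i: "i < n" for i
      using K_Z_abs[OF y vZ[OF i]] e by (simp add: ip_commute[of n y] divide_le_eq abs_divide)
    moreover have "(\<Sum>i<n. mat_app n v y i * ip n (v i) x) = ip n y x"
    proof -
      have "(\<Sum>i<n. mat_app n v y i * ip n (v i) x) = ip n (mat_app n v y) (mat_app n v x)"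
        unfolding ip_def[of n "mat_app n v y"] by (intro sum.cong refl) (simp add: frame_coord)
      then show ?thesis by (simp add: frame_parseval[OF v])
    qed
    moreover have "ip n y x \<le> 1" "y \<in> Rn n" using y x by (auto simp: K_iff)
    ultimately show "y \<in> {y \<in> Rn n. mat_app n v y \<in> B}" by (simp add: B_def cube_iff frame_coord)
  qed
  then have "emeasure (Leb n) K \<le> emeasure (Leb n) {y \<in> Rn n. mat_app n v y \<in> B}"
    by (rule emeasure_mono) (rule frame_preimage_sets[OF B])
  also have "\<dots> = emeasure (Leb n) B" by (rule emeasure_frame[OF v B])
  finally have KB: "emeasure (Leb n) K \<le> emeasure (Leb n) B" .
  have eC: "emeasure (Leb n) C = ennreal (m * (1 / 4) ^ (n - 1))"
  proof -
    have "emeasure (Leb n) C = ennreal (\<Prod>i<n. 1 - (if i = k then 1 - m else 3 / 4))"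
      unfolding C_def by (rule emeasure_box) (use m in auto)
    also have "(\<Prod>i<n. 1 - (if i = k then 1 - m else 3 / 4)) = m * (\<Prod>i\<in>{..<n} - {k}. 1 / 4)"
      using prod.remove[of "{..<n}" k "\<lambda>i. 1 - (if i = k then 1 - m else 3 / 4)"] k by simp
    also have "\<dots> = m * (1 / 4) ^ (n - 1)" using k by simp
    finally show ?thesis .
  qed
  have "emeasure (Leb n) K + emeasure (Leb n) C \<le> emeasure (Leb n) B + emeasure (Leb n) C"
    using KB by (rule add_right_mono)
  also have "\<dots> = emeasure (Leb n) (B \<union> C)" by (rule plus_emeasure[OF B C disj])
  also have "\<dots> \<le> emeasure (Leb n) (cube n (1 + e))"
  proof (rule emeasure_mono[OF _ cube_sets])
    have "y \<in> cube n (1 + e)" if "y \<in> C" for y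
    proof -
      have "\<bar>y i\<bar> \<le> 1 + e" if "i < n" for i
        using \<open>y \<in> C\<close> that m e by (cases "i = k") (force simp: C_def PiE_iff abs_le_iff)+
      moreover have "y \<in> Rn n" using \<open>y \<in> C\<close> by (auto simp: C_def Rn_def PiE_iff)
      ultimately show ?thesis by (simp add: cube_iff)
    qed
    then show "B \<union> C \<subseteq> cube n (1 + e)" by (auto simp: B_def)
  qed
  also have "\<dots> = ennreal (2 ^ n * (1 + e) ^ n)"
    using e by (subst emeasure_cube) (auto simp: power_mult_distrib[symmetric] distrib_left)
  finally have le: "emeasure (Leb n) K + ennreal (m * (1 / 4) ^ (n - 1)) \<le> ennreal (2 ^ n * (1 + e) ^ n)"
    by (simp only: eC)
  have "emeasure (Leb n) K \<le> emeasure (Leb n) K + ennreal (m * (1 / 4) ^ (n - 1))"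
    by (rule add_increasing2) auto
  then have "emeasure (Leb n) K \<le> ennreal (2 ^ n * (1 + e) ^ n)" using le by (rule order_trans)
  then have "emeasure (Leb n) K = ennreal (vol n K)"
    unfolding vol_def by (intro emeasure_eq_ennreal_measure) (auto simp: top_unique)
  with le have "ennreal (vol n K + m * (1 / 4) ^ (n - 1)) \<le> ennreal (2 ^ n * (1 + e) ^ n)"
    using m by (simp add: ennreal_plus vol_def)
  then have "vol n K + m * (1 / 4) ^ (n - 1) \<le> 2 ^ n * (1 + e) ^ n"
    using e by (subst (asm) ennreal_le_iff) auto
  moreover have "m * (1 / 4) ^ n \<le> m * (1 / 4) ^ (n - 1)"
    using m by (intro mult_left_mono power_decreasing) auto
  ultimately show ?thesis by (simp add: power_one_over)
qed

text \<open>
  Besides a shrunken cross-polytope the hull contains the thin layer above its positive facet in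
  which all coordinates are at least \<open>1 / (2 * n)\<close> times the size of the polytope:
  after scaling to size \<open>1\<close>, such a point is a combination of \<open>x\<close>, with
  weight at most \<open>b = 1 / (2 * n)\<close>, and a point of the polytope, with weight \<open>1
  - b\<close>. By Bernoulli's inequality the volume of the layer is at least linear in its
  thickness.
\<close>

lemma tilted_hull_volume:
  assumes v: "orthonormal_basis n v" and e: "0 \<le> e" and vZ: "\<And>i. i < n \<Longrightarrow> (\<lambda>j\<in>{..<n}. v i j / (1 + e)) \<in> Z"
    and x: "x \<in> X" and a: "\<And>i. i < n \<Longrightarrow> 0 \<le> ip n (v i) x" "\<And>i. i < n \<Longrightarrow> ip n (v i) x \<le> 1"
    and s: "1 \<le> s" "s = (\<Sum>i<n. ip n (v i) x)"
  shows "(1 / (1 + e)) ^ n * ((2 ^ n + (s - 1) / 2 ^ n) / fact n) \<le> vol n Z"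
proof -
  define b t \<kappa> where "b = 1 / (2 * real n)" and "t = (1 / 2 :: real)" and "\<kappa> = (s - 1) / (2 * n)"
  have b: "0 < b" "b \<le> 1" "n * b = t" and kap: "0 \<le> \<kappa>" "\<kappa> = b * (s - 1)"
    using n_pos s by (auto simp: b_def t_def \<kappa>_def)
  define S1 where "S1 = {y \<in> Rn n. (\<Sum>i<n. \<bar>y i\<bar>) \<le> 1}"
  define S2 where "S2 = {y \<in> Rn n. (\<forall>i<n. b \<le> y i) \<and> n * b + t < (\<Sum>i<n. y i) \<and> (\<Sum>i<n. y i) \<le> n * b + t + \<kappa>}"
  have S1 [measurable]: "S1 \<in> sets (Leb n)"
  proof -
    have "{y \<in> space (Leb n). (\<Sum>i<n. \<bar>y i\<bar>) \<le> 1} \<in> sets (Leb n)" by measurable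
    then show ?thesis by (simp add: S1_def)
  qed
  have S2 [measurable]: "S2 \<in> sets (Leb n)"
  proof -
    have "S2 = {y \<in> space (Leb n). (\<forall>i\<in>{..<n}. b \<le> y i) \<and> n * b + t < (\<Sum>i<n. y i) \<and> (\<Sum>i<n. y i) \<le> n * b + t + \<kappa>}"
      unfolding S2_def by (rule Collect_cong) auto
    also have "\<dots> \<in> sets (Leb n)" by measurable
    finally show ?thesis .
  qed
  have disj: "S1 \<inter> S2 = {}"
  proof -
    have False if "y \<in> S1" "y \<in> S2" for y
    proof -
      have "(\<Sum>i<n. y i) \<le> (\<Sum>i<n. \<bar>y i\<bar>)" by (intro sum_mono) auto
      then show False using that b(3) by (simp add: S1_def S2_def t_def)
    qed
    then show ?thesis by blast
  qed
  have inZ: "(\<lambda>j\<in>{..<n}. \<Sum>i<n. y i * (v i j / (1 + e))) \<in> Z" if y: "y \<in> S1 \<union> S2" for y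
  proof -
    \<comment> \<open>\<open>r\<close> is the weight of \<open>x\<close> in the combination\<close>
    define r where "r = (if y \<in> S1 then 0 else b)"
    define z where "z i = y i - r * ip n (v i) x" for i
    have xZ: "x \<in> Z" using x X_subset_Z by blast
    obtain z' where z': "z' \<in> Z" "\<And>j. j < n \<Longrightarrow> (\<Sum>i<n. z i * (\<lambda>j\<in>{..<n}. v i j / (1 + e)) j) = (\<Sum>i<n. \<bar>z i\<bar>) * z' j"
      using Z_abs_combo[of "{..<n}" "\<lambda>i. \<lambda>j\<in>{..<n}. v i j / (1 + e)" z] vZ by auto
    have zs: "(\<Sum>i<n. \<bar>z i\<bar>) \<le> 1 - r"
    proof (cases "y \<in> S1")
      case True
      then show ?thesis by (simp add: z_def r_def S1_def)
    next
      case False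
      then have y2: "\<And>i. i < n \<Longrightarrow> b \<le> y i" "(\<Sum>i<n. y i) \<le> n * b + t + \<kappa>" and r: "r = b" using y by (auto simp: S2_def r_def)
      have "0 \<le> z i" if "i < n" for i
        using mult_left_mono[OF a(2)[OF that] less_imp_le[OF b(1)]] y2(1)[OF that] by (simp add: z_def r)
      then have "(\<Sum>i<n. \<bar>z i\<bar>) = (\<Sum>i<n. z i)" by (intro sum.cong) auto
      also have "\<dots> = (\<Sum>i<n. y i) - b * s" by (simp add: z_def r sum_subtractf s(2) sum_distrib_left)
      also have "\<dots> \<le> 1 + b * (s - 1) - b * s" using y2(2) b(3) kap(2) by (simp add: t_def)
      also have "\<dots> = 1 - r" by (simp add: r algebra_simps)
      finally show ?thesis .
    qed
    have r: "0 \<le> r" using b by (simp add: r_def)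
    have "(\<lambda>j\<in>{..<n}. (r / (1 + e)) * x j + (\<Sum>i<n. \<bar>z i\<bar>) * z' j) \<in> Z"
    proof (rule Z_combo[OF xZ z'(1)])
      have "r / (1 + e) \<le> r / 1" using r e by (intro divide_left_mono) auto
      moreover have "0 \<le> (\<Sum>i<n. \<bar>z i\<bar>)" by (intro sum_nonneg) auto
      ultimately show "\<bar>r / (1 + e)\<bar> + \<bar>\<Sum>i<n. \<bar>z i\<bar>\<bar> \<le> 1" using zs r e by (simp add: abs_of_nonneg)
    qed
    also have "(\<lambda>j\<in>{..<n}. (r / (1 + e)) * x j + (\<Sum>i<n. \<bar>z i\<bar>) * z' j) = (\<lambda>j\<in>{..<n}. \<Sum>i<n. y i * (v i j / (1 + e)))"
    proof (rule Rn_ext[of _ n])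
      fix j assume j: "j < n"
      have "(r / (1 + e)) * x j + (\<Sum>i<n. \<bar>z i\<bar>) * z' j = (r / (1 + e)) * (\<Sum>i<n. ip n (v i) x * v i j) + (\<Sum>i<n. z i * (v i j / (1 + e)))"
        using z'(2)[OF j] j frame_expand[OF v j, of x] by simp
      also have "\<dots> = (\<Sum>i<n. y i * (v i j / (1 + e)))"
        unfolding sum_distrib_left sum.distrib[symmetric]
        by (intro sum.cong refl) (simp add: z_def left_diff_distrib diff_divide_distrib)
      finally show "(\<lambda>j\<in>{..<n}. (r / (1 + e)) * x j + (\<Sum>i<n. \<bar>z i\<bar>) * z' j) j = (\<lambda>j\<in>{..<n}. \<Sum>i<n. y i * (v i j / (1 + e))) j"
        using j by simp
    qed auto
    finally show ?thesis .
  qed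
  define \<rho> where "\<rho> = 1 / (1 + e)"
  have rho: "0 < \<rho>" using e by (simp add: \<rho>_def)
  define T where "T = {y \<in> Rn n. (\<lambda>i\<in>{..<n}. y i / \<rho>) \<in> S1 \<union> S2}"
  have T: "T \<in> sets (Leb n)"
  proof -
    have "{y \<in> space (Leb n). (\<lambda>i\<in>{..<n}. y i / \<rho>) \<in> S1 \<union> S2} \<in> sets (Leb n)" by measurable
    then show ?thesis by (simp add: T_def)
  qed
  have sub: "{y \<in> Rn n. mat_app n v y \<in> T} \<subseteq> Z"
  proof
    fix y assume "y \<in> {y \<in> Rn n. mat_app n v y \<in> T}"
    then have y: "y \<in> Rn n" "(\<lambda>i\<in>{..<n}. ip n (v i) y / \<rho>) \<in> S1 \<union> S2"
      by (auto simp: T_def frame_coord cong: restrict_cong)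
    have "(\<lambda>j\<in>{..<n}. \<Sum>i<n. (\<lambda>i\<in>{..<n}. ip n (v i) y / \<rho>) i * (v i j / (1 + e))) = y"
    proof (rule Rn_ext[of _ n])
      fix j assume j: "j < n"
      have "(\<Sum>i<n. (\<lambda>i\<in>{..<n}. ip n (v i) y / \<rho>) i * (v i j / (1 + e))) = (\<Sum>i<n. ip n (v i) y * v i j)"
        by (intro sum.cong refl) (use e in \<open>simp add: \<rho>_def\<close>)
      also have "\<dots> = y j" by (rule frame_expand[OF v j])
      finally show "(\<lambda>j\<in>{..<n}. \<Sum>i<n. (\<lambda>i\<in>{..<n}. ip n (v i) y / \<rho>) i * (v i j / (1 + e))) j = y j"
        using j by simp
    qed (use y in auto)
    then show "y \<in> Z" using inZ[OF y(2)] by simp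
  qed
  have "ennreal (\<rho> ^ n * ((2 ^ n + (s - 1) / 2 ^ n) / fact n)) \<le> ennreal (\<rho> ^ n * (2 ^ n / fact n + ((t + \<kappa>) ^ n - t ^ n) / fact n))"
  proof (intro ennreal_leI mult_left_mono)
    have "1 + n * (\<kappa> / t) \<le> (1 + \<kappa> / t) ^ n"
      by (rule Bernoulli_inequality) (use kap in \<open>auto simp: t_def\<close>)
    then have "t ^ n * (1 + n * (\<kappa> / t)) \<le> t ^ n * (1 + \<kappa> / t) ^ n" by (rule mult_left_mono) (simp add: t_def)
    also have "\<dots> = (t + \<kappa>) ^ n" by (simp add: power_mult_distrib[symmetric] distrib_left t_def)
    also have "n * (\<kappa> / t) = s - 1" using n_pos by (simp add: \<kappa>_def t_def)
    finally have "(s - 1) / 2 ^ n \<le> (t + \<kappa>) ^ n - t ^ n" by (simp add: t_def power_one_over algebra_simps diff_divide_distrib)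
    then show "(2 ^ n + (s - 1) / 2 ^ n) / fact n \<le> 2 ^ n / fact n + ((t + \<kappa>) ^ n - t ^ n) / fact n"
      by (simp add: add_divide_distrib[symmetric] divide_right_mono)
  qed (use rho in auto)
  also have "\<dots> = ennreal (\<rho> ^ n) * (ennreal (2 ^ n / fact n) + ennreal (((t + \<kappa>) ^ n - t ^ n) / fact n))"
  proof -
    have "t ^ n \<le> (t + \<kappa>) ^ n" using kap by (intro power_mono) (auto simp: t_def)
    then have "0 \<le> ((t + \<kappa>) ^ n - t ^ n) / fact n" by simp
    moreover have "0 \<le> \<rho> ^ n" "0 \<le> 2 ^ n / (fact n :: real)" using rho by auto
    ultimately show ?thesis by (simp only: ennreal_plus[symmetric] ennreal_mult[symmetric] add_nonneg_nonneg)
  qed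
  also have "\<dots> = ennreal (\<rho> ^ n) * emeasure (Leb n) (S1 \<union> S2)"
  proof -
    have "emeasure (Leb n) (S1 \<union> S2) = emeasure (Leb n) S1 + emeasure (Leb n) S2" by (rule plus_emeasure[OF S1 S2 disj, symmetric])
    also have "emeasure (Leb n) S1 = ennreal (2 ^ n / fact n)" unfolding S1_def by (rule emeasure_cross_polytope)
    also have "emeasure (Leb n) S2 = ennreal (((t + \<kappa>) ^ n - t ^ n) / fact n)"
      unfolding S2_def by (rule emeasure_simplex_layer) (use kap in \<open>auto simp: t_def\<close>)
    finally show ?thesis by simp
  qed
  also have "\<dots> = emeasure (Leb n) T" unfolding T_def by (rule emeasure_scale[symmetric, OF rho]) measurable
  also have "\<dots> = emeasure (Leb n) {y \<in> Rn n. mat_app n v y \<in> T}" by (rule emeasure_frame[OF v T, symmetric])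
  also have "\<dots> \<le> emeasure (Leb n) Z" by (rule emeasure_mono[OF sub Z_sets])
  also have "\<dots> = ennreal (vol n Z)"
    unfolding vol_def by (intro emeasure_eq_ennreal_measure) (use emeasure_Z_finite in auto)
  finally have "\<rho> ^ n * ((2 ^ n + (s - 1) / 2 ^ n) / fact n) \<le> vol n Z"
    by (subst (asm) ennreal_le_iff) (auto simp: vol_def)
  then show ?thesis by (simp add: \<rho>_def)
qed

text \<open>
  Choose a tuple of support vectors for which the sum of the squared inner products is at most its
  mean, the defect, apply \<open>almost_orthonormal_frame\<close> to it and
  \<open>far_point\<close> to the resulting frame. Changing signs of frame vectors makes all inner
  products with the far vector nonnegative.
\<close>

lemma tilted_frame:
  fixes \<epsilon> \<tau> :: real
  assumes e: "0 < \<epsilon>" and tau: "0 \<le> \<tau>" "24 * (n * \<tau>) \<le> 1" "4 * (n * \<tau>) * \<tau> \<le> \<epsilon>\<^sup>2 / 32"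
    and small: "defect \<le> \<tau>\<^sup>2"
    and far: "\<And>v. orthonormal_basis n v \<Longrightarrow> \<epsilon> \<le> sph_hausdorff n X (v ` {..<n} \<union> (\<lambda>i. vneg n (v i)) ` {..<n})"
  obtains v x where "orthonormal_basis n v" "\<forall>i<n. (\<lambda>j\<in>{..<n}. v i j / (1 + 12 * (n * \<tau>))) \<in> Z"
    "x \<in> X" "\<forall>i<n. 0 \<le> ip n (v i) x \<and> ip n (v i) x \<le> 1 - \<epsilon>\<^sup>2 / 32"
proof -
  let ?h = "\<lambda>W. \<Sum>k<n. \<Sum>l<n. if k = l then 0 else (ip n (W k) (W l))\<^sup>2"
  have h: "bmeas PW ?h"
  proof (intro bmeas_sum)
    fix k l assume kl: "k \<in> {..<n}" "l \<in> {..<n}"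
    have "bmeas PW (\<lambda>W. (ip n (W k) (W l))\<^sup>2)"
      unfolding ip_def using kl by (intro bmeas_power bmeas_sum bmeas_mult bmeas_PW_coord) auto
    then show "bmeas PW (\<lambda>W. if k = l then 0 else (ip n (W k) (W l))\<^sup>2)"
      by (cases "k = l") (auto intro: bmeas_const)
  qed
  obtain W where W: "\<And>k. k < n \<Longrightarrow> W k \<in> X" "?h W \<le> defect"
  proof (rule exists_tuple[OF h tuple_orthogonality_defect], goal_cases)
    case (1 W)
    show ?case by (rule 1(1)[OF 1(2) 1(4)])
  qed
  have near: "\<bar>ip n (W i) (W j)\<bar> \<le> \<tau>" if "i < n" "j < n" "i \<noteq> j" for i j
  proof -
    have "(ip n (W i) (W j))\<^sup>2 = (\<lambda>l. if i = l then 0 else (ip n (W i) (W l))\<^sup>2) j" using that by simp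
    also have "\<dots> \<le> (\<Sum>l<n. if i = l then 0 else (ip n (W i) (W l))\<^sup>2)"
      by (rule member_le_sum) (use that in auto)
    also have "\<dots> \<le> ?h W"
      by (rule member_le_sum[where f = "\<lambda>k. \<Sum>l<n. if k = l then 0 else (ip n (W k) (W l))\<^sup>2"])
         (use that in \<open>auto intro!: sum_nonneg\<close>)
    also have "\<dots> \<le> \<tau>\<^sup>2" using W(2) small by linarith
    finally show ?thesis using tau(1) by (simp add: abs_le_square_iff[symmetric])
  qed
  have W1: "ip n (W k) (W k) = 1" if "k < n" for k using ip_usphere X_usphere W(1)[OF that] by blast
  obtain v b where v: "orthonormal_basis n v" "\<forall>k<n. v k = (\<lambda>i\<in>{..<n}. \<Sum>l<n. b k l * W l i)"
    "\<forall>k<n. (\<Sum>l<n. \<bar>b k l\<bar>) \<le> 1 + 12 * (n * \<tau>)" "\<forall>k<n. 1 - 4 * (n * \<tau>) * \<tau> \<le> ip n (v k) (W k)"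
  proof -
    have "\<exists>v b. orthonormal_basis n v \<and> (\<forall>k<n. v k = (\<lambda>i\<in>{..<n}. \<Sum>l<n. b k l * W l i)) \<and>
      (\<forall>k<n. (\<Sum>l<n. \<bar>b k l\<bar>) \<le> 1 + 12 * (n * \<tau>)) \<and> (\<forall>k<n. 1 - 4 * (n * \<tau>) * \<tau> \<le> ip n (v k) (W k))"
      by (rule almost_orthonormal_frame[OF W1 near tau(1,2)])
    then show ?thesis using that by blast
  qed
  let ?e = "12 * (n * \<tau>)"
  have e0: "0 \<le> ?e" using tau by simp
  have vZ: "(\<lambda>j\<in>{..<n}. v k j / (1 + ?e)) \<in> Z" if k: "k < n" for k
  proof -
    obtain z where z: "z \<in> Z" "\<And>i. i < n \<Longrightarrow> (\<Sum>l<n. b k l * W l i) = (\<Sum>l<n. \<bar>b k l\<bar>) * z i"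
      using Z_abs_combo[of "{..<n}" W "b k"] W(1) X_subset_Z by auto
    have "(\<lambda>j\<in>{..<n}. ((\<Sum>l<n. \<bar>b k l\<bar>) / (1 + ?e)) * z j + 0 * z j) \<in> Z"
    proof (rule Z_combo[OF z(1) z(1)])
      show "\<bar>(\<Sum>l<n. \<bar>b k l\<bar>) / (1 + ?e)\<bar> + \<bar>0\<bar> \<le> 1"
      proof -
        have "0 \<le> (\<Sum>l<n. \<bar>b k l\<bar>)" by (intro sum_nonneg) auto
        moreover have "0 < 1 + ?e" using e0 by linarith
        ultimately show ?thesis using v(3)[rule_format, OF k] by (simp only: abs_of_nonneg divide_nonneg_pos divide_le_eq_1_pos abs_zero add_0_right)
      qed
    qed
    also have "(\<lambda>j\<in>{..<n}. ((\<Sum>l<n. \<bar>b k l\<bar>) / (1 + ?e)) * z j + 0 * z j) = (\<lambda>j\<in>{..<n}. v k j / (1 + ?e))"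
      by (rule Rn_ext[of _ n]) (use z(2) v(2) k in auto)
    finally show ?thesis .
  qed
  have vW: "1 - \<epsilon>\<^sup>2 / 32 \<le> ip n (W i) (v i)" if "i < n" for i
    using v(4)[rule_format, OF that] tau(3) by (simp add: ip_commute[of n "W i"])
  have vX: "\<exists>x\<in>X. 1 - \<epsilon>\<^sup>2 / 32 \<le> ip n x (v i)" if "i < n" for i
    using vW[OF that] W(1)[OF that] by blast
  have vX': "\<exists>x\<in>X. 1 - \<epsilon>\<^sup>2 / 32 \<le> ip n x (vneg n (v i))" if i: "i < n" for i
  proof (rule bexI)
    show "vneg n (W i) \<in> X" by (rule X_sym[OF W(1)[OF i]])
    show "1 - \<epsilon>\<^sup>2 / 32 \<le> ip n (vneg n (W i)) (vneg n (v i))" using vW[OF i] by simp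
  qed
  obtain x where x: "x \<in> X" "\<And>i. i < n \<Longrightarrow> \<bar>ip n x (v i)\<bar> \<le> 1 - \<epsilon>\<^sup>2 / 32"
    using far_point[OF X_nonempty X_usphere n_pos v(1) e far[OF v(1)] vX vX'] by metis
  define \<sigma> where "\<sigma> i = (if 0 \<le> ip n x (v i) then 1 else -1 :: real)" for i
  define v' where "v' i = (\<lambda>j\<in>{..<n}. \<sigma> i * v i j)" for i
  have sg: "\<sigma> i * \<sigma> i = 1" for i by (simp add: \<sigma>_def)
  show ?thesis
  proof (rule that[of v' x])
    show "orthonormal_basis n v'"
      using v(1) sg by (auto simp: orthonormal_basis_def v'_def simp del: restrict_apply)
    show "x \<in> X" by (rule x(1))
    have "ip n (v' i) x = \<bar>ip n x (v i)\<bar>" for i by (simp add: v'_def \<sigma>_def ip_commute[of n _ x])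
    then show "\<forall>i<n. 0 \<le> ip n (v' i) x \<and> ip n (v' i) x \<le> 1 - \<epsilon>\<^sup>2 / 32" using x(2) by auto
    have "(\<lambda>j\<in>{..<n}. v' i j / (1 + ?e)) \<in> Z" if i: "i < n" for i
    proof (cases "\<sigma> i = 1")
      case True
      then have "(\<lambda>j\<in>{..<n}. v' i j / (1 + ?e)) = (\<lambda>j\<in>{..<n}. v i j / (1 + ?e))" by (auto simp: v'_def)
      then show ?thesis using vZ[OF i] by simp
    next
      case False
      then have "(\<lambda>j\<in>{..<n}. v' i j / (1 + ?e)) = vneg n (\<lambda>j\<in>{..<n}. v i j / (1 + ?e))"
        by (auto simp: v'_def \<sigma>_def vneg_def split: if_splits)
      then show ?thesis using Z_sym[OF vZ[OF i]] by simp
    qed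
    then show "\<forall>i<n. (\<lambda>j\<in>{..<n}. v' i j / (1 + ?e)) \<in> Z" by blast
  qed
qed

end

section \<open>The volume gap\<close>

context even_isotropic
begin

text \<open>
  With \<open>\<eta>\<close> the rounding error of the frame and \<open>\<delta> = n *
  \<eta>\<close>, the errors in both volumes are relative errors of at most \<open>2 *
  \<delta>\<close>, while the tilted support vector contributes \<open>4 * \<delta>\<close>. The
  threshold for the defect is chosen to make this so.
\<close>

lemma small_defect_volumes:
  fixes \<epsilon> :: real
  assumes e: "0 < \<epsilon>" "\<epsilon> \<le> 4" and small: "defect \<le> (\<epsilon> / (1728 * real n ^ 2 * 8 ^ n))\<^sup>2"
    and far: "\<And>v. orthonormal_basis n v \<Longrightarrow> \<epsilon> \<le> sph_hausdorff n X (v ` {..<n} \<union> (\<lambda>i. vneg n (v i)) ` {..<n})"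
  shows "vol n K \<le> 2 ^ n * (1 - \<epsilon> / (72 * 8 ^ n))" "2 ^ n / fact n * (1 + \<epsilon> / (72 * 8 ^ n)) \<le> vol n Z"
proof -
  define \<tau> where "\<tau> = \<epsilon> / (1728 * real n ^ 2 * 8 ^ n)"
  define \<delta> where "\<delta> = \<epsilon> / (144 * 8 ^ n)"
  define \<eta> where "\<eta> = 12 * (n * \<tau>)"
  have n1: "1 \<le> real n" using n_pos by simp
  have p8: "(8::real) \<le> 8 ^ n" using power_increasing[of 1 n "8::real"] n_pos by simp
  have eta: "n * \<eta> = \<delta>" "0 \<le> \<eta>"
    using n1 e by (auto simp: \<eta>_def \<tau>_def \<delta>_def power2_eq_square)
  have dl: "0 < \<delta>" "\<delta> \<le> 1 / 288"
  proof -
    show "0 < \<delta>" using e by (simp add: \<delta>_def)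
    have "\<delta> \<le> 4 / (144 * 8)" unfolding \<delta>_def using e p8 by (intro frac_le) auto
    then show "\<delta> \<le> 1 / 288" by simp
  qed
  have tau0: "0 \<le> \<tau>" using e by (simp add: \<tau>_def)
  have nt: "n * \<tau> \<le> \<delta> / 12"
    using mult_right_mono[OF n1 eta(2)] eta(1) by (simp add: \<eta>_def)
  have tn: "\<tau> \<le> n * \<tau>" using mult_right_mono[OF n1 tau0] by simp
  have tau1: "24 * (n * \<tau>) \<le> 1" using nt dl by simp
  have "\<delta> \<le> \<epsilon> / 144" unfolding \<delta>_def using e p8 by (intro frac_le) auto
  then have nte: "n * \<tau> \<le> \<epsilon> / 16" using nt e dl by linarith
  have tau2: "4 * (n * \<tau>) * \<tau> \<le> \<epsilon>\<^sup>2 / 32"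
  proof -
    have "n * \<tau> * \<tau> \<le> \<epsilon> / 16 * (\<epsilon> / 16)" using nte tn tau0 e by (intro mult_mono) auto
    also have "\<dots> \<le> \<epsilon>\<^sup>2 / 128" by (simp add: power2_eq_square)
    finally show ?thesis by simp
  qed
  obtain v x where v: "orthonormal_basis n v" and vZ: "\<And>i. i < n \<Longrightarrow> (\<lambda>j\<in>{..<n}. v i j / (1 + \<eta>)) \<in> Z"
    and x: "x \<in> X" and a: "\<And>i. i < n \<Longrightarrow> 0 \<le> ip n (v i) x" "\<And>i. i < n \<Longrightarrow> ip n (v i) x \<le> 1 - \<epsilon>\<^sup>2 / 32"
    using tilted_frame[OF e(1) tau0 tau1 tau2 small[folded \<tau>_def] far] unfolding \<eta>_def by metis
  have a1: "ip n (v i) x \<le> 1" if "i < n" for i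
    using a(2)[OF that] zero_le_power2[of \<epsilon>] by linarith
  have one: "(\<Sum>i<n. (ip n (v i) x)\<^sup>2) = 1"
  proof -
    have "(\<Sum>i<n. (ip n (v i) x)\<^sup>2) = ip n (mat_app n v x) (mat_app n v x)"
      unfolding ip_def[of n "mat_app n v x"] by (intro sum.cong refl) (simp add: frame_coord power2_eq_square)
    then show ?thesis using frame_parseval[OF v, of x x] ip_usphere[OF X_usphere[OF x]] by simp
  qed
  obtain k where k: "k < n" and tilt: "1 + \<epsilon> / 30 \<le> ip n (v k) x + 3 / 4 * (\<Sum>i\<in>{..<n} - {k}. ip n (v i) x)"
    using tilted_sum_bound[of n "\<lambda>i. ip n (v i) x" \<epsilon>, OF a one e(1)] by blast
  have split8: "(2::real) ^ n * 4 ^ n = 8 ^ n" by (simp add: power_mult_distrib[symmetric])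
  have growth: "(1 + \<eta>) ^ n \<le> 1 + 2 * \<delta>"
  proof -
    have "(1 + \<eta>) ^ n \<le> exp \<eta> ^ n" using eta(2) exp_ge_add_one_self[of \<eta>] by (intro power_mono) auto
    also have "\<dots> = exp \<delta>" by (simp add: exp_of_nat_mult[symmetric] eta(1))
    also have "\<dots> \<le> 1 + \<delta> + \<delta>\<^sup>2" using dl by (intro exp_bound) auto
    also have "\<dots> \<le> 1 + 2 * \<delta>" using dl mult_left_mono[of \<delta> 1 \<delta>] by (simp add: power2_eq_square)
    finally show ?thesis .
  qed
  have "vol n K \<le> 2 ^ n * (1 + \<eta>) ^ n - (\<epsilon> / 36) / 4 ^ n"
    by (rule tilted_polar_volume[OF v eta(2) vZ x a(1) a1 k]) (use e tilt in auto)
  also have "(\<epsilon> / 36) / 4 ^ n = 2 ^ n * (4 * \<delta>)"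
    unfolding \<delta>_def split8[symmetric] by simp
  also have "2 ^ n * (1 + \<eta>) ^ n - 2 ^ n * (4 * \<delta>) \<le> 2 ^ n * (1 + 2 * \<delta>) - 2 ^ n * (4 * \<delta>)"
    using growth by (intro diff_right_mono mult_left_mono) auto
  also have "\<dots> = 2 ^ n * (1 - 2 * \<delta>)" by (simp add: algebra_simps)
  finally show "vol n K \<le> 2 ^ n * (1 - \<epsilon> / (72 * 8 ^ n))" by (simp add: \<delta>_def)
  define s where "s = (\<Sum>i<n. ip n (v i) x)"
  have s: "1 + \<epsilon> / 30 \<le> s"
  proof -
    have "0 \<le> (\<Sum>i\<in>{..<n} - {k}. ip n (v i) x)" by (intro sum_nonneg) (use a in auto)
    moreover have "s = ip n (v k) x + (\<Sum>i\<in>{..<n} - {k}. ip n (v i) x)"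
      unfolding s_def using k by (intro sum.remove) auto
    ultimately show ?thesis using tilt by simp
  qed
  have shrink: "1 - \<delta> \<le> (1 / (1 + \<eta>)) ^ n"
  proof -
    have "\<eta> \<le> n * \<eta>" using mult_right_mono[OF n1 eta(2)] by simp
    then have "\<eta> \<le> 1" using eta(1) dl by simp
    then have "1 - n * \<eta> \<le> (1 + - \<eta>) ^ n" using Bernoulli_inequality[of "- \<eta>" n] by simp
    also have "\<dots> \<le> (1 / (1 + \<eta>)) ^ n"
      using \<open>\<eta> \<le> 1\<close> eta(2) by (intro power_mono) (auto simp: field_simps)
    finally show ?thesis by (simp add: eta(1))
  qed
  have "2 ^ n / fact n * (1 + 2 * \<delta>) \<le> 2 ^ n / fact n * ((1 - \<delta>) * (1 + 4 * \<delta>))"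
    using dl mult_left_mono[of "4 * \<delta>" 1 \<delta>] by (intro mult_left_mono) (auto simp: algebra_simps)
  also have "\<dots> \<le> 2 ^ n / fact n * ((1 / (1 + \<eta>)) ^ n * (1 + (s - 1) / 4 ^ n))"
  proof (intro mult_left_mono mult_mono shrink)
    have "4 * \<delta> = \<epsilon> / 36 / 8 ^ n" by (simp add: \<delta>_def)
    also have "\<dots> \<le> (s - 1) / 4 ^ n" using s e by (intro frac_le power_mono) auto
    finally show "1 + 4 * \<delta> \<le> 1 + (s - 1) / 4 ^ n" by simp
  qed (use dl eta(2) in auto)
  also have "\<dots> = (1 / (1 + \<eta>)) ^ n * ((2 ^ n + (s - 1) / 2 ^ n) / fact n)"
  proof -
    have "(2::real) ^ n * ((s - 1) / 4 ^ n) = (s - 1) / 2 ^ n"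
      by (simp add: field_simps power_mult_distrib[symmetric])
    then have "(2::real) ^ n * (1 + (s - 1) / 4 ^ n) = 2 ^ n + (s - 1) / 2 ^ n" by (simp add: distrib_left)
    then show ?thesis by (simp add: mult_ac)
  qed
  also have "\<dots> \<le> vol n Z"
    by (rule tilted_hull_volume[OF v eta(2) vZ x a(1) a1 _ s_def]) (use s e in auto)
  finally show "2 ^ n / fact n * (1 + \<epsilon> / (72 * 8 ^ n)) \<le> vol n Z" by (simp add: \<delta>_def)
qed

text \<open>
  On the line the defect vanishes, so \<open>tilted_frame\<close> applies with \<open>\<tau> =
  0\<close>; but two unit vectors of the line are equal or opposite.
\<close>

lemma line_not_far:
  assumes n: "n = 1" and e: "0 < \<epsilon>"
    and far: "\<And>v. orthonormal_basis n v \<Longrightarrow> \<epsilon> \<le> sph_hausdorff n X (v ` {..<n} \<union> (\<lambda>i. vneg n (v i)) ` {..<n})"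
  shows False
proof -
  have sq: "(ip n u w)\<^sup>2 = 1" if "ip n u u = 1" "ip n w w = 1" for u w
  proof -
    have "(ip n u w)\<^sup>2 = ip n u u * ip n w w" unfolding ip_def n by (simp add: power2_eq_square mult_ac)
    then show ?thesis using that by simp
  qed
  have "defect = (\<integral>u. (\<integral>w. 0 \<partial>\<mu>) \<partial>\<mu>)"
    unfolding defect_def
    by (intro Bochner_Integration.integral_cong refl) (simp add: sq ip_usphere)
  then have d: "defect \<le> 0\<^sup>2" by simp
  obtain v x where v: "orthonormal_basis n v" and x: "x \<in> X"
    and a: "\<forall>i<n. 0 \<le> ip n (v i) x \<and> ip n (v i) x \<le> 1 - \<epsilon>\<^sup>2 / 32"
    by (rule tilted_frame[OF e _ _ _ d far]) simp_all
  have "(ip n (v 0) x)\<^sup>2 = 1" using v x n ip_usphere[OF X_usphere[OF x]] by (intro sq) (auto simp: orthonormal_basis_def)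
  moreover have "0 \<le> ip n (v 0) x" "ip n (v 0) x \<le> 1 - \<epsilon>\<^sup>2 / 32" "0 < \<epsilon>\<^sup>2 / 32" using a n e by auto
  ultimately show False by (auto simp: power2_eq_1_iff)
qed

text \<open>
  The exponent \<open>10 * n ^ 3\<close> absorbs all constants: for \<open>n \<ge> 2\<close> every
  numerical factor is bounded by a power of \<open>2\<close>, hence by a power of
  \<open>n\<close>, and the resulting exponent is at most \<open>11 * n + 57\<close>.
\<close>

lemma volume_gap:
  fixes \<epsilon> :: real
  assumes n: "2 \<le> n" and e: "0 < \<epsilon>" "\<epsilon> \<le> 4"
    and far: "\<And>v. orthonormal_basis n v \<Longrightarrow> \<epsilon> \<le> sph_hausdorff n X (v ` {..<n} \<union> (\<lambda>i. vneg n (v i)) ` {..<n})"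
  shows "vol n K \<le> 2 ^ n * (1 - \<epsilon> ^ 3 / real n ^ (10 * n ^ 3))"
    "2 ^ n / fact n * (1 + \<epsilon> ^ 3 / real n ^ (10 * n ^ 3)) \<le> vol n Z"
proof -
  define \<gamma> where "\<gamma> = 1 / real n ^ (10 * n ^ 3)"
  have n2: "2 \<le> real n" using n by simp
  have pw: "(2 ^ k :: real) \<le> real n ^ k" for k by (rule power_mono[OF n2]) simp
  \<comment> \<open>the case \<open>n = 2\<close> reads \<open>79 \<le> 80\<close>\<close>
  have expo: "11 * n + 57 \<le> 10 * n ^ 3"
  proof -
    have "2 * 2 * n \<le> n * n * n" using n by (intro mult_le_mono) auto
    then show ?thesis using n unfolding power3_eq_cube by linarith
  qed
  have big: "real n ^ (11 * n + 57) * \<gamma> \<le> 1"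
  proof -
    have "real n ^ (11 * n + 57) \<le> real n ^ (10 * n ^ 3)" using n by (intro power_increasing expo) auto
    then show ?thesis using n by (simp add: \<gamma>_def divide_le_eq)
  qed
  have g0: "0 < \<gamma>" using n by (simp add: \<gamma>_def)
  have main: "(\<epsilon> ^ 3 * \<gamma> \<le> t * \<epsilon> ^ 2)" if "4 \<le> t * real n ^ (11 * n + 57)" "0 \<le> t" for t
  proof -
    have "4 * \<gamma> \<le> t * real n ^ (11 * n + 57) * \<gamma>" using that g0 by (intro mult_right_mono) auto
    also have "\<dots> \<le> t * 1" using mult_left_mono[OF big that(2)] by (simp add: mult.assoc)
    finally have "4 * \<gamma> \<le> t" by simp
    moreover have "\<epsilon> * \<gamma> \<le> 4 * \<gamma>" using e g0 by (intro mult_right_mono) auto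
    ultimately have "\<epsilon> * \<gamma> \<le> t" by linarith
    then have "\<epsilon> * \<gamma> * \<epsilon>\<^sup>2 \<le> t * \<epsilon>\<^sup>2" by (rule mult_right_mono) simp
    then show ?thesis by (simp add: power2_eq_square power3_eq_cube mult_ac)
  qed
  let ?G = "\<epsilon> ^ 3 / real n ^ (10 * n ^ 3)"
  have G: "?G = \<epsilon> ^ 3 * \<gamma>" by (simp add: \<gamma>_def)
  show "vol n K \<le> 2 ^ n * (1 - ?G)" "2 ^ n / fact n * (1 + ?G) \<le> vol n Z"
  proof (atomize (full), cases "defect \<le> (\<epsilon> / (1728 * real n ^ 2 * 8 ^ n))\<^sup>2")
    case True
    have "?G \<le> (1 / (288 * 8 ^ n)) * \<epsilon>\<^sup>2"
      unfolding G
    proof (rule main)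
      have "4 * (288 * 8 ^ n) \<le> (2 ^ 57 * 2 ^ (11 * n) :: real)"
      proof (rule order_trans[of _ "2 ^ 57 * 2 ^ (3 * n)"])
        show "4 * (288 * 8 ^ n) \<le> (2 ^ 57 * 2 ^ (3 * n) :: real)" by (simp add: power_mult)
        show "2 ^ 57 * 2 ^ (3 * n) \<le> (2 ^ 57 * 2 ^ (11 * n) :: real)" by (intro mult_left_mono power_increasing) auto
      qed
      also have "\<dots> = 2 ^ (11 * n + 57)" by (simp add: power_add)
      also note pw
      finally show "4 \<le> 1 / (288 * 8 ^ n) * real n ^ (11 * n + 57)" by (simp add: field_simps)
    qed simp
    also have "\<dots> \<le> (1 / (288 * 8 ^ n)) * (4 * \<epsilon>)"
      using e by (intro mult_left_mono) (auto simp: power2_eq_square)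
    finally have G1: "?G \<le> \<epsilon> / (72 * 8 ^ n)" by simp
    have "vol n K \<le> 2 ^ n * (1 - \<epsilon> / (72 * 8 ^ n))" by (rule small_defect_volumes(1)[OF e True far])
    also have "\<dots> \<le> 2 ^ n * (1 - ?G)" using G1 by (intro mult_left_mono) auto
    finally have 1: "vol n K \<le> 2 ^ n * (1 - ?G)" .
    have "2 ^ n / fact n * (1 + ?G) \<le> 2 ^ n / fact n * (1 + \<epsilon> / (72 * 8 ^ n))" using G1 by (intro mult_left_mono) auto
    also have "\<dots> \<le> vol n Z" by (rule small_defect_volumes(2)[OF e True far])
    finally show "vol n K \<le> 2 ^ n * (1 - ?G) \<and> 2 ^ n / fact n * (1 + ?G) \<le> vol n Z" using 1 by simp
  next
    case False
    define t where "t = core_radius ^ (n + 4) / 360 * (1 / (1728 * real n ^ 2 * 8 ^ n))\<^sup>2"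
    have c0: "0 < core_radius" using n by (simp add: core_radius_def)
    have t0: "0 < t" using c0 n by (simp add: t_def)
    have "?G \<le> t * \<epsilon>\<^sup>2"
      unfolding G
    proof (rule main)
      have "4 / t = 4 * 360 * 1728\<^sup>2 * (8 * real n ^ 2) ^ (n + 4) * (real n ^ 4 * 64 ^ n)"
      proof -
        have "(64::real) ^ n = 8 ^ n * 8 ^ n" by (simp add: power_mult_distrib[symmetric])
        then show ?thesis
          unfolding t_def core_radius_def power_one_over by (simp add: power_mult_distrib power_mult[symmetric] power2_eq_square power4_eq_xxxx)
      qed
      also have "\<dots> \<le> 2 ^ 33 * (2 ^ 3 * real n ^ 2) ^ (n + 4) * (real n ^ 4 * (2 ^ 6) ^ n)"
        by (intro mult_mono order_refl) auto
      also have "\<dots> \<le> real n ^ 33 * (real n ^ 3 * real n ^ 2) ^ (n + 4) * (real n ^ 4 * (real n ^ 6) ^ n)"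
        by (intro mult_mono power_mono pw) auto
      also have "\<dots> = real n ^ (33 + 5 * (n + 4) + (4 + 6 * n))"
        by (simp only: power_add[symmetric] power_mult[symmetric]) simp
      also have "33 + 5 * (n + 4) + (4 + 6 * n) = 11 * n + 57" by simp
      finally show "4 \<le> t * real n ^ (11 * n + 57)" using t0 by (simp add: field_simps)
    qed (use t0 in simp)
    also have "\<dots> = core_radius ^ (n + 4) / 360 * (\<epsilon> / (1728 * real n ^ 2 * 8 ^ n))\<^sup>2"
      by (simp add: t_def power_divide)
    also have "\<dots> \<le> core_radius ^ (n + 4) / 360 * defect" using False c0 by (intro mult_left_mono) auto
    finally have G2: "?G \<le> core_radius ^ (n + 4) / 360 * defect" .
    have gn: "gain = 2 ^ n * (core_radius ^ (n + 4) / 360 * defect)"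
      by (simp add: gain_def power_mult_distrib power_add)
    have "2 ^ n * ?G \<le> gain" unfolding gn using G2 by (intro mult_left_mono) auto
    then have "vol n K \<le> 2 ^ n - 2 ^ n * ?G" using polar_volume_defect gain_nonneg by linarith
    then have 1: "vol n K \<le> 2 ^ n * (1 - ?G)" by (simp add: algebra_simps)
    have "?G \<le> gain"
    proof -
      have "0 \<le> core_radius ^ (n + 4) / 360 * defect" using defect_nonneg c0 by simp
      then have "1 * (core_radius ^ (n + 4) / 360 * defect) \<le> gain" unfolding gn by (intro mult_right_mono) auto
      then show ?thesis using G2 by linarith
    qed
    then have "2 ^ n / fact n * (1 + ?G) \<le> 2 ^ n / fact n * (1 + gain)" by (intro mult_left_mono) auto
    also have "\<dots> \<le> vol n Z" by (rule hull_volume_defect)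
    finally show "vol n K \<le> 2 ^ n * (1 - ?G) \<and> 2 ^ n / fact n * (1 + ?G) \<le> vol n Z" using 1 by simp
  qed
qed

end

theorem corollary1p5:
  shows "\<exists>c::real. c > 0 \<and>
    (\<forall>(n::nat) (\<nu>::rvec measure) (\<mu>::rvec measure) (\<epsilon>::real).
       n \<ge> 1 \<longrightarrow> cross_measure n \<nu> \<longrightarrow>
       even_measure n \<mu> \<longrightarrow> isotropic n \<mu> \<longrightarrow>
       \<epsilon> > 0 \<longrightarrow> sph_hausdorff_O n (supp n \<mu>) (supp n \<nu>) \<ge> \<epsilon> \<longrightarrow>
       (let \<gamma> = real n powr (- (c * real n ^ 3)) in
          vol n (Z_inf n \<mu>) \<ge> (1 + \<gamma> * \<epsilon> ^ 3) * vol n (Z_inf n \<nu>) \<and>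
          vol n (Z_inf_polar n \<mu>) \<le> (1 - \<gamma> * \<epsilon> ^ 3) * vol n (Z_inf_polar n \<nu>)))"
proof (intro exI[of _ 10] conjI allI impI)
  fix n :: nat and \<nu> \<mu> :: "rvec measure" and \<epsilon> :: real
  assume n1: "1 \<le> n" and nu: "cross_measure n \<nu>" and ev: "even_measure n \<mu>" and iso: "isotropic n \<mu>"
    and e: "0 < \<epsilon>" and d: "\<epsilon> \<le> sph_hausdorff_O n (supp n \<mu>) (supp n \<nu>)"
  interpret even_isotropic n \<mu> by unfold_locales (use iso ev n1 in auto)
  obtain f where f: "orthonormal_basis n f" and sf: "supp n \<nu> = f ` {..<n} \<union> (\<lambda>i. vneg n (f i)) ` {..<n}"
    using nu unfolding cross_measure_def by blast
  have far: "\<epsilon> \<le> sph_hausdorff n X (v ` {..<n} \<union> (\<lambda>i. vneg n (v i)) ` {..<n})" if "orthonormal_basis n v" for v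
    using sph_hausdorff_O_le[OF X_nonempty n1 f that] d unfolding sf by linarith
  have "f 0 \<in> f ` {..<n} \<union> (\<lambda>i. vneg n (f i)) ` {..<n}" using n1 by simp
  then have ne: "f ` {..<n} \<union> (\<lambda>i. vneg n (f i)) ` {..<n} \<noteq> {}" by blast
  have "\<epsilon> \<le> pi"
    using far[OF f] sph_hausdorff_range(2)[OF X_nonempty ne, of n] by linarith
  then have e4: "\<epsilon> \<le> 4" using pi_less_4 by linarith
  have "n \<noteq> 1" using line_not_far[OF _ e far] by blast
  then have n2: "2 \<le> n" using n1 by simp
  define g where "g = \<epsilon> ^ 3 / real n ^ (10 * n ^ 3)"
  have g0: "0 \<le> g" using e by (simp add: g_def)
  have gam: "real n powr (- (10 * real n ^ 3)) * \<epsilon> ^ 3 = g"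
  proof -
    have "real n powr (10 * real n ^ 3) = real n ^ (10 * n ^ 3)"
      using powr_realpow[of "real n" "10 * n ^ 3"] n1 by simp
    then show ?thesis by (simp add: powr_minus g_def divide_inverse)
  qed
  have "(1 + g) * vol n (Z_inf n \<nu>) \<le> (1 + g) * (2 ^ n / fact n)"
    using cross_hull_volume[OF f sf] g0 by (intro mult_left_mono) auto
  also have "\<dots> \<le> vol n Z" using volume_gap(2)[OF n2 e e4 far] by (simp only: g_def mult.commute)
  finally have Z: "(1 + g) * vol n (Z_inf n \<nu>) \<le> vol n Z" .
  have K: "vol n K \<le> (1 - g) * vol n (Z_inf_polar n \<nu>)"
    using volume_gap(1)[OF n2 e e4 far] unfolding cross_polar_volume[OF f sf] by (simp only: g_def mult.commute)
  show "let \<gamma> = real n powr (- (10 * real n ^ 3)) in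
          vol n (Z_inf n \<mu>) \<ge> (1 + \<gamma> * \<epsilon> ^ 3) * vol n (Z_inf n \<nu>) \<and>
          vol n (Z_inf_polar n \<mu>) \<le> (1 - \<gamma> * \<epsilon> ^ 3) * vol n (Z_inf_polar n \<nu>)"
    unfolding Let_def gam using Z K by simp
qed simp

end
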